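(* Let $n\ge1$, let $M$ be a positive definite symmetric real $n\times n$ matrix with $\det M=1$ and with no eigenvalues equal to one, and let $X=\mathbb R\ltimes_M\mathbb R^n$. Then any $(K,C)$-quasi-isometry $\varphi:X\to X$ is within a bounded distance of a height respecting quasi-isometry $\hat\varphi$, i.e. $\sup_{p\in X}d(\varphi(p),\hat\varphi(p))<\infty$. Furthermore, the bound is uniform in $K$ and $C$.
   Context: For a positive definite symmetric matrix $M$, real powers $M^z$ are defined by the spectral theorem. $\mathbb R\ltimes_M\mathbb R^n$ is the semidirect product in which $z\in\mathbb R$ acts on $\mathbb R^n$ by $M^z$, i.e. $(z,v)(z',v')=(z+z',v+M^zv')$, equipped with a left-invariant Riemannian metric. In coordinates $(z,\vec x)$, $z\in\mathbb R$, $\vec x\in\mathbb R^n$, the height function is $h(z,\vec x)=z$; its level sets are the $\mathbb R^n$-cosets. A map $f:X\to Y$ between metric spaces is a $(K,C)$-quasi-isometry ($K\ge 1$, $C\ge 0$) if $\frac1K d_X(x_1,x_2)-C\le d_Y(f(x_1),f(x_2))\le K d_X(x_1,x_2)+C$ for all $x_1,x_2\in X$, and the $C$-neighborhood of $f(X)$ is all of $Y$. A quasi-isometry is height respecting if it permutes the level sets of $h$ to within bounded distance: there is a constant $B$ such that the image of every level set of $h$ is within Hausdorff distance $B$ of a level set of $h$. "The bound is uniform in $K$ and $C$" means that, for the fixed space $X$, it depends only on $K$ and $C$. *)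

theory Defs
  imports "HOL-Analysis.Analysis"
begin

section \<open>Positive definite matrices and their real powers\<close>

definition pos_def :: "real^'n^'n \<Rightarrow> bool" where
  "pos_def M \<longleftrightarrow> (\<forall>x. x \<noteq> 0 \<longrightarrow> x \<bullet> (M *v x) > 0)"

definition eigenvalue :: "real^'n^'n \<Rightarrow> real \<Rightarrow> bool" where
  "eigenvalue M c \<longleftrightarrow> (\<exists>v. v \<noteq> 0 \<and> M *v v = c *\<^sub>R v)"

definition diag_mat :: "real^'n \<Rightarrow> real^'n^'n" where
  "diag_mat d = (\<chi> i j. if i = j then d $ i else 0)"

text \<open>The spectral-theorem power \<open>M\<^sup>z\<close>: diagonalise \<open>M\<close> orthogonally and raise the
  eigenvalues to the power \<open>z\<close>. The description is meaningful for symmetric positive definite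
  \<open>M\<close>; the result does not depend on the diagonalisation, by \<open>mat_powr_eq\<close> below.\<close>

definition mat_powr :: "real^'n^'n \<Rightarrow> real \<Rightarrow> real^'n^'n" where
  "mat_powr M z = (THE P. \<exists>U d. orthogonal_matrix U \<and> M = U ** diag_mat d ** transpose U \<and>
      P = U ** diag_mat (\<chi> i. (d $ i) powr z) ** transpose U)"

lemma mat_mult_diag_mat: "(W ** diag_mat d) $ i $ j = W $ i $ j * d $ j"
  by (simp add: matrix_matrix_mult_def diag_mat_def if_distrib cong: if_cong)

lemma diag_mat_mult: "(diag_mat d ** W) $ i $ j = d $ i * W $ i $ j"
  by (simp add: matrix_matrix_mult_def diag_mat_def if_distrib[of "\<lambda>x. x * _"] cong: if_cong)

lemma mat_powr_unique:
  fixes U V :: "real^'n^'n"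
  assumes U: "orthogonal_matrix U" and V: "orthogonal_matrix V"
    and eq: "U ** diag_mat d ** transpose U = V ** diag_mat e ** transpose V"
  shows "U ** diag_mat (\<chi> i. (d $ i) powr z) ** transpose U
       = V ** diag_mat (\<chi> i. (e $ i) powr z) ** transpose V"
proof -
  have u: "transpose U ** U = mat 1" "U ** transpose U = mat 1"
    and v: "transpose V ** V = mat 1" "V ** transpose V = mat 1"
    using U V by (auto simp: orthogonal_matrix_def)
  define W where "W = transpose V ** U"
  have "W ** diag_mat d = transpose V ** (U ** diag_mat d ** transpose U) ** U"
    by (simp add: W_def u flip: matrix_mul_assoc)
  also have "\<dots> = transpose V ** V ** diag_mat e ** W"
    unfolding eq by (simp add: W_def flip: matrix_mul_assoc)
  finally have "W ** diag_mat d = diag_mat e ** W"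
    by (simp add: v)
  then have *: "W $ i $ j * d $ j = e $ i * W $ i $ j" for i j
    by (metis mat_mult_diag_mat diag_mat_mult)
  have "W $ i $ j * (d $ j) powr z = (e $ i) powr z * W $ i $ j" for i j
    using *[of i j] by (cases "W $ i $ j = 0") auto
  then have **: "W ** diag_mat (\<chi> i. (d $ i) powr z) = diag_mat (\<chi> i. (e $ i) powr z) ** W"
    by (simp add: vec_eq_iff mat_mult_diag_mat diag_mat_mult)
  have "U ** diag_mat (\<chi> i. (d $ i) powr z) ** transpose U
      = V ** (W ** diag_mat (\<chi> i. (d $ i) powr z)) ** transpose U"
    by (simp add: W_def matrix_mul_assoc v)
  also have "\<dots> = V ** diag_mat (\<chi> i. (e $ i) powr z) ** transpose V ** (U ** transpose U)"
    unfolding ** by (simp add: W_def matrix_mul_assoc)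
  finally show ?thesis by (simp add: u)
qed

lemma mat_powr_eq:
  assumes "orthogonal_matrix U" "M = U ** diag_mat d ** transpose U"
  shows "mat_powr M z = U ** diag_mat (\<chi> i. (d $ i) powr z) ** transpose U"
  unfolding mat_powr_def
proof (rule the_equality)
  show "\<exists>Ua da. orthogonal_matrix Ua \<and> M = Ua ** diag_mat da ** transpose Ua \<and>
      U ** diag_mat (\<chi> i. (d $ i) powr z) ** transpose U
        = Ua ** diag_mat (\<chi> i. (da $ i) powr z) ** transpose Ua"
    using assms by blast
  fix P
  assume "\<exists>U d. orthogonal_matrix U \<and> M = U ** diag_mat d ** transpose U \<and>
      P = U ** diag_mat (\<chi> i. (d $ i) powr z) ** transpose U"
  then obtain V e where V: "orthogonal_matrix V" "M = V ** diag_mat e ** transpose V"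
    "P = V ** diag_mat (\<chi> i. (e $ i) powr z) ** transpose V" by blast
  have "V ** diag_mat e ** transpose V = U ** diag_mat d ** transpose U"
    using V(2) assms(2) by simp
  from mat_powr_unique[OF V(1) assms(1) this] V(3)
  show "P = U ** diag_mat (\<chi> i. (d $ i) powr z) ** transpose U" by simp
qed

section \<open>The semidirect product and its height function\<close>

text \<open>The group law of \<open>\<real> \<ltimes>\<^sub>M \<real>\<^sup>n\<close> on the underlying manifold \<open>\<real> \<times> \<real>\<^sup>n\<close>.\<close>

definition sol_mult ::
  "real^'n^'n \<Rightarrow> real \<times> (real^'n) \<Rightarrow> real \<times> (real^'n) \<Rightarrow> real \<times> (real^'n)" where
  "sol_mult M p q = (fst p + fst q, snd p + mat_powr M (fst p) *v snd q)"

definition height :: "real \<times> (real^'n) \<Rightarrow> real" where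
  "height p = fst p"

definition level_set :: "real \<Rightarrow> (real \<times> (real^'n)) set" where
  "level_set t = {p. height p = t}"

section \<open>Left-invariant Riemannian metrics and Riemannian distance\<close>

text \<open>\<open>C\<^sup>k\<close> functions on a finite-dimensional vector space.\<close>

primrec Ck :: "nat \<Rightarrow> ('a::euclidean_space \<Rightarrow> real) \<Rightarrow> bool" where
  "Ck 0 f \<longleftrightarrow> continuous_on UNIV f"
| "Ck (Suc k) f \<longleftrightarrow> (\<forall>x. f differentiable (at x)) \<and>
      (\<forall>v. Ck k (\<lambda>x. frechet_derivative f (at x) v))"

definition is_inner_product :: "('a::real_vector \<Rightarrow> 'a \<Rightarrow> real) \<Rightarrow> bool" where
  "is_inner_product b \<longleftrightarrow> bilinear b \<and> (\<forall>u v. b u v = b v u) \<and> (\<forall>u. u \<noteq> 0 \<longrightarrow> b u u > 0)"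

text \<open>A Riemannian metric on the vector space \<open>'a\<close> regarded as a manifold, all tangent spaces being
  identified with \<open>'a\<close>: \<open>g p\<close> is the inner product on the tangent space at \<open>p\<close>.\<close>

definition riemannian_metric :: "('a::euclidean_space \<Rightarrow> 'a \<Rightarrow> 'a \<Rightarrow> real) \<Rightarrow> bool" where
  "riemannian_metric g \<longleftrightarrow> (\<forall>p. is_inner_product (g p)) \<and> (\<forall>u v k. Ck k (\<lambda>p. g p u v))"

definition left_invariant ::
  "('a::euclidean_space \<Rightarrow> 'a \<Rightarrow> 'a) \<Rightarrow> ('a \<Rightarrow> 'a \<Rightarrow> 'a \<Rightarrow> real) \<Rightarrow> bool" where
  "left_invariant m g \<longleftrightarrow> (\<forall>p q u v.
      g (m p q) (frechet_derivative (m p) (at q) u) (frechet_derivative (m p) (at q) v)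
        = g q u v)"

text \<open>\<open>valid_path\<close> does not force the velocity to stay bounded near the finitely many exceptional
  parameters, so a path may have infinite length; hence the extended nonnegative integral (the real
  one would assign such a path length \<open>0\<close>).\<close>

definition riemannian_length ::
  "('a::euclidean_space \<Rightarrow> 'a \<Rightarrow> 'a \<Rightarrow> real) \<Rightarrow> (real \<Rightarrow> 'a) \<Rightarrow> ennreal" where
  "riemannian_length g \<gamma> =
     (\<integral>\<^sup>+ t \<in> {0..1}. ennreal (sqrt (g (\<gamma> t) (vector_derivative \<gamma> (at t))
                                          (vector_derivative \<gamma> (at t)))) \<partial>lborel)"

definition riemannian_dist ::
  "('a::euclidean_space \<Rightarrow> 'a \<Rightarrow> 'a \<Rightarrow> real) \<Rightarrow> 'a \<Rightarrow> 'a \<Rightarrow> real" where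
  "riemannian_dist g p q =
     enn2real (INF \<gamma> \<in> {\<gamma>. valid_path \<gamma> \<and> pathstart \<gamma> = p \<and> pathfinish \<gamma> = q}.
       riemannian_length g \<gamma>)"

section \<open>Quasi-isometries\<close>

definition quasi_isometry ::
  "real \<Rightarrow> real \<Rightarrow> ('a \<Rightarrow> 'a \<Rightarrow> real) \<Rightarrow> ('b \<Rightarrow> 'b \<Rightarrow> real) \<Rightarrow> ('a \<Rightarrow> 'b) \<Rightarrow> bool" where
  "quasi_isometry K C dX dY f \<longleftrightarrow> K \<ge> 1 \<and> C \<ge> 0 \<and>
     (\<forall>x1 x2. 1 / K * dX x1 x2 - C \<le> dY (f x1) (f x2) \<and> dY (f x1) (f x2) \<le> K * dX x1 x2 + C) \<and>
     (\<forall>y. \<exists>x. dY (f x) y \<le> C)"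

definition hausdorff_dist :: "('a \<Rightarrow> 'a \<Rightarrow> real) \<Rightarrow> 'a set \<Rightarrow> 'a set \<Rightarrow> ennreal" where
  "hausdorff_dist d A B =
     max (SUP a\<in>A. INF b\<in>B. ennreal (d a b)) (SUP b\<in>B. INF a\<in>A. ennreal (d a b))"

definition height_respecting ::
  "(real \<times> (real^'n) \<Rightarrow> real \<times> (real^'n) \<Rightarrow> real) \<Rightarrow>
   (real \<times> (real^'n) \<Rightarrow> real \<times> (real^'n)) \<Rightarrow> bool" where
  "height_respecting d f \<longleftrightarrow>
     (\<exists>B::real. \<forall>t. \<exists>s. hausdorff_dist d (f ` level_set t) (level_set s) \<le> ennreal B)"

end

theory Submission
  imports Defs
begin

text \<open>
  In an eigenbasis of \<open>M\<close>, the group is coarsely a space of dyadic cells: at height \<open>z\<close> the \<open>i\<close>-th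
  coordinate is measured in units of size \<open>2 powr (lam i * z)\<close>, where \<open>lam i\<close> is the binary logarithm of the
  \<open>i\<close>-th eigenvalue. The coordinates with positive and those with negative weight both form trees, one
  branching downwards and one upwards, and \<open>det M = 1\<close> gives the two trees the same growth rate \<open>Lam\<close>.

  Let \<open>F\<close> be the height of the image under a quasi-isometry. Counting shows that a typical
  vertical line of length \<open>L\<close> cannot map into a slab of height much less than \<open>L\<close>. Conversely, the mean square
  of the increments of \<open>F\<close> along vertical lines cannot much exceed \<open>L\<^sup>2\<close>: near the extremal value \<open>F\<close> is almost
  affine in the height with the same slope on most lines of a slab, and the coarse inverse shows by another
  count that this slope is at most 1. So most lines climb or descend monotonically at unit speed, up to \<open>o(L)\<close>.

  Two vertical lines that share their upper end but start at points where \<open>F\<close> differs much are excluded by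
  prolonging them into two separating branches: the four image lines would bring points of separate branches
  close together. This promotes "most lines above most points" to "most lines above every point", hence
  every vertical segment maps with a definite rate of climb. The same quadrilateral argument
  with bounded errors then bounds the variation of \<open>F\<close> over a level set. So every quasi-isometry is itself
  height respecting, and one can take \<open>\<phi>' = \<phi>\<close>.
\<close>

section \<open>Averages and frequencies\<close>

text \<open>The multiplicative constant of a quasi-isometry persists at all scales, so slopes of
  \<open>F\<close> have no limits to pass to. The substitute is extremal: among the constants
  \<open>c\<close> that bound the mean square of increments by \<open>c * r^2\<close> at some scale
  \<open>r\<close>, the infimum is nearly attained at one scale and cannot be beaten at any other.
  Between such a scale and a multiple of it almost no variance is left. Squares are used because
  strict convexity turns near-extremality into near-affinity. The range count compares
  \<open>2 powr (Lam * length)\<close> with polynomial factors, so any fixed proportion of the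
  length gained in the exponent decides it; the slope count rests on the two trees compensating each
  other, all heights of a slab carrying about equally many cells. The first energy bound averages
  over both ends of a line; quadrilaterals are needed to fix one end, because a single bad end is
  invisible to that average. Errors stay proportional to the length until every line climbs at a
  definite rate; then the accumulated drift is a geometric series and all errors become
  bounded.\<close>

definition avg :: "'a set \<Rightarrow> ('a \<Rightarrow> real) \<Rightarrow> real" where
  "avg A g = sum g A / real (card A)"

abbreviation freq :: "'a set \<Rightarrow> ('a \<Rightarrow> bool) \<Rightarrow> real" where
  "freq A Q \<equiv> avg A (\<lambda>a. of_bool (Q a))"

lemma avg_mono: "(\<And>a. a \<in> A \<Longrightarrow> g a \<le> h a) \<Longrightarrow> avg A g \<le> avg A h"
  by (simp add: avg_def sum_mono divide_right_mono)

lemma avg_cong: "(\<And>a. a \<in> A \<Longrightarrow> g a = h a) \<Longrightarrow> avg A g = avg A h"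
  by (simp add: avg_def)

lemma avg_const: "finite A \<Longrightarrow> A \<noteq> {} \<Longrightarrow> avg A (\<lambda>_. c) = c"
  by (simp add: avg_def)

lemma avg_add: "avg A (\<lambda>a. g a + h a) = avg A g + avg A h"
  by (simp add: avg_def sum.distrib add_divide_distrib)

lemma avg_diff: "avg A (\<lambda>a. g a - h a) = avg A g - avg A h"
  by (simp add: avg_def sum_subtractf diff_divide_distrib)

lemma avg_cmult: "avg A (\<lambda>a. c * g a) = c * avg A g"
  by (simp add: avg_def sum_distrib_left)

lemma avg_sum: "avg A (\<lambda>a. \<Sum>j\<in>J. g j a) = (\<Sum>j\<in>J. avg A (g j))"
  unfolding avg_def by (subst sum.swap) (simp add: sum_divide_distrib)

lemma avg_nonneg: "(\<And>a. a \<in> A \<Longrightarrow> 0 \<le> g a) \<Longrightarrow> 0 \<le> avg A g"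
  by (simp add: avg_def sum_nonneg)

lemma avg_le: "finite A \<Longrightarrow> A \<noteq> {} \<Longrightarrow> (\<And>a. a \<in> A \<Longrightarrow> g a \<le> c) \<Longrightarrow> avg A g \<le> c"
  using avg_mono[of A g "\<lambda>_. c"] by (simp add: avg_const)

lemma ex_le_avg:
  assumes "finite A" "A \<noteq> {}" shows "\<exists>a\<in>A. g a \<le> avg A g"
proof (rule ccontr)
  assume "\<not> ?thesis"
  then have "sum (\<lambda>_. avg A g) A < sum g A"
    using assms by (intro sum_strict_mono) auto
  then show False using assms by (simp add: avg_def)
qed

lemma freq_nonneg: "0 \<le> freq A Q"
  by (simp add: avg_nonneg)

lemma freq_mono: "(\<And>a. a \<in> A \<Longrightarrow> Q a \<Longrightarrow> R a) \<Longrightarrow> freq A Q \<le> freq A R"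
  by (intro avg_mono) (auto simp: of_bool_def)

lemma freq_disj: "freq A (\<lambda>a. Q a \<or> R a) \<le> freq A Q + freq A R"
  unfolding avg_add[symmetric] by (intro avg_mono) auto

lemma freq_Ex:
  assumes "finite J" shows "freq A (\<lambda>a. \<exists>j\<in>J. Q j a) \<le> (\<Sum>j\<in>J. freq A (Q j))"
proof -
  have *: "of_bool (\<exists>j\<in>J. Q j a) \<le> (\<Sum>j\<in>J. of_bool (Q j a) :: real)" for a
  proof (cases "\<exists>j\<in>J. Q j a")
    case True
    then obtain j where j: "j \<in> J" "Q j a" by blast
    have "of_bool (Q j a) \<le> (\<Sum>j\<in>J. of_bool (Q j a) :: real)"
      by (rule member_le_sum) (use j assms in auto)
    then show ?thesis using j True by simp
  qed (simp add: sum_nonneg)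
  show ?thesis unfolding avg_sum[symmetric] by (intro avg_mono *)
qed

lemma freq_card: "finite A \<Longrightarrow> freq A Q = real (card {a \<in> A. Q a}) / real (card A)"
  by (simp add: avg_def Int_def of_bool_def sum.If_cases)

lemma freq_less_1_ex:
  assumes "finite A" "A \<noteq> {}" "freq A Q < 1" shows "\<exists>a\<in>A. \<not> Q a"
  using ex_le_avg[OF assms(1,2), of "\<lambda>a. of_bool (Q a)"] assms(3) by force

lemma markov:
  assumes "\<And>a. a \<in> A \<Longrightarrow> 0 \<le> g a" "0 < t"
  shows "freq A (\<lambda>a. t \<le> g a) \<le> avg A g / t"
proof -
  have "t * freq A (\<lambda>a. t \<le> g a) \<le> avg A g"
    unfolding avg_cmult[symmetric] by (intro avg_mono) (use assms in \<open>auto simp: of_bool_def\<close>)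
  then show ?thesis using assms by (simp add: field_simps)
qed

text \<open>Fibres of equal size make the uniform distribution on \<open>A\<close> project to the
  uniform one on \<open>B\<close>, so averages can be taken in two stages. It is meant for trees of
  cells, where all cells of a height have equally many descendants.\<close>

lemma avg_fibres:
  assumes "finite A" "finite B" "\<And>a. a \<in> A \<Longrightarrow> p a \<in> B"
    and c: "\<And>b. b \<in> B \<Longrightarrow> card {a \<in> A. p a = b} = c"
  shows "avg A g = avg B (\<lambda>b. avg {a \<in> A. p a = b} g)"
proof -
  have s: "sum g A = (\<Sum>b\<in>B. sum g {a \<in> A. p a = b})" for g :: "'a \<Rightarrow> real"
    by (rule sum.group[symmetric]) (use assms in auto)
  have "real (card A) = (\<Sum>b\<in>B. real (card {a \<in> A. p a = b}))"
    using s[of "\<lambda>_. 1"] by simp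
  then have "real (card A) = real (card B) * real c"
    using c by simp
  then show ?thesis
    by (simp add: avg_def s[of g] c sum_divide_distrib mult.commute cong: sum.cong)
qed

lemma avg_Times: "avg (A \<times> B) g = avg A (\<lambda>a. avg B (\<lambda>b. g (a, b)))"
  by (simp add: avg_def sum.cartesian_product sum_divide_distrib card_cartesian_product mult.commute)

lemma avg_Times2: "avg (A \<times> B) g = avg B (\<lambda>b. avg A (\<lambda>a. g (a, b)))"
  unfolding avg_Times unfolding avg_def
  by (simp add: sum_divide_distrib mult.commute) (rule sum.swap)

lemma avg_power2_le: "(avg A g)\<^sup>2 \<le> avg A (\<lambda>a. (g a)\<^sup>2)"
proof (cases "finite A \<and> A \<noteq> {}")
  case True
  have "0 \<le> avg A (\<lambda>a. (g a - avg A g)\<^sup>2)" by (simp add: avg_nonneg)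
  also have "(\<lambda>a. (g a - avg A g)\<^sup>2) = (\<lambda>a. (g a)\<^sup>2 - 2 * avg A g * g a + (avg A g)\<^sup>2)"
    by (auto simp: power2_eq_square algebra_simps)
  also have "avg A \<dots> = avg A (\<lambda>a. (g a)\<^sup>2) - 2 * avg A g * avg A g + (avg A g)\<^sup>2"
    using True by (simp add: avg_add avg_diff avg_cmult avg_const)
  finally show ?thesis by (simp add: power2_eq_square)
qed (auto simp: avg_def)

lemma avg_abs_le:
  assumes "avg A (\<lambda>a. (g a)\<^sup>2) \<le> c\<^sup>2" "0 \<le> c"
  shows "avg A (\<lambda>a. \<bar>g a\<bar>) \<le> c"
proof -
  have "(avg A (\<lambda>a. \<bar>g a\<bar>))\<^sup>2 \<le> c\<^sup>2"
    using avg_power2_le[of A "\<lambda>a. \<bar>g a\<bar>"] assms by simp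
  then show ?thesis using assms(2) power2_le_imp_le by blast
qed

text \<open>Some fixed \<open>b\<close> does at least as well as the average, and \<open>w b\<close>
  is the constant. In this way quantities that depend on opposite ends of a line are shown to be
  almost constant.\<close>

lemma most_pairs_const:
  assumes "finite B" "B \<noteq> {}" "freq (A \<times> B) (\<lambda>(a, b). \<bar>u a - w b\<bar> > e) \<le> d"
  shows "\<exists>c. freq A (\<lambda>a. \<bar>u a - c\<bar> > e) \<le> d"
proof -
  obtain b where "b \<in> B"
    "avg A (\<lambda>a. of_bool (\<bar>u a - w b\<bar> > e)) \<le> avg B (\<lambda>b. avg A (\<lambda>a. of_bool (\<bar>u a - w b\<bar> > e)))"
    using ex_le_avg[OF assms(1,2), of "\<lambda>b. freq A (\<lambda>a. \<bar>u a - w b\<bar> > e)"] by blast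
  then show ?thesis using assms(3) by (intro exI[of _ "w b"]) (simp add: avg_Times2)
qed

text \<open>The squared deviations of the increments from their mean add up to the sum of the
  squared increments minus the squared total over \<open>m\<close>, and the hypotheses leave at most
  \<open>2 * \<epsilon> * m * r^2\<close> of that on average. Cauchy-Schwarz passes from increments
  to partial sums, Markov's inequality from averages to frequencies.\<close>

lemma near_affine:
  fixes g :: "nat \<Rightarrow> 'a \<Rightarrow> real"
  assumes fin: "finite A" "A \<noteq> {}" and m: "0 < m" and pos: "0 < r" "0 < \<eta>"
    and tot: "avg A (\<lambda>a. (g m a - g 0 a)\<^sup>2) \<ge> (e - \<epsilon>) * (real m * r)\<^sup>2"
    and inc: "\<And>j. j < m \<Longrightarrow> avg A (\<lambda>a. (g (Suc j) a - g j a)\<^sup>2) \<le> (e + \<epsilon>) * r\<^sup>2"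
  shows "freq A (\<lambda>a. \<exists>j\<le>m. \<bar>g j a - g 0 a - real j / real m * (g m a - g 0 a)\<bar> \<ge> \<eta> * (real m * r))
          \<le> 2 * \<epsilon> / \<eta>\<^sup>2"
proof -
  define D where "D a = (g m a - g 0 a) / real m" for a
  define V where "V a = (\<Sum>j<m. (g (Suc j) a - g j a - D a)\<^sup>2)" for a
  have tele: "(\<Sum>j<k. g (Suc j) a - g j a) = g k a - g 0 a" for k a
    by (rule sum_lessThan_telescope)
  have V: "V a = (\<Sum>j<m. (g (Suc j) a - g j a)\<^sup>2) - (g m a - g 0 a)\<^sup>2 / real m" for a
  proof -
    have "V a = (\<Sum>j<m. (g (Suc j) a - g j a)\<^sup>2 - 2 * D a * (g (Suc j) a - g j a) + (D a)\<^sup>2)"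
      unfolding V_def by (intro sum.cong) (auto simp: power2_eq_square algebra_simps)
    also have "\<dots> = (\<Sum>j<m. (g (Suc j) a - g j a)\<^sup>2) - 2 * D a * (g m a - g 0 a) + m * (D a)\<^sup>2"
      unfolding tele[symmetric] by (simp add: sum.distrib sum_subtractf sum_distrib_left right_diff_distrib)
    also have "2 * D a * (g m a - g 0 a) = 2 * ((g m a - g 0 a)\<^sup>2 / real m)"
      by (simp add: D_def power2_eq_square)
    also have "m * (D a)\<^sup>2 = (g m a - g 0 a)\<^sup>2 / real m"
      using m by (simp add: D_def power2_eq_square)
    finally show ?thesis by linarith
  qed
  have "avg A V = (\<Sum>j<m. avg A (\<lambda>a. (g (Suc j) a - g j a)\<^sup>2)) - avg A (\<lambda>a. (g m a - g 0 a)\<^sup>2) / real m"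
    using avg_cmult[of A "1 / real m"] by (simp add: V[abs_def] avg_diff avg_sum)
  also have "\<dots> \<le> (\<Sum>j<m. (e + \<epsilon>) * r\<^sup>2) - (e - \<epsilon>) * (real m * r)\<^sup>2 / real m"
    by (intro diff_mono sum_mono inc divide_right_mono tot) auto
  also have "\<dots> = 2 * \<epsilon> * m * r\<^sup>2"
    using m by (simp add: power2_eq_square field_simps)
  finally have aV: "avg A V \<le> 2 * \<epsilon> * m * r\<^sup>2" .
  have dev: "(g j a - g 0 a - real j / real m * (g m a - g 0 a))\<^sup>2 \<le> m * V a" if "j \<le> m" for j a
  proof -
    have "g j a - g 0 a - real j / real m * (g m a - g 0 a) = (\<Sum>i<j. g (Suc i) a - g i a - D a)"
      using tele[where k = j and a = a] by (simp add: sum_subtractf D_def)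
    also have "\<dots>\<^sup>2 \<le> (\<Sum>i<j. 1\<^sup>2) * (\<Sum>i<j. (g (Suc i) a - g i a - D a)\<^sup>2)"
      using Cauchy_Schwarz_ineq_sum[of "\<lambda>_. 1" "\<lambda>i. g (Suc i) a - g i a - D a" "{..<j}"] by simp
    also have "\<dots> \<le> m * V a"
      unfolding V_def using that by (intro mult_mono sum_mono2) (auto intro: sum_nonneg)
    finally show ?thesis .
  qed
  have "freq A (\<lambda>a. \<exists>j\<le>m. \<bar>g j a - g 0 a - real j / real m * (g m a - g 0 a)\<bar> \<ge> \<eta> * (real m * r))
      \<le> freq A (\<lambda>a. \<eta>\<^sup>2 * m * r\<^sup>2 \<le> V a)"
  proof (rule freq_mono)
    fix a assume "\<exists>j\<le>m. \<bar>g j a - g 0 a - real j / real m * (g m a - g 0 a)\<bar> \<ge> \<eta> * (real m * r)"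
    then obtain j where j: "j \<le> m" "\<bar>g j a - g 0 a - real j / real m * (g m a - g 0 a)\<bar> \<ge> \<eta> * (real m * r)"
      by blast
    have "(\<eta> * (real m * r))\<^sup>2 \<le> \<bar>g j a - g 0 a - real j / real m * (g m a - g 0 a)\<bar>\<^sup>2"
      using j pos m by (intro power_mono) auto
    also have "\<dots> \<le> m * V a" using dev[OF j(1)] by simp
    finally show "\<eta>\<^sup>2 * m * r\<^sup>2 \<le> V a" using m by (simp add: power2_eq_square mult_ac)
  qed
  also have "\<dots> \<le> avg A V / (\<eta>\<^sup>2 * m * r\<^sup>2)"
    by (rule markov) (use m pos in \<open>auto simp: V_def sum_nonneg\<close>)
  also have "\<dots> \<le> 2 * \<epsilon> * m * r\<^sup>2 / (\<eta>\<^sup>2 * m * r\<^sup>2)"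
    using aV m pos by (intro divide_right_mono) auto
  finally show ?thesis using m pos by simp
qed

text \<open>A path of variation \<open>T\<close> that covers a range \<open>R\<close> between two of
  its times has at most \<open>T - R\<close> left outside them, so its net displacement is at least
  \<open>R - (T - R)\<close>. A backward piece of size \<open>c\<close> costs \<open>2 * c\<close>
  of variation beyond the net displacement, whence \<open>c \<le> T - R\<close>.\<close>

lemma tv_mono:
  fixes g :: "nat \<Rightarrow> real"
  assumes tv: "(\<Sum>j<m. \<bar>g (Suc j) - g j\<bar>) \<le> T" and "i \<le> m" "k \<le> m" "g i - g k \<ge> R"
  shows "\<bar>g m - g 0\<bar> \<ge> 2 * R - T"
    and "\<lbrakk>p \<le> q; q \<le> m; \<bar>\<sigma>\<bar> = 1; \<sigma> * (g m - g 0) = \<bar>g m - g 0\<bar>\<rbrakk> \<Longrightarrow> \<sigma> * (g q - g p) \<ge> R - T"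
proof -
  have seg: "\<bar>g b - g a\<bar> \<le> (\<Sum>j=a..<b. \<bar>g (Suc j) - g j\<bar>)" if "a \<le> b" for a b
    using sum_abs[of "\<lambda>j. g (Suc j) - g j" "{a..<b}"] sum_Suc_diff'[OF that, of g] by simp
  have three: "\<bar>g a - g 0\<bar> + \<bar>g b - g a\<bar> + \<bar>g m - g b\<bar> \<le> T" if "a \<le> b" "b \<le> m" for a b
  proof -
    have "\<bar>g a - g 0\<bar> + \<bar>g b - g a\<bar> + \<bar>g m - g b\<bar>
       \<le> (\<Sum>j=0..<a. \<bar>g (Suc j) - g j\<bar>) + (\<Sum>j=a..<b. \<bar>g (Suc j) - g j\<bar>) + (\<Sum>j=b..<m. \<bar>g (Suc j) - g j\<bar>)"
      using seg[of 0 a] seg[of a b] seg[of b m] that by linarith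
    also have "\<dots> = (\<Sum>j=0..<m. \<bar>g (Suc j) - g j\<bar>)"
      using that by (simp add: sum.atLeastLessThan_concat)
    also have "\<dots> \<le> T" using tv by (simp add: atLeast0LessThan)
    finally show ?thesis .
  qed
  have RT: "R \<le> T" using three[of i k] three[of k i] assms(2-4) by (cases "i \<le> k") linarith+
  show A: "\<bar>g m - g 0\<bar> \<ge> 2 * R - T"
    using three[of i k] three[of k i] assms(2-4) by (cases "i \<le> k") linarith+
  assume pq: "p \<le> q" "q \<le> m" "\<bar>\<sigma>\<bar> = 1" "\<sigma> * (g m - g 0) = \<bar>g m - g 0\<bar>"
  have le: "\<sigma> * x \<le> \<bar>x\<bar>" for x
    using abs_ge_self[of "\<sigma> * x"] pq(3) by (simp add: abs_mult)
  have "\<sigma> * (g m - g 0) = \<sigma> * (g p - g 0) + \<sigma> * (g q - g p) + \<sigma> * (g m - g q)"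
    by (simp add: algebra_simps)
  moreover have "\<bar>\<sigma> * (g q - g p)\<bar> = \<bar>g q - g p\<bar>" using pq(3) by (simp add: abs_mult)
  ultimately show "\<sigma> * (g q - g p) \<ge> R - T"
    using three[OF pq(1,2)] A pq(4) RT le[of "g p - g 0"] le[of "g m - g q"] by linarith
qed

section \<open>Cells and vertical lines\<close>

lemma int_div_eq_iff: "(0::int) < q \<Longrightarrow> b div q = a \<longleftrightarrow> a * q \<le> b \<and> b < (a + 1) * q"
proof
  assume q: "0 < q" and "b div q = a"
  then have "b = a * q + b mod q" using div_mult_mod_eq[of b q] by simp
  then show "a * q \<le> b \<and> b < (a + 1) * q"
    using pos_mod_bound[OF q, of b] pos_mod_sign[OF q, of b] by (simp add: distrib_right)
next
  assume "0 < q" and "a * q \<le> b \<and> b < (a + 1) * q"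
  then show "b div q = a"
    by (intro int_div_pos_eq[of b q a "b - a * q"]) (auto simp: algebra_simps)
qed

lemma card_int_interval_le:
  fixes c R q :: real
  assumes "0 < q" "0 \<le> R"
  shows "finite {k::int. \<bar>of_int k * q - c\<bar> \<le> R}"
    and "real (card {k::int. \<bar>of_int k * q - c\<bar> \<le> R}) \<le> 2 * R / q + 1"
proof -
  have sub: "{k::int. \<bar>of_int k * q - c\<bar> \<le> R} \<subseteq> {\<lceil>(c - R) / q\<rceil>..\<lfloor>(c + R) / q\<rfloor>}"
    using assms by (auto simp: ceiling_le_iff le_floor_iff field_simps)
  then show "finite {k::int. \<bar>of_int k * q - c\<bar> \<le> R}"
    using finite_subset by blast
  have "real (card {k::int. \<bar>of_int k * q - c\<bar> \<le> R}) \<le> real (card {\<lceil>(c - R) / q\<rceil>..\<lfloor>(c + R) / q\<rfloor>})"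
    using card_mono[OF _ sub] by simp
  also have "\<dots> = real (nat (\<lfloor>(c + R) / q\<rfloor> - \<lceil>(c - R) / q\<rceil> + 1))" by simp
  also have "\<dots> \<le> (c + R) / q - (c - R) / q + 1"
  proof -
    have "(c - R) / q \<le> (c + R) / q" using assms by (intro divide_right_mono) auto
    then have "real_of_int (\<lfloor>(c + R) / q\<rfloor> - \<lceil>(c - R) / q\<rceil> + 1) \<le> (c + R) / q - (c - R) / q + 1"
      "0 \<le> (c + R) / q - (c - R) / q + 1" by linarith+
    then show ?thesis by (cases "0 \<le> \<lfloor>(c + R) / q\<rfloor> - \<lceil>(c - R) / q\<rceil> + 1") simp_all
  qed
  also have "\<dots> = 2 * R / q + 1" using assms by (simp add: field_simps)
  finally show "real (card {k::int. \<bar>of_int k * q - c\<bar> \<le> R}) \<le> 2 * R / q + 1" .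
qed

lemma card_int_vectors_le:
  fixes c R q :: "'n::finite \<Rightarrow> real"
  assumes "\<And>i. 0 < q i" "\<And>i. 0 \<le> R i" "\<And>i. 2 * R i / q i + 1 \<le> B i"
  shows "finite {k::'n \<Rightarrow> int. \<forall>i. \<bar>of_int (k i) * q i - c i\<bar> \<le> R i}"
    and "real (card {k::'n \<Rightarrow> int. \<forall>i. \<bar>of_int (k i) * q i - c i\<bar> \<le> R i}) \<le> (\<Prod>i\<in>UNIV. B i)"
proof -
  let ?S = "\<lambda>i. {k::int. \<bar>of_int k * q i - c i\<bar> \<le> R i}"
  have eq: "{k::'n \<Rightarrow> int. \<forall>i. \<bar>of_int (k i) * q i - c i\<bar> \<le> R i} = PiE UNIV ?S"
    by (auto simp: PiE_def)
  show "finite {k::'n \<Rightarrow> int. \<forall>i. \<bar>of_int (k i) * q i - c i\<bar> \<le> R i}"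
    unfolding eq by (intro finite_PiE card_int_interval_le) (use assms in auto)
  have "real (card (PiE UNIV ?S)) = (\<Prod>i\<in>UNIV. real (card (?S i)))"
    by (simp add: card_PiE)
  also have "\<dots> \<le> (\<Prod>i\<in>UNIV. B i)"
    by (intro prod_mono conjI order.trans[OF card_int_interval_le(2) assms(3)]) (use assms in auto)
  finally show "real (card {k::'n \<Rightarrow> int. \<forall>i. \<bar>of_int (k i) * q i - c i\<bar> \<le> R i}) \<le> (\<Prod>i\<in>UNIV. B i)"
    unfolding eq .
qed

section \<open>Dyadic scales and the two trees of cells\<close>

locale weights =
  fixes lam :: "'n::finite \<Rightarrow> real"
  assumes nz: "lam i \<noteq> 0" and sum_lam: "(\<Sum>i\<in>UNIV. lam i) = 0"
begin

text \<open>The cell of height \<open>z\<close> with label \<open>k\<close> stands for the point with coordinates \<open>k i * 2 powr E i z\<close>. Labels are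
  split into a part with index set \<open>P\<close> and one with index set \<open>N\<close>, each undefined outside its index set. The
  map \<open>up A u v\<close> sends a cell of height \<open>u\<close> to the one of height \<open>v\<close> containing it, which makes sense for
  \<open>u \<le> v\<close> if \<open>A = P\<close> and for \<open>v \<le> u\<close> if \<open>A = N\<close>; \<open>dn A u v a\<close> are the cells of height \<open>u\<close> inside \<open>a\<close>.\<close>

definition E :: "'n \<Rightarrow> int \<Rightarrow> int" where "E i z = \<lfloor>lam i * real_of_int z\<rfloor>"
definition P :: "'n set" where "P = {i. 0 < lam i}"
definition N :: "'n set" where "N = {i. lam i < 0}"
definition lmx :: real where "lmx = (\<Sum>i\<in>UNIV. \<bar>lam i\<bar>)"
definition lmn :: real where "lmn = Min (range (\<lambda>i. \<bar>lam i\<bar>))"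
definition Lam :: real where "Lam = (\<Sum>i\<in>P. lam i)"

lemma P_N: "i \<in> N \<longleftrightarrow> i \<notin> P"
  using nz[of i] by (auto simp: P_def N_def)

lemma abs_lam_le: "\<bar>lam i\<bar> \<le> lmx"
  unfolding lmx_def by (rule member_le_sum) auto

lemma lmx_nonneg: "0 \<le> lmx" by (simp add: lmx_def sum_nonneg)

lemma lmn_pos: "0 < lmn" unfolding lmn_def by (subst Min_gr_iff) (auto simp: nz)

lemma lmn_le: "lmn \<le> \<bar>lam i\<bar>" unfolding lmn_def by (intro Min_le) auto

lemma Lam_N: "(\<Sum>i\<in>N. lam i) = - Lam"
proof -
  have "(\<Sum>i\<in>UNIV. lam i) = (\<Sum>i\<in>P. lam i) + (\<Sum>i\<in>N. lam i)"
    by (subst sum.union_disjoint[symmetric]) (auto simp: P_N intro!: sum.cong)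
  then show ?thesis using sum_lam by (simp add: Lam_def)
qed

lemma Lam_pos: "0 < Lam"
proof -
  have "P \<noteq> {}"
  proof
    assume P: "P = {}"
    then have "N = UNIV" by (auto simp: P_N)
    then have "(\<Sum>i\<in>UNIV. lam i) < (\<Sum>i\<in>(UNIV::'n set). 0)"
      by (intro sum_strict_mono) (auto simp: N_def)
    then show False using sum_lam by simp
  qed
  then show ?thesis unfolding Lam_def by (intro sum_pos) (auto simp: P_def)
qed

lemma E_le: "real_of_int (E i z) \<le> lam i * z" by (simp add: E_def)
lemma E_ge: "lam i * z - 1 \<le> real_of_int (E i z)" unfolding E_def by linarith

text \<open>Cells grow upwards in the coordinates of \<open>P\<close> and downwards in those of
  \<open>N\<close>. Comparing scales instead of heights lets one set of lemmas, with
  \<open>A\<close> as parameter, serve both trees.\<close>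

definition coarser :: "'n set \<Rightarrow> int \<Rightarrow> int \<Rightarrow> bool" where
  "coarser A u v \<longleftrightarrow> (\<forall>i\<in>A. E i u \<le> E i v)"

lemma coarser_P: "s \<le> t \<Longrightarrow> coarser P s t"
  by (auto simp: coarser_def E_def P_def intro!: floor_mono)

lemma coarser_N: "s \<le> t \<Longrightarrow> coarser N t s"
  by (auto simp: coarser_def E_def N_def intro!: floor_mono mult_left_mono_neg)

text \<open>Since the exponents \<open>E\<close> are integers, the ratio of two cell sizes is
  exactly \<open>2 ^ depth u v i\<close> when \<open>v\<close> is the coarser height. This is what
  makes cells nest and \<open>up\<close> an integer division.\<close>

definition depth :: "int \<Rightarrow> int \<Rightarrow> 'n \<Rightarrow> nat" where "depth u v i = nat (E i v - E i u)"

definition up :: "'n set \<Rightarrow> int \<Rightarrow> int \<Rightarrow> ('n \<Rightarrow> int) \<Rightarrow> ('n \<Rightarrow> int)" where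
  "up A u v b = (\<lambda>i\<in>A. b i div 2 ^ depth u v i)"

definition dn :: "'n set \<Rightarrow> int \<Rightarrow> int \<Rightarrow> ('n \<Rightarrow> int) \<Rightarrow> ('n \<Rightarrow> int) set" where
  "dn A u v a = PiE A (\<lambda>i. {a i * 2 ^ depth u v i ..< (a i + 1) * 2 ^ depth u v i})"

lemma mem_dn: "b \<in> dn A u v a \<longleftrightarrow> b \<in> extensional A \<and> (\<forall>i\<in>A. b i div 2 ^ depth u v i = a i)"
  by (auto simp: dn_def PiE_def Pi_def int_div_eq_iff)

lemma up_ext [simp]: "up A u v b \<in> extensional A" by (simp add: up_def)

lemma mem_dn_up: "a \<in> extensional A \<Longrightarrow> b \<in> dn A u v a \<longleftrightarrow> b \<in> extensional A \<and> up A u v b = a"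
proof -
  assume a: "a \<in> extensional A"
  have "up A u v b = a \<longleftrightarrow> (\<forall>i\<in>A. b i div 2 ^ depth u v i = a i)"
  proof
    assume "\<forall>i\<in>A. b i div 2 ^ depth u v i = a i"
    then show "up A u v b = a"
      using a by (intro extensionalityI[of _ A]) (auto simp: up_def)
  qed (auto simp: up_def)
  then show ?thesis by (simp add: mem_dn)
qed

lemma dn_ext: "b \<in> dn A u v a \<Longrightarrow> b \<in> extensional A" by (simp add: mem_dn)

lemma up_dn: "a \<in> extensional A \<Longrightarrow> b \<in> dn A u v a \<Longrightarrow> up A u v b = a" by (simp add: mem_dn_up)

lemma up_self: "b \<in> extensional A \<Longrightarrow> up A u u b = b"
  by (auto simp: up_def depth_def fun_eq_iff extensional_def)

lemma depth_add: "coarser A u v \<Longrightarrow> coarser A v w \<Longrightarrow> i \<in> A \<Longrightarrow> depth u w i = depth u v i + depth v w i"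
  by (auto simp: coarser_def depth_def nat_add_distrib[symmetric])

lemma up_up: "coarser A u v \<Longrightarrow> coarser A v w \<Longrightarrow> up A v w (up A u v b) = up A u w b"
  by (auto simp: up_def fun_eq_iff depth_add power_add zdiv_zmult2_eq)

lemma finite_dn [simp]: "finite (dn A u v a)"
  unfolding dn_def by (intro finite_PiE) auto

lemma card_dn: "card (dn A u v a) = 2 ^ (\<Sum>i\<in>A. depth u v i)"
proof -
  have "nat ((a + 1) * 2 ^ k - a * 2 ^ k) = 2 ^ k" for a :: int and k
    by (simp add: distrib_right nat_power_eq)
  then show ?thesis unfolding dn_def by (simp add: card_PiE power_sum nat_power_eq)
qed

lemma dn_ne [simp]: "dn A u v a \<noteq> {}"
proof
  assume "dn A u v a = {}"
  then have "card (dn A u v a) = 0" by simp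
  then show False by (simp add: card_dn)
qed

lemma dn_fibre:
  assumes "coarser A u v" "coarser A v w" "a \<in> extensional A" "c \<in> dn A v w a"
  shows "{b \<in> dn A u w a. up A u v b = c} = dn A u v c"
proof -
  have c: "c \<in> extensional A" "up A v w c = a"
    using dn_ext[OF assms(4)] up_dn[OF assms(3,4)] by blast+
  have "b \<in> dn A u w a \<and> up A u v b = c \<longleftrightarrow> b \<in> dn A u v c" for b
    unfolding mem_dn_up[OF assms(3)] mem_dn_up[OF c(1)] using up_up[OF assms(1,2), of b] c(2) by auto
  then show ?thesis by blast
qed

lemma up_mem_dn:
  assumes "coarser A u v" "coarser A v w" "a \<in> extensional A" "b \<in> dn A u w a"
  shows "up A u v b \<in> dn A v w a"
  using assms(4) up_up[OF assms(1,2), of b] unfolding mem_dn_up[OF assms(3)] by simp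

text \<open>Every cell has the same number of descendants at a given height, so choosing a random
  descendant at once or by way of an intermediate cell gives the same distribution.\<close>

lemma avg_dn_tower:
  assumes "coarser A u v" "coarser A v w" "a \<in> extensional A"
  shows "avg (dn A u w a) g = avg (dn A v w a) (\<lambda>b. avg (dn A u v b) g)"
proof -
  have "avg (dn A u w a) g = avg (dn A v w a) (\<lambda>c. avg {b \<in> dn A u w a. up A u v b = c} g)"
    using dn_fibre[OF assms] up_mem_dn[OF assms]
    by (intro avg_fibres[where c = "2 ^ (\<Sum>i\<in>A. depth u v i)"]) (auto simp: card_dn)
  also have "\<dots> = avg (dn A v w a) (\<lambda>b. avg (dn A u v b) g)"
    using dn_fibre[OF assms] by (intro avg_cong) auto
  finally show ?thesis .
qed

lemma avg_dn_up:
  assumes "coarser A u v" "coarser A v w" "a \<in> extensional A"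
  shows "avg (dn A u w a) (\<lambda>b. g (up A u v b)) = avg (dn A v w a) g"
  unfolding avg_dn_tower[OF assms]
proof (rule avg_cong)
  fix c assume c: "c \<in> dn A v w a"
  have "avg (dn A u v c) (\<lambda>b. g (up A u v b)) = avg (dn A u v c) (\<lambda>b. g c)"
    using up_dn[OF dn_ext[OF c]] by (intro avg_cong) auto
  then show "avg (dn A u v c) (\<lambda>b. g (up A u v b)) = g c" by (simp add: avg_const)
qed

text \<open>Rounding the exponents costs at most 1 in each coordinate. This is a source of the
  factors \<open>2 powr CARD('n)\<close> in the counts that follow.\<close>

lemma sum_depth_bounds:
  assumes "coarser A u v"
  shows "real (\<Sum>i\<in>A. depth u v i) \<le> (\<Sum>i\<in>A. lam i) * (v - u) + CARD('n)"
    and "(\<Sum>i\<in>A. lam i) * (v - u) - CARD('n) \<le> real (\<Sum>i\<in>A. depth u v i)"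
proof -
  have b: "real (depth u v i) \<le> lam i * (v - u) + 1" "lam i * (v - u) - 1 \<le> real (depth u v i)" if "i \<in> A" for i
  proof -
    have "real (depth u v i) = real_of_int (E i v) - real_of_int (E i u)"
      using assms that by (simp add: coarser_def depth_def)
    then show "real (depth u v i) \<le> lam i * (v - u) + 1" "lam i * (v - u) - 1 \<le> real (depth u v i)"
      using E_le[of i u] E_ge[of i u] E_le[of i v] E_ge[of i v] by (simp_all add: algebra_simps)
  qed
  have c: "real (card A) \<le> CARD('n)" by (simp add: card_mono)
  have "real (\<Sum>i\<in>A. depth u v i) \<le> (\<Sum>i\<in>A. lam i * (v - u) + 1)"
    unfolding of_nat_sum by (intro sum_mono b)
  also have "\<dots> \<le> (\<Sum>i\<in>A. lam i) * (v - u) + CARD('n)"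
    using c by (simp add: sum.distrib sum_distrib_right)
  finally show "real (\<Sum>i\<in>A. depth u v i) \<le> (\<Sum>i\<in>A. lam i) * (v - u) + CARD('n)" .
  have "(\<Sum>i\<in>A. lam i) * (v - u) - CARD('n) \<le> (\<Sum>i\<in>A. lam i * (v - u) - 1)"
    using c by (simp add: sum_subtractf sum_distrib_right)
  also have "\<dots> \<le> real (\<Sum>i\<in>A. depth u v i)"
    unfolding of_nat_sum by (intro sum_mono b)
  finally show "(\<Sum>i\<in>A. lam i) * (v - u) - CARD('n) \<le> real (\<Sum>i\<in>A. depth u v i)" .
qed

lemma card_dn_P:
  assumes "s \<le> t"
  shows "real (card (dn P s t a)) \<le> 2 powr (Lam * (t - s) + CARD('n))"
    and "2 powr (Lam * (t - s) - CARD('n)) \<le> real (card (dn P s t a))"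
  using sum_depth_bounds[OF coarser_P[OF assms]]
  by (simp_all add: card_dn Lam_def powr_realpow[symmetric] del: of_nat_sum)

lemma card_dn_N:
  assumes "s \<le> t"
  shows "real (card (dn N t s a)) \<le> 2 powr (Lam * (t - s) + CARD('n))"
    and "2 powr (Lam * (t - s) - CARD('n)) \<le> real (card (dn N t s a))"
proof -
  have "(\<Sum>i\<in>N. lam i) * real_of_int (s - t) = Lam * (t - s)"
    by (simp add: Lam_N algebra_simps)
  then show "real (card (dn N t s a)) \<le> 2 powr (Lam * (t - s) + CARD('n))"
    "2 powr (Lam * (t - s) - CARD('n)) \<le> real (card (dn N t s a))"
    using sum_depth_bounds[OF coarser_N[OF assms]]
    by (simp_all add: card_dn powr_realpow[symmetric] del: of_nat_sum)
qed

text \<open>A vertical line over the heights \<open>s..t\<close> is given by its finest labels: the \<open>P\<close>-part \<open>x\<close> at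
  height \<open>s\<close> and the \<open>N\<close>-part \<open>y\<close> at height \<open>t\<close>.\<close>

definition mk :: "int \<Rightarrow> ('n \<Rightarrow> int) \<Rightarrow> ('n \<Rightarrow> int) \<Rightarrow> int \<times> ('n \<Rightarrow> int)" where
  "mk z x y = (z, \<lambda>i. if i \<in> P then x i else y i)"

definition line :: "int \<Rightarrow> int \<Rightarrow> ('n \<Rightarrow> int) \<Rightarrow> ('n \<Rightarrow> int) \<Rightarrow> int \<Rightarrow> int \<times> ('n \<Rightarrow> int)" where
  "line s t x y u = mk u (up P s u x) (up N t u y)"

definition pos :: "int \<times> ('n \<Rightarrow> int) \<Rightarrow> 'n \<Rightarrow> real" where
  "pos p i = real_of_int (snd p i) * 2 powr E i (fst p)"

text \<open>A coarse substitute for the distance. Horizontal separation is measured logarithmically,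
  in units belonging to the height of the first point, as in hyperbolic space. The relation is
  symmetric and transitive only up to constants that depend on \<open>lmx\<close>.\<close>

definition near :: "real \<Rightarrow> int \<times> ('n \<Rightarrow> int) \<Rightarrow> int \<times> ('n \<Rightarrow> int) \<Rightarrow> bool" where
  "near D p q \<longleftrightarrow> \<bar>real_of_int (fst p) - fst q\<bar> \<le> D \<and>
     (\<forall>i. \<bar>pos p i - pos q i\<bar> \<le> 2 powr (lam i * fst p + D))"

lemma fst_mk [simp]: "fst (mk z x y) = z" by (simp add: mk_def)
lemma fst_line [simp]: "fst (line s t x y u) = u" by (simp add: line_def)

lemma mk_inj: "\<lbrakk>mk z x y = mk z' x' y'; x \<in> extensional P; x' \<in> extensional P;
   y \<in> extensional N; y' \<in> extensional N\<rbrakk> \<Longrightarrow> z = z' \<and> x = x' \<and> y = y'"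
  by (auto simp: mk_def fun_eq_iff extensional_def P_N split: if_splits) metis+

lemma mk_surj: "p = mk (fst p) (restrict (snd p) P) (restrict (snd p) N)"
  by (cases p) (auto simp: mk_def fun_eq_iff P_N)

lemma near_refl: "0 \<le> D \<Longrightarrow> near D p p" by (simp add: near_def)

lemma lam_shift: "\<bar>z - z'\<bar> \<le> D \<Longrightarrow> lam i * z \<le> lam i * z' + lmx * D"
proof -
  assume "\<bar>z - z'\<bar> \<le> D"
  then have "\<bar>lam i * (z - z')\<bar> \<le> lmx * D"
    unfolding abs_mult using abs_lam_le[of i] lmx_nonneg by (intro mult_mono) auto
  then show ?thesis by (simp add: algebra_simps abs_le_iff)
qed

text \<open>The same relation for real points. It carries the proofs of symmetry and transitivity
  for cells and again for points of the group.\<close>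

definition nearby :: "real \<Rightarrow> real \<times> ('n \<Rightarrow> real) \<Rightarrow> real \<times> ('n \<Rightarrow> real) \<Rightarrow> bool" where
  "nearby D p q \<longleftrightarrow> \<bar>fst p - fst q\<bar> \<le> D \<and> (\<forall>i. \<bar>snd p i - snd q i\<bar> \<le> 2 powr (lam i * fst p + D))"

lemma nearby_nonneg: "nearby D p q \<Longrightarrow> 0 \<le> D"
  unfolding nearby_def by (meson abs_ge_zero order.trans)

lemma nearby_sym: "nearby D p q \<Longrightarrow> nearby ((1 + lmx) * D) q p"
proof -
  assume n: "nearby D p q"
  then have D: "0 \<le> D" by (rule nearby_nonneg)
  have "\<bar>snd q i - snd p i\<bar> \<le> 2 powr (lam i * fst q + (1 + lmx) * D)" for i
  proof -
    have "\<bar>snd q i - snd p i\<bar> \<le> 2 powr (lam i * fst p + D)"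
      using n by (simp add: nearby_def abs_minus_commute)
    also have "\<dots> \<le> 2 powr (lam i * fst q + (1 + lmx) * D)"
      using lam_shift[of "fst p" "fst q" D i] n by (intro powr_mono) (auto simp: nearby_def algebra_simps)
    finally show ?thesis .
  qed
  moreover have "\<bar>fst q - fst p\<bar> \<le> (1 + lmx) * D"
    using n D lmx_nonneg mult_nonneg_nonneg[of lmx D] unfolding nearby_def distrib_right by linarith
  ultimately show ?thesis by (simp add: nearby_def)
qed

lemma nearby_trans: "nearby D p q \<Longrightarrow> nearby D' q r \<Longrightarrow> nearby ((1 + lmx) * (D + D') + 1) p r"
proof -
  assume n: "nearby D p q" and n': "nearby D' q r"
  have D: "0 \<le> D" "0 \<le> D'" using nearby_nonneg n n' by blast+
  have lD: "0 \<le> lmx * D" "0 \<le> lmx * D'" using D lmx_nonneg by auto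
  have "\<bar>snd p i - snd r i\<bar> \<le> 2 powr (lam i * fst p + ((1 + lmx) * (D + D') + 1))" for i
  proof -
    let ?X = "2 powr (lam i * fst p + (1 + lmx) * (D + D'))"
    have "\<bar>snd p i - snd q i\<bar> \<le> 2 powr (lam i * fst p + D)" using n by (simp add: nearby_def)
    also have "\<dots> \<le> ?X" using D lD by (intro powr_mono) (auto simp: algebra_simps)
    finally have 1: "\<bar>snd p i - snd q i\<bar> \<le> ?X" .
    have "\<bar>snd q i - snd r i\<bar> \<le> 2 powr (lam i * fst q + D')" using n' by (simp add: nearby_def)
    also have "\<dots> \<le> ?X"
      using lam_shift[of "fst q" "fst p" D i] n D lD
      by (intro powr_mono) (auto simp: nearby_def algebra_simps abs_minus_commute)
    finally have "\<bar>snd p i - snd r i\<bar> \<le> 2 * ?X" using 1 by linarith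
    also have "\<dots> = 2 powr (lam i * fst p + ((1 + lmx) * (D + D') + 1))"
      by (simp add: powr_add)
    finally show ?thesis .
  qed
  moreover have "\<bar>fst p - fst r\<bar> \<le> (1 + lmx) * (D + D') + 1"
    using n n' lD unfolding nearby_def distrib_right distrib_left by linarith
  ultimately show ?thesis by (simp add: nearby_def)
qed

lemma nearby_mono: "nearby D p q \<Longrightarrow> D \<le> D' \<Longrightarrow> nearby D' p q"
proof -
  assume n: "nearby D p q" and D: "D \<le> D'"
  have "2 powr (lam i * fst p + D) \<le> 2 powr (lam i * fst p + D')" for i using D by (intro powr_mono) auto
  then show "nearby D' p q" using n D unfolding nearby_def by (meson order.trans)
qed

lemma near_nearby: "near D p q \<longleftrightarrow> nearby D (real_of_int (fst p), pos p) (real_of_int (fst q), pos q)"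
  by (simp add: near_def nearby_def)

lemma near_nonneg: "near D p q \<Longrightarrow> 0 \<le> D" unfolding near_nearby by (rule nearby_nonneg)
lemma near_mono: "near D p q \<Longrightarrow> D \<le> D' \<Longrightarrow> near D' p q" unfolding near_nearby by (rule nearby_mono)
lemma near_sym: "near D p q \<Longrightarrow> near ((1 + lmx) * D) q p" unfolding near_nearby by (rule nearby_sym)
lemma near_trans: "near D p q \<Longrightarrow> near D' q r \<Longrightarrow> near ((1 + lmx) * (D + D') + 1) p r"
  unfolding near_nearby by (rule nearby_trans)

lemma up_pos:
  assumes "coarser A u v" "i \<in> A"
  shows "\<bar>real_of_int (b i) * 2 powr E i u - real_of_int (up A u v b i) * 2 powr E i v\<bar> \<le> 2 powr E i v"
proof -
  let ?q = "2 ^ depth u v i :: int"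
  have q: "real_of_int ?q * 2 powr E i u = 2 powr E i v"
    using assms by (simp add: coarser_def depth_def powr_realpow[symmetric] powr_add[symmetric])
  have "b i = up A u v b i * ?q + b i mod ?q" using assms by (simp add: up_def del: div_mult_mod_eq) (simp only: div_mult_mod_eq)
  then have "real_of_int (b i) = of_int (up A u v b i) * of_int ?q + of_int (b i mod ?q)"
    by (metis of_int_add of_int_mult)
  then have "real_of_int (b i) * 2 powr E i u - real_of_int (up A u v b i) * 2 powr E i v
      = of_int (b i mod ?q) * 2 powr E i u"
    unfolding q[symmetric] by (simp add: algebra_simps)
  moreover have "0 \<le> b i mod ?q" "b i mod ?q < ?q" by auto
  then have "0 \<le> real_of_int (b i mod ?q)" "real_of_int (b i mod ?q) \<le> real_of_int ?q"
    by (simp_all only: of_int_0_le_iff of_int_le_iff less_imp_le)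
  then have "0 \<le> of_int (b i mod ?q) * 2 powr E i u"
    "of_int (b i mod ?q) * 2 powr E i u \<le> real_of_int ?q * 2 powr E i u"
    by (simp_all del: of_int_power add: mult_right_mono)
  ultimately show ?thesis unfolding q by linarith
qed

lemma pos_line_P: "i \<in> P \<Longrightarrow> pos (line s t x y u) i = real_of_int (up P s u x i) * 2 powr E i u"
  by (simp add: pos_def line_def mk_def)

lemma pos_line_N: "i \<in> N \<Longrightarrow> pos (line s t x y u) i = real_of_int (up N t u y i) * 2 powr E i u"
  by (simp add: pos_def line_def mk_def P_N)

text \<open>In each coordinate the two points lie in a common cell of the coarser of their two
  scales, and a change of height by \<open>\<bar>u - v\<bar>\<close> changes the exponent of a scale
  by at most \<open>lmx * \<bar>u - v\<bar>\<close>.\<close>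

lemma near_line:
  assumes "s \<le> u" "u \<le> t" "s \<le> v" "v \<le> t"
  shows "near ((1 + lmx) * \<bar>u - v\<bar>) (line s t x y u) (line s t x y v)"
proof -
  have *: "\<bar>pos (line s t x y u) i - pos (line s t x y v) i\<bar> \<le> 2 powr (lam i * w + lmx * \<bar>u - v\<bar>)"
    if uv: "u \<le> v" "s \<le> u" "v \<le> t" and w: "w \<in> {u, v}" for u v w i
  proof (cases "i \<in> P")
    case True
    have "\<bar>pos (line s t x y u) i - pos (line s t x y v) i\<bar> \<le> 2 powr E i v"
      using up_pos[OF coarser_P True, of u v "up P s u x"] uv True
      by (simp add: pos_line_P up_up coarser_P)
    also have "\<dots> \<le> 2 powr (lam i * w + lmx * \<bar>u - v\<bar>)"
      using lam_shift[of v w "\<bar>u - v\<bar>" i] E_le[of i v] w by (intro powr_mono) (auto simp: abs_minus_commute)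
    finally show ?thesis .
  next
    case False
    then have i: "i \<in> N" by (simp add: P_N)
    have "\<bar>pos (line s t x y v) i - pos (line s t x y u) i\<bar> \<le> 2 powr E i u"
      using up_pos[OF coarser_N i, of u v "up N t v y"] uv i
      by (simp add: pos_line_N up_up coarser_N)
    also have "\<dots> \<le> 2 powr (lam i * w + lmx * \<bar>u - v\<bar>)"
      using lam_shift[of u w "\<bar>u - v\<bar>" i] E_le[of i u] w by (intro powr_mono) (auto simp: abs_minus_commute)
    finally show ?thesis by (simp add: abs_minus_commute)
  qed
  have "\<bar>pos (line s t x y u) i - pos (line s t x y v) i\<bar> \<le> 2 powr (lam i * u + (1 + lmx) * \<bar>u - v\<bar>)" for i
  proof -
    have "\<bar>pos (line s t x y u) i - pos (line s t x y v) i\<bar> \<le> 2 powr (lam i * u + lmx * \<bar>u - v\<bar>)"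
      using *[of u v u i] *[of v u u i] assms by (cases "u \<le> v") (auto simp: abs_minus_commute)
    also have "\<dots> \<le> 2 powr (lam i * u + (1 + lmx) * \<bar>u - v\<bar>)"
      by (intro powr_mono) (auto simp: algebra_simps)
    finally show ?thesis .
  qed
  moreover have "\<bar>real_of_int u - v\<bar> \<le> (1 + lmx) * \<bar>u - v\<bar>"
    using lmx_nonneg by (simp add: distrib_right)
  ultimately show ?thesis by (simp add: near_def)
qed

definition ballc :: "real \<Rightarrow> real" where
  "ballc D = (2 * D + 1) * (2 * 2 powr (D + lmx * D + 1) + 1) ^ CARD('n)"

text \<open>Bounded geometry: there are at most \<open>2 * D + 1\<close> heights to consider, and at
  each of them the allowed displacement is at most \<open>2 powr (D + lmx * D + 1)\<close> cell
  sizes in every coordinate.\<close>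

lemma card_ball:
  assumes D: "0 \<le> D"
  shows "finite {q. near D p q}" "real (card {q. near D p q}) \<le> ballc D"
proof -
  let ?Z = "{z::int. \<bar>of_int z * 1 - real_of_int (fst p)\<bar> \<le> D}"
  let ?K = "\<lambda>z. {k::'n \<Rightarrow> int. \<forall>i. \<bar>of_int (k i) * 2 powr E i z - pos p i\<bar> \<le> 2 powr (lam i * fst p + D)}"
  let ?b = "2 * 2 powr (D + lmx * D + 1) + 1 :: real"
  have Z: "finite ?Z" "real (card ?Z) \<le> 2 * D + 1"
    using card_int_interval_le[of 1 D "real_of_int (fst p)"] D by simp_all
  have K: "finite (?K z)" "real (card (?K z)) \<le> ?b ^ CARD('n)" if z: "z \<in> ?Z" for z
  proof -
    have "2 * 2 powr (lam i * fst p + D) / 2 powr E i z + 1 \<le> ?b" for i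
    proof -
      have "2 powr (lam i * fst p + D) / 2 powr E i z = 2 powr (lam i * fst p + D - E i z)"
        by (simp add: powr_diff)
      also have "\<dots> \<le> 2 powr (D + lmx * D + 1)"
        using lam_shift[of "fst p" z D i] E_ge[of i z] z
        by (intro powr_mono) (auto simp: abs_minus_commute)
      finally show ?thesis by simp
    qed
    from card_int_vectors_le[OF _ _ this, where c = "pos p"]
    show "finite (?K z)" "real (card (?K z)) \<le> ?b ^ CARD('n)" by simp_all
  qed
  have sub: "{q. near D p q} \<subseteq> (SIGMA z:?Z. ?K z)"
    by (auto simp: near_def pos_def abs_minus_commute)
  have fin: "finite (SIGMA z:?Z. ?K z)" using Z K by (intro finite_SigmaI) auto
  with sub show "finite {q. near D p q}" by (rule finite_subset)
  have "real (card {q. near D p q}) \<le> real (card (SIGMA z:?Z. ?K z))"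
    using card_mono[OF fin sub] by simp
  also have "\<dots> = (\<Sum>z\<in>?Z. real (card (?K z)))"
    using Z K by (subst card_SigmaI) auto
  also have "\<dots> \<le> real (card ?Z) * ?b ^ CARD('n)"
    using sum_bounded_above[of ?Z "\<lambda>z. real (card (?K z))" "?b ^ CARD('n)"] K by simp
  also have "\<dots> \<le> ballc D"
    unfolding ballc_def using Z(2) by (intro mult_right_mono) auto
  finally show "real (card {q. near D p q}) \<le> ballc D" .
qed

end

lemma weights_neg: "weights lam \<Longrightarrow> weights (\<lambda>i. - lam i)"
  by (simp add: weights_def sum_negf)

section \<open>Discrete quasi-isometries\<close>

lemma poly_exp_small:
  fixes C c \<epsilon> :: real
  assumes "0 < c" "0 < \<epsilon>"
  shows "\<exists>L0. \<forall>L\<ge>L0. C * L ^ k * 2 powr (- c * L) \<le> \<epsilon>"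
proof -
  define d where "d = c * ln 2"
  have d: "0 < d" using assms by (simp add: d_def)
  have "filterlim (\<lambda>L. d * L) at_top at_top"
    using d by (intro filterlim_tendsto_pos_mult_at_top[OF tendsto_const]) (auto simp: filterlim_ident)
  then have "((\<lambda>L. (d * L) ^ k / exp (d * L)) \<longlongrightarrow> 0) at_top"
    by (rule filterlim_compose[OF tendsto_power_div_exp_0])
  then have "((\<lambda>L. C / d ^ k * ((d * L) ^ k / exp (d * L))) \<longlongrightarrow> 0) at_top"
    by (rule tendsto_mult_right_zero)
  also have "(\<lambda>L. C / d ^ k * ((d * L) ^ k / exp (d * L))) = (\<lambda>L. C * L ^ k * 2 powr (- c * L))"
    using d by (auto simp: d_def powr_def power_mult_distrib exp_minus field_simps)
  finally have "\<forall>\<^sub>F L in at_top. C * L ^ k * 2 powr (- c * L) < \<epsilon>"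
    using assms(2) by (rule order_tendstoD)
  then show ?thesis unfolding eventually_at_top_linorder using less_imp_le by blast
qed

lemma card_le_fibres:
  assumes "finite A" "\<And>w. w \<in> f ` A \<Longrightarrow> card {a \<in> A. f a = w} \<le> m"
  shows "card A \<le> m * card (f ` A)"
proof -
  have "A = (\<Union>w\<in>f ` A. {a \<in> A. f a = w})" by auto
  then have "card A \<le> (\<Sum>w\<in>f ` A. card {a \<in> A. f a = w})"
    using card_UN_le[of "f ` A" "\<lambda>w. {a \<in> A. f a = w}"] assms(1) by simp
  also have "\<dots> \<le> card (f ` A) * m"
    using sum_bounded_above[of "f ` A" "\<lambda>w. card {a \<in> A. f a = w}" m] assms(2) by simp
  finally show ?thesis by (simp add: mult.commute)
qed

text \<open>A quasi-isometric embedding of the space of cells, with \<open>\<alpha>\<close> as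
  multiplicative and \<open>\<beta>\<close> as additive constant; both inequalities are phrased as
  implications between statements \<open>near D\<close>.\<close>

locale embedding = weights lam for lam :: "'n::finite \<Rightarrow> real" +
  fixes \<Phi> :: "int \<times> ('n \<Rightarrow> int) \<Rightarrow> int \<times> ('n \<Rightarrow> int)" and \<alpha> \<beta> :: real
  assumes alpha: "1 \<le> \<alpha>" and beta: "0 \<le> \<beta>"
    and upper: "near D p q \<Longrightarrow> near (\<alpha> * D + \<beta>) (\<Phi> p) (\<Phi> q)"
    and lower: "near D (\<Phi> p) (\<Phi> q) \<Longrightarrow> near (\<alpha> * D + \<beta>) p q"
begin

definition F :: "int \<times> ('n \<Rightarrow> int) \<Rightarrow> real" where "F p = real_of_int (fst (\<Phi> p))"
text \<open>Consecutive points of a vertical line are within \<open>1 + lmx\<close> in the sense of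
  \<open>near\<close>, and \<open>\<kappa>\<close> is what \<open>upper\<close> makes of this. It is
  the Lipschitz constant of \<open>F\<close> along vertical lines.\<close>

definition \<kappa> :: real where "\<kappa> = \<alpha> * (1 + lmx) + \<beta>"

lemma kappa_ge_1: "1 \<le> \<kappa>"
proof -
  have "1 * 1 \<le> \<alpha> * (1 + lmx)" using alpha lmx_nonneg by (intro mult_mono) auto
  then show ?thesis using beta by (simp add: \<kappa>_def)
qed

lemma F_near: "near D p q \<Longrightarrow> \<bar>F p - F q\<bar> \<le> \<alpha> * D + \<beta>"
  using upper[of D p q] by (simp add: near_def F_def)

lemma F_line:
  assumes "s \<le> u" "u \<le> t" "s \<le> v" "v \<le> t"
  shows "\<bar>F (line s t x y u) - F (line s t x y v)\<bar> \<le> \<kappa> * \<bar>u - v\<bar>"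
proof (cases "u = v")
  case False
  then have "1 \<le> real_of_int \<bar>u - v\<bar>" by linarith
  then have "\<beta> * 1 \<le> \<beta> * real_of_int \<bar>u - v\<bar>" using beta by (intro mult_left_mono)
  then show ?thesis
    using F_near[OF near_line[OF assms, of x y]] by (simp add: \<kappa>_def distrib_right mult.assoc)
qed simp

text \<open>One step along the line moves the image by at most \<open>\<kappa>\<close>, which at
  image height \<open>h\<close> allows a displacement of
  \<open>2 powr (lam i * h + \<kappa>)\<close> in coordinate \<open>i\<close>. Hence a coordinate
  with positive weight moves mainly while the image is high, one with negative weight mainly while
  it is low.\<close>

lemma drift_sum:
  assumes "s \<le> u" "u \<le> v" "v \<le> t"
  shows "\<bar>pos (\<Phi> (line s t x y v)) i - pos (\<Phi> (line s t x y u)) i\<bar>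
     \<le> (\<Sum>w\<in>{u..<v}. 2 powr (lam i * F (line s t x y w) + \<kappa>))"
  using assms(2,3)
proof (induction v rule: int_ge_induct)
  case (step v)
  have "near ((1 + lmx) * \<bar>real_of_int v - real_of_int (v + 1)\<bar>) (line s t x y v) (line s t x y (v + 1))"
    by (rule near_line) (use step assms in auto)
  then have "near \<kappa> (\<Phi> (line s t x y v)) (\<Phi> (line s t x y (v + 1)))"
    using upper by (auto simp: \<kappa>_def)
  then have "\<bar>pos (\<Phi> (line s t x y (v + 1))) i - pos (\<Phi> (line s t x y v)) i\<bar>
      \<le> 2 powr (lam i * F (line s t x y v) + \<kappa>)"
    by (simp add: near_def F_def abs_minus_commute)
  moreover have "{u..<v + 1} = insert v {u..<v}" using step by auto
  ultimately show ?case using step by simp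
qed simp

lemma drift:
  assumes "s \<le> u" "u \<le> v" "v \<le> t"
    and c: "\<And>w. u \<le> w \<Longrightarrow> w \<le> v \<Longrightarrow> lam i * F (line s t x y w) \<le> c"
  shows "\<bar>pos (\<Phi> (line s t x y v)) i - pos (\<Phi> (line s t x y u)) i\<bar> \<le> real_of_int (v - u) * 2 powr (c + \<kappa>)"
proof -
  have "(\<Sum>w\<in>{u..<v}. 2 powr (lam i * F (line s t x y w) + \<kappa>)) \<le> (\<Sum>w\<in>{u..<v}. 2 powr (c + \<kappa>))"
    by (intro sum_mono powr_mono) (use c in auto)
  also have "\<dots> = real_of_int (v - u) * 2 powr (c + \<kappa>)" using assms by simp
  finally show ?thesis using drift_sum[OF assms(1-3), of x y i] by linarith
qed

text \<open>Cells with the same image are within \<open>\<beta>\<close> of each other, by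
  \<open>lower\<close> with \<open>D = 0\<close>, so a fibre is no larger than a ball and
  cardinalities survive the passage to images.\<close>

lemma card_fibre: "finite {p. \<Phi> p = w}" "real (card {p. \<Phi> p = w}) \<le> ballc \<beta>"
proof -
  have "finite {p. \<Phi> p = w} \<and> real (card {p. \<Phi> p = w}) \<le> ballc \<beta>"
  proof (cases "\<exists>p0. \<Phi> p0 = w")
    case True
    then obtain p0 where p0: "\<Phi> p0 = w" by blast
    have sub: "{p. \<Phi> p = w} \<subseteq> {p. near \<beta> p0 p}"
      using lower[of 0 p0] near_refl[of 0 w] p0 by auto
    have b: "finite {p. near \<beta> p0 p}" "real (card {p. near \<beta> p0 p}) \<le> ballc \<beta>"
      using card_ball[OF beta] by auto
    have "real (card {p. \<Phi> p = w}) \<le> real (card {p. near \<beta> p0 p})"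
      using card_mono[OF b(1) sub] by simp
    then show ?thesis using finite_subset[OF sub b(1)] b(2) by simp
  next
    case False
    then have "{p. \<Phi> p = w} = {}" by blast
    moreover have "0 \<le> ballc \<beta>" using beta by (simp add: ballc_def)
    ultimately show ?thesis by (simp only: finite.emptyI card.empty of_nat_0 simp_thms)
  qed
  then show "finite {p. \<Phi> p = w}" "real (card {p. \<Phi> p = w}) \<le> ballc \<beta>" by auto
qed

lemma card_le_image:
  assumes "finite A" shows "real (card A) \<le> ballc \<beta> * real (card (\<Phi> ` A))"
proof -
  have "card {a \<in> A. \<Phi> a = w} \<le> nat \<lfloor>ballc \<beta>\<rfloor>" for w
  proof -
    have "card {a \<in> A. \<Phi> a = w} \<le> card {p. \<Phi> p = w}"
      by (intro card_mono card_fibre) auto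
    then have "real (card {a \<in> A. \<Phi> a = w}) \<le> ballc \<beta>"
      using card_fibre(2)[of w] by linarith
    then show ?thesis by (simp add: le_nat_floor)
  qed
  then have "card A \<le> nat \<lfloor>ballc \<beta>\<rfloor> * card (\<Phi> ` A)"
    by (intro card_le_fibres assms)
  then have "real (card A) \<le> real (nat \<lfloor>ballc \<beta>\<rfloor>) * real (card (\<Phi> ` A))"
    by (metis of_nat_le_iff of_nat_mult)
  also have "\<dots> \<le> ballc \<beta> * real (card (\<Phi> ` A))"
    using beta by (intro mult_right_mono) (auto simp: ballc_def)
  finally show ?thesis .
qed

end

context weights begin

text \<open>Where a path of \<open>L\<close> bounded steps starting at \<open>q\<close> and staying between the heights \<open>a\<close> and
  \<open>b\<close> can end.\<close>

definition region :: "real \<Rightarrow> real \<Rightarrow> int \<times> ('n \<Rightarrow> int) \<Rightarrow> int \<Rightarrow> int \<Rightarrow> (int \<times> ('n \<Rightarrow> int)) set" where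
  "region \<kappa> L q a b = {w. a \<le> fst w \<and> fst w \<le> b \<and>
     (\<forall>i. \<bar>pos w i - pos q i\<bar> \<le> L * 2 powr (lam i * (if i \<in> P then b else a) + \<kappa>))}"

text \<open>At height \<open>z\<close> the size of the box relative to a cell contributes
  \<open>Lam * (b - z)\<close> to the exponent from the coordinates in \<open>P\<close> and
  \<open>Lam * (z - a)\<close> from those in \<open>N\<close>. The sum is
  \<open>Lam * (b - a)\<close> at every height.\<close>

lemma card_region:
  assumes L: "1 \<le> L" and ab: "a \<le> b"
  shows "finite (region \<kappa> L q a b)"
    "real (card (region \<kappa> L q a b)) \<le> real_of_int (b - a + 1) * (((4 * 2 powr \<kappa> + 1) * L) ^ CARD('n) * 2 powr (Lam * real_of_int (b - a)))"
proof -
  define c where "c i = lam i * (if i \<in> P then b else a)" for i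
  let ?K = "\<lambda>z. {k::'n \<Rightarrow> int. \<forall>i. \<bar>of_int (k i) * 2 powr E i z - pos q i\<bar> \<le> L * 2 powr (c i + \<kappa>)}"
  let ?b = "((4 * 2 powr \<kappa> + 1) * L) ^ CARD('n) * 2 powr (Lam * real_of_int (b - a))"
  have K: "finite (?K z)" "real (card (?K z)) \<le> ?b" if z: "z \<in> {a..b}" for z
  proof -
    let ?B = "\<lambda>i. (4 * 2 powr \<kappa> + 1) * L * 2 powr (c i - lam i * z)"
    have B: "2 * (L * 2 powr (c i + \<kappa>)) / 2 powr E i z + 1 \<le> ?B i" for i
    proof -
      have "0 \<le> c i - lam i * z"
        using z by (auto simp: c_def P_def mult_left_mono mult_left_mono_neg)
      then have 1: "1 \<le> 2 powr (c i - lam i * z)" by (simp add: ge_one_powr_ge_zero)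
      have "2 powr (c i + \<kappa>) / 2 powr E i z = 2 powr (c i + \<kappa> - E i z)" by (simp add: powr_diff)
      also have "\<dots> \<le> 2 powr (c i - lam i * z + \<kappa> + 1)"
        using E_ge[of i z] by (intro powr_mono) auto
      also have "\<dots> = 2 * 2 powr \<kappa> * 2 powr (c i - lam i * z)"
        by (simp add: powr_add)
      finally have "L * (2 powr (c i + \<kappa>) / 2 powr E i z) \<le> L * (2 * 2 powr \<kappa> * 2 powr (c i - lam i * z))"
        using L by (intro mult_left_mono) auto
      moreover have "1 * 1 \<le> L * 2 powr (c i - lam i * z)"
        using 1 L by (intro mult_mono) auto
      ultimately have "2 * (L * (2 powr (c i + \<kappa>) / 2 powr E i z)) + 1
          \<le> 2 * (L * (2 * 2 powr \<kappa> * 2 powr (c i - lam i * z))) + L * 2 powr (c i - lam i * z)"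
        by linarith
      also have "\<dots> = ?B i" by (simp add: algebra_simps)
      finally show ?thesis by simp
    qed
    have "(\<Sum>i\<in>UNIV. c i - lam i * z) = (\<Sum>i\<in>P. c i - lam i * z) + (\<Sum>i\<in>N. c i - lam i * z)"
      by (subst sum.union_disjoint[symmetric]) (auto simp: P_N intro!: sum.cong)
    also have "(\<Sum>i\<in>P. c i - lam i * z) = (\<Sum>i\<in>P. lam i * (b - z))"
      by (intro sum.cong) (auto simp: c_def algebra_simps)
    also have "(\<Sum>i\<in>N. c i - lam i * z) = (\<Sum>i\<in>N. lam i * (a - z))"
      by (intro sum.cong) (auto simp: c_def algebra_simps P_N)
    also have "(\<Sum>i\<in>P. lam i * (b - z)) + (\<Sum>i\<in>N. lam i * (a - z)) = Lam * (b - z) - Lam * (a - z)"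
      by (simp add: sum_distrib_right[symmetric] Lam_N Lam_def[symmetric])
    finally have s: "(\<Sum>i\<in>UNIV. c i - lam i * z) = Lam * real_of_int (b - a)" by (simp add: algebra_simps)
    have p: "(\<Prod>i\<in>UNIV. ?B i) = ?b"
      unfolding prod.distrib s[symmetric] by (simp add: powr_sum power_mult_distrib)
    show "finite (?K z)" "real (card (?K z)) \<le> ?b"
      using card_int_vectors_le[of "\<lambda>i. 2 powr E i z" "\<lambda>i. L * 2 powr (c i + \<kappa>)" ?B "pos q", OF _ _ B] L
      unfolding p by simp_all
  qed
  have sub: "region \<kappa> L q a b = (SIGMA z:{a..b}. ?K z)"
    by (auto simp: region_def pos_def c_def)
  show "finite (region \<kappa> L q a b)" unfolding sub using K by (intro finite_SigmaI) auto
  have "real (card (SIGMA z:{a..b}. ?K z)) = (\<Sum>z\<in>{a..b}. real (card (?K z)))"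
    using K by (subst card_SigmaI) auto
  also have "\<dots> \<le> real (card {a..b}) * ?b"
    using sum_bounded_above[of "{a..b}" "\<lambda>z. real (card (?K z))" ?b] K by simp
  finally show "real (card (region \<kappa> L q a b)) \<le> real_of_int (b - a + 1) * ?b"
    unfolding sub using ab by simp
qed

end

context embedding begin

text \<open>The endpoints of the lines of length \<open>L\<close> above a point fill about \<open>2 powr (Lam * L)\<close> cells,
  whereas the images of those lines staying in a slab of height \<open>H\<close> end in only about \<open>2 powr (Lam * H)\<close> cells.\<close>

lemma range_large:
  fixes \<epsilon> :: real
  assumes e: "0 < \<epsilon>" "\<epsilon> < 1"
  shows "\<exists>L0::int. \<forall>L\<ge>L0. \<forall>z x b. x \<in> extensional P \<longrightarrow> b \<in> extensional N \<longrightarrow>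
    freq (dn N (z + L) z b) (\<lambda>y. \<forall>u\<in>{z..z+L}. \<forall>v\<in>{z..z+L}.
       F (line z (z + L) x y u) - F (line z (z + L) x y v) < (1 - \<epsilon>) * L) \<le> \<epsilon>"
proof -
  define n where "n = CARD('n)"
  \<comment> \<open>The power \<open>n + 3\<close> of \<open>L\<close> below is made of
    \<open>L ^ n\<close> for the box in a region, \<open>L\<close> for its heights and
    \<open>L ^ 2\<close> for the possible pairs of extreme heights.\<close>
  define C where "C = ballc \<beta> * (2 * \<kappa> + 3)\<^sup>2 * 2 * (4 * 2 powr \<kappa> + 1) ^ n * 2 ^ n"
  obtain L0 where L0: "\<And>L. L \<ge> L0 \<Longrightarrow> C * L ^ (n + 3) * 2 powr (- (Lam * \<epsilon>) * L) \<le> \<epsilon>"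
    using poly_exp_small[of "Lam * \<epsilon>" \<epsilon> C "n + 3"] Lam_pos e by auto
  have ballc0: "0 \<le> ballc \<beta>" using beta by (simp add: ballc_def)
  show ?thesis
  proof (intro exI[of _ "max 1 \<lceil>L0\<rceil>"] allI impI)
    fix L z :: int and x b :: "'n \<Rightarrow> int"
    assume L: "max 1 \<lceil>L0\<rceil> \<le> L" and x: "x \<in> extensional P" and b: "b \<in> extensional N"
    let ?l = "\<lambda>y. line z (z + L) x y"
    let ?A = "dn N (z + L) z b"
    let ?bad = "\<lambda>y. \<forall>u\<in>{z..z+L}. \<forall>v\<in>{z..z+L}. F (?l y u) - F (?l y v) < (1 - \<epsilon>) * L"
    define S where "S = {y \<in> ?A. ?bad y}"
    define q where "q = \<Phi> (mk z x b)"
    define I where "I = {w::int. \<bar>of_int w * 1 - real_of_int (fst q)\<bar> \<le> \<kappa> * L}"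
    \<comment> \<open>A bad line has an image between two heights \<open>a\<close> and
      \<open>c\<close> with \<open>c - a < (1 - \<epsilon>) * L\<close>, both within
      \<open>\<kappa> * L\<close> of the start. There are only quadratically many such
      pairs.\<close>
    define R where "R = (\<Union>(a, c)\<in>{(a, c). a \<in> I \<and> c \<in> I \<and> a \<le> c \<and> c - a < (1 - \<epsilon>) * L}. region \<kappa> L q a c)"
    have L1: "1 \<le> L" "1 \<le> real_of_int L" "L0 \<le> L" using L by linarith+
    have I: "finite I" "real (card I) \<le> 2 * (\<kappa> * L) + 1"
      using card_int_interval_le[of 1 "\<kappa> * L" "real_of_int (fst q)"] L1 kappa_ge_1
      unfolding I_def by simp_all
    let ?J = "{(a, c). a \<in> I \<and> c \<in> I \<and> a \<le> c \<and> c - a < (1 - \<epsilon>) * L}"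
    have J: "finite ?J" "real (card ?J) \<le> (2 * (\<kappa> * L) + 1)\<^sup>2"
    proof -
      have sub: "?J \<subseteq> I \<times> I" by auto
      then show "finite ?J" using I(1) finite_subset by blast
      have "real (card ?J) \<le> real (card I) * real (card I)"
        using card_mono[OF _ sub] I(1) by (simp add: card_cartesian_product flip: of_nat_mult)
      also have "\<dots> \<le> (2 * (\<kappa> * L) + 1)\<^sup>2"
        unfolding power2_eq_square using I(2) L1 kappa_ge_1 by (intro mult_mono) auto
      finally show "real (card ?J) \<le> (2 * (\<kappa> * L) + 1)\<^sup>2" .
    qed
    let ?r = "2 * L * (((4 * 2 powr \<kappa> + 1) * L) ^ n * 2 powr (Lam * ((1 - \<epsilon>) * L)))"
    have reg: "finite (region \<kappa> L q a c)" "real (card (region \<kappa> L q a c)) \<le> ?r" if "(a, c) \<in> ?J" for a c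
    proof -
      have ac: "a \<le> c" "real_of_int (c - a) < (1 - \<epsilon>) * L" using that by simp_all
      show "finite (region \<kappa> L q a c)" using card_region(1)[OF L1(2) ac(1)] .
      have "(1 - \<epsilon>) * real_of_int L \<le> 1 * real_of_int L" using e L1 by (intro mult_right_mono) auto
      then have "real_of_int (c - a + 1) \<le> 2 * real_of_int L" using ac(2) L1(2) by linarith
      then have "real_of_int (c - a + 1) * (((4 * 2 powr \<kappa> + 1) * L) ^ n * 2 powr (Lam * real_of_int (c - a))) \<le> ?r"
        using ac L1 Lam_pos
        by (intro mult_mono powr_mono mult_left_mono) (auto intro!: mult_nonneg_nonneg)
      then show "real (card (region \<kappa> L q a c)) \<le> ?r"
        using card_region(2)[OF L1(2) ac(1), of \<kappa> q] by (simp add: n_def)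
    qed
    have R: "finite R" "real (card R) \<le> (2 * (\<kappa> * L) + 1)\<^sup>2 * ?r"
    proof -
      show "finite R" unfolding R_def using J reg by auto
      have "real (card R) \<le> real (\<Sum>(a,c)\<in>?J. card (region \<kappa> L q a c))"
        unfolding R_def of_nat_le_iff
        using card_UN_le[OF J(1), of "\<lambda>(a,c). region \<kappa> L q a c"] by (simp add: case_prod_beta)
      also have "\<dots> = (\<Sum>(a,c)\<in>?J. real (card (region \<kappa> L q a c)))"
        by (simp add: case_prod_beta)
      also have "\<dots> \<le> real (card ?J) * ?r"
        using reg by (intro sum_bounded_above) auto
      also have "\<dots> \<le> (2 * (\<kappa> * L) + 1)\<^sup>2 * ?r"
        using L1 by (intro mult_right_mono J(2)) auto
      finally show "real (card R) \<le> (2 * (\<kappa> * L) + 1)\<^sup>2 * ?r" .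
    qed
    have start: "?l y z = mk z x b" if "y \<in> ?A" for y
      using that x b by (simp add: line_def up_self up_dn)
    have into: "\<Phi> (?l y (z + L)) \<in> R" if y: "y \<in> S" for y
    proof -
      let ?H = "(\<lambda>u. fst (\<Phi> (?l y u))) ` {z..z+L}"
      define a c where "a = Min ?H" and "c = Max ?H"
      have H: "finite ?H" "?H \<noteq> {}" using L1 by auto
      have "a \<in> ?H" "c \<in> ?H" unfolding a_def c_def using H by (intro Min_in Max_in; simp)+
      then obtain u v where uv: "u \<in> {z..z+L}" "v \<in> {z..z+L}" "a = fst (\<Phi> (?l y u))" "c = fst (\<Phi> (?l y v))"
        by blast
      have bd: "a \<le> fst (\<Phi> (?l y w))" "fst (\<Phi> (?l y w)) \<le> c" if "w \<in> {z..z+L}" for w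
        unfolding a_def c_def using H that by auto
      have yA: "y \<in> ?A" using y by (simp add: S_def)
      have Fq: "real_of_int (fst q) = F (?l y z)" by (simp add: start[OF yA] q_def F_def)
      have "a \<in> I" "c \<in> I"
      proof -
        have "\<bar>F (?l y w) - F (?l y z)\<bar> \<le> \<kappa> * L" if "w \<in> {z..z+L}" for w
        proof -
          have "\<bar>F (?l y w) - F (?l y z)\<bar> \<le> \<kappa> * \<bar>w - z\<bar>"
            using that L1 by (intro F_line) auto
          also have "\<dots> \<le> \<kappa> * L" using that kappa_ge_1 by (intro mult_left_mono) auto
          finally show ?thesis .
        qed
        then show "a \<in> I" "c \<in> I" unfolding I_def Fq uv using uv(1,2) by (auto simp: F_def)
      qed
      moreover have "a \<le> c" using bd[of z] L1 by simp
      moreover have "real_of_int (c - a) < (1 - \<epsilon>) * L"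
        using y uv unfolding S_def by (auto simp: F_def)
      moreover have "\<Phi> (?l y (z + L)) \<in> region \<kappa> L q a c"
      proof -
        have "\<bar>pos (\<Phi> (?l y (z + L))) i - pos q i\<bar> \<le> L * 2 powr (lam i * (if i \<in> P then c else a) + \<kappa>)" for i
        proof -
          have "\<bar>pos (\<Phi> (?l y (z + L))) i - pos (\<Phi> (?l y z)) i\<bar>
            \<le> real_of_int (z + L - z) * 2 powr (lam i * (if i \<in> P then c else a) + \<kappa>)"
          proof (rule drift)
            fix w assume "z \<le> w" "w \<le> z + L"
            then show "lam i * F (?l y w) \<le> lam i * (if i \<in> P then c else a)"
              using bd[of w] by (auto simp: F_def P_def mult_left_mono mult_left_mono_neg)
          qed (use L1 in auto)
          then show ?thesis by (simp add: start[OF yA] q_def)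
        qed
        then show ?thesis using bd[of "z + L"] L1 by (simp add: region_def)
      qed
      ultimately show ?thesis unfolding R_def by (intro UN_I[of "(a, c)"]) simp_all
    qed
    \<comment> \<open>The label of the upper end contains \<open>y\<close> itself, so distinct lines
      have distinct upper ends.\<close>
    have inj: "inj_on (\<lambda>y. ?l y (z + L)) S"
    proof (rule inj_onI)
      fix y y' assume yy: "y \<in> S" "y' \<in> S" "?l y (z + L) = ?l y' (z + L)"
      then have "y \<in> extensional N" "y' \<in> extensional N" using dn_ext by (auto simp: S_def)
      then show "y = y'" using mk_inj[OF yy(3)[unfolded line_def]] by (simp add: up_self)
    qed
    have "finite S" by (simp add: S_def)
    have "real (card S) = real (card ((\<lambda>y. ?l y (z + L)) ` S))" by (simp add: card_image[OF inj])
    also have "\<dots> \<le> ballc \<beta> * real (card (\<Phi> ` (\<lambda>y. ?l y (z + L)) ` S))"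
      using \<open>finite S\<close> by (intro card_le_image) auto
    also have "\<dots> \<le> ballc \<beta> * real (card R)"
      using into R(1) ballc0 by (intro mult_left_mono) (auto intro!: card_mono)
    also have "\<dots> \<le> ballc \<beta> * ((2 * (\<kappa> * L) + 1)\<^sup>2 * ?r)"
      using R(2) ballc0 by (intro mult_left_mono)
    also have "\<dots> \<le> ballc \<beta> * (((2 * \<kappa> + 3) * L)\<^sup>2 * ?r)"
      using ballc0 L1 kappa_ge_1
      by (intro mult_left_mono mult_right_mono power_mono) (auto simp: algebra_simps)
    also have "\<dots> = C * real_of_int L ^ (n + 3) * 2 powr (- (Lam * \<epsilon>) * L) * 2 powr (Lam * L - n)"
    proof -
      have "2 powr (Lam * ((1 - \<epsilon>) * L)) = 2 ^ n * (2 powr (- (Lam * \<epsilon>) * L) * 2 powr (Lam * L - n))"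
        by (simp add: powr_realpow[symmetric] powr_add[symmetric] algebra_simps)
      moreover have "B * ((k * l)\<^sup>2 * (2 * l * ((m * l) ^ n * (p * (d * e)))))
          = (B * k\<^sup>2 * 2 * m ^ n * p) * l ^ (n + 3) * d * e" for B k l m p d e :: real
      proof -
        have "l ^ (n + 3) = l ^ n * (l\<^sup>2 * l)" by (simp add: power_add power2_eq_square power3_eq_cube)
        then show ?thesis by (simp only: power_mult_distrib) (simp only: mult_ac)
      qed
      ultimately show ?thesis unfolding C_def by (simp only: of_int_power of_int_mult of_int_numeral)
    qed
    also have "\<dots> \<le> \<epsilon> * 2 powr (Lam * L - n)"
      using L0[OF L1(3)] by (intro mult_right_mono) auto
    also have "\<dots> \<le> \<epsilon> * real (card ?A)"
      using card_dn_N(2)[of z "z + L" b] L1 e by (intro mult_left_mono) (auto simp: n_def)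
    finally have "real (card S) \<le> \<epsilon> * real (card ?A)" .
    then show "freq ?A ?bad \<le> \<epsilon>"
      unfolding freq_card[OF finite_dn] S_def[symmetric]
      by (simp add: card_gt_0_iff divide_le_eq)
  qed
qed

end

section \<open>Slabs, their exceptional cells and their deep cells\<close>

context weights begin

text \<open>These are the cells met between the heights \<open>s\<close> and \<open>t\<close> by the
  lines whose finest labels descend from \<open>a\<close> in the \<open>P\<close>-tree and from
  \<open>b\<close> in the \<open>N\<close>-tree. The coordinatewise form allows membership of an
  arbitrary neighbouring cell to be tested directly.\<close>

definition slab :: "int \<Rightarrow> int \<Rightarrow> ('n \<Rightarrow> int) \<Rightarrow> ('n \<Rightarrow> int) \<Rightarrow> (int \<times> ('n \<Rightarrow> int)) set" where
  "slab s t a b = {q. s \<le> fst q \<and> fst q \<le> t \<and> (\<forall>i\<in>P. snd q i div 2 ^ depth (fst q) t i = a i) \<and>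
     (\<forall>i\<in>N. snd q i div 2 ^ depth (fst q) s i = b i)}"

lemma snd_mk_P [simp]: "i \<in> P \<Longrightarrow> snd (mk z x y) i = x i" by (simp add: mk_def)
lemma snd_mk_N [simp]: "i \<in> N \<Longrightarrow> snd (mk z x y) i = y i" by (simp add: mk_def P_N)

lemma mk_in_slab:
  assumes "s \<le> u" "u \<le> t" "x \<in> dn P u t a" "y \<in> dn N u s b"
  shows "mk u x y \<in> slab s t a b"
  using assms by (simp add: slab_def mem_dn)

lemma slab_eq: "slab s t a b = (\<Union>u\<in>{s..t}. (\<lambda>(x, y). mk u x y) ` (dn P u t a \<times> dn N u s b))"
proof (intro equalityI subsetI)
  fix q assume q: "q \<in> slab s t a b"
  then have "(restrict (snd q) P, restrict (snd q) N) \<in> dn P (fst q) t a \<times> dn N (fst q) s b"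
    by (auto simp: slab_def mem_dn)
  then have "q \<in> (\<lambda>(x, y). mk (fst q) x y) ` (dn P (fst q) t a \<times> dn N (fst q) s b)"
    using mk_surj[of q] by (intro image_eqI[of _ _ "(restrict (snd q) P, restrict (snd q) N)"]) simp_all
  moreover have "fst q \<in> {s..t}" using q by (simp add: slab_def)
  ultimately show "q \<in> (\<Union>u\<in>{s..t}. (\<lambda>(x, y). mk u x y) ` (dn P u t a \<times> dn N u s b))" by blast
qed (auto intro: mk_in_slab)

lemma finite_slab [simp]: "finite (slab s t a b)" by (simp add: slab_eq)

text \<open>At height \<open>u\<close> the two trees contribute \<open>Lam * (t - u)\<close> and
  \<open>Lam * (u - s)\<close> to the exponent, so every height carries about
  \<open>2 powr (Lam * (t - s))\<close> cells and frequencies can be summed over the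
  heights.\<close>

lemma card_slab_bad:
  assumes st: "s \<le> t" and \<delta>: "0 \<le> \<delta>"
    and B: "\<And>u. u \<in> {s..t} \<Longrightarrow> freq (dn P u t a \<times> dn N u s b) (\<lambda>(x, y). B (mk u x y)) \<le> \<delta>"
  shows "real (card {q \<in> slab s t a b. B q}) \<le> real_of_int (t - s + 1) * (\<delta> * 2 powr (Lam * real_of_int (t - s) + 2 * CARD('n)))"
proof -
  let ?D = "\<lambda>u. dn P u t a \<times> dn N u s b"
  let ?S = "\<lambda>u. {xy \<in> ?D u. B (mk u (fst xy) (snd xy))}"
  have sub: "{q \<in> slab s t a b. B q} \<subseteq> (\<Union>u\<in>{s..t}. (\<lambda>xy. mk u (fst xy) (snd xy)) ` ?S u)"
  proof
    fix q assume q: "q \<in> {q \<in> slab s t a b. B q}"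
    then obtain u x y where u: "u \<in> {s..t}" "x \<in> dn P u t a" "y \<in> dn N u s b" "q = mk u x y"
      unfolding slab_eq by auto
    then show "q \<in> (\<Union>u\<in>{s..t}. (\<lambda>xy. mk u (fst xy) (snd xy)) ` ?S u)"
      using q by (intro UN_I[of u] image_eqI[of _ _ "(x, y)"]) auto
  qed
  have "card {q \<in> slab s t a b. B q} \<le> card (\<Union>u\<in>{s..t}. (\<lambda>xy. mk u (fst xy) (snd xy)) ` ?S u)"
    by (intro card_mono sub) auto
  also have "\<dots> \<le> (\<Sum>u\<in>{s..t}. card ((\<lambda>xy. mk u (fst xy) (snd xy)) ` ?S u))"
    by (rule card_UN_le) simp
  also have "\<dots> \<le> (\<Sum>u\<in>{s..t}. card (?S u))"
    by (intro sum_mono card_image_le) simp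
  finally have "real (card {q \<in> slab s t a b. B q}) \<le> (\<Sum>u\<in>{s..t}. real (card (?S u)))"
    by (simp flip: of_nat_sum)
  also have "\<dots> \<le> (\<Sum>u\<in>{s..t}. \<delta> * 2 powr (Lam * real_of_int (t - s) + 2 * CARD('n)))"
  proof (intro sum_mono)
    fix u assume u: "u \<in> {s..t}"
    have "real (card (?S u)) / real (card (?D u)) \<le> \<delta>"
      using B[OF u] by (simp add: freq_card case_prod_beta)
    then have "real (card (?S u)) \<le> \<delta> * real (card (?D u))"
      by (simp add: divide_le_eq card_gt_0_iff card_cartesian_product)
    also have "\<dots> \<le> \<delta> * (2 powr (Lam * (t - u) + CARD('n)) * 2 powr (Lam * (u - s) + CARD('n)))"
      using card_dn_P(1)[of u t a] card_dn_N(1)[of s u b] u \<delta>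
      by (intro mult_left_mono) (auto simp: card_cartesian_product intro!: mult_mono)
    also have "\<dots> = \<delta> * 2 powr (Lam * real_of_int (t - s) + 2 * CARD('n))"
      by (simp add: powr_add[symmetric] algebra_simps)
    finally show "real (card (?S u)) \<le> \<delta> * 2 powr (Lam * real_of_int (t - s) + 2 * CARD('n))" .
  qed
  also have "\<dots> = real_of_int (t - s + 1) * (\<delta> * 2 powr (Lam * real_of_int (t - s) + 2 * CARD('n)))"
    using st by simp
  finally show ?thesis .
qed

definition core :: "'n set \<Rightarrow> int \<Rightarrow> int \<Rightarrow> int \<Rightarrow> ('n \<Rightarrow> int) \<Rightarrow> ('n \<Rightarrow> int) set" where
  "core A m u v a = PiE A (\<lambda>i. {a i * 2 ^ depth u v i + m ..< (a i + 1) * 2 ^ depth u v i - m})"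

lemma core_dn: "0 \<le> m \<Longrightarrow> core A m u v a \<subseteq> dn A u v a"
  unfolding core_def dn_def by (intro PiE_mono) auto

text \<open>A margin of at most a quarter on each side leaves at least half of every label interval.
  This factor 2 per coordinate, together with the rounding of the scales, makes up
  \<open>2 * CARD('n)\<close>.\<close>

lemma card_core:
  assumes "coarser A u v" "\<And>i. i \<in> A \<Longrightarrow> 4 * m \<le> 2 ^ depth u v i"
  shows "2 powr ((\<Sum>i\<in>A. lam i) * (v - u) - 2 * CARD('n)) \<le> real (card (core A m u v a))"
proof -
  have "(\<Prod>i\<in>A. 2 ^ depth u v i / 2) \<le> (\<Prod>i\<in>A. real (nat (2 ^ depth u v i - 2 * m)))"
  proof (intro prod_mono conjI)
    fix i assume "i \<in> A"
    then have "2 * m \<le> 2 ^ depth u v i - 2 * m" using assms(2)[of i] by linarith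
    have "real_of_int (4 * m) \<le> real_of_int (2 ^ depth u v i)"
      using assms(2)[OF \<open>i \<in> A\<close>] by (simp only: of_int_le_iff)
    then have "2 ^ depth u v i / 2 \<le> real_of_int (2 ^ depth u v i - 2 * m)" by simp
    also have "\<dots> \<le> real (nat (2 ^ depth u v i - 2 * m))" by linarith
    finally show "2 ^ depth u v i / 2 \<le> real (nat (2 ^ depth u v i - 2 * m))" .
  qed simp
  also have "\<dots> = real (card (core A m u v a))"
    unfolding core_def by (simp add: card_PiE algebra_simps)
  finally have 1: "(\<Prod>i\<in>A. 2 ^ depth u v i / 2) \<le> real (card (core A m u v a))" .
  have "(\<Prod>i\<in>A. 2 ^ depth u v i / 2) = 2 powr (real (\<Sum>i\<in>A. depth u v i) - card A)"
    by (simp add: prod_dividef power_sum[symmetric] powr_diff powr_realpow del: of_nat_sum)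
  moreover have "(\<Sum>i\<in>A. lam i) * (v - u) - 2 * CARD('n) \<le> real (\<Sum>i\<in>A. depth u v i) - card A"
    using sum_depth_bounds(2)[OF assms(1)] card_mono[of UNIV A] by (simp del: of_nat_sum)
  ultimately have "2 powr ((\<Sum>i\<in>A. lam i) * (v - u) - 2 * CARD('n)) \<le> (\<Prod>i\<in>A. 2 ^ depth u v i / 2)"
    by (simp only: powr_mono one_le_numeral)
  with 1 show ?thesis by linarith
qed

text \<open>A margin of \<open>2 powr (\<Delta> + 1)\<close> labels is at least as wide as any
  displacement allowed by \<open>near \<Delta>\<close>; the additional 1 in the exponent pays for
  the rounding in \<open>E\<close>.\<close>

lemma core_absorbs:
  assumes coarser: "coarser A u v" "coarser A u' v" and i: "i \<in> A" and x: "x \<in> core A m u v a"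
    and m: "2 powr (\<Delta> + 1) \<le> m"
    and near: "\<bar>real_of_int (x i) * 2 powr E i u - real_of_int k * 2 powr E i u'\<bar> \<le> 2 powr (lam i * u + \<Delta>)"
  shows "k div 2 ^ depth u' v i = a i"
proof -
  let ?q = "2 ^ depth u v i :: int" and ?q' = "2 ^ depth u' v i :: int"
  have q: "real_of_int ?q * 2 powr E i u = 2 powr E i v" "real_of_int ?q' * 2 powr E i u' = 2 powr E i v"
    using coarser i by (simp_all add: coarser_def depth_def powr_realpow[symmetric] powr_add[symmetric])
  have "2 powr (lam i * u + \<Delta>) \<le> 2 powr (\<Delta> + 1) * 2 powr E i u"
    unfolding powr_add[symmetric] using E_ge[of i u] by (intro powr_mono) auto
  also have "\<dots> \<le> m * 2 powr E i u" using m by (intro mult_right_mono) auto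
  finally have d: "2 powr (lam i * u + \<Delta>) \<le> m * 2 powr E i u" .
  have xi: "a i * ?q + m \<le> x i" "x i < (a i + 1) * ?q - m"
    using x i by (auto simp: core_def PiE_def Pi_def)
  have "real_of_int (a i * ?q + m) * 2 powr E i u \<le> real_of_int (x i) * 2 powr E i u"
    using xi(1) by (intro mult_right_mono) (simp_all only: of_int_le_iff powr_ge_zero)
  then have "real_of_int (a i) * 2 powr E i v + m * 2 powr E i u \<le> real_of_int (x i) * 2 powr E i u"
    unfolding q(1)[symmetric] by (simp add: algebra_simps)
  with near d have lo: "real_of_int (a i) * 2 powr E i v \<le> real_of_int k * 2 powr E i u'"
    by linarith
  have "real_of_int (x i) * 2 powr E i u < real_of_int ((a i + 1) * ?q - m) * 2 powr E i u"
    using xi(2) by (intro mult_strict_right_mono) (simp_all only: of_int_less_iff, simp)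
  then have "real_of_int (x i) * 2 powr E i u < real_of_int (a i + 1) * 2 powr E i v - m * 2 powr E i u"
    unfolding q(1)[symmetric] by (simp add: algebra_simps)
  with near d have hi: "real_of_int k * 2 powr E i u' < real_of_int (a i + 1) * 2 powr E i v"
    by linarith
  have p: "0 < 2 powr real_of_int (E i u')" by simp
  have "real_of_int (a i * ?q') * 2 powr E i u' \<le> real_of_int k * 2 powr E i u'"
    using lo unfolding q(2)[symmetric] by (simp only: of_int_mult mult.assoc)
  then have "a i * ?q' \<le> k" using p by (simp only: mult_le_cancel_right_pos of_int_le_iff)
  moreover have "real_of_int k * 2 powr E i u' < real_of_int ((a i + 1) * ?q') * 2 powr E i u'"
    using hi unfolding q(2)[symmetric] by (simp only: of_int_mult mult.assoc)
  then have "k < (a i + 1) * ?q'" using p by (simp only: mult_less_cancel_right_pos of_int_less_iff)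
  ultimately show ?thesis by (simp add: int_div_eq_iff)
qed

text \<open>Deep cells are found by keeping a height margin \<open>h\<close> from both faces and a
  label margin \<open>m\<close> from the sides. \<open>\<Delta> \<le> h\<close> keeps neighbours
  between the faces, and the condition on \<open>4 * m\<close> makes the label margin at most a
  quarter of each label interval at the heights that remain.\<close>

lemma card_deep:
  assumes \<Delta>: "0 \<le> \<Delta>" "2 powr (\<Delta> + 1) \<le> real_of_int m" "\<Delta> \<le> real_of_int h"
    and h: "4 * real_of_int m \<le> 2 powr (lmn * h - 1)" "2 * h \<le> t - s"
  shows "real_of_int (t - s - 2 * h + 1) * 2 powr (Lam * real_of_int (t - s) - 4 * CARD('n))
    \<le> real (card {p \<in> slab s t a b. \<forall>q. near \<Delta> p q \<longrightarrow> q \<in> slab s t a b})"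
proof -
  let ?S = "SIGMA u:{s+h..t-h}. core P m u t a \<times> core N m u s b"
  let ?f = "\<lambda>(u, x, y). mk u x y"
  have h0: "0 \<le> h" using \<Delta> by linarith
  have m0: "0 \<le> m"
  proof -
    have "0 \<le> 2 powr (\<Delta> + 1)" by simp
    then have "0 \<le> real_of_int m" using \<Delta>(2) by linarith
    then show ?thesis by simp
  qed
  have depth: "4 * m \<le> 2 ^ depth u v i" if "coarser A u v" "i \<in> A" "h \<le> \<bar>v - u\<bar>" "0 < lam i * (v - u) \<or> h = 0" for A u v i
  proof -
    have k: "real (depth u v i) = real_of_int (E i v) - real_of_int (E i u)"
      using that(1,2) by (simp add: coarser_def depth_def)
    have "lmn * h \<le> \<bar>lam i\<bar> * \<bar>v - u\<bar>"
      using lmn_le[of i] lmn_pos that(3) h0 by (intro mult_mono) auto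
    also have "\<dots> = \<bar>lam i * (v - u)\<bar>" by (simp add: abs_mult)
    finally have "lmn * h \<le> lam i * (v - u) \<or> h = 0" using that(4) by auto
    then have "lmn * h - 1 \<le> real (depth u v i)"
    proof
      assume "lmn * h \<le> lam i * (v - u)"
      moreover have "lam i * (v - u) - 1 \<le> real_of_int (E i v) - real_of_int (E i u)"
        using E_ge[of i v] E_le[of i u] by (simp add: algebra_simps)
      ultimately show ?thesis using k by linarith
    next
      assume "h = 0" then show ?thesis by simp
    qed
    then have "2 powr (lmn * h - 1) \<le> 2 powr real (depth u v i)" by (intro powr_mono) auto
    then have "real_of_int (4 * m) \<le> real_of_int (2 ^ depth u v i)"
      using h(1) by (simp add: powr_realpow)
    then show ?thesis by (simp only: of_int_le_iff)
  qed
  have kP: "4 * m \<le> 2 ^ depth u t i" if "u \<in> {s+h..t-h}" "i \<in> P" for u i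
    using that h0 by (intro depth[OF coarser_P]) (auto simp: P_def zero_less_mult_iff)
  have kN: "4 * m \<le> 2 ^ depth u s i" if "u \<in> {s+h..t-h}" "i \<in> N" for u i
    using that h0 by (intro depth[OF coarser_N]) (auto simp: N_def zero_less_mult_iff)
  have sub: "?f ` ?S \<subseteq> {p \<in> slab s t a b. \<forall>q. near \<Delta> p q \<longrightarrow> q \<in> slab s t a b}"
  proof (clarsimp, intro conjI allI impI)
    fix u x y assume u: "s + h \<le> u" "u \<le> t - h" and x: "x \<in> core P m u t a" and y: "y \<in> core N m u s b"
    show "mk u x y \<in> slab s t a b"
      using u h0 subsetD[OF core_dn[OF m0] x] subsetD[OF core_dn[OF m0] y] by (intro mk_in_slab) auto
    fix v k assume n: "near \<Delta> (mk u x y) (v, k)"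
    then have v: "s \<le> v" "v \<le> t" using u \<Delta>(3) by (auto simp: near_def)
    have d: "\<bar>pos (mk u x y) i - k i * 2 powr E i v\<bar> \<le> 2 powr (lam i * u + \<Delta>)" for i
      using n by (simp add: near_def pos_def)
    have "k i div 2 ^ depth v t i = a i" if "i \<in> P" for i
      using d[of i] that u v h0
      by (intro core_absorbs[OF _ _ that x \<Delta>(2)] coarser_P) (auto simp: pos_def)
    moreover have "k i div 2 ^ depth v s i = b i" if "i \<in> N" for i
      using d[of i] that u v h0
      by (intro core_absorbs[OF _ _ that y \<Delta>(2)] coarser_N) (auto simp: pos_def)
    ultimately show "(v, k) \<in> slab s t a b" using v by (simp add: slab_def)
  qed
  have fin: "finite (core A m u v a)" for A u v a unfolding core_def by (intro finite_PiE) auto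
  have ext: "x \<in> extensional A" if "x \<in> core A m u v a" for x A u v a
    using that by (auto simp: core_def PiE_def)
  have inj: "inj_on ?f ?S"
    by (rule inj_onI) (auto dest!: mk_inj ext)
  have "(\<Sum>u\<in>{s+h..t-h}. 2 powr (Lam * real_of_int (t - s) - 4 * CARD('n)))
      \<le> (\<Sum>u\<in>{s+h..t-h}. real (card (core P m u t a)) * real (card (core N m u s b)))"
  proof (intro sum_mono)
    fix u assume u: "u \<in> {s+h..t-h}"
    have 1: "2 powr (Lam * (t - u) - 2 * CARD('n)) \<le> real (card (core P m u t a))"
      using card_core[OF coarser_P kP[OF u], of a] u h0 by (simp add: Lam_def)
    have "(\<Sum>i\<in>N. lam i) * real_of_int (s - u) = Lam * (u - s)" by (simp add: Lam_N algebra_simps)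
    then have 2: "2 powr (Lam * (u - s) - 2 * CARD('n)) \<le> real (card (core N m u s b))"
      using card_core[OF coarser_N kN[OF u], of b] u h0 by simp
    have "2 powr (Lam * real_of_int (t - s) - 4 * CARD('n))
        = 2 powr (Lam * (t - u) - 2 * CARD('n)) * 2 powr (Lam * (u - s) - 2 * CARD('n))"
      by (simp add: powr_add[symmetric] algebra_simps)
    also have "\<dots> \<le> real (card (core P m u t a)) * real (card (core N m u s b))"
      using 1 2 by (intro mult_mono) auto
    finally show "2 powr (Lam * real_of_int (t - s) - 4 * CARD('n))
      \<le> real (card (core P m u t a)) * real (card (core N m u s b))" .
  qed
  also have "\<dots> = real (card ?S)"
    using fin by (subst card_SigmaI) (auto simp: card_cartesian_product)
  also have "\<dots> = real (card (?f ` ?S))" by (simp add: card_image[OF inj])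
  also have "\<dots> \<le> real (card {p \<in> slab s t a b. \<forall>q. near \<Delta> p q \<longrightarrow> q \<in> slab s t a b})"
    using card_mono[OF _ sub] by simp
  finally show ?thesis using h(2) by (simp add: algebra_simps)
qed

end

section \<open>The coarse inverse and the slope of an affine slab\<close>

locale quasi = embedding lam \<Phi> \<alpha> \<beta> for lam :: "'n::finite \<Rightarrow> real" and \<Phi> \<alpha> \<beta> +
  assumes onto: "\<exists>p. near \<beta> (\<Phi> p) w"
begin

definition \<psi> :: "int \<times> ('n \<Rightarrow> int) \<Rightarrow> int \<times> ('n \<Rightarrow> int)" where
  "\<psi> w = (SOME p. near \<beta> (\<Phi> p) w)"

lemma near_psi: "near \<beta> (\<Phi> (\<psi> w)) w"
  unfolding \<psi>_def using onto by (rule someI_ex)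

lemma F_psi: "\<bar>F (\<psi> w) - fst w\<bar> \<le> \<beta>"
  using near_psi[of w] by (simp add: near_def F_def)

text \<open>The constant term when both points of a \<open>near\<close> statement are displaced by
  \<open>\<beta>\<close>: two uses of \<open>near_trans\<close>, with displacements that may first
  have to be reversed by \<open>near_sym\<close>.\<close>

definition c0 :: real where
  "c0 = (1 + lmx) * ((1 + lmx) * ((1 + lmx) * \<beta>) + 1 + (1 + lmx) * \<beta>) + 1"

lemma c0_nonneg: "0 \<le> c0" using lmx_nonneg beta by (simp add: c0_def)

lemma near_transfer:
  assumes "near \<beta> v w" "near \<beta> v' w'"
  shows "near D v v' \<Longrightarrow> near ((1 + lmx)\<^sup>2 * D + c0) w w'"
    and "near D w w' \<Longrightarrow> near ((1 + lmx)\<^sup>2 * D + c0) v v'"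
proof -
  have *: "near ((1 + lmx)\<^sup>2 * D + c0) p p'" if "near B p q" "near D q q'" "near B q' p'" "B \<le> (1 + lmx) * \<beta>" for p q q' p' B
  proof (rule near_mono)
    show "near ((1 + lmx) * ((1 + lmx) * (B + D) + 1 + B) + 1) p p'"
      by (rule near_trans[OF near_trans[OF that(1,2)] that(3)])
    have "(1 + lmx) * ((1 + lmx) * (B + D) + 1 + B) + 1
        \<le> (1 + lmx) * ((1 + lmx) * ((1 + lmx) * \<beta> + D) + 1 + (1 + lmx) * \<beta>) + 1"
      using lmx_nonneg that(4) by (intro add_mono mult_left_mono) auto
    also have "\<dots> = (1 + lmx)\<^sup>2 * D + c0"
      by (simp add: c0_def power2_eq_square algebra_simps)
    finally show "(1 + lmx) * ((1 + lmx) * (B + D) + 1 + B) + 1 \<le> (1 + lmx)\<^sup>2 * D + c0" .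
  qed
  have le: "\<beta> \<le> (1 + lmx) * \<beta>" using lmx_nonneg beta by (simp add: distrib_right)
  have up: "near ((1 + lmx) * \<beta>) p q" if "near \<beta> p q" for p q using near_mono[OF that le] .
  show "near D v v' \<Longrightarrow> near ((1 + lmx)\<^sup>2 * D + c0) w w'"
    by (rule *[OF near_sym[OF assms(1)] _ up[OF assms(2)] order.refl])
  show "near D w w' \<Longrightarrow> near ((1 + lmx)\<^sup>2 * D + c0) v v'"
    by (rule *[OF up[OF assms(1)] _ near_sym[OF assms(2)] order.refl])
qed

definition \<alpha>' :: real where "\<alpha>' = \<alpha> * (1 + lmx)\<^sup>2"
definition \<beta>' :: real where "\<beta>' = \<alpha> * c0 + \<beta> + (1 + lmx)\<^sup>2 * \<beta> + c0"

lemma embedding_psi: "embedding lam \<psi> \<alpha>' \<beta>'"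
proof
  have l1: "1 \<le> (1 + lmx)\<^sup>2" using lmx_nonneg by (intro one_le_power) auto
  have "1 * 1 \<le> \<alpha> * (1 + lmx)\<^sup>2" using alpha l1 by (intro mult_mono) auto
  then show "1 \<le> \<alpha>'" by (simp add: \<alpha>'_def)
  have ac: "0 \<le> \<alpha> * c0" using alpha c0_nonneg by simp
  then show "0 \<le> \<beta>'" using c0_nonneg beta by (simp add: \<beta>'_def)
  fix D p q
  show "near (\<alpha>' * D + \<beta>') (\<psi> p) (\<psi> q)" if "near D p q"
  proof (rule near_mono[OF lower])
    show "near ((1 + lmx)\<^sup>2 * D + c0) (\<Phi> (\<psi> p)) (\<Phi> (\<psi> q))"
      by (rule near_transfer(2)[OF near_psi near_psi that])
    show "\<alpha> * ((1 + lmx)\<^sup>2 * D + c0) + \<beta> \<le> \<alpha>' * D + \<beta>'"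
      using c0_nonneg beta by (simp add: \<alpha>'_def \<beta>'_def algebra_simps)
  qed
  show "near (\<alpha>' * D + \<beta>') p q" if "near D (\<psi> p) (\<psi> q)"
  proof (rule near_mono)
    show "near ((1 + lmx)\<^sup>2 * (\<alpha> * D + \<beta>) + c0) p q"
      by (rule near_transfer(1)[OF near_psi near_psi upper[OF that]])
    show "(1 + lmx)\<^sup>2 * (\<alpha> * D + \<beta>) + c0 \<le> \<alpha>' * D + \<beta>'"
      using ac beta by (simp add: \<alpha>'_def \<beta>'_def algebra_simps)
  qed
qed

text \<open>All counts, in particular \<open>range_large\<close>, become available for the inverse
  map. There \<open>psi.F\<close> measures source height along vertical lines of the target.\<close>

sublocale psi: embedding lam \<psi> \<alpha>' \<beta>' by (rule embedding_psi)

lemma psi_F: "psi.F w = real_of_int (fst (\<psi> w))" by (simp add: psi.F_def)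

lemma near_psi_Phi: "near ((1 + lmx) * (\<alpha> * \<beta> + \<beta>)) p (\<psi> (\<Phi> p))"
  by (rule near_sym[OF lower[OF near_psi]])

end

context weights begin

text \<open>Vertical lines of length \<open>t\<close> with lower end \<open>w\<close>, labelled by their upper ends.\<close>

definition lineup :: "int \<Rightarrow> int \<times> ('n \<Rightarrow> int) \<Rightarrow> ('n \<Rightarrow> int) \<Rightarrow> int \<Rightarrow> int \<times> ('n \<Rightarrow> int)" where
  "lineup t w y u = line (fst w) (fst w + t) (restrict (snd w) P) y u"

definition above :: "int \<Rightarrow> int \<times> ('n \<Rightarrow> int) \<Rightarrow> ('n \<Rightarrow> int) set" where
  "above t w = dn N (fst w + t) (fst w) (restrict (snd w) N)"

lemma fst_lineup [simp]: "fst (lineup t w y u) = u" by (simp add: lineup_def)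

lemma lineup_start: "y \<in> above t w \<Longrightarrow> lineup t w y (fst w) = w"
  by (subst (3) mk_surj[of w]) (simp add: lineup_def line_def above_def up_self up_dn[OF restrict_extensional])

text \<open>A line that passes through a given cell at distance \<open>d\<close> above its lower end
  is determined by a \<open>P\<close>-label \<open>d\<close> levels below that cell and an
  \<open>N\<close>-label \<open>t - d\<close> levels above it. The exponents \<open>Lam * d\<close>
  and \<open>Lam * (t - d)\<close> add up to \<open>Lam * t\<close>, so a sparse set of cells meets
  few lines, whatever \<open>d\<close> is.\<close>

lemma card_lines_through:
  assumes U: "finite U" and B: "finite B" and d: "0 \<le> d" "d \<le> t"
  shows "real (card {(w, y) \<in> Sigma U (above t). lineup t w y (fst w + d) \<in> B})
    \<le> real (card B) * 2 powr (Lam * t + 2 * CARD('n))"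
proof -
  let ?A = "\<lambda>v. {(w, y) \<in> Sigma U (above t). lineup t w y (fst w + d) = v}"
  have fin: "finite (Sigma U (above t))" using U by (intro finite_SigmaI) (auto simp: above_def)
  have A: "real (card (?A v)) \<le> 2 powr (Lam * t + 2 * CARD('n))" for v
  proof -
    let ?X = "dn P (fst v - d) (fst v) (restrict (snd v) P)"
    let ?Y = "dn N (fst v - d + t) (fst v) (restrict (snd v) N)"
    let ?f = "\<lambda>wy :: (int \<times> ('n \<Rightarrow> int)) \<times> ('n \<Rightarrow> int). (restrict (snd (fst wy)) P, snd wy)"
    have key: "fst w = fst v - d" "restrict (snd w) P \<in> ?X" "y \<in> ?Y"
      "restrict (snd w) N = up N (fst v - d + t) (fst v - d) y" if wy: "(w, y) \<in> ?A v" for w y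
    proof -
      have y: "y \<in> above t w" and v: "lineup t w y (fst w + d) = v" using wy by auto
      have "fst v = fst w + d" unfolding v[symmetric] by simp
      then show z: "fst w = fst v - d" by simp
      have v': "v = mk (fst v) (up P (fst v - d) (fst v) (restrict (snd w) P)) (up N (fst v - d + t) (fst v) y)"
        using v z by (simp add: lineup_def line_def)
      have "restrict (snd v) P = up P (fst v - d) (fst v) (restrict (snd w) P)"
        by (subst (1) v') (auto simp: up_def fun_eq_iff)
      then show "restrict (snd w) P \<in> ?X" by (simp add: mem_dn_up)
      have "restrict (snd v) N = up N (fst v - d + t) (fst v) y"
        by (subst (1) v') (auto simp: up_def fun_eq_iff)
      then show "y \<in> ?Y" using y by (auto simp: mem_dn_up above_def dest: dn_ext)
      show "restrict (snd w) N = up N (fst v - d + t) (fst v - d) y"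
        using y z by (simp add: above_def up_dn[OF restrict_extensional])
    qed
    have "inj_on ?f (?A v)"
    proof (rule inj_onI)
      fix p q assume p: "p \<in> ?A v" and q: "q \<in> ?A v" and e: "?f p = ?f q"
      obtain w y w' y' where pq: "p = (w, y)" "q = (w', y')" by (metis surj_pair)
      have 1: "restrict (snd w) P = restrict (snd w') P" "y = y'" using e pq by auto
      have "restrict (snd w) N = restrict (snd w') N" "fst w = fst w'"
        using key(1,4)[of w y] key(1,4)[of w' y'] p q pq 1 by auto
      then have "w = w'" using mk_surj[of w] mk_surj[of w'] 1 by simp
      then show "p = q" using pq 1 by simp
    qed
    then have "card (?A v) \<le> card (?X \<times> ?Y)"
      by (rule card_inj_on_le) (use key in auto)
    then have "real (card (?A v)) \<le> real (card ?X) * real (card ?Y)"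
      by (simp add: card_cartesian_product flip: of_nat_mult)
    also have "\<dots> \<le> 2 powr (Lam * d + CARD('n)) * 2 powr (Lam * (t - d) + CARD('n))"
      using card_dn_P(1)[of "fst v - d" "fst v"] card_dn_N(1)[of "fst v" "fst v - d + t"] d
      by (intro mult_mono) (auto simp: algebra_simps)
    also have "\<dots> = 2 powr (Lam * t + 2 * CARD('n))" by (simp add: powr_add[symmetric] algebra_simps)
    finally show ?thesis .
  qed
  have "{(w, y) \<in> Sigma U (above t). lineup t w y (fst w + d) \<in> B} = (\<Union>v\<in>B. ?A v)" by auto
  then have "card {(w, y) \<in> Sigma U (above t). lineup t w y (fst w + d) \<in> B} \<le> (\<Sum>v\<in>B. card (?A v))"
    using card_UN_le[OF B, of ?A] by simp
  then have "real (card {(w, y) \<in> Sigma U (above t). lineup t w y (fst w + d) \<in> B}) \<le> (\<Sum>v\<in>B. real (card (?A v)))"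
    by (simp flip: of_nat_sum)
  also have "\<dots> \<le> real (card B) * 2 powr (Lam * t + 2 * CARD('n))"
    by (rule sum_bounded_above) (rule A)
  finally show ?thesis .
qed

lemma ballc_ge_1: "0 \<le> D \<Longrightarrow> 1 \<le> ballc D"
proof -
  assume D: "0 \<le> D"
  have "1 * 1 \<le> (2 * D + 1) * (2 * 2 powr (D + lmx * D + 1) + 1) ^ CARD('n)"
    using D by (intro mult_mono one_le_power) auto
  then show ?thesis by (simp add: ballc_def)
qed

end

context quasi begin

text \<open>\<open>\<psi> (\<Phi> p)\<close> is within bounded distance of \<open>p\<close>, so
  \<open>\<Phi>\<close> sends cells that are deep for the larger radius \<open>\<Delta>'\<close>
  into \<open>U\<close>, and it does so with bounded multiplicity.\<close>

lemma deep_counts: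
  fixes s t :: int and a b :: "'n \<Rightarrow> int"
  assumes \<Delta>: "0 \<le> \<Delta>" and near: "\<And>p q r. near ((1 + lmx) * (\<alpha> * \<beta> + \<beta>)) p q \<Longrightarrow> near \<Delta> q r \<Longrightarrow> near \<Delta>' p r"
  defines "U \<equiv> {w. \<psi> w \<in> {p \<in> slab s t a b. \<forall>q. near \<Delta> p q \<longrightarrow> q \<in> slab s t a b}}"
  shows "finite U"
    "real (card {p \<in> slab s t a b. \<forall>q. near \<Delta>' p q \<longrightarrow> q \<in> slab s t a b}) \<le> ballc \<beta> * real (card U)"
proof -
  let ?D = "{p \<in> slab s t a b. \<forall>q. near \<Delta>' p q \<longrightarrow> q \<in> slab s t a b}"
  have "U \<subseteq> (\<Union>p\<in>slab s t a b. {w. \<psi> w = p})" by (auto simp: U_def)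
  then show fin: "finite U"
    by (rule finite_subset) (auto intro: psi.card_fibre)
  have "\<Phi> ` ?D \<subseteq> U"
  proof (rule image_subsetI)
    fix p assume p: "p \<in> ?D"
    have n: "near ((1 + lmx) * (\<alpha> * \<beta> + \<beta>)) p (\<psi> (\<Phi> p))" by (rule near_psi_Phi)
    have "q \<in> slab s t a b" if "near \<Delta> (\<psi> (\<Phi> p)) q" for q
      using near[OF n that] p by blast
    moreover have "\<psi> (\<Phi> p) \<in> slab s t a b"
      using near[OF n near_refl[OF \<Delta>]] p by blast
    ultimately show "\<Phi> p \<in> U" by (simp add: U_def)
  qed
  then have "card (\<Phi> ` ?D) \<le> card U" using fin by (intro card_mono)
  moreover have "real (card ?D) \<le> ballc \<beta> * real (card (\<Phi> ` ?D))"
    by (intro card_le_image finite_subset[OF _ finite_slab]) auto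
  ultimately show "real (card ?D) \<le> ballc \<beta> * real (card U)"
    using ballc_ge_1[OF beta] by (meson mult_left_mono of_nat_le_iff order.trans zero_le_one)
qed

text \<open>If \<open>F\<close> has slope \<open>c\<close> on most of a slab, then a typical vertical line in the target that starts
  deep inside the image of the slab gains as much source height as its own length,
  while \<open>F\<close> recovers exactly that length.\<close>

lemma slope_le_1:
  fixes \<epsilon> :: real
  assumes eps: "0 < \<epsilon>" "\<epsilon> \<le> 1"
  shows "\<exists>\<delta>>0. \<exists>\<eta>>0. \<exists>R0::int. \<forall>R\<ge>R0. \<forall>s a b. \<forall>c d :: real.
    (\<forall>u\<in>{s..s+R}. freq (dn P u (s+R) a \<times> dn N u s b)
       (\<lambda>(x, y). \<eta> * real_of_int R < \<bar>F (mk u x y) - d - c * real_of_int (u - s)\<bar>) \<le> \<delta>) \<longrightarrow> \<bar>c\<bar> \<le> 1 + \<epsilon>"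
proof -
  define n where "n = CARD('n)"
  define e where "e = \<epsilon> / 8"
  define M where "M = nat \<lceil>16 * psi.\<kappa> / \<epsilon>\<rceil>"
  define A where "A = (1 + lmx) * (\<alpha>' * (1 + lmx))"
  define c1 where "c1 = (1 + lmx) * (\<alpha> * \<beta> + \<beta>)"
  define B where "B = (1 + lmx) * (c1 + \<beta>') + 1"
  define G where "G = 1 / lmn + 1"
  define K where "K = (B + 5) * G + 1"
  \<comment> \<open>\<open>\<psi>\<close> moves along a target line of length \<open>t\<close> by
    \<open>A * t\<close> up to a constant, and \<open>G\<close> converts a displacement into the
    height margin required by \<open>card_deep\<close>. With \<open>t \<le> \<theta> * R\<close>
    that margin takes at most a quarter of the slab.\<close>
  define \<theta> where "\<theta> = 1 / (8 * A * G)"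
  define \<eta> where "\<eta> = \<theta> * \<epsilon> / 32"
  define bb where "bb = ballc \<beta> * ballc \<beta>'"
  \<comment> \<open>The exponent \<open>9 * n\<close> collects \<open>4 * n\<close> from the deep
    cells, \<open>n\<close> from the lines above a cell, \<open>2 * n\<close> from the bad cells of
    a slab and \<open>2 * n\<close> from the lines through a cell. \<open>M + 1\<close> is the
    number of sampled heights, and \<open>bb\<close> contains the multiplicities of
    \<open>\<Phi>\<close> and \<open>\<psi>\<close>.\<close>
  define \<delta> where "\<delta> = 1 / (16 * (M + 1) * bb * 2 ^ (9 * n))"
  have e01: "0 < e" "e < 1" using eps by (auto simp: e_def)
  obtain L0 where L0: "\<And>L z x b. L \<ge> L0 \<Longrightarrow> x \<in> extensional P \<Longrightarrow> b \<in> extensional N \<Longrightarrow>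
    freq (dn N (z + L) z b) (\<lambda>y. \<forall>u\<in>{z..z+L}. \<forall>v\<in>{z..z+L}.
       psi.F (line z (z + L) x y u) - psi.F (line z (z + L) x y v) < (1 - e) * L) \<le> e"
    using psi.range_large[OF e01] by blast
  have a1: "1 \<le> A" unfolding A_def
    using mult_mono[of 1 "1 + lmx" 1 "\<alpha>' * (1 + lmx)"] mult_mono[of 1 \<alpha>' 1 "1 + lmx"] lmx_nonneg psi.alpha by auto
  have G1: "1 \<le> G" using lmn_pos by (simp add: G_def)
  then have G1: "1 \<le> G" "G > 0" by linarith+
  have th: "0 < \<theta>" using a1 G1 by (simp add: \<theta>_def)
  have c1: "0 \<le> c1" using lmx_nonneg alpha beta by (auto simp: c1_def)
  have B0: "0 \<le> B" using lmx_nonneg c1 psi.beta by (auto simp: B_def)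
  have bb: "1 \<le> bb" "0 \<le> ballc \<beta>" "0 \<le> ballc \<beta>'"
    using mult_mono[OF ballc_ge_1[OF beta] ballc_ge_1[OF psi.beta]] ballc_ge_1[OF beta] ballc_ge_1[OF psi.beta]
    by (auto simp: bb_def)
  have M1: "16 * psi.\<kappa> / \<epsilon> \<le> M" unfolding M_def by linarith
  have "0 < 16 * psi.\<kappa> / \<epsilon>" using psi.kappa_ge_1 eps by simp
  then have M0: "0 < M" using M1 by linarith
  have \<delta>: "0 < \<delta>" using bb(1) by (simp add: \<delta>_def)
  have \<eta>: "0 < \<eta>" using th eps by (simp add: \<eta>_def)
  define R0 :: int where "R0 = 1 + \<lceil>32 * \<beta> / (\<theta> * \<epsilon>)\<rceil> + \<lceil>2 * M / \<theta>\<rceil> + \<bar>\<lceil>2 * L0 / \<theta>\<rceil>\<bar> + \<lceil>8 * K\<rceil>"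
  show ?thesis
  proof (intro exI conjI allI impI)
    show "0 < \<delta>" "0 < \<eta>" by fact+
    fix R s :: int and a b :: "'n \<Rightarrow> int" and c d :: real
    assume R: "R0 \<le> R" and aff: "\<forall>u\<in>{s..s+R}. freq (dn P u (s+R) a \<times> dn N u s b)
       (\<lambda>(x, y). \<eta> * real_of_int R < \<bar>F (mk u x y) - d - c * real_of_int (u - s)\<bar>) \<le> \<delta>"
    have nn: "0 \<le> 32 * \<beta> / (\<theta> * \<epsilon>)" "0 \<le> 2 * M / \<theta>" "0 \<le> 8 * K"
      using beta th eps B0 G1 by (auto simp: K_def)
    have R1: "1 \<le> R" "32 * \<beta> / (\<theta> * \<epsilon>) \<le> R" "2 * M / \<theta> \<le> R" "2 * L0 / \<theta> \<le> R"
      "8 * K \<le> R"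
      using R nn unfolding R0_def by linarith+
    \<comment> \<open>Lines are sampled at \<open>M + 1\<close> heights at distance
      \<open>\<tau>\<close>, so that bad cells have to be avoided at a bounded number of heights
      only; in between \<open>psi.F\<close> changes by at most \<open>psi.\<kappa> * \<tau>\<close>,
      a small part of \<open>t\<close>.\<close>
    define \<tau> where "\<tau> = \<lfloor>\<theta> * R / M\<rfloor>"
    define t where "t = int M * \<tau>"
    have "\<tau> \<le> \<theta> * R / M" "\<theta> * R / M - 1 \<le> \<tau>" unfolding \<tau>_def by linarith+
    then have t1: "t \<le> \<theta> * R" "\<theta> * R - M \<le> t"
      using M0 by (simp_all add: t_def field_simps)
    have "M \<le> \<theta> * R / 2" using R1(3) th by (simp add: field_simps)
    then have t2: "\<theta> * R / 2 \<le> t" using t1 by linarith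
    have "L0 \<le> \<theta> * R / 2" using R1(4) th by (simp add: field_simps)
    then have t3: "L0 \<le> t" using t2 by linarith
    have "0 < \<theta> * R" using th R1(1) by simp
    then have t0: "0 < real_of_int t" "0 < t" using t2 by linarith+
    have \<tau>0: "0 < \<tau>" using t0(2) M0 by (simp add: t_def zero_less_mult_iff)
    define \<Delta> where "\<Delta> = \<alpha>' * ((1 + lmx) * t) + \<beta>'"
    define \<Delta>' where "\<Delta>' = (1 + lmx) * (c1 + \<Delta>) + 1"
    have \<Delta>'t: "\<Delta>' = A * t + B" by (simp add: \<Delta>'_def \<Delta>_def A_def B_def algebra_simps)
    have \<Delta>0: "0 \<le> \<Delta>" using psi.alpha psi.beta lmx_nonneg t0 by (auto simp: \<Delta>_def)
    have \<Delta>'0: "0 \<le> \<Delta>'" using \<Delta>0 c1 lmx_nonneg by (auto simp: \<Delta>'_def)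
    \<comment> \<open>The summand 5 arises because \<open>4 * m\<close> is at most
      \<open>8 * 2 powr (\<Delta>' + 1)\<close>, so \<open>lmn * h - 1\<close> has to reach
      \<open>\<Delta>' + 4\<close>.\<close>
    define Z where "Z = (\<Delta>' + 5) * G"
    define h where "h = \<lceil>Z\<rceil>"
    define m where "m = \<lceil>2 powr (\<Delta>' + 1)\<rceil>"
    have h4: "4 * h \<le> R"
    proof -
      have "A * t \<le> A * (\<theta> * R)" using t1(1) a1 by (intro mult_left_mono) auto
      then have "A * t * G \<le> A * (\<theta> * R) * G" using G1 by (intro mult_right_mono) auto
      also have "\<dots> = R / 8" using a1 G1 by (simp add: \<theta>_def)
      finally have 1: "A * t * G \<le> R / 8" .
      have "real_of_int h \<le> Z + 1" unfolding h_def by linarith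
      also have "\<dots> = A * t * G + K" by (simp add: \<Delta>'t K_def Z_def algebra_simps)
      also have "\<dots> \<le> R / 8 + R / 8" using 1 R1(5) by linarith
      finally show ?thesis by linarith
    qed
    have hG: "Z \<le> h" unfolding h_def by linarith
    have h1: "\<Delta>' \<le> h"
    proof -
      have "(\<Delta>' + 5) * 1 \<le> Z" unfolding Z_def using \<Delta>'0 G1 by (intro mult_left_mono) auto
      then show ?thesis using hG by simp
    qed
    have h2: "4 * real_of_int m \<le> 2 powr (lmn * h - 1)"
    proof -
      have "(\<Delta>' + 5) * (1 / lmn) \<le> Z"
        unfolding Z_def using \<Delta>'0 by (intro mult_left_mono) (auto simp: G_def)
      then have "(\<Delta>' + 5) * (1 / lmn) \<le> h" using hG by (rule order.trans)
      then have "lmn * ((\<Delta>' + 5) * (1 / lmn)) \<le> lmn * h" using lmn_pos by (intro mult_left_mono) auto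
      then have "\<Delta>' + 4 \<le> lmn * h - 1" using lmn_pos by simp
      then have "2 powr (\<Delta>' + 4) \<le> 2 powr (lmn * h - 1)" by (intro powr_mono) auto
      moreover have "m \<le> 2 powr (\<Delta>' + 1) + 1" unfolding m_def by linarith
      moreover have "1 \<le> 2 powr (\<Delta>' + 1)" using \<Delta>'0 by (intro ge_one_powr_ge_zero) auto
      moreover have "2 powr (\<Delta>' + 4) = 8 * 2 powr (\<Delta>' + 1)" by (simp add: powr_add)
      ultimately show ?thesis by linarith
    qed
    have m1: "2 powr (\<Delta>' + 1) \<le> m" unfolding m_def by linarith
    let ?Q = "slab s (s + R) a b"
    define U where "U = {w. \<psi> w \<in> {p \<in> ?Q. \<forall>q. near \<Delta> p q \<longrightarrow> q \<in> ?Q}}"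
    have tr: "near \<Delta>' p r" if "near ((1 + lmx) * (\<alpha> * \<beta> + \<beta>)) p q" "near \<Delta> q r" for p q r
      using near_trans[OF that] by (simp add: \<Delta>'_def c1_def)
    have U: "finite U" "real (card {p \<in> ?Q. \<forall>q. near \<Delta>' p q \<longrightarrow> q \<in> ?Q}) \<le> ballc \<beta> * real (card U)"
      unfolding U_def by (rule deep_counts[OF \<Delta>0 tr]; assumption)+
    define W where "W = 2 powr (Lam * R) "
    have cU: "R / 2 * (W / 2 ^ (4 * n)) \<le> ballc \<beta> * real (card U)"
    proof -
      have WE: "W / 2 ^ (4 * n) = 2 powr (Lam * real_of_int (s + R - s) - 4 * CARD('n))"
        by (simp add: W_def powr_diff n_def powr_realpow[symmetric])
      have "R / 2 * (W / 2 ^ (4 * n)) \<le> real_of_int (s + R - s - 2 * h + 1) * (W / 2 ^ (4 * n))"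
        using h4 by (intro mult_right_mono) (auto simp: W_def)
      also have "\<dots> \<le> real (card {p \<in> ?Q. \<forall>q. near \<Delta>' p q \<longrightarrow> q \<in> ?Q})"
        unfolding WE using h4 R1(1) by (intro card_deep[OF \<Delta>'0 m1 h1 h2]) auto
      finally show ?thesis using U(2) by (rule order.trans)
    qed
    define Bad where "Bad = {q \<in> ?Q. \<eta> * R < \<bar>F q - d - c * (fst q - s)\<bar>}"
    have cBad: "real (card Bad) \<le> (R + 1) * (\<delta> * (W * 2 ^ (2 * n)))"
    proof -
      have "real (card Bad) \<le> real_of_int (s + R - s + 1) * (\<delta> * 2 powr (Lam * real_of_int (s + R - s) + 2 * CARD('n)))"
        unfolding Bad_def using R1(1) \<delta> aff by (intro card_slab_bad) auto
      moreover have "2 powr (Lam * real_of_int (s + R - s) + 2 * CARD('n)) = W * 2 ^ (2 * n)"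
        by (simp add: W_def powr_add n_def powr_realpow[symmetric])
      ultimately show ?thesis by simp
    qed
    define Bad' where "Bad' = {w. \<psi> w \<in> Bad}"
    have fBad': "finite Bad'"
    proof (rule finite_subset)
      show "Bad' \<subseteq> (\<Union>p\<in>?Q. {w. \<psi> w = p})" by (auto simp: Bad'_def Bad_def)
    qed (auto intro: psi.card_fibre)
    have "real (card Bad') \<le> ballc \<beta>' * real (card (\<psi> ` Bad'))" by (rule psi.card_le_image[OF fBad'])
    also have "\<dots> \<le> ballc \<beta>' * real (card Bad)"
      using bb by (intro mult_left_mono) (auto intro!: card_mono simp: Bad'_def Bad_def)
    finally have cBad': "real (card Bad') \<le> ballc \<beta>' * ((R + 1) * (\<delta> * (W * 2 ^ (2 * n))))"
      using cBad bb(3) by (meson mult_left_mono order.trans)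
    define S where "S = Sigma U (above t)"
    have fS: "finite S" unfolding S_def using U(1) by (intro finite_SigmaI) (auto simp: above_def)
    define V where "V = 2 powr (Lam * t)"
    have V0: "0 < V" "0 < W" by (simp_all add: V_def W_def)
    have cS: "real (card U) * (V / 2 ^ n) \<le> real (card S)"
    proof -
      have "real (card U) * (V / 2 ^ n) = (\<Sum>w\<in>U. V / 2 ^ n)" by simp
      also have "\<dots> \<le> (\<Sum>w\<in>U. real (card (above t w)))"
      proof (intro sum_mono)
        fix w
        show "V / 2 ^ n \<le> real (card (above t w))"
          using card_dn_N(2)[of "fst w" "fst w + t"] t0
          by (simp add: above_def V_def n_def powr_diff powr_realpow[symmetric])
      qed
      also have "\<dots> = real (card S)"
        unfolding S_def using U(1) by (subst card_SigmaI) (auto simp: above_def)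
      finally show ?thesis .
    qed
    define rb where "rb w y \<longleftrightarrow> (\<forall>u\<in>{fst w..fst w + t}. \<forall>v\<in>{fst w..fst w + t}.
      psi.F (lineup t w y u) - psi.F (lineup t w y v) < (1 - e) * t)" for w y
    have cr: "real (card {(w, y) \<in> S. rb w y}) \<le> e * real (card S)"
    proof -
      have "{(w, y) \<in> S. rb w y} = (SIGMA w:U. {y \<in> above t w. rb w y})" by (auto simp: S_def)
      then have "real (card {(w, y) \<in> S. rb w y}) = (\<Sum>w\<in>U. real (card {y \<in> above t w. rb w y}))"
        using U(1) by (simp add: above_def)
      also have "\<dots> \<le> (\<Sum>w\<in>U. e * real (card (above t w)))"
      proof (intro sum_mono)
        fix w
        have "freq (above t w) (rb w) \<le> e"
          using L0[OF t3, of "restrict (snd w) P" "restrict (snd w) N" "fst w"]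
          by (simp add: above_def rb_def lineup_def)
        then show "real (card {y \<in> above t w. rb w y}) \<le> e * real (card (above t w))"
          by (simp add: freq_card above_def divide_le_eq card_gt_0_iff)
      qed
      also have "\<dots> = e * real (card S)"
        unfolding S_def using U(1) by (simp add: above_def sum_distrib_left)
      finally show ?thesis .
    qed
    define Bj where "Bj j = {(w, y) \<in> S. lineup t w y (fst w + int j * \<tau>) \<in> Bad'}" for j
    have fBj: "finite (Bj j)" for j by (rule finite_subset[OF _ fS]) (auto simp: Bj_def)
    have frb: "finite {(w, y) \<in> S. rb w y}" by (rule finite_subset[OF _ fS]) auto
    have cBj: "real (card (Bj j)) \<le> real (card Bad') * (V * 2 ^ (2 * n))" if "j \<le> M" for j
    proof -
      have "int j * \<tau> \<le> t" unfolding t_def using that \<tau>0 by (intro mult_right_mono) auto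
      then have "real (card (Bj j)) \<le> real (card Bad') * 2 powr (Lam * t + 2 * CARD('n))"
        unfolding Bj_def S_def using \<tau>0 by (intro card_lines_through[OF U(1) fBad']) auto
      then show ?thesis by (simp add: V_def powr_add n_def powr_realpow[symmetric])
    qed
    \<comment> \<open>At most a fraction \<open>e\<close> of the lines has small range, and by the
      choice of \<open>\<delta>\<close> the lines with a bad sample are too few to make up the
      rest.\<close>
    have "\<exists>w y. (w, y) \<in> S \<and> \<not> rb w y \<and> (\<forall>j\<le>M. (w, y) \<notin> Bj j)"
    proof (rule ccontr)
      assume "\<not> ?thesis"
      then have "S \<subseteq> {(w, y) \<in> S. rb w y} \<union> (\<Union>j\<in>{..M}. Bj j)" by auto
      then have "card S \<le> card ({(w, y) \<in> S. rb w y} \<union> (\<Union>j\<in>{..M}. Bj j))"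
        by (intro card_mono finite_UnI finite_UN_I frb fBj) auto
      also have "\<dots> \<le> card {(w, y) \<in> S. rb w y} + card (\<Union>j\<in>{..M}. Bj j)" by (rule card_Un_le)
      also have "card (\<Union>j\<in>{..M}. Bj j) \<le> (\<Sum>j\<in>{..M}. card (Bj j))" by (rule card_UN_le) simp
      finally have "real (card S) \<le> real (card {(w, y) \<in> S. rb w y}) + (\<Sum>j\<in>{..M}. real (card (Bj j)))"
        by (simp flip: of_nat_sum of_nat_add)
      also have "\<dots> \<le> e * real (card S) + (M + 1) * (real (card Bad') * (V * 2 ^ (2 * n)))"
        using cr sum_bounded_above[of "{..M}" "\<lambda>j. real (card (Bj j))" "real (card Bad') * (V * 2 ^ (2 * n))"] cBj
        by simp
      finally have 1: "(1 - e) * real (card S) \<le> (M + 1) * (real (card Bad') * (V * 2 ^ (2 * n)))"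
        by (simp add: algebra_simps)
      have "(1 / 2) * (real (card U) * (V / 2 ^ n)) \<le> (1 - e) * real (card S)"
        using cS eps V0 by (intro mult_mono) (auto simp: e_def)
      also note 1
      also have "(M + 1) * (real (card Bad') * (V * 2 ^ (2 * n)))
          \<le> (M + 1) * (ballc \<beta>' * ((R + 1) * (\<delta> * (W * 2 ^ (2 * n)))) * (V * 2 ^ (2 * n)))"
        using cBad' V0 by (intro mult_left_mono mult_right_mono) auto
      finally have 2: "real (card U) * V \<le> 2 * 2 ^ n * (M + 1) * ballc \<beta>' * (R + 1) * \<delta> * W * 2 ^ (2 * n) * V * 2 ^ (2 * n)"
        by (simp add: field_simps)
      have 3: "real (card U) \<le> 2 * 2 ^ n * (M + 1) * ballc \<beta>' * (R + 1) * \<delta> * W * 2 ^ (2 * n) * 2 ^ (2 * n)"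
        using 2 V0 by (simp add: mult.commute mult.left_commute)
      have "R / 2 * (W / 2 ^ (4 * n)) \<le> ballc \<beta> * (2 * 2 ^ n * (M + 1) * ballc \<beta>' * (R + 1) * \<delta> * W * 2 ^ (2 * n) * 2 ^ (2 * n))"
        using cU mult_left_mono[OF 3 bb(2)] by linarith
      also have "\<dots> = (16 * (M + 1) * bb * 2 ^ (9 * n) * \<delta>) * ((R + 1) / 8 * (W / 2 ^ (4 * n)))"
      proof -
        have "(2::real) ^ (9 * n) = 2 ^ n * 2 ^ (2 * n) * 2 ^ (2 * n) * 2 ^ (4 * n)"
          by (simp add: power_add[symmetric])
        then show ?thesis by (simp add: bb_def field_simps)
      qed
      also have "16 * (M + 1) * bb * 2 ^ (9 * n) * \<delta> = 1" using bb(1) by (simp add: \<delta>_def)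
      finally have "R / 2 * (W / 2 ^ (4 * n)) \<le> 1 * ((R + 1) / 8 * (W / 2 ^ (4 * n)))" .
      moreover have "0 < W / 2 ^ (4 * n)" using V0 by simp
      ultimately have "R / 2 \<le> (R + 1) / 8" by (simp only: mult_1 mult_le_cancel_right_pos)
      then show False using R1(1) by simp
    qed
    then obtain w y where wy: "(w, y) \<in> S" "\<not> rb w y" and nB: "\<And>j. j \<le> M \<Longrightarrow> (w, y) \<notin> Bj j" by blast
    have w: "\<psi> w \<in> ?Q" "\<And>q. near \<Delta> (\<psi> w) q \<Longrightarrow> q \<in> ?Q" and y: "y \<in> above t w"
      using wy(1) by (auto simp: S_def U_def)
    let ?l = "lineup t w y"
    define T where "T j = ?l (fst w + int j * \<tau>)" for j
    have jt: "int j * \<tau> \<le> t" "0 \<le> int j * \<tau>" if "j \<le> M" for j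
      using that \<tau>0 unfolding t_def by (auto intro: mult_right_mono)
    have good: "\<bar>F (\<psi> (T j)) - d - c * (fst (\<psi> (T j)) - s)\<bar> \<le> \<eta> * R" if "j \<le> M" for j
    proof -
      have "near ((1 + lmx) * \<bar>real_of_int (fst w) - real_of_int (fst w + int j * \<tau>)\<bar>) (?l (fst w)) (T j)"
        unfolding T_def lineup_def using jt[OF that] by (intro near_line) auto
      then have "near ((1 + lmx) * t) w (T j)"
        unfolding lineup_start[OF y]
      proof (rule near_mono)
        have "real_of_int (int j * \<tau>) \<le> t" "0 \<le> real_of_int (int j * \<tau>)"
          using jt[OF that] by (simp_all only: of_int_le_iff of_int_0_le_iff)
        then have "\<bar>real_of_int (fst w) - real_of_int (fst w + int j * \<tau>)\<bar> \<le> t"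
          by simp
        then show "(1 + lmx) * \<bar>real_of_int (fst w) - real_of_int (fst w + int j * \<tau>)\<bar> \<le> (1 + lmx) * t"
          using lmx_nonneg by (intro mult_left_mono) auto
      qed
      then have "near \<Delta> (\<psi> w) (\<psi> (T j))" unfolding \<Delta>_def by (rule psi.upper)
      then have "\<psi> (T j) \<in> ?Q" by (rule w(2))
      moreover have "\<psi> (T j) \<notin> Bad" using nB[OF that] wy(1) by (simp add: Bj_def Bad'_def T_def)
      ultimately show ?thesis by (simp add: Bad_def not_less)
    qed
    have FT: "\<bar>F (\<psi> (T j)) - (fst w + int j * \<tau>)\<bar> \<le> \<beta>" for j
      using F_psi[of "T j"] by (simp add: T_def)
    obtain u v where uv: "u \<in> {fst w..fst w + t}" "v \<in> {fst w..fst w + t}"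
      "psi.F (?l u) - psi.F (?l v) \<ge> (1 - e) * t"
      using wy(2) by (auto simp: rb_def not_less)
    have sample: "\<exists>j\<le>M. \<bar>psi.F (?l u) - fst (\<psi> (T j))\<bar> \<le> psi.\<kappa> * \<tau>"
      if "u \<in> {fst w..fst w + t}" for u
    proof -
      define j where "j = nat ((u - fst w) div \<tau>)"
      have j0: "0 \<le> (u - fst w) div \<tau>" using that \<tau>0 by (simp add: pos_imp_zdiv_nonneg_iff)
      have "(u - fst w) div \<tau> \<le> t div \<tau>" using that \<tau>0 by (intro zdiv_mono1) auto
      then have jM: "j \<le> M" using \<tau>0 by (simp add: j_def t_def)
      have jj: "int j * \<tau> = (u - fst w) - (u - fst w) mod \<tau>"
        using j0 by (simp add: j_def minus_mod_eq_div_mult)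
      have "\<bar>psi.F (?l u) - psi.F (T j)\<bar> \<le> psi.\<kappa> * \<bar>real_of_int u - real_of_int (fst w + int j * \<tau>)\<bar>"
        unfolding T_def lineup_def using jt[OF jM] that by (intro order.trans[OF psi.F_line]) auto
      also have "\<dots> \<le> psi.\<kappa> * \<tau>"
        using pos_mod_bound[OF \<tau>0, of "u - fst w"] pos_mod_sign[OF \<tau>0, of "u - fst w"] psi.kappa_ge_1 jj
        by (intro mult_left_mono) auto
      finally show ?thesis using jM by (auto simp: psi_F)
    qed
    obtain i j where ij: "i \<le> M" "j \<le> M" "\<bar>psi.F (?l u) - fst (\<psi> (T i))\<bar> \<le> psi.\<kappa> * \<tau>"
      "\<bar>psi.F (?l v) - fst (\<psi> (T j))\<bar> \<le> psi.\<kappa> * \<tau>"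
      using sample[OF uv(1)] sample[OF uv(2)] by blast
    define X where "X = real_of_int (fst (\<psi> (T i))) - fst (\<psi> (T j))"
    have k\<tau>: "2 * (psi.\<kappa> * \<tau>) \<le> e * t"
    proof -
      have "16 * psi.\<kappa> \<le> M * \<epsilon>" using M1 eps by (simp add: divide_le_eq)
      then have "16 * psi.\<kappa> * \<tau> \<le> M * \<epsilon> * \<tau>" using \<tau>0 by (intro mult_right_mono) auto
      then show ?thesis by (simp add: e_def t_def mult_ac)
    qed
    have X: "(1 - 2 * e) * t \<le> X" using ij(3,4) uv(3) k\<tau> by (simp add: X_def algebra_simps)
    have "c * X = (c * (fst (\<psi> (T i)) - s)) - (c * (fst (\<psi> (T j)) - s))" by (simp add: X_def algebra_simps)
    then have "\<bar>c * X\<bar> \<le> \<bar>F (\<psi> (T i)) - F (\<psi> (T j))\<bar> + 2 * (\<eta> * R)"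
      using good[OF ij(1)] good[OF ij(2)] by linarith
    also have "\<dots> \<le> \<bar>real_of_int (int i * \<tau>) - real_of_int (int j * \<tau>)\<bar> + 2 * \<beta> + 2 * (\<eta> * R)"
      using FT[of i] FT[of j] by simp
    also have "\<bar>real_of_int (int i * \<tau>) - real_of_int (int j * \<tau>)\<bar> \<le> t"
      using jt[OF ij(1)] jt[OF ij(2)] by linarith
    finally have cX: "\<bar>c * X\<bar> \<le> t + 2 * \<beta> + 2 * (\<eta> * R)" by simp
    have "32 * \<beta> \<le> \<epsilon> * (\<theta> * R)" using R1(2) th eps by (simp add: field_simps)
    also have "\<dots> \<le> \<epsilon> * (2 * t)" using t2 eps by (intro mult_left_mono) auto
    finally have b1: "2 * \<beta> \<le> e * t" by (simp add: e_def)
    have "\<epsilon> * (\<theta> * R) \<le> \<epsilon> * (2 * t)" using t2 eps by (intro mult_left_mono) auto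
    then have b2: "2 * (\<eta> * R) \<le> e * t" by (simp add: \<eta>_def e_def)
    have "\<bar>c\<bar> * ((1 - 2 * e) * t) \<le> \<bar>c\<bar> * X" using X by (intro mult_left_mono) auto
    also have "\<dots> \<le> \<bar>c * X\<bar>" by (simp add: abs_mult mult_left_mono)
    also have "\<dots> \<le> (1 + 2 * e) * t" using cX b1 b2 by (simp add: algebra_simps)
    finally have "\<bar>c\<bar> * (1 - 2 * e) \<le> 1 + 2 * e" using t0 by (simp add: mult.assoc[symmetric])
    also have "\<dots> \<le> (1 + \<epsilon>) * (1 - 2 * e)"
      using eps by (simp add: e_def field_simps)
    finally show "\<bar>c\<bar> \<le> 1 + \<epsilon>" using eps by (simp add: e_def mult_le_cancel_right)
  qed
qed

end

section \<open>Energy of vertical lines\<close>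

lemma avg_swap: "avg A (\<lambda>a. avg B (\<lambda>b. g a b)) = avg B (\<lambda>b. avg A (\<lambda>a. g a b))"
  using avg_Times[of A B "\<lambda>(a, b). g a b"] avg_Times2[of A B "\<lambda>(a, b). g a b"] by simp

lemma abs_scale: "0 \<le> k \<Longrightarrow> \<bar>k * x - k * y\<bar> = k * \<bar>x - y\<bar>" for k x y :: real
  by (simp add: right_diff_distrib[symmetric] abs_mult)

lemma freq_disj_le: "freq A Q \<le> p \<Longrightarrow> freq A R \<le> q \<Longrightarrow> p + q \<le> r \<Longrightarrow> freq A (\<lambda>a. Q a \<or> R a) \<le> r"
  using freq_disj[of A Q R] by linarith

context weights begin

text \<open>The lines of a slab are sorted by their \<open>P\<close>-ancestor \<open>a'\<close> at
  height \<open>v\<close> and their \<open>N\<close>-ancestor \<open>b'\<close> at height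
  \<open>u\<close>. Lines of one class agree in the \<open>P\<close>-part from \<open>v\<close>
  upwards and in the \<open>N\<close>-part from \<open>u\<close> downwards.\<close>

lemma avg_sub:
  assumes "s \<le> v" "v \<le> t" "s \<le> u" "u \<le> t" "a \<in> extensional P" "b \<in> extensional N"
  shows "avg (dn P s t a \<times> dn N t s b) G
       = avg (dn P v t a \<times> dn N u s b) (\<lambda>(a', b'). avg (dn P s v a' \<times> dn N t u b') G)"
proof -
  have "avg (dn P s t a \<times> dn N t s b) G = avg (dn P s t a) (\<lambda>x. avg (dn N t s b) (\<lambda>y. G (x, y)))"
    by (rule avg_Times)
  also have "\<dots> = avg (dn P v t a) (\<lambda>a'. avg (dn P s v a') (\<lambda>x. avg (dn N u s b) (\<lambda>b'. avg (dn N t u b') (\<lambda>y. G (x, y)))))"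
    using assms by (simp add: avg_dn_tower[OF coarser_P coarser_P, of s v t] avg_dn_tower[OF coarser_N coarser_N, of u t s])
  also have "\<dots> = avg (dn P v t a) (\<lambda>a'. avg (dn N u s b) (\<lambda>b'. avg (dn P s v a') (\<lambda>x. avg (dn N t u b') (\<lambda>y. G (x, y)))))"
    by (intro avg_cong avg_swap)
  also have "\<dots> = avg (dn P v t a \<times> dn N u s b) (\<lambda>(a', b'). avg (dn P s v a' \<times> dn N t u b') G)"
    by (simp add: avg_Times)
  finally show ?thesis .
qed

lemma avg_push:
  assumes "s \<le> u" "u \<le> v'" "u' \<le> v" "v \<le> t" "a \<in> extensional P" "b \<in> extensional N"
  shows "avg (dn P s v' a \<times> dn N t u' b) (\<lambda>(x, y). G (up P s u x) (up N t v y))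
       = avg (dn P u v' a \<times> dn N v u' b) (\<lambda>(x, y). G x y)"
  using assms avg_dn_up[OF coarser_P[of s u] coarser_P[of u v'], of a "\<lambda>x. avg (dn N v u' b) (G x)"]
  by (simp add: avg_Times avg_dn_up[OF coarser_N[of v t] coarser_N[of u' v], of b])

end

context embedding begin

text \<open>\<open>c\<close> bounds the mean square slope at scale \<open>r\<close>, uniformly over
  all boxes of lines; within a box both ends vary.\<close>

definition energy_le :: "int \<Rightarrow> real \<Rightarrow> bool" where
  "energy_le r c \<longleftrightarrow> (\<forall>s. \<forall>a\<in>extensional P. \<forall>b\<in>extensional N.
     avg (dn P s (s + r) a \<times> dn N (s + r) s b) (\<lambda>(x, y). (F (mk (s + r) a y) - F (mk s x b))\<^sup>2) \<le> c * (real_of_int r)\<^sup>2)"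

text \<open>Sorting the lines of a long slab by their ancestors at the ends of the window exhibits
  the average over the window as a mixture of averages over boxes of length
  \<open>r\<close>.\<close>

lemma energy_window:
  assumes e: "energy_le r c" and r: "0 \<le> r" "s \<le> u" "u + r \<le> t" and ab: "a \<in> extensional P" "b \<in> extensional N"
  shows "avg (dn P s t a \<times> dn N t s b) (\<lambda>(x, y). (F (line s t x y (u + r)) - F (line s t x y u))\<^sup>2) \<le> c * (real_of_int r)\<^sup>2"
proof -
  let ?v = "u + r"
  let ?G = "\<lambda>x y. (F (mk ?v (up P u ?v x) y) - F (mk u x (up N ?v u y)))\<^sup>2"
  have "avg (dn P s t a \<times> dn N t s b) (\<lambda>(x, y). (F (line s t x y ?v) - F (line s t x y u))\<^sup>2)
     = avg (dn P s t a \<times> dn N t s b) (\<lambda>(x, y). ?G (up P s u x) (up N t ?v y))"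
    using r by (intro avg_cong) (auto simp: line_def up_up coarser_P coarser_N)
  also have "\<dots> = avg (dn P u t a \<times> dn N ?v s b) (\<lambda>(x, y). ?G x y)"
    using r ab by (intro avg_push) auto
  also have "\<dots> = avg (dn P u t a) (\<lambda>x. avg (dn N ?v s b) (?G x))"
    by (simp add: avg_Times)
  also have "\<dots> = avg (dn P ?v t a) (\<lambda>a'. avg (dn P u ?v a') (\<lambda>x. avg (dn N u s b) (\<lambda>b'. avg (dn N ?v u b') (?G x))))"
    using r ab by (simp add: avg_dn_tower[OF coarser_P coarser_P, of u ?v t] avg_dn_tower[OF coarser_N coarser_N, of u ?v s])
  also have "\<dots> = avg (dn P ?v t a) (\<lambda>a'. avg (dn N u s b) (\<lambda>b'. avg (dn P u ?v a') (\<lambda>x. avg (dn N ?v u b') (?G x))))"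
    by (intro avg_cong avg_swap)
  also have "\<dots> \<le> c * (real_of_int r)\<^sup>2"
  proof (rule avg_le[OF finite_dn dn_ne], rule avg_le[OF finite_dn dn_ne])
    fix a' b' assume a': "a' \<in> dn P ?v t a" and b': "b' \<in> dn N u s b"
    then have ex: "a' \<in> extensional P" "b' \<in> extensional N" by (auto dest: dn_ext)
    have "avg (dn P u ?v a') (\<lambda>x. avg (dn N ?v u b') (?G x))
        = avg (dn P u ?v a' \<times> dn N ?v u b') (\<lambda>(x, y). (F (mk ?v a' y) - F (mk u x b'))\<^sup>2)"
      unfolding avg_Times using up_dn[OF ex(1)] up_dn[OF ex(2)] by (intro avg_cong) auto
    also have "\<dots> \<le> c * (real_of_int r)\<^sup>2" using e ex by (simp add: energy_le_def)
    finally show "avg (dn P u ?v a') (\<lambda>x. avg (dn N ?v u b') (?G x)) \<le> c * (real_of_int r)\<^sup>2" .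
  qed
  finally show ?thesis by simp
qed

lemma line_ends:
  assumes "s \<le> t" "a \<in> extensional P" "b \<in> extensional N" "x \<in> dn P s t a" "y \<in> dn N t s b"
  shows "line s t x y s = mk s x b" "line s t x y t = mk t a y"
  using assms by (simp_all add: line_def up_self dn_ext up_dn)

lemma energy_le_kappa: "energy_le 1 (\<kappa>\<^sup>2)"
  unfolding energy_le_def
proof (intro allI ballI avg_le)
  fix s :: int and a b :: "'n \<Rightarrow> int" assume ab: "a \<in> extensional P" "b \<in> extensional N"
  fix xy assume "xy \<in> dn P s (s + 1) a \<times> dn N (s + 1) s b"
  then obtain x y where xy: "xy = (x, y)" "x \<in> dn P s (s + 1) a" "y \<in> dn N (s + 1) s b" by auto
  have "\<bar>F (line s (s + 1) x y (s + 1)) - F (line s (s + 1) x y s)\<bar> \<le> \<kappa> * \<bar>real_of_int (s + 1) - real_of_int s\<bar>"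
    using F_line[of s "s + 1" "s + 1" s x y] by simp
  then have "\<bar>F (mk (s + 1) a y) - F (mk s x b)\<bar> \<le> \<kappa>"
    using line_ends[OF _ ab xy(2,3)] by simp
  then show "(case xy of (x, y) \<Rightarrow> (F (mk (s + 1) a y) - F (mk s x b))\<^sup>2) \<le> \<kappa>\<^sup>2 * (real_of_int 1)\<^sup>2"
    using xy(1) power_mono[of "\<bar>F (mk (s + 1) a y) - F (mk s x b)\<bar>" \<kappa> 2] by simp
qed auto

end

context quasi begin

text \<open>For a nearly extremal slab the increments over consecutive windows must be nearly equal on most lines, by
  convexity. In an inner slab, the increment below depends on \<open>x\<close> only and the one above on \<open>y\<close> only, so
  both are almost constant and \<open>F\<close> has constant slope there.\<close>

lemma energy_le_1:
  assumes "0 < \<epsilon>" shows "\<exists>r\<ge>1. energy_le r (1 + \<epsilon>)"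
proof -
  define S where "S = {c. \<exists>r\<ge>1. energy_le r c}"
  define e where "e = Inf S"
  have S0: "0 \<le> c" if cS: "c \<in> S" for c
  proof -
    obtain r where r: "1 \<le> r" "energy_le r c" using cS by (auto simp: S_def)
    have "0 \<le> avg (dn P 0 (0 + r) (restrict (\<lambda>_. 0) P) \<times> dn N (0 + r) 0 (restrict (\<lambda>_. 0) N))
       (\<lambda>(x, y). (F (mk (0 + r) (restrict (\<lambda>_. 0) P) y) - F (mk 0 x (restrict (\<lambda>_. 0) N)))\<^sup>2)"
      by (intro avg_nonneg) auto
    also have "\<dots> \<le> c * (real_of_int r)\<^sup>2" using r(2) unfolding energy_le_def by blast
    finally show ?thesis using r(1) by (simp add: zero_le_mult_iff)
  qed
  have Sne: "S \<noteq> {}" using energy_le_kappa by (auto simp: S_def)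
  have bdd: "bdd_below S" using S0 by (rule bdd_belowI)
  have "e \<le> 1"
  proof (rule ccontr)
    assume "\<not> e \<le> 1"
    define g where "g = e - 1"
    have g: "0 < g" using \<open>\<not> e \<le> 1\<close> by (simp add: g_def)
    define \<epsilon>1 where "\<epsilon>1 = min 1 (g / 40)"
    have e1: "0 < \<epsilon>1" "\<epsilon>1 \<le> 1" "\<epsilon>1 \<le> g / 40" using g by (auto simp: \<epsilon>1_def)
    obtain \<delta> \<eta> R0 where \<delta>: "0 < \<delta>" and \<eta>: "0 < \<eta>" and slope: "\<And>R s a b c d. R \<ge> R0 \<Longrightarrow>
      (\<And>u. u \<in> {s..s+R} \<Longrightarrow> freq (dn P u (s+R) a \<times> dn N u s b)
       (\<lambda>(x, y). \<eta> * real_of_int R < \<bar>F (mk u x y) - d - c * real_of_int (u - s)\<bar>) \<le> \<delta>) \<Longrightarrow> \<bar>c\<bar> \<le> 1 + \<epsilon>1"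
      using slope_le_1[OF e1(1,2)] by metis
    define m where "m = 1 + nat R0 + nat \<lceil>18 * \<kappa> / \<eta>\<rceil>"
    have m: "1 \<le> m" "R0 \<le> int m" "18 * \<kappa> / \<eta> \<le> m" unfolding m_def by linarith+
    define \<zeta> where "\<zeta> = min (\<eta> / 36) (\<epsilon>1 / 2)"
    have \<zeta>: "0 < \<zeta>" "36 * \<zeta> \<le> \<eta>" "2 * \<zeta> \<le> \<epsilon>1" using \<eta> e1 by (auto simp: \<zeta>_def)
    \<comment> \<open>Deviations from affinity over the whole length must be small against a single
      window, so that slopes over single windows can be compared: the choice gives
      \<open>\<eta>' * L = \<zeta> * r / 3\<close>.\<close>
    define \<eta>' where "\<eta>' = \<zeta> / 3 / real (m + 2)"
    have \<eta>': "0 < \<eta>'" "3 * (\<eta>' * real (m + 2)) = \<zeta>"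
    proof -
      have "3 * (\<zeta> / 3 / k * k) = \<zeta>" if "0 < k" for k :: real using that by simp
      from this[of "real (m + 2)"] show "3 * (\<eta>' * real (m + 2)) = \<zeta>" unfolding \<eta>'_def by simp
      show "0 < \<eta>'" using \<zeta>(1) by (simp add: \<eta>'_def)
    qed
    define p0 where "p0 = min (\<delta> / 4) (g / (10 * \<kappa>\<^sup>2))"
    have k0: "0 < \<kappa>" "0 < \<kappa>\<^sup>2" using kappa_ge_1 by auto
    have p0: "0 < p0" "4 * p0 \<le> \<delta>" "2 * (p0 * \<kappa>\<^sup>2) \<le> g / 5"
    proof -
      show "0 < p0" "4 * p0 \<le> \<delta>" using \<delta> g k0 by (auto simp: p0_def)
      have "p0 * \<kappa>\<^sup>2 \<le> g / (10 * \<kappa>\<^sup>2) * \<kappa>\<^sup>2" using k0 by (intro mult_right_mono) (auto simp: p0_def)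
      then show "2 * (p0 * \<kappa>\<^sup>2) \<le> g / 5" using k0 by simp
    qed
    define A0 where "A0 = 2 * \<kappa>\<^sup>2 / p0"
    have A0: "0 < A0" using k0 p0 by (simp add: A0_def)
    define q where "q = min (p0 / 2) (g / (10 * A0))"
    have q: "0 < q" "q \<le> p0 / 2" "A0 * q \<le> g / 10"
    proof -
      show "0 < q" "q \<le> p0 / 2" using p0 A0 g by (auto simp: q_def)
      have "A0 * q \<le> A0 * (g / (10 * A0))" using A0 by (intro mult_left_mono) (auto simp: q_def)
      then show "A0 * q \<le> g / 10" using A0 by simp
    qed
    define \<epsilon>' where "\<epsilon>' = min (g / 10) (q * \<eta>'\<^sup>2 / 2)"
    have \<epsilon>': "0 < \<epsilon>'" "\<epsilon>' \<le> g / 10" "2 * \<epsilon>' / \<eta>'\<^sup>2 \<le> q"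
    proof -
      show "0 < \<epsilon>'" "\<epsilon>' \<le> g / 10" using g q \<eta>' by (auto simp: \<epsilon>'_def)
      have "\<epsilon>' \<le> q * \<eta>'\<^sup>2 / 2" by (simp add: \<epsilon>'_def)
      then show "2 * \<epsilon>' / \<eta>'\<^sup>2 \<le> q" using \<eta>' by (simp add: divide_le_eq)
    qed
    obtain c0 where c0: "c0 \<in> S" "c0 < e + \<epsilon>'"
      using cInf_lessD[OF Sne, of "e + \<epsilon>'"] \<epsilon>' by (auto simp: e_def)
    then obtain r where r: "1 \<le> r" "energy_le r c0" by (auto simp: S_def)
    have er: "energy_le r (e + \<epsilon>')"
      using r(2) c0(2) unfolding energy_le_def
      by (meson less_imp_le mult_right_mono order.trans zero_le_power2)
    \<comment> \<open>One window below the inner slab, \<open>m\<close> windows in it and one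
      above.\<close>
    define L where "L = int (m + 2) * r"
    have L: "1 \<le> L" "real_of_int L = real (m + 2) * real_of_int r"
      using mult_mono[of 1 "int (m + 2)" 1 r] r(1) by (auto simp: L_def)
    \<comment> \<open>No scale does better than the infimum, so some slab of length \<open>L\<close>
      has mean square slope above \<open>e - \<epsilon>'\<close>, while over its windows of length
      \<open>r\<close> the bound is \<open>e + \<epsilon>'\<close>.\<close>
    have "e - \<epsilon>' \<notin> S" using cInf_lower[OF _ bdd, of "e - \<epsilon>'"] \<epsilon>' by (auto simp: e_def)
    then have "\<not> energy_le L (e - \<epsilon>')" using L(1) by (auto simp: S_def)
    then obtain s a b where ab: "a \<in> extensional P" "b \<in> extensional N" and
      big: "(e - \<epsilon>') * (real_of_int L)\<^sup>2
        < avg (dn P s (s + L) a \<times> dn N (s + L) s b) (\<lambda>(x, y). (F (mk (s + L) a y) - F (mk s x b))\<^sup>2)"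
      unfolding energy_le_def by (auto simp: not_le)
    define t where "t = s + L"
    define h where "h j p = F (line s t (fst p) (snd p) (s + int j * r))" for j p
    let ?Q = "dn P s t a \<times> dn N t s b"
    have jr: "int j * r \<le> L" "0 \<le> int j * r" if "j \<le> m + 2" for j
      using that r(1) unfolding L_def by (auto intro: mult_right_mono)
    have ends: "h 0 p = F (mk s (fst p) b)" "h (m + 2) p = F (mk t a (snd p))" if "p \<in> ?Q" for p
      using that line_ends[of s t a b "fst p" "snd p"] ab L(1)
      by (auto simp: h_def t_def L_def)
    define Bad where "Bad p \<longleftrightarrow> (\<exists>j\<le>m+2. \<bar>h j p - h 0 p - real j / real (m + 2) * (h (m + 2) p - h 0 p)\<bar>
        \<ge> \<eta>' * (real (m + 2) * real_of_int r))" for p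
    define D where "D p = (h (m + 2) p - h 0 p) / L" for p
    have fQ: "freq ?Q Bad \<le> q"
    proof -
      have "freq ?Q Bad \<le> 2 * \<epsilon>' / \<eta>'\<^sup>2"
        unfolding Bad_def
      proof (rule near_affine[where e = e])
        have "avg ?Q (\<lambda>p. (h (m + 2) p - h 0 p)\<^sup>2)
          = avg ?Q (\<lambda>(x, y). (F (mk (s + L) a y) - F (mk s x b))\<^sup>2)"
          using ends by (intro avg_cong) (auto simp: t_def)
        then show "(e - \<epsilon>') * (real (m + 2) * real_of_int r)\<^sup>2 \<le> avg ?Q (\<lambda>p. (h (m + 2) p - h 0 p)\<^sup>2)"
          using big L(2) by (simp add: t_def)
        fix j assume j: "j < m + 2"
        have "avg ?Q (\<lambda>(x, y). (F (line s t x y (s + int j * r + r)) - F (line s t x y (s + int j * r)))\<^sup>2)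
            \<le> (e + \<epsilon>') * (real_of_int r)\<^sup>2"
          using jr[of j] jr[of "Suc j"] j r(1) ab
          by (intro energy_window[OF er]) (auto simp: t_def algebra_simps)
        then show "avg ?Q (\<lambda>p. (h (Suc j) p - h j p)\<^sup>2) \<le> (e + \<epsilon>') * (real_of_int r)\<^sup>2"
          by (simp add: h_def case_prod_unfold algebra_simps)
      qed (use r(1) \<eta>' in auto)
      then show ?thesis using \<epsilon>' by linarith
    qed
    \<comment> \<open>\<open>W\<close> trades bad lines against slope, so one averaging picks a
      class of lines that is good in both respects: the squared slope is at most
      \<open>\<kappa>^2\<close>, hence the weight \<open>A0\<close> forces few bad lines, and as the
      first term is nonnegative the mean square slope stays near \<open>e\<close>.\<close>
    define W where "W p = A0 * of_bool (Bad p) - (D p)\<^sup>2" for p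
    have "(e - \<epsilon>') * (real_of_int L)\<^sup>2 \<le> avg ?Q (\<lambda>p. (h (m + 2) p - h 0 p)\<^sup>2)"
    proof -
      have "avg ?Q (\<lambda>p. (h (m + 2) p - h 0 p)\<^sup>2)
          = avg ?Q (\<lambda>(x, y). (F (mk (s + L) a y) - F (mk s x b))\<^sup>2)"
        using ends by (intro avg_cong) (auto simp: t_def)
      then show ?thesis using big by (simp add: t_def)
    qed
    also have "\<dots> = (real_of_int L)\<^sup>2 * avg ?Q (\<lambda>p. (D p)\<^sup>2)"
      unfolding avg_cmult[symmetric] using L(1) by (intro avg_cong) (auto simp: D_def power_divide)
    finally have eD: "e - \<epsilon>' \<le> avg ?Q (\<lambda>p. (D p)\<^sup>2)" using L(1) by (simp add: mult.commute)
    have "avg ?Q W = A0 * freq ?Q Bad - avg ?Q (\<lambda>p. (D p)\<^sup>2)"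
      unfolding W_def avg_diff avg_cmult ..
    also have "A0 * freq ?Q Bad \<le> A0 * q" using fQ A0 by (intro mult_left_mono) auto
    finally have WQ: "avg ?Q W \<le> A0 * q - (e - \<epsilon>')" using eD by linarith
    define u v where "u = s + r" and "v = s + int (m + 1) * r"
    have tv: "t = v + r" by (simp add: t_def v_def L_def algebra_simps)
    have vR: "v = u + int m * r" by (simp add: u_def v_def algebra_simps)
    have mr: "int m * r \<ge> int m" using r(1) by (simp add: mult_le_cancel_left1)
    have suv: "s \<le> u" "u \<le> v" "v \<le> t" "s \<le> v" "u \<le> t" using r(1) mr tv vR by (auto simp: u_def)
    obtain a' b' where a'b': "a' \<in> dn P v t a" "b' \<in> dn N u s b" and
      Wle: "avg (dn P s v a' \<times> dn N t u b') W \<le> avg ?Q W"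
      using ex_le_avg[of "dn P v t a \<times> dn N u s b" "\<lambda>(a', b'). avg (dn P s v a' \<times> dn N t u b') W"]
      unfolding avg_sub[OF suv(4,3,1,5) ab, of W] by auto
    let ?X = "dn P s v a'" and ?Y = "dn N t u b'"
    have ex': "a' \<in> extensional P" "b' \<in> extensional N" using a'b' by (auto dest: dn_ext)
    define p where "p = freq (?X \<times> ?Y) Bad"
    have XY: "finite (?X \<times> ?Y)" "?X \<times> ?Y \<noteq> {}" by auto
    have avW: "A0 * p - avg (?X \<times> ?Y) (\<lambda>p. (D p)\<^sup>2) \<le> A0 * q - (e - \<epsilon>')"
      using Wle WQ unfolding W_def avg_diff avg_cmult p_def by linarith
    have inQ: "xy \<in> ?Q" if xyin: "xy \<in> ?X \<times> ?Y" for xy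
    proof -
      obtain x y where xy: "xy = (x, y)" "x \<in> ?X" "y \<in> ?Y" using xyin by auto
      have "up P s t x = a"
        using up_up[OF coarser_P coarser_P, of s v t x] suv up_dn[OF ex'(1) xy(2)] up_dn[OF ab(1) a'b'(1)] by simp
      moreover have "up N t s y = b"
        using up_up[OF coarser_N coarser_N, of u t s y] suv up_dn[OF ex'(2) xy(3)] up_dn[OF ab(2) a'b'(2)] by simp
      ultimately show ?thesis using xy ab by (auto simp: mem_dn_up dest: dn_ext)
    qed
    have D\<kappa>: "(D xy)\<^sup>2 \<le> \<kappa>\<^sup>2" if "xy \<in> ?X \<times> ?Y" for xy
    proof -
      have "\<bar>h (m + 2) xy - h 0 xy\<bar> \<le> \<kappa> * L"
        using F_line[of s "s + int (m + 2) * r" t "s + int 0 * r" "fst xy" "snd xy"] L(1) jr[of "m + 2"]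
        by (simp add: h_def t_def L_def)
      then have "\<bar>D xy\<bar> \<le> \<kappa>" using L(1) by (simp add: D_def divide_le_eq)
      then show ?thesis using power_mono[of "\<bar>D xy\<bar>" \<kappa> 2] by simp
    qed
    have avD: "avg (?X \<times> ?Y) (\<lambda>p. (D p)\<^sup>2) \<le> \<kappa>\<^sup>2" using D\<kappa> XY by (intro avg_le) auto
    have pp0: "p \<le> p0"
    proof -
      have "A0 * p \<le> A0 * q + \<kappa>\<^sup>2" using avW avD \<epsilon>' g by (simp add: g_def)
      also have "\<dots> \<le> A0 * (p0 / 2) + A0 * (p0 / 2)"
        using q A0 p0 by (intro add_mono mult_left_mono) (auto simp: A0_def)
      finally have "A0 * p \<le> A0 * p0" by simp
      then show ?thesis using A0 by simp
    qed
    have avD2: "e - g / 5 \<le> avg (?X \<times> ?Y) (\<lambda>p. (D p)\<^sup>2)"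
    proof -
      have "0 \<le> A0 * p" using A0 freq_nonneg[of "?X \<times> ?Y" Bad] by (simp add: p_def)
      then show ?thesis using avW q(3) \<epsilon>'(2) by linarith
    qed
    define U where "U x = (F (mk u (up P s u x) b') - F (mk s x b)) / r" for x
    define V where "V y = (F (mk t a y) - F (mk v a' (up N t v y))) / r" for y
    define f0 where "f0 x = F (mk u (up P s u x) b')" for x
    define f1 where "f1 y = F (mk v a' (up N t v y))" for y
    have h1: "h 1 (x, y) = f0 x" "h (m + 1) (x, y) = f1 y" "h 1 (x, y) - h 0 (x, y) = r * U x"
      "h (m + 2) (x, y) - h (m + 1) (x, y) = r * V y" if "x \<in> ?X" "y \<in> ?Y" for x y
    proof -
      have xy: "(x, y) \<in> ?Q" using inQ that by auto
      show 1: "h 1 (x, y) = f0 x"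
        using up_dn[OF ex'(2) that(2)] by (simp add: h_def f0_def line_def u_def)
      show 2: "h (m + 1) (x, y) = f1 y"
        using up_dn[OF ex'(1) that(1)] by (simp add: h_def f1_def line_def v_def)
      show "h 1 (x, y) - h 0 (x, y) = r * U x"
        using r(1) ends(1)[OF xy] by (simp only: 1 U_def f0_def fst_conv) simp
      show "h (m + 2) (x, y) - h (m + 1) (x, y) = r * V y"
        using r(1) ends(2)[OF xy] by (simp only: 2 V_def f1_def snd_conv) simp
    qed
    have dev: "\<bar>h j xy - h 0 xy - j * r * D xy\<bar> < \<eta>' * L" if "\<not> Bad xy" "j \<le> m + 2" for j xy
    proof -
      have "x * \<rho> * (X / (k * \<rho>)) = x / k * X" if "\<rho> \<noteq> 0" for x \<rho> X k :: real
        using that by simp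
      from this[of "real_of_int r" "real j" "h (m + 2) xy - h 0 xy" "real (m + 2)"]
      have eq: "j * r * D xy = real j / real (m + 2) * (h (m + 2) xy - h 0 xy)"
        using r(1) unfolding D_def L(2) by simp
      have "\<not> \<eta>' * (real (m + 2) * real_of_int r) \<le> \<bar>h j xy - h 0 xy - real j / real (m + 2) * (h (m + 2) xy - h 0 xy)\<bar>"
        using that unfolding Bad_def by blast
      then show ?thesis by (simp only: not_le L(2) eq)
    qed
    have \<eta>L: "\<eta>' * L = \<zeta> * r / 3"
    proof -
      have "\<eta>' * (k * \<rho>) = (3 * (\<eta>' * k)) * \<rho> / 3" for k \<rho> :: real by simp
      from this[of "real (m + 2)" "real_of_int r"] show ?thesis by (simp only: L(2) \<eta>'(2))
    qed
    \<comment> \<open>On a good line the slopes over the lowest and the highest window both agree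
      with the slope of the whole line; one depends on \<open>x\<close>, the other on
      \<open>y\<close>.\<close>
    have "\<exists>c. freq ?X (\<lambda>x. \<bar>U x - c\<bar> > \<zeta>) \<le> p"
    proof (rule most_pairs_const)
      show "freq (?X \<times> ?Y) (\<lambda>(x, y). \<zeta> < \<bar>U x - V y\<bar>) \<le> p"
        unfolding p_def
      proof (rule freq_mono)
        fix xy assume xy: "xy \<in> ?X \<times> ?Y" and "case xy of (x, y) \<Rightarrow> \<zeta> < \<bar>U x - V y\<bar>"
        then obtain x y where xy': "xy = (x, y)" "x \<in> ?X" "y \<in> ?Y" "\<zeta> < \<bar>U x - V y\<bar>" by auto
        show "Bad xy"
        proof (rule ccontr)
          assume nb: "\<not> Bad xy"
          have "\<bar>r * U x - r * D xy\<bar> < \<eta>' * L"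
            using dev[OF nb, of 1] h1(3)[OF xy'(2,3)] xy'(1) by simp
          moreover have "\<bar>r * V y - r * D xy\<bar> < \<eta>' * L + \<eta>' * L"
            using dev[OF nb, of "m + 1"] dev[OF nb, of "m + 2"] h1(4)[OF xy'(2,3)] xy'(1)
            by (simp add: algebra_simps abs_less_iff)
          ultimately have "\<bar>r * U x - r * V y\<bar> < \<zeta> * r" using \<eta>L by linarith
          then have "r * \<bar>U x - V y\<bar> < r * \<zeta>"
            using r(1) by (simp add: right_diff_distrib[symmetric] abs_mult mult.commute)
          then show False using xy'(4) r(1) by simp
        qed
      qed
    qed auto
    then obtain c where c: "freq ?X (\<lambda>x. \<bar>U x - c\<bar> > \<zeta>) \<le> p" by blast
    define B1 where "B1 xy \<longleftrightarrow> Bad xy \<or> \<bar>U (fst xy) - c\<bar> > \<zeta>" for xy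
    have B1: "freq (?X \<times> ?Y) B1 \<le> 2 * p"
    proof -
      have "freq (?X \<times> ?Y) (\<lambda>xy. \<bar>U (fst xy) - c\<bar> > \<zeta>) \<le> p"
        using c by (simp add: avg_Times avg_const)
      then show ?thesis unfolding B1_def by (rule freq_disj_le[OF order.refl]) (simp add: p_def)
    qed
    have Dc: "\<bar>D xy - c\<bar> \<le> 2 * \<zeta>" if xyin: "xy \<in> ?X \<times> ?Y" "\<not> B1 xy" for xy
    proof -
      obtain x y where xy: "xy = (x, y)" "x \<in> ?X" "y \<in> ?Y" using xyin by auto
      have nb: "\<not> Bad xy" "\<bar>U x - c\<bar> \<le> \<zeta>" using xyin xy by (auto simp: B1_def)
      have "\<bar>r * U x - r * D xy\<bar> < \<eta>' * L"
        using dev[OF nb(1), of 1] h1(3)[OF xy(2,3)] xy(1) by simp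
      then have "r * \<bar>U x - D xy\<bar> < r * (\<zeta> / 3)"
        using abs_scale[of "real_of_int r" "U x" "D xy"] r(1) \<eta>L by (simp only: mult.commute) simp
      then have "\<bar>U x - D xy\<bar> < \<zeta> / 3" using r(1) by (simp only: mult_less_cancel_left_pos of_int_0_less_iff)
      then show ?thesis using nb(2) \<zeta>(1) by linarith
    qed
    have rL: "\<zeta> * r \<le> \<zeta> * L" using \<zeta>(1) L(2) r(1) by (intro mult_left_mono) (auto simp: mult_le_cancel_right1)
    have EL: "\<eta>' * L + \<eta>' * L \<le> \<zeta> * L" using rL \<eta>L \<zeta>(1) L(1) r(1) mult_pos_pos[of \<zeta> r] by linarith
    have jD: "\<bar>j * r * D xy - j * r * c\<bar> \<le> 2 * (\<zeta> * L)" if "xy \<in> ?X \<times> ?Y" "\<not> B1 xy" "j \<le> m + 2" for xy j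
    proof -
      have "\<bar>j * r * D xy - j * r * c\<bar> = (j * r) * \<bar>D xy - c\<bar>"
        using r(1) by (simp add: right_diff_distrib[symmetric] abs_mult)
      also have "\<dots> \<le> L * (2 * \<zeta>)"
        using Dc[OF that(1,2)] L r(1) that(3) by (intro mult_mono) auto
      finally show ?thesis by (simp add: mult_ac)
    qed
    \<comment> \<open>With the slope known, the value at the bottom of the inner slab, which depends
      on \<open>x\<close>, predicts the value at its top, which depends on \<open>y\<close>. So both
      are almost constant.\<close>
    have "\<exists>d. freq ?X (\<lambda>x. \<bar>(f0 x + m * r * c) - d\<bar> > 3 * (\<zeta> * L)) \<le> 2 * p"
    proof (rule most_pairs_const)
      show "freq (?X \<times> ?Y) (\<lambda>(x, y). 3 * (\<zeta> * L) < \<bar>f0 x + m * r * c - f1 y\<bar>) \<le> 2 * p"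
      proof (rule order.trans[OF freq_mono B1])
        fix xy assume xy: "xy \<in> ?X \<times> ?Y" and "case xy of (x, y) \<Rightarrow> 3 * (\<zeta> * L) < \<bar>f0 x + m * r * c - f1 y\<bar>"
        then obtain x y where xy': "xy = (x, y)" "x \<in> ?X" "y \<in> ?Y" "3 * (\<zeta> * L) < \<bar>f0 x + m * r * c - f1 y\<bar>"
          by auto
        show "B1 xy"
        proof (rule ccontr)
          assume nb: "\<not> B1 xy"
          then have nB: "\<not> Bad xy" by (simp add: B1_def)
          have "\<bar>f0 x - h 0 xy - 1 * r * D xy\<bar> < \<eta>' * L" "\<bar>f1 y - h 0 xy - (m + 1) * r * D xy\<bar> < \<eta>' * L"
            using dev[OF nB, of 1] dev[OF nB, of "m + 1"] h1(1,2)[OF xy'(2,3)] xy'(1) by simp_all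
          then have "\<bar>f1 y - f0 x - m * r * D xy\<bar> < \<eta>' * L + \<eta>' * L"
            by (simp add: algebra_simps abs_less_iff)
          moreover have "\<bar>m * r * D xy - m * r * c\<bar> \<le> 2 * (\<zeta> * L)" using jD[OF xy nb, of m] by simp
          ultimately have "\<bar>f0 x + m * r * c - f1 y\<bar> < \<eta>' * L + \<eta>' * L + 2 * (\<zeta> * L)" by linarith
          then show False using xy'(4) EL by linarith
        qed
      qed
    qed auto
    then obtain d where d: "freq ?X (\<lambda>x. \<bar>(f0 x + m * r * c) - d\<bar> > 3 * (\<zeta> * L)) \<le> 2 * p" by blast
    define B2 where "B2 xy \<longleftrightarrow> B1 xy \<or> \<bar>(f0 (fst xy) + m * r * c) - d\<bar> > 3 * (\<zeta> * L)" for xy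
    have B2: "freq (?X \<times> ?Y) B2 \<le> 4 * p"
    proof -
      have "freq (?X \<times> ?Y) (\<lambda>xy. \<bar>(f0 (fst xy) + m * r * c) - d\<bar> > 3 * (\<zeta> * L)) \<le> 2 * p"
        using d by (simp add: avg_Times avg_const)
      then show ?thesis unfolding B2_def by (rule freq_disj_le[OF B1]) simp
    qed
    define R where "R = int m * r"
    have R: "R0 \<le> R" using mr m(2) by (simp add: R_def)
    have vR': "v = u + R" by (simp add: vR R_def)
    have RL: "real_of_int L \<le> 3 * real_of_int R"
    proof -
      have "real (m + 2) * r \<le> 3 * real m * r" using m(1) r(1) by (intro mult_right_mono) auto
      then show ?thesis by (simp add: L(2) R_def)
    qed
    have "\<bar>c\<bar> \<le> 1 + \<epsilon>1"
    proof (rule slope[OF R, of u a' b' "d - m * r * c" c])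
      fix w assume "w \<in> {u..u + R}"
      then have w: "u \<le> w" "w \<le> v" by (auto simp: vR R_def)
      have "freq (dn P w v a' \<times> dn N w u b') (\<lambda>(x, y). \<eta> * R < \<bar>F (mk w x y) - (d - m * r * c) - c * real_of_int (w - u)\<bar>)
         = freq (?X \<times> ?Y) (\<lambda>(x, y). \<eta> * R < \<bar>F (mk w (up P s w x) (up N t w y)) - (d - m * r * c) - c * real_of_int (w - u)\<bar>)"
        using w suv ex' avg_push[of s w v u w t a' b' "\<lambda>x y. of_bool (\<eta> * R < \<bar>F (mk w x y) - (d - m * r * c) - c * real_of_int (w - u)\<bar>)"]
        by (simp add: case_prod_unfold)
      also have "\<dots> \<le> freq (?X \<times> ?Y) B2"
      proof (rule freq_mono)
        fix xy assume xy: "xy \<in> ?X \<times> ?Y"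
          and "case xy of (x, y) \<Rightarrow> \<eta> * R < \<bar>F (mk w (up P s w x) (up N t w y)) - (d - m * r * c) - c * real_of_int (w - u)\<bar>"
        then obtain x y where xy': "xy = (x, y)" "x \<in> ?X" "y \<in> ?Y"
          and far: "\<eta> * R < \<bar>F (line s t x y w) - (d - m * r * c) - c * real_of_int (w - u)\<bar>" by (auto simp: line_def)
        show "B2 xy"
        proof (rule ccontr)
          assume nb: "\<not> B2 xy"
          then have nb1: "\<not> B1 xy" "\<not> Bad xy" and f0: "\<bar>f0 x + m * r * c - d\<bar> \<le> 3 * (\<zeta> * L)"
            using xy'(1) by (auto simp: B2_def B1_def)
          define j where "j = nat ((w - s) div r)"
          have j0: "0 \<le> (w - s) div r" using w suv r(1) by (simp add: pos_imp_zdiv_nonneg_iff)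
          then have jj: "int j * r = (w - s) - (w - s) mod r" by (simp add: j_def minus_mod_eq_div_mult)
          have md: "0 \<le> (w - s) mod r" "(w - s) mod r < r" using r(1) by auto
          have "int j * r \<le> int (m + 1) * r" using jj md w(2) by (simp add: v_def)
          then have jm: "j \<le> m + 1" using r(1) by (simp add: mult_le_cancel_right)
          have ws: "\<bar>real_of_int w - real_of_int (s + int j * r)\<bar> \<le> r" using jj md by simp
          have "\<bar>F (line s t x y w) - h j xy\<bar> \<le> \<kappa> * \<bar>real_of_int w - real_of_int (s + int j * r)\<bar>"
            unfolding h_def xy'(1) fst_conv snd_conv using w suv jr[of j] jm
            by (intro order.trans[OF F_line]) (auto simp: t_def)
          also have "\<dots> \<le> \<kappa> * r" using ws k0 by (intro mult_left_mono) auto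
          finally have 1: "\<bar>F (line s t x y w) - h j xy\<bar> \<le> \<kappa> * r" .
          have 2: "\<bar>h j xy - h 0 xy - j * r * D xy\<bar> < \<eta>' * L" using dev[OF nb1(2)] jm by simp
          have 3: "\<bar>f0 x - h 0 xy - 1 * r * D xy\<bar> < \<eta>' * L"
            using dev[OF nb1(2), of 1] h1(1)[OF xy'(2,3)] xy'(1) by simp
          have 4: "\<bar>j * r * D xy - j * r * c\<bar> \<le> 2 * (\<zeta> * L)" using jD[OF xy nb1(1)] jm by simp
          have 5: "\<bar>1 * r * D xy - 1 * r * c\<bar> \<le> 2 * (\<zeta> * L)" using jD[OF xy nb1(1), of 1] by simp
          have c\<kappa>: "\<bar>c\<bar> \<le> 2 * \<kappa>"
          proof -
            have "\<bar>D xy\<bar> \<le> \<kappa>" using D\<kappa>[OF xy] k0(1) abs_le_square_iff[of "D xy" \<kappa>] by simp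
            then show ?thesis using Dc[OF xy nb1(1)] \<zeta>(3) e1(2) kappa_ge_1 by linarith
          qed
          have 6: "\<bar>c * real_of_int (w - u) - (j * r * c - 1 * r * c)\<bar> \<le> 2 * \<kappa> * r"
          proof -
            have "real_of_int (w - u) - (real j * r - r) = real_of_int w - real_of_int (s + int j * r)"
              by (simp add: u_def)
            moreover have "c * real_of_int (w - u) - (j * r * c - 1 * r * c) = c * (real_of_int (w - u) - (real j * r - r))"
              by (simp add: right_diff_distrib mult_ac)
            ultimately have "c * real_of_int (w - u) - (j * r * c - 1 * r * c) = c * (real_of_int w - real_of_int (s + int j * r))"
              by (simp only:)
            also have "\<bar>\<dots>\<bar> \<le> 2 * \<kappa> * r"
              unfolding abs_mult using c\<kappa> ws k0 by (intro mult_mono) auto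
            finally show ?thesis .
          qed
          have "\<bar>F (line s t x y w) - (d - m * r * c) - c * real_of_int (w - u)\<bar>
              < \<kappa> * r + (\<eta>' * L + \<eta>' * L) + 4 * (\<zeta> * L) + 2 * \<kappa> * r + 3 * (\<zeta> * L)"
            using 1 2 3 4 5 6 f0 by linarith
          also have "\<dots> \<le> 3 * (\<kappa> * r) + 8 * (\<zeta> * L)"
            using EL by linarith
          also have "\<dots> \<le> \<eta> * R"
          proof -
            have "8 * (\<zeta> * L) \<le> 8 * (\<zeta> * (3 * R))" using RL \<zeta>(1) by (intro mult_left_mono) auto
            also have "\<dots> = 24 * \<zeta> * R" by simp
            finally have A: "8 * (\<zeta> * L) \<le> 24 * \<zeta> * R" .
            have R0: "0 \<le> real_of_int R" using r(1) by (simp add: R_def)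
            have B: "36 * \<zeta> * R \<le> \<eta> * R" using \<zeta>(2) R0 by (intro mult_right_mono) auto
            have "18 * \<kappa> \<le> \<eta> * m" using m(3) \<eta> by (simp add: divide_le_eq mult.commute)
            then have "18 * \<kappa> * r \<le> \<eta> * m * r" using r(1) by (intro mult_right_mono) auto
            then have C: "18 * (\<kappa> * r) \<le> \<eta> * R" by (simp add: R_def mult_ac)
            define x y z w where "x = \<zeta> * L" and "y = \<kappa> * r" and "z = \<eta> * R" and "w = \<zeta> * R"
            have "8 * x \<le> 24 * w" "36 * w \<le> z" "18 * y \<le> z" "0 \<le> z"
              using A B C \<eta> R0 by (simp_all add: x_def y_def z_def w_def)
            then show ?thesis unfolding x_def[symmetric] y_def[symmetric] z_def[symmetric] by linarith
          qed
          finally show False using far by linarith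
        qed
      qed
      also have "\<dots> \<le> \<delta>" using B2 pp0 p0(2) by linarith
      finally show "freq (dn P w (u + R) a' \<times> dn N w u b')
          (\<lambda>(x, y). \<eta> * R < \<bar>F (mk w x y) - (d - m * r * c) - c * real_of_int (w - u)\<bar>) \<le> \<delta>"
        unfolding vR'[symmetric] .
    qed
    have "avg (?X \<times> ?Y) (\<lambda>p. (D p)\<^sup>2) \<le> avg (?X \<times> ?Y) (\<lambda>xy. (1 + 2 * \<epsilon>1)\<^sup>2 + \<kappa>\<^sup>2 * of_bool (B1 xy))"
    proof (rule avg_mono)
      fix xy assume xy: "xy \<in> ?X \<times> ?Y"
      show "(D xy)\<^sup>2 \<le> (1 + 2 * \<epsilon>1)\<^sup>2 + \<kappa>\<^sup>2 * of_bool (B1 xy)"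
      proof (cases "B1 xy")
        case True
        then show ?thesis using D\<kappa>[OF xy] by (simp add: add_increasing)
      next
        case False
        then have "\<bar>D xy\<bar> \<le> 1 + 2 * \<epsilon>1" using Dc[OF xy] \<open>\<bar>c\<bar> \<le> 1 + \<epsilon>1\<close> \<zeta>(3) by linarith
        then show ?thesis using power_mono[of "\<bar>D xy\<bar>" "1 + 2 * \<epsilon>1" 2] False by simp
      qed
    qed
    also have "\<dots> = (1 + 2 * \<epsilon>1)\<^sup>2 + \<kappa>\<^sup>2 * freq (?X \<times> ?Y) B1"
      using XY by (simp add: avg_add avg_cmult avg_const)
    also have "\<dots> \<le> 1 + g / 5 + \<kappa>\<^sup>2 * (2 * p0)"
    proof -
      have "\<epsilon>1\<^sup>2 \<le> \<epsilon>1" using e1 by (simp add: power2_eq_square mult_left_le_one_le)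
      then have "(1 + 2 * \<epsilon>1)\<^sup>2 \<le> 1 + 8 * \<epsilon>1" by (simp add: power2_eq_square algebra_simps)
      then show ?thesis using e1(3) B1 pp0 k0 by (intro add_mono mult_left_mono) auto
    qed
    also have "\<dots> \<le> 1 + 2 * g / 5" using p0(3) by (simp add: mult_ac)
    finally show False using avD2 g g_def by linarith
  qed
  then have "Inf S < 1 + \<epsilon>" using assms by (simp add: e_def)
  from cInf_lessD[OF Sne this] obtain c where c: "c \<in> S" "c < 1 + \<epsilon>" by blast
  then obtain r where r: "1 \<le> r" "energy_le r c" by (auto simp: S_def)
  have "energy_le r (1 + \<epsilon>)"
    unfolding energy_le_def
  proof (intro allI ballI)
    fix s :: int and a b :: "'n \<Rightarrow> int" assume ab: "a \<in> extensional P" "b \<in> extensional N"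
    have "avg (dn P s (s + r) a \<times> dn N (s + r) s b) (\<lambda>(x, y). (F (mk (s + r) a y) - F (mk s x b))\<^sup>2) \<le> c * (real_of_int r)\<^sup>2"
      using r(2) ab by (simp add: energy_le_def)
    also have "\<dots> \<le> (1 + \<epsilon>) * (real_of_int r)\<^sup>2" using c(2) by (intro mult_right_mono) auto
    finally show "avg (dn P s (s + r) a \<times> dn N (s + r) s b) (\<lambda>(x, y). (F (mk (s + r) a y) - F (mk s x b))\<^sup>2)
      \<le> (1 + \<epsilon>) * (real_of_int r)\<^sup>2" .
  qed
  then show ?thesis using r(1) by blast
qed

end

section \<open>Almost monotone lines\<close>

context embedding begin

definition mono_path :: "real \<Rightarrow> real \<Rightarrow> int \<Rightarrow> int \<Rightarrow> ('n \<Rightarrow> int) \<Rightarrow> ('n \<Rightarrow> int) \<Rightarrow> bool" where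
  "mono_path \<sigma> e s t x y \<longleftrightarrow> \<bar>\<sigma>\<bar> = 1 \<and>
     (\<forall>u v. s \<le> u \<longrightarrow> u \<le> v \<longrightarrow> v \<le> t \<longrightarrow> - e \<le> \<sigma> * (F (line s t x y v) - F (line s t x y u)))"

definition steep :: "real \<Rightarrow> int \<Rightarrow> int \<Rightarrow> ('n \<Rightarrow> int) \<Rightarrow> ('n \<Rightarrow> int) \<Rightarrow> real \<Rightarrow> bool" where
  "steep e s t x y \<sigma> \<longleftrightarrow> mono_path \<sigma> (e * real_of_int (t - s)) s t x y \<and>
     \<bar>\<sigma> * (F (line s t x y t) - F (line s t x y s)) - real_of_int (t - s)\<bar> \<le> e * real_of_int (t - s)"

definition tv :: "int \<Rightarrow> nat \<Rightarrow> int \<Rightarrow> int \<Rightarrow> ('n \<Rightarrow> int) \<Rightarrow> ('n \<Rightarrow> int) \<Rightarrow> real" where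
  "tv r m s t x y = (\<Sum>j<m. \<bar>F (line s t x y (s + int (Suc j) * r)) - F (line s t x y (s + int j * r))\<bar>)"

lemma grid:
  assumes r: "1 \<le> r" and u: "s \<le> u" "u \<le> s + L" and m: "m = nat (L div r)"
  defines "j \<equiv> nat ((u - s) div r)"
  shows "j \<le> m" "s + int j * r \<le> u" "u < s + int j * r + r" "s + int j * r \<le> s + L"
    "\<bar>F (line s (s + L) x y u) - F (line s (s + L) x y (s + int j * r))\<bar> \<le> \<kappa> * r"
proof -
  have j0: "0 \<le> (u - s) div r" using u r by (simp add: pos_imp_zdiv_nonneg_iff)
  have "(u - s) div r \<le> L div r" using u r by (intro zdiv_mono1) auto
  then show "j \<le> m" by (simp add: j_def m nat_mono)
  have jj: "int j * r = (u - s) - (u - s) mod r"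
    using j0 by (simp add: j_def minus_mod_eq_div_mult)
  have md: "0 \<le> (u - s) mod r" "(u - s) mod r < r" using r by auto
  show 1: "s + int j * r \<le> u" "u < s + int j * r + r" "s + int j * r \<le> s + L" using jj md u by auto
  have 2: "s \<le> s + int j * r" using r by auto
  have "\<bar>F (line s (s + L) x y u) - F (line s (s + L) x y (s + int j * r))\<bar>
      \<le> \<kappa> * \<bar>real_of_int u - real_of_int (s + int j * r)\<bar>"
    using F_line[OF u 2 1(3), of x y] by simp
  also have "\<dots> \<le> \<kappa> * r"
    using 1 kappa_ge_1 by (intro mult_left_mono) linarith+
  finally show "\<bar>F (line s (s + L) x y u) - F (line s (s + L) x y (s + int j * r))\<bar> \<le> \<kappa> * r" .
qed

lemma range_grid:
  assumes r: "1 \<le> r" and m: "m = nat (L div r)" and uv: "u \<in> {s..s+L}" "v \<in> {s..s+L}"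
    and R: "R \<le> F (line s (s + L) x y u) - F (line s (s + L) x y v)"
  shows "\<exists>i\<le>m. \<exists>k\<le>m. R - 2 * (\<kappa> * r) \<le> F (line s (s + L) x y (s + int i * r)) - F (line s (s + L) x y (s + int k * r))"
proof -
  have u: "s \<le> u" "u \<le> s + L" and v: "s \<le> v" "v \<le> s + L" using uv by auto
  note gu = grid(1,5)[OF r u m] and gv = grid(1,5)[OF r v m]
  show ?thesis
    using gu gv gu(2)[of x y] gv(2)[of x y] R
    by (intro exI[of _ "nat ((u - s) div r)"] exI[of _ "nat ((v - s) div r)"] conjI) linarith+
qed

text \<open>Sampling lowers the guaranteed range to \<open>(1 - 3 * e) * L\<close>. By
  \<open>tv_mono\<close> the sampled path then has net displacement at least
  \<open>(1 - 7 * e) * L\<close> and backtracks by at most \<open>4 * e * L\<close>; adding the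
  sampling error again leads to \<open>8 * e\<close>.\<close>

lemma steepI:
  assumes r: "1 \<le> r" and L: "0 < L" "\<kappa> * r \<le> e * L" and e: "0 \<le> e" "7 * e < 1" and m: "m = nat (L div r)"
    and T: "tv r m s (s + L) x y \<le> (1 + e) * L"
    and uv: "u \<in> {s..s+L}" "v \<in> {s..s+L}" "(1 - e) * L \<le> F (line s (s + L) x y u) - F (line s (s + L) x y v)"
  shows "\<exists>\<sigma>. steep (8 * e) s (s + L) x y \<sigma>"
proof -
  let ?F = "\<lambda>w. F (line s (s + L) x y w)"
  define g where "g j = ?F (s + int j * r)" for j :: nat
  define l where "l = real_of_int L"
  define k where "k = \<kappa> * r"
  define el where "el = e * l"
  have l: "0 < l" "k \<le> el" "0 \<le> el" "7 * el < l" "0 \<le> k"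
    using L e r kappa_ge_1 by (simp_all add: l_def k_def el_def)
  obtain i j where ij: "i \<le> m" "j \<le> m" "l - 3 * el \<le> g i - g j"
  proof -
    have "l - el - 2 * k \<le> g i - g j \<Longrightarrow> l - 3 * el \<le> g i - g j" for i j using l by linarith
    moreover have "(1 - e) * L = l - el" by (simp add: l_def el_def algebra_simps)
    ultimately show ?thesis
      using range_grid[OF r m uv] that unfolding g_def k_def by metis
  qed
  have tv: "(\<Sum>j<m. \<bar>g (Suc j) - g j\<bar>) \<le> l + el"
    using T by (simp add: tv_def g_def l_def el_def algebra_simps)
  have big: "l - 7 * el \<le> \<bar>g m - g 0\<bar>" 
  proof -
    have "2 * (l - 3 * el) - (l + el) = l - 7 * el" by simp
    then show ?thesis using tv_mono(1)[OF tv ij] by (simp only:)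
  qed
  define \<sigma> where "\<sigma> = sgn (g m - g 0)"
  have "g m - g 0 \<noteq> 0" using big l by auto
  then have \<sigma>: "\<bar>\<sigma>\<bar> = 1" "\<sigma> * (g m - g 0) = \<bar>g m - g 0\<bar>"
    by (simp_all add: \<sigma>_def abs_sgn mult.commute)
  have \<sigma>le: "- \<bar>z\<bar> \<le> \<sigma> * z" "\<sigma> * z \<le> \<bar>z\<bar>" "\<bar>\<sigma> * z\<bar> = \<bar>z\<bar>" for z
    using abs_ge_self[of "\<sigma> * z"] abs_ge_minus_self[of "\<sigma> * z"] \<sigma>(1) by (simp_all add: abs_mult)
  have up: "\<bar>g m - g 0\<bar> \<le> l + el"
  proof -
    have "g m - g 0 = (\<Sum>j<m. g (Suc j) - g j)" by (rule sum_lessThan_telescope[symmetric])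
    then have "\<bar>g m - g 0\<bar> \<le> (\<Sum>j<m. \<bar>g (Suc j) - g j\<bar>)" by (simp only: sum_abs)
    then show ?thesis using tv by linarith
  qed
  have s: "s \<le> s + L" using L by simp
  have "nat ((s + L - s) div r) = m" by (simp add: m)
  then have gm: "\<bar>?F (s + L) - g m\<bar> \<le> k"
    using grid(5)[OF r s order.refl m, of x y] unfolding g_def k_def by simp
  have g0: "g 0 = ?F s" by (simp add: g_def)
  have "mono_path \<sigma> (8 * el) s (s + L) x y"
    unfolding mono_path_def
  proof (intro conjI allI impI)
    fix p q assume pq: "s \<le> p" "p \<le> q" "q \<le> s + L"
    let ?i = "nat ((p - s) div r)" and ?j = "nat ((q - s) div r)"
    have ij': "?i \<le> ?j" using pq r by (intro nat_mono zdiv_mono1) auto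
    have jm: "?j \<le> m" using grid(1)[OF r _ pq(3) m] pq by simp
    have "- (4 * el) \<le> \<sigma> * (g ?j - g ?i)"
      using tv_mono(2)[OF tv ij ij' jm \<sigma>] by linarith
    moreover have "\<bar>?F p - g ?i\<bar> \<le> k" "\<bar>?F q - g ?j\<bar> \<le> k"
      using grid(5)[OF r _ _ m, of s p x y] grid(5)[OF r _ _ m, of s q x y] pq unfolding g_def k_def by auto
    moreover have "\<sigma> * (?F q - ?F p) = \<sigma> * (g ?j - g ?i) + \<sigma> * (?F q - g ?j) - \<sigma> * (?F p - g ?i)"
      by (simp add: algebra_simps)
    ultimately show "- (8 * el) \<le> \<sigma> * (?F q - ?F p)"
      using \<sigma>le(1)[of "?F q - g ?j"] \<sigma>le(2)[of "?F p - g ?i"] l by linarith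
  qed (use \<sigma> in auto)
  moreover have "\<bar>\<sigma> * (?F (s + L) - ?F s) - l\<bar> \<le> 8 * el"
  proof -
    have "\<sigma> * (?F (s + L) - ?F s) = \<sigma> * (g m - g 0) + \<sigma> * (?F (s + L) - g m)"
      unfolding g0 by (simp add: algebra_simps)
    then show ?thesis using big up gm \<sigma>(2) \<sigma>le(1,2)[of "?F (s + L) - g m"] l by linarith
  qed
  ultimately show ?thesis
    unfolding steep_def by (intro exI[of _ \<sigma>]) (simp add: l_def el_def mult.assoc)
qed

text \<open>Lines whose range is almost \<open>L\<close> while their variation is, on average, at most about \<open>L\<close>
  have to be almost monotone.\<close>

lemma mostly_steep:
  fixes \<epsilon> :: real
  assumes \<epsilon>: "0 < \<epsilon>" "\<epsilon> \<le> 1"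
  shows "\<exists>a>0. a < 1 \<and> (\<forall>r\<ge>1. \<exists>L0. \<forall>L\<ge>L0. \<forall>s \<Omega>. finite \<Omega> \<longrightarrow> \<Omega> \<noteq> {} \<longrightarrow>
    (\<forall>u. s \<le> u \<longrightarrow> u + r \<le> s + L \<longrightarrow>
      avg \<Omega> (\<lambda>(x, y). (F (line s (s + L) x y (u + r)) - F (line s (s + L) x y u))\<^sup>2) \<le> (1 + a) * (real_of_int r)\<^sup>2) \<longrightarrow>
    freq \<Omega> (\<lambda>(x, y). \<forall>u\<in>{s..s+L}. \<forall>v\<in>{s..s+L}.
      F (line s (s + L) x y u) - F (line s (s + L) x y v) < (1 - a) * real_of_int L) \<le> a \<longrightarrow>
    freq \<Omega> (\<lambda>(x, y). \<not> (\<exists>\<sigma>. steep \<epsilon> s (s + L) x y \<sigma>)) \<le> \<epsilon>)"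
proof -
  define e where "e = \<epsilon> / 8"
  define a where "a = e\<^sup>2 / 5"
  have e: "0 < e" "7 * e < 1" "e \<le> 1 / 8" using \<epsilon> by (simp_all add: e_def)
  have "e\<^sup>2 \<le> e" using e by (simp add: power2_eq_square mult_left_le_one_le)
  then have a: "0 < a" "a \<le> e / 5" "5 * a = e\<^sup>2" using e by (simp_all add: a_def)
  show ?thesis
  proof (intro exI[of _ a] conjI allI impI)
    show "0 < a" "a < 1" using a e by linarith+
    fix r :: int assume r: "1 \<le> r"
    show "\<exists>L0. \<forall>L\<ge>L0. \<forall>s \<Omega>. finite \<Omega> \<longrightarrow> \<Omega> \<noteq> {} \<longrightarrow>
      (\<forall>u. s \<le> u \<longrightarrow> u + r \<le> s + L \<longrightarrow>
        avg \<Omega> (\<lambda>(x, y). (F (line s (s + L) x y (u + r)) - F (line s (s + L) x y u))\<^sup>2) \<le> (1 + a) * (real_of_int r)\<^sup>2) \<longrightarrow>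
      freq \<Omega> (\<lambda>(x, y). \<forall>u\<in>{s..s+L}. \<forall>v\<in>{s..s+L}.
        F (line s (s + L) x y u) - F (line s (s + L) x y v) < (1 - a) * real_of_int L) \<le> a \<longrightarrow>
      freq \<Omega> (\<lambda>(x, y). \<not> (\<exists>\<sigma>. steep \<epsilon> s (s + L) x y \<sigma>)) \<le> \<epsilon>"
    proof (intro exI[of _ "1 + \<lceil>\<kappa> * r / a\<rceil>"] allI impI)
      fix L s :: int and \<Omega> :: "(('n \<Rightarrow> int) \<times> ('n \<Rightarrow> int)) set"
      assume L: "1 + \<lceil>\<kappa> * r / a\<rceil> \<le> L" and \<Omega>: "finite \<Omega>" "\<Omega> \<noteq> {}"
        and en: "\<forall>u. s \<le> u \<longrightarrow> u + r \<le> s + L \<longrightarrow>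
          avg \<Omega> (\<lambda>(x, y). (F (line s (s + L) x y (u + r)) - F (line s (s + L) x y u))\<^sup>2) \<le> (1 + a) * (real_of_int r)\<^sup>2"
        and rg: "freq \<Omega> (\<lambda>(x, y). \<forall>u\<in>{s..s+L}. \<forall>v\<in>{s..s+L}.
          F (line s (s + L) x y u) - F (line s (s + L) x y v) < (1 - a) * real_of_int L) \<le> a"
      define B where "B xy \<longleftrightarrow> (\<forall>u\<in>{s..s+L}. \<forall>v\<in>{s..s+L}.
          F (line s (s + L) (fst xy) (snd xy) u) - F (line s (s + L) (fst xy) (snd xy) v) < (1 - a) * real_of_int L)" for xy
      have fB: "freq \<Omega> B \<le> a" using rg by (simp add: B_def case_prod_unfold)
      define m where "m = nat (L div r)"
      define l where "l = real_of_int L"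
      have "0 < \<kappa> * r / a" using kappa_ge_1 r a by simp
      then have l: "0 < l" "0 < L" "\<kappa> * r / a \<le> l" using L unfolding l_def by linarith+
      then have \<kappa>r: "\<kappa> * r \<le> a * l" using a by (simp add: divide_le_eq mult.commute)
      have mL: "int m * r \<le> L"
      proof -
        have "L div r * r \<le> L" using r by (simp add: minus_mod_eq_div_mult[symmetric])
        then show ?thesis using r l by (simp add: m_def pos_imp_zdiv_nonneg_iff)
      qed
      define V where "V xy = tv r m s (s + L) (fst xy) (snd xy)" for xy
      have Vn: "0 \<le> V xy" for xy by (simp add: V_def tv_def sum_nonneg)
      have aV: "avg \<Omega> V \<le> (1 + a) * l"
      proof -
        have "avg \<Omega> V = (\<Sum>j<m. avg \<Omega> (\<lambda>xy. \<bar>F (line s (s + L) (fst xy) (snd xy) (s + int (Suc j) * r))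
            - F (line s (s + L) (fst xy) (snd xy) (s + int j * r))\<bar>))"
          unfolding V_def tv_def by (rule avg_sum)
        also have "\<dots> \<le> (\<Sum>j<m. (1 + a) * r)"
        proof (intro sum_mono avg_abs_le)
          fix j assume j: "j \<in> {..<m}"
          have "int (Suc j) * r \<le> int m * r" using j r by (intro mult_right_mono) auto
          then have jL: "s + int j * r + r \<le> s + L" using mL by (simp add: algebra_simps)
          have "avg \<Omega> (\<lambda>(x, y). (F (line s (s + L) x y (s + int j * r + r)) - F (line s (s + L) x y (s + int j * r)))\<^sup>2)
              \<le> (1 + a) * (real_of_int r)\<^sup>2"
            using en jL r by simp
          also have "\<dots> \<le> ((1 + a) * real_of_int r)\<^sup>2"
          proof -
            have "1 + a \<le> (1 + a)\<^sup>2" using a by (simp add: power2_eq_square algebra_simps)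
            then show ?thesis unfolding power_mult_distrib by (intro mult_right_mono) auto
          qed
          finally show "avg \<Omega> (\<lambda>xy. (F (line s (s + L) (fst xy) (snd xy) (s + int (Suc j) * r))
            - F (line s (s + L) (fst xy) (snd xy) (s + int j * r)))\<^sup>2) \<le> ((1 + a) * real_of_int r)\<^sup>2"
            by (simp add: case_prod_unfold algebra_simps)
        qed (use a r in auto)
        also have "\<dots> = (1 + a) * real_of_int (int m * r)" by simp
        also have "\<dots> \<le> (1 + a) * l" unfolding l_def using a mL by (intro mult_left_mono) linarith+
        finally show ?thesis .
      qed
      \<comment> \<open>The excess of the variation over the guaranteed range, made nonnegative on
        lines of small range by the second term. Its mean is at most
        \<open>5 * a * l = e^2 * l\<close>, which is why \<open>a = e^2 / 5\<close>, and Markov's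
        inequality at level \<open>e * l\<close> leaves a frequency of at most
        \<open>e\<close>.\<close>
      define X where "X xy = V xy + l * of_bool (B xy) - (1 - 3 * a) * l" for xy
      have notB: "\<exists>u\<in>{s..s+L}. \<exists>v\<in>{s..s+L}. (1 - a) * l \<le> F (line s (s + L) (fst xy) (snd xy) u) - F (line s (s + L) (fst xy) (snd xy) v)"
        if "\<not> B xy" for xy
        using that unfolding B_def l_def by (auto simp: not_less)
      have Xn: "0 \<le> X xy" for xy
      proof (cases "B xy")
        case True
        have "0 \<le> 3 * (a * l)" using a l by simp
        then show ?thesis using True Vn[of xy] by (simp add: X_def algebra_simps)
      next
        case False
        from notB[OF this] obtain u v where uv: "u \<in> {s..s+L}" "v \<in> {s..s+L}"
          "(1 - a) * l \<le> F (line s (s + L) (fst xy) (snd xy) u) - F (line s (s + L) (fst xy) (snd xy) v)" by blast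
        obtain i k where ik: "i \<le> m" "k \<le> m"
          "(1 - a) * l - 2 * (\<kappa> * r) \<le> F (line s (s + L) (fst xy) (snd xy) (s + int i * r)) - F (line s (s + L) (fst xy) (snd xy) (s + int k * r))"
          using range_grid[OF r m_def uv] by blast
        have seg: "\<bar>g b - g c\<bar> \<le> (\<Sum>j<m. \<bar>g (Suc j) - g j\<bar>)" if "c \<le> b" "b \<le> m" for g :: "nat \<Rightarrow> real" and b c
        proof -
          have "\<bar>g b - g c\<bar> \<le> (\<Sum>j=c..<b. \<bar>g (Suc j) - g j\<bar>)"
            using sum_abs[of "\<lambda>j. g (Suc j) - g j" "{c..<b}"] sum_Suc_diff'[OF that(1), of g] by simp
          also have "\<dots> \<le> (\<Sum>j<m. \<bar>g (Suc j) - g j\<bar>)" using that by (intro sum_mono2) auto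
          finally show ?thesis .
        qed
        let ?g = "\<lambda>j. F (line s (s + L) (fst xy) (snd xy) (s + int j * r))"
        have "\<bar>?g i - ?g k\<bar> \<le> V xy"
        proof (cases "i \<le> k")
          case True
          show ?thesis unfolding V_def tv_def using seg[OF True ik(2), of ?g] by (subst abs_minus_commute)
        next
          case False
          show ?thesis unfolding V_def tv_def using seg[OF _ ik(1), of k ?g] False by simp
        qed
        then have "?g i - ?g k \<le> V xy" using abs_ge_self order.trans by blast
        moreover have e1: "(1 - a) * l = l - a * l" "(1 - 3 * a) * l = l - 3 * (a * l)" by (simp_all add: algebra_simps)
        moreover have "p - c - 2 * d \<le> q \<Longrightarrow> q \<le> v \<Longrightarrow> d \<le> c \<Longrightarrow> p - 3 * c \<le> v" for p q c d v :: real
          by linarith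
        ultimately have "l - 3 * (a * l) \<le> V xy" using ik(3) \<kappa>r by metis
        then show ?thesis using False unfolding X_def e1(2) by simp
      qed
      have "avg \<Omega> X = avg \<Omega> V + l * freq \<Omega> B - (1 - 3 * a) * l"
        unfolding X_def using \<Omega> by (simp add: avg_diff avg_add avg_cmult avg_const)
      also have "\<dots> \<le> (1 + a) * l + l * a - (1 - 3 * a) * l"
        using aV fB l by (intro diff_right_mono add_mono mult_left_mono) auto
      also have "\<dots> = e\<^sup>2 * l" by (simp add: a(3)[symmetric] algebra_simps)
      finally have aX: "avg \<Omega> X \<le> e\<^sup>2 * l" .
      have mk: "freq \<Omega> (\<lambda>xy. e * l \<le> X xy) \<le> e"
      proof -
        have "freq \<Omega> (\<lambda>xy. e * l \<le> X xy) \<le> avg \<Omega> X / (e * l)" using Xn e l by (intro markov) auto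
        also have "\<dots> \<le> e\<^sup>2 * l / (e * l)" using aX e l by (intro divide_right_mono) auto
        also have "\<dots> = e" using e l by (simp add: power2_eq_square)
        finally show ?thesis .
      qed
      have "freq \<Omega> (\<lambda>(x, y). \<not> (\<exists>\<sigma>. steep \<epsilon> s (s + L) x y \<sigma>)) \<le> freq \<Omega> (\<lambda>xy. B xy \<or> e * l \<le> X xy)"
      proof (rule freq_mono)
        fix xy assume "case xy of (x, y) \<Rightarrow> \<not> (\<exists>\<sigma>. steep \<epsilon> s (s + L) x y \<sigma>)"
        then have ns: "\<not> (\<exists>\<sigma>. steep (8 * e) s (s + L) (fst xy) (snd xy) \<sigma>)"
          by (simp add: case_prod_unfold e_def)
        show "B xy \<or> e * l \<le> X xy"
        proof (rule ccontr)
          assume n: "\<not> (B xy \<or> e * l \<le> X xy)"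
          then obtain u v where uv: "u \<in> {s..s+L}" "v \<in> {s..s+L}"
            "(1 - a) * l \<le> F (line s (s + L) (fst xy) (snd xy) u) - F (line s (s + L) (fst xy) (snd xy) v)"
            using notB by blast
          have al: "a * l \<le> e * l" "0 \<le> a * l" using a e l by (auto intro!: mult_right_mono)
          have "(1 - e) * l \<le> (1 - a) * l" using a e l by (intro mult_right_mono) auto
          then have 3: "(1 - e) * real_of_int L \<le> F (line s (s + L) (fst xy) (snd xy) u) - F (line s (s + L) (fst xy) (snd xy) v)"
            using uv(3) unfolding l_def by linarith
          have n': "\<not> B xy" "\<not> e * l \<le> X xy" using n by blast+
          then have "X xy = V xy - (1 - 3 * a) * l" by (simp add: X_def)
          then have "V xy < e * l + (1 - 3 * a) * l" using n'(2) by (simp add: not_le diff_less_eq)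
          also have "\<dots> \<le> (1 + e) * l" using al by (simp add: algebra_simps)
          finally have 2: "tv r m s (s + L) (fst xy) (snd xy) \<le> (1 + e) * real_of_int L" by (simp add: V_def l_def)
          have 1: "\<kappa> * r \<le> e * real_of_int L" using \<kappa>r al unfolding l_def by linarith
          show False
            using steepI[OF r l(2) 1 less_imp_le[OF e(1)] e(2) m_def 2 uv(1,2) 3] ns by blast
        qed
      qed
      also have "\<dots> \<le> \<epsilon>" by (rule freq_disj_le[OF fB mk]) (use a e in \<open>simp add: e_def\<close>)
      finally show "freq \<Omega> (\<lambda>(x, y). \<not> (\<exists>\<sigma>. steep \<epsilon> s (s + L) x y \<sigma>)) \<le> \<epsilon>" .
    qed
  qed
qed

end

context quasi begin

text \<open>The set of lines in \<open>mostly_steep\<close> is arbitrary. Here it is a whole box, in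
  \<open>up_steep\<close> the fan of lines from one lower end.\<close>

lemma box_steep:
  fixes \<epsilon> :: real
  assumes \<epsilon>: "0 < \<epsilon>" "\<epsilon> \<le> 1"
  shows "\<exists>L0. \<forall>L\<ge>L0. \<forall>s. \<forall>a\<in>extensional P. \<forall>b\<in>extensional N.
    freq (dn P s (s + L) a \<times> dn N (s + L) s b) (\<lambda>(x, y). \<not> (\<exists>\<sigma>. steep \<epsilon> s (s + L) x y \<sigma>)) \<le> \<epsilon>"
proof -
  obtain \<delta> where \<delta>: "0 < \<delta>" "\<delta> < 1" and st: "\<And>r. r \<ge> 1 \<Longrightarrow> \<exists>L0. \<forall>L\<ge>L0. \<forall>s \<Omega>. finite \<Omega> \<longrightarrow> \<Omega> \<noteq> {} \<longrightarrow>
    (\<forall>u. s \<le> u \<longrightarrow> u + r \<le> s + L \<longrightarrow>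
      avg \<Omega> (\<lambda>(x, y). (F (line s (s + L) x y (u + r)) - F (line s (s + L) x y u))\<^sup>2) \<le> (1 + \<delta>) * (real_of_int r)\<^sup>2) \<longrightarrow>
    freq \<Omega> (\<lambda>(x, y). \<forall>u\<in>{s..s+L}. \<forall>v\<in>{s..s+L}.
      F (line s (s + L) x y u) - F (line s (s + L) x y v) < (1 - \<delta>) * real_of_int L) \<le> \<delta> \<longrightarrow>
    freq \<Omega> (\<lambda>(x, y). \<not> (\<exists>\<sigma>. steep \<epsilon> s (s + L) x y \<sigma>)) \<le> \<epsilon>"
    using mostly_steep[OF \<epsilon>] by blast
  obtain r where r: "1 \<le> r" "energy_le r (1 + \<delta>)" using energy_le_1[OF \<delta>(1)] by blast
  from st[OF r(1)] obtain L1 where L1: "\<forall>L\<ge>L1. \<forall>s \<Omega>. finite \<Omega> \<longrightarrow> \<Omega> \<noteq> {} \<longrightarrow>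
    (\<forall>u. s \<le> u \<longrightarrow> u + r \<le> s + L \<longrightarrow>
      avg \<Omega> (\<lambda>(x, y). (F (line s (s + L) x y (u + r)) - F (line s (s + L) x y u))\<^sup>2) \<le> (1 + \<delta>) * (real_of_int r)\<^sup>2) \<longrightarrow>
    freq \<Omega> (\<lambda>(x, y). \<forall>u\<in>{s..s+L}. \<forall>v\<in>{s..s+L}.
      F (line s (s + L) x y u) - F (line s (s + L) x y v) < (1 - \<delta>) * real_of_int L) \<le> \<delta> \<longrightarrow>
    freq \<Omega> (\<lambda>(x, y). \<not> (\<exists>\<sigma>. steep \<epsilon> s (s + L) x y \<sigma>)) \<le> \<epsilon>" ..
  obtain L2 where L2: "\<And>L z x b. L \<ge> L2 \<Longrightarrow> x \<in> extensional P \<Longrightarrow> b \<in> extensional N \<Longrightarrow>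
    freq (dn N (z + L) z b) (\<lambda>y. \<forall>u\<in>{z..z+L}. \<forall>v\<in>{z..z+L}.
       F (line z (z + L) x y u) - F (line z (z + L) x y v) < (1 - \<delta>) * L) \<le> \<delta>"
    using range_large[OF \<delta>] by blast
  show ?thesis
  proof (intro exI[of _ "max L1 L2"] allI impI ballI)
    fix L s :: int and a b :: "'n \<Rightarrow> int"
    assume L: "max L1 L2 \<le> L" and ab: "a \<in> extensional P" "b \<in> extensional N"
    show "freq (dn P s (s + L) a \<times> dn N (s + L) s b) (\<lambda>(x, y). \<not> (\<exists>\<sigma>. steep \<epsilon> s (s + L) x y \<sigma>)) \<le> \<epsilon>"
    proof (rule L1[rule_format])
      show "avg (dn P s (s + L) a \<times> dn N (s + L) s b)
        (\<lambda>(x, y). (F (line s (s + L) x y (u + r)) - F (line s (s + L) x y u))\<^sup>2) \<le> (1 + \<delta>) * (real_of_int r)\<^sup>2"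
        if "s \<le> u" "u + r \<le> s + L" for u
        using that r ab by (intro energy_window) auto
      show "freq (dn P s (s + L) a \<times> dn N (s + L) s b) (\<lambda>(x, y). \<forall>u\<in>{s..s+L}. \<forall>v\<in>{s..s+L}.
        F (line s (s + L) x y u) - F (line s (s + L) x y v) < (1 - \<delta>) * real_of_int L) \<le> \<delta>"
        unfolding avg_Times
      proof (rule avg_le[OF finite_dn dn_ne])
        fix x assume "x \<in> dn P s (s + L) a"
        then show "freq (dn N (s + L) s b) (\<lambda>y. case (x, y) of (x, y) \<Rightarrow> \<forall>u\<in>{s..s+L}. \<forall>v\<in>{s..s+L}.
            F (line s (s + L) x y u) - F (line s (s + L) x y v) < (1 - \<delta>) * real_of_int L) \<le> \<delta>"
          using L2[of L x b s] L ab(2) by (simp add: dn_ext)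
      qed
    qed (use L in auto)
  qed
qed

end

section \<open>Quadrilaterals of vertical lines\<close>

lemma abs_diff_via: "\<bar>a - h\<bar> \<le> k \<Longrightarrow> \<bar>b - h\<bar> \<le> k \<Longrightarrow> 0 \<le> e \<Longrightarrow> \<bar>a - b\<bar> \<le> 2 * (e + k)" for a b h k e :: real
  unfolding distrib_left by linarith

context weights begin

lemma up_pos_nonneg:
  assumes "coarser A u v" "i \<in> A"
  shows "real_of_int (up A u v b i) * 2 powr E i v \<le> real_of_int (b i) * 2 powr E i u"
proof -
  let ?q = "2 ^ depth u v i :: int"
  have q: "real_of_int ?q * 2 powr E i u = 2 powr E i v"
    using assms by (simp add: coarser_def depth_def powr_realpow[symmetric] powr_add[symmetric])
  have "up A u v b i * ?q \<le> b i"
    using assms by (simp add: up_def minus_mod_eq_div_mult[symmetric])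
  then have "real_of_int (up A u v b i * ?q) \<le> real_of_int (b i)" by (simp only: of_int_le_iff)
  then have "real_of_int (up A u v b i * ?q) * 2 powr E i u \<le> real_of_int (b i) * 2 powr E i u"
    by (rule mult_right_mono) simp
  then show ?thesis unfolding q[symmetric] by (simp only: of_int_mult mult.assoc)
qed

text \<open>Labels that differ by 2 leave a whole cell of height \<open>w\<close> between the two
  branches. Going up from \<open>w\<close>, the unit of length in coordinate \<open>i\<close>
  shrinks by at least \<open>lmn\<close> in the exponent per level, so points on the two branches
  can be near each other only shortly above \<open>w\<close>.\<close>

lemma separated:
  assumes i: "i \<in> N" and sep: "2 \<le> \<bar>up N t w y1 i - up N t w y2 i\<bar>"
    and lv: "w \<le> u1" "u1 \<le> t" "w \<le> u2" "u2 \<le> t"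
    and near: "near D (line s t x y1 u1) (line s t x' y2 u2)"
  shows "lmn * real_of_int (u1 - w) - 1 \<le> D"
proof -
  let ?c1 = "real_of_int (up N t w y1 i)" and ?c2 = "real_of_int (up N t w y2 i)" and ?W = "2 powr real_of_int (E i w)"
  let ?p1 = "pos (line s t x y1 u1) i" and ?p2 = "pos (line s t x' y2 u2) i"
  have b: "?c1 * ?W \<le> ?p1" "?p1 - ?c1 * ?W \<le> ?W" "?c2 * ?W \<le> ?p2" "?p2 - ?c2 * ?W \<le> ?W"
    using up_pos_nonneg[OF coarser_N i, of w u1 "up N t u1 y1"] up_pos[OF coarser_N i, of w u1 "up N t u1 y1"]
      up_pos_nonneg[OF coarser_N i, of w u2 "up N t u2 y2"] up_pos[OF coarser_N i, of w u2 "up N t u2 y2"] lv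
    by (simp_all add: pos_line_N[OF i] up_up coarser_N)
  have "2 \<le> \<bar>?c1 - ?c2\<bar>" using sep by linarith
  then have "2 * ?W \<le> \<bar>?c1 - ?c2\<bar> * ?W" by (intro mult_right_mono) auto
  also have "\<bar>?c1 - ?c2\<bar> * ?W = \<bar>?c1 * ?W - ?c2 * ?W\<bar>" by (simp add: left_diff_distrib[symmetric] abs_mult)
  finally have "?W \<le> \<bar>?p1 - ?p2\<bar>" using b by linarith
  also have "\<dots> \<le> 2 powr (lam i * u1 + D)" using near by (simp add: near_def)
  finally have "real_of_int (E i w) \<le> lam i * u1 + D" by simp
  then have "lam i * w - 1 \<le> lam i * u1 + D" using E_ge[of i w] by linarith
  then have "\<bar>lam i\<bar> * real_of_int (u1 - w) - 1 \<le> D" using i by (simp add: N_def algebra_simps)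
  moreover have "lmn * real_of_int (u1 - w) \<le> \<bar>lam i\<bar> * real_of_int (u1 - w)"
    using lmn_le[of i] lv by (intro mult_right_mono) auto
  ultimately show ?thesis by linarith
qed

text \<open>One-sided control of the height suffices for each coordinate: an upper bound in
  direction \<open>\<sigma>\<close> if \<open>\<sigma> * lam i\<close> is positive, a lower one if
  it is negative.\<close>

lemma lam_bound:
  assumes \<sigma>: "\<bar>\<sigma>\<bar> = 1" and d: "0 \<le> d"
    and h: "0 < \<sigma> * lam i \<and> \<sigma> * f \<le> \<sigma> * H + d \<or> \<sigma> * lam i < 0 \<and> \<sigma> * H - d \<le> \<sigma> * f"
  shows "lam i * f \<le> lam i * H + lmx * d"
proof -
  have \<sigma>2: "\<sigma> * \<sigma> = 1" using \<sigma> by (auto simp: abs_if split: if_splits)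
  then have e: "(\<sigma> * lam i) * (\<sigma> * z) = lam i * z" for z
    by (metis (no_types, opaque_lifting) mult.assoc mult.commute mult_1)
  have "\<bar>\<sigma> * lam i\<bar> * d \<le> lmx * d"
    using abs_lam_le[of i] \<sigma> d by (intro mult_right_mono) (simp_all add: abs_mult)
  moreover have "(\<sigma> * lam i) * (\<sigma> * f) \<le> (\<sigma> * lam i) * (\<sigma> * H) + \<bar>\<sigma> * lam i\<bar> * d"
    using h
  proof (elim disjE conjE)
    assume p: "0 < \<sigma> * lam i" "\<sigma> * f \<le> \<sigma> * H + d"
    then have "(\<sigma> * lam i) * (\<sigma> * f) \<le> (\<sigma> * lam i) * (\<sigma> * H + d)" by (intro mult_left_mono) auto
    then show ?thesis using p by (simp add: distrib_left)
  next
    assume p: "\<sigma> * lam i < 0" "\<sigma> * H - d \<le> \<sigma> * f"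
    then have "(\<sigma> * lam i) * (\<sigma> * f) \<le> (\<sigma> * lam i) * (\<sigma> * H - d)" by (intro mult_left_mono_neg) auto
    then show ?thesis using p by (simp add: right_diff_distrib)
  qed
  ultimately show ?thesis unfolding e by linarith
qed

end

context embedding begin

lemma mono_pathD:
  "mono_path \<sigma> e s t x y \<Longrightarrow> s \<le> u \<Longrightarrow> u \<le> v \<Longrightarrow> v \<le> t \<Longrightarrow> \<sigma> * F (line s t x y u) - e \<le> \<sigma> * F (line s t x y v)"
proof -
  assume "mono_path \<sigma> e s t x y" "s \<le> u" "u \<le> v" "v \<le> t"
  then have "- e \<le> \<sigma> * (F (line s t x y v) - F (line s t x y u))" unfolding mono_path_def by blast
  then show ?thesis by (simp add: right_diff_distrib)
qed

text \<open>\<open>M\<close> is left open because the quadrilateral argument is used twice: with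
  \<open>M\<close> proportional to the length of the line, which \<open>drifts_line\<close> always
  provides, and with a constant \<open>M\<close> once \<open>climbing\<close> is known.\<close>

definition drifts :: "real \<Rightarrow> int \<Rightarrow> int \<Rightarrow> ('n \<Rightarrow> int) \<Rightarrow> ('n \<Rightarrow> int) \<Rightarrow> bool" where
  "drifts M s t x y \<longleftrightarrow> (\<forall>u v c i. s \<le> u \<longrightarrow> u \<le> v \<longrightarrow> v \<le> t \<longrightarrow>
     (\<forall>w. u \<le> w \<longrightarrow> w \<le> v \<longrightarrow> lam i * F (line s t x y w) \<le> c) \<longrightarrow>
     \<bar>pos (\<Phi> (line s t x y v)) i - pos (\<Phi> (line s t x y u)) i\<bar> \<le> M * 2 powr c)"

lemma drifts_line: "drifts (real_of_int (t - s) * 2 powr \<kappa>) s t x y"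
  unfolding drifts_def
proof (intro allI impI)
  fix u v c i assume uv: "s \<le> u" "u \<le> v" "v \<le> t" and c: "\<forall>w. u \<le> w \<longrightarrow> w \<le> v \<longrightarrow> lam i * F (line s t x y w) \<le> c"
  have "\<bar>pos (\<Phi> (line s t x y v)) i - pos (\<Phi> (line s t x y u)) i\<bar> \<le> real_of_int (v - u) * 2 powr (c + \<kappa>)"
    using c by (intro drift uv) auto
  also have "\<dots> \<le> real_of_int (t - s) * 2 powr (c + \<kappa>)" using uv by (intro mult_right_mono) auto
  finally show "\<bar>pos (\<Phi> (line s t x y v)) i - pos (\<Phi> (line s t x y u)) i\<bar> \<le> real_of_int (t - s) * 2 powr \<kappa> * 2 powr c"
    by (simp add: powr_add mult_ac)
qed

text \<open>\<open>r\<close> records, coordinate by coordinate, the bottom corner that controls the point of the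
  image path at height \<open>H\<close>: its own starting point from below, the other one from above.\<close>

lemma crossing:
  assumes \<sigma>: "\<bar>\<sigma>\<bar> = 1" and e: "0 \<le> e" and M: "0 \<le> M" and st: "s \<le> t"
    and mono: "mono_path \<sigma> e s t x y" "mono_path \<sigma> e s t x' y" and dr: "drifts M s t x y" "drifts M s t x' y"
    and top: "line s t x' y t = line s t x y t"
    and H: "H = F (line s t x' y s)" and low: "m \<le> \<sigma> * (H - F (line s t x y s))" "0 < m"
    and high: "0 \<le> \<sigma> * (F (line s t x y t) - H)"
    and r: "\<And>i. r i = pos (\<Phi> (if 0 < \<sigma> * lam i then line s t x y s else line s t x' y s)) i"
  shows "\<exists>u. s \<le> u \<and> u \<le> t \<and> m \<le> \<kappa> * real_of_int (u - s) \<and> \<bar>F (line s t x y u) - H\<bar> \<le> \<kappa> \<and>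
     (\<forall>i. \<bar>pos (\<Phi> (line s t x y u)) i - r i\<bar> \<le> 2 * M * 2 powr (lam i * H + lmx * (e + \<kappa>)))"
proof -
  let ?h = "\<lambda>u. \<sigma> * F (line s t x y u)"
  define S where "S = {u \<in> {s..t}. \<sigma> * H \<le> ?h u}"
  have S: "finite S" unfolding S_def by (rule finite_subset[of _ "{s..t}"]) auto
  have "t \<in> S" using st high by (auto simp: S_def algebra_simps)
  note S = S this
  \<comment> \<open>\<open>u\<close> is the first height at which the image reaches \<open>H\<close>
    in direction \<open>\<sigma>\<close>. Before \<open>u\<close> it stays below \<open>H\<close>,
    which controls the coordinates with \<open>\<sigma> * lam i > 0\<close> from the start. After
    \<open>u\<close> it stays above \<open>H - e\<close>, and so does the whole second path, which
    controls the other coordinates through the common top.\<close>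
  define u where "u = Min S"
  have uS: "u \<in> S" unfolding u_def using S by (intro Min_in) auto
  have least: "?h w < \<sigma> * H" if "s \<le> w" "w < u" for w
  proof (rule ccontr)
    assume "\<not> ?h w < \<sigma> * H"
    then have "w \<in> S" using that uS by (auto simp: S_def)
    then show False using that(2) Min_le[OF S(1), of w] by (simp add: u_def)
  qed
  have su: "s \<le> u" "u \<le> t" and hu: "\<sigma> * H \<le> ?h u" using uS by (auto simp: S_def)
  have \<sigma>abs: "\<bar>\<sigma> * z\<bar> = \<bar>z\<bar>" for z using \<sigma> by (simp add: abs_mult)
  have Fl: "\<bar>?h v - ?h w\<bar> \<le> \<kappa> * real_of_int \<bar>v - w\<bar>" if "s \<le> v" "v \<le> t" "s \<le> w" "w \<le> t" for v w
    using F_line[OF that, of x y] \<sigma>abs[of "F (line s t x y v) - F (line s t x y w)"] by (simp add: right_diff_distrib)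
  have "?h s < ?h u" using low hu by (simp add: right_diff_distrib)
  then have "s < u" using su by (cases "s = u") auto
  then have "?h (u - 1) < \<sigma> * H" "\<bar>?h u - ?h (u - 1)\<bar> \<le> \<kappa>"
    using least[of "u - 1"] Fl[of u "u - 1"] su by auto
  then have hu2: "?h u \<le> \<sigma> * H + \<kappa>" by linarith
  have below: "?h w \<le> \<sigma> * H + \<kappa>" if "s \<le> w" "w \<le> u" for w
    using least[of w] that hu2 kappa_ge_1 by (cases "w = u") auto
  have above: "\<sigma> * H - e \<le> ?h w" if "u \<le> w" "w \<le> t" for w
    using mono_pathD[OF mono(1) su(1) that] hu by linarith
  have above': "\<sigma> * H - e \<le> \<sigma> * F (line s t x' y w)" if "s \<le> w" "w \<le> t" for w
    using mono_pathD[OF mono(2) order.refl that] H by simp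
  have m: "m \<le> \<kappa> * real_of_int (u - s)"
  proof -
    have "m \<le> ?h u - ?h s" using low(1) hu by (simp add: right_diff_distrib)
    also have "\<dots> \<le> \<kappa> * real_of_int \<bar>u - s\<bar>" using Fl[of u s] su st by linarith
    finally show ?thesis using su by simp
  qed
  have "\<bar>?h u - \<sigma> * H\<bar> \<le> \<kappa>" using hu hu2 by linarith
  then have FH: "\<bar>F (line s t x y u) - H\<bar> \<le> \<kappa>" using \<sigma>abs[of "F (line s t x y u) - H"] by (simp add: right_diff_distrib)
  have "\<bar>pos (\<Phi> (line s t x y u)) i - r i\<bar> \<le> 2 * M * 2 powr (lam i * H + lmx * (e + \<kappa>))" for i
  proof -
    let ?X = "2 powr (lam i * H + lmx * (e + \<kappa>))"
    have k0: "0 \<le> \<kappa>" using kappa_ge_1 by simp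
    have mono1: "M * 2 powr (lam i * H + lmx * d) \<le> M * ?X" if "d \<le> e + \<kappa>" for d
      using that M lmx_nonneg by (intro mult_left_mono powr_mono add_left_mono) auto
    have "\<sigma> * lam i \<noteq> 0" using \<sigma> nz[of i] by auto
    then consider "0 < \<sigma> * lam i" | "\<sigma> * lam i < 0" by linarith
    then show ?thesis
    proof cases
      case 1
      have "\<bar>pos (\<Phi> (line s t x y u)) i - pos (\<Phi> (line s t x y s)) i\<bar> \<le> M * 2 powr (lam i * H + lmx * \<kappa>)"
        using dr(1) su below lam_bound[OF \<sigma> k0, of i _ H] 1 unfolding drifts_def by blast
      also have "\<dots> \<le> M * ?X" using e by (intro mono1) auto
      finally show ?thesis using 1 M by (simp add: r)
    next
      case 2
      have a: "\<bar>pos (\<Phi> (line s t x y t)) i - pos (\<Phi> (line s t x y u)) i\<bar> \<le> M * 2 powr (lam i * H + lmx * e)"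
        using dr(1) su above lam_bound[OF \<sigma> e, of i _ H] 2 unfolding drifts_def by blast
      have b: "\<bar>pos (\<Phi> (line s t x' y t)) i - pos (\<Phi> (line s t x' y s)) i\<bar> \<le> M * 2 powr (lam i * H + lmx * e)"
        using dr(2) st above' lam_bound[OF \<sigma> e, of i _ H] 2 unfolding drifts_def by blast
      have "M * 2 powr (lam i * H + lmx * e) \<le> M * ?X" using k0 by (intro mono1) auto
      then show ?thesis using a b 2 unfolding top by (simp add: r)
    qed
  qed
  then show ?thesis using su m FH by blast
qed

text \<open>The \<open>near\<close> distance of two image points of nearly equal height whose
  coordinates are both within \<open>2 * M\<close> scale units of common reference values. The
  factor \<open>4 * M\<close> from the triangle inequality becomes the logarithm; the terms with
  \<open>lmx\<close> come from comparing scales at different heights.\<close>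

definition quad_bound :: "real \<Rightarrow> real \<Rightarrow> real" where
  "quad_bound e M = 2 * e + 2 * \<kappa> + lmx * (2 * e + 2 * \<kappa>) + log 2 (4 * M)"

lemma near_from_corners:
  assumes e: "0 \<le> e" and M: "1 \<le> M" and d: "d \<le> e + \<kappa>"
    and f: "\<bar>F p - H\<bar> \<le> d" "\<bar>F p - F q\<bar> \<le> 2 * (e + \<kappa>)"
    and c: "\<And>i. \<bar>pos (\<Phi> p) i - r i\<bar> \<le> 2 * M * 2 powr (lam i * H + lmx * (e + \<kappa>))"
      "\<And>i. \<bar>pos (\<Phi> q) i - r i\<bar> \<le> 2 * M * 2 powr (lam i * H + lmx * (e + \<kappa>))"
  shows "near (quad_bound e M) (\<Phi> p) (\<Phi> q)"
proof -
  have k0: "0 \<le> \<kappa>" using kappa_ge_1 by simp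
  have l0: "0 \<le> log 2 (4 * M)" using M by simp
  have D: "2 * (e + \<kappa>) \<le> quad_bound e M" using l0 e k0 lmx_nonneg by (simp add: quad_bound_def)
  have "\<bar>pos (\<Phi> p) i - pos (\<Phi> q) i\<bar> \<le> 2 powr (lam i * fst (\<Phi> p) + quad_bound e M)" for i
  proof -
    have "\<bar>pos (\<Phi> p) i - pos (\<Phi> q) i\<bar> \<le> 4 * M * 2 powr (lam i * H + lmx * (e + \<kappa>))"
      using c[of i] by linarith
    also have "4 * M = 2 powr log 2 (4 * M)" using M by simp
    also have "2 powr log 2 (4 * M) * 2 powr (lam i * H + lmx * (e + \<kappa>)) = 2 powr (log 2 (4 * M) + (lam i * H + lmx * (e + \<kappa>)))"
      by (simp add: powr_add)
    also have "\<dots> \<le> 2 powr (lam i * fst (\<Phi> p) + quad_bound e M)"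
    proof (intro powr_mono)
      have "lam i * H \<le> lam i * F p + lmx * (e + \<kappa>)"
        using f(1) d by (intro lam_shift) (simp add: abs_minus_commute)
      then show "log 2 (4 * M) + (lam i * H + lmx * (e + \<kappa>)) \<le> lam i * fst (\<Phi> p) + quad_bound e M"
        using e k0 by (simp add: quad_bound_def F_def algebra_simps)
    qed simp
    finally show ?thesis .
  qed
  moreover have "\<bar>real_of_int (fst (\<Phi> p)) - fst (\<Phi> q)\<bar> \<le> quad_bound e M" using f(2) D by (simp add: F_def)
  ultimately show ?thesis by (simp add: near_def)
qed

text \<open>The lines \<open>(x, y1)\<close> and \<open>(x, y2)\<close> both cross the height of the image of the lower end of \<open>x'\<close>, at image points
  that are close to each other, since both are controlled by the same two lower corners.\<close>

lemma quad_same: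
  assumes \<sigma>: "\<bar>\<sigma>\<bar> = 1" and e: "0 \<le> e" and M: "1 \<le> M" and w: "s \<le> w" "w \<le> t"
    and ab: "a \<in> extensional P" "b \<in> extensional N"
    and xx: "x \<in> dn P s t a" "x' \<in> dn P s t a" and yy: "y1 \<in> dn N t s b" "y2 \<in> dn N t s b"
    and i: "i \<in> N" and sep: "2 \<le> \<bar>up N t w y1 i - up N t w y2 i\<bar>"
    and mono: "\<And>y. y \<in> {y1, y2} \<Longrightarrow> mono_path \<sigma> e s t x y" "\<And>y. y \<in> {y1, y2} \<Longrightarrow> mono_path \<sigma> e s t x' y"
    and dr: "\<And>y. y \<in> {y1, y2} \<Longrightarrow> drifts M s t x y" "\<And>y. y \<in> {y1, y2} \<Longrightarrow> drifts M s t x' y"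
    and low: "m \<le> \<sigma> * (F (mk s x' b) - F (mk s x b))" "0 < m"
    and high: "\<And>y. y \<in> {y1, y2} \<Longrightarrow> 0 \<le> \<sigma> * (F (mk t a y) - F (mk s x' b))"
  shows "lmn * (m / \<kappa> - real_of_int (w - s)) - 1 \<le> \<alpha> * quad_bound e M + \<beta>"
proof -
  have st: "s \<le> t" using w by simp
  define r where "r i = pos (\<Phi> (if 0 < \<sigma> * lam i then mk s x b else mk s x' b)) i" for i
  define H where "H = F (mk s x' b)"
  have ends: "line s t x y s = mk s x b" "line s t x y t = mk t a y"
    "line s t x' y s = mk s x' b" "line s t x' y t = mk t a y" if "y \<in> {y1, y2}" for y
    using line_ends[OF st ab xx(1), of y] line_ends[OF st ab xx(2), of y] that yy by auto
  have cr: "\<exists>u. s \<le> u \<and> u \<le> t \<and> m \<le> \<kappa> * real_of_int (u - s) \<and> \<bar>F (line s t x y u) - H\<bar> \<le> \<kappa> \<and>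
     (\<forall>i. \<bar>pos (\<Phi> (line s t x y u)) i - r i\<bar> \<le> 2 * M * 2 powr (lam i * H + lmx * (e + \<kappa>)))" if y: "y \<in> {y1, y2}" for y
    using M low high[OF y]
    by (intro crossing[OF \<sigma> e _ st mono(1)[OF y] mono(2)[OF y] dr(1)[OF y] dr(2)[OF y], where m = m])
      (auto simp: ends[OF y] H_def r_def)
  obtain u1 where u1: "s \<le> u1" "u1 \<le> t" "m \<le> \<kappa> * real_of_int (u1 - s)" "\<bar>F (line s t x y1 u1) - H\<bar> \<le> \<kappa>"
     "\<And>i. \<bar>pos (\<Phi> (line s t x y1 u1)) i - r i\<bar> \<le> 2 * M * 2 powr (lam i * H + lmx * (e + \<kappa>))"
    using cr[of y1] by auto
  obtain u2 where u2: "s \<le> u2" "u2 \<le> t" "m \<le> \<kappa> * real_of_int (u2 - s)" "\<bar>F (line s t x y2 u2) - H\<bar> \<le> \<kappa>"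
     "\<And>i. \<bar>pos (\<Phi> (line s t x y2 u2)) i - r i\<bar> \<le> 2 * M * 2 powr (lam i * H + lmx * (e + \<kappa>))"
    using cr[of y2] by auto
  have k: "0 < \<kappa>" using kappa_ge_1 by simp
  \<comment> \<open>\<open>F\<close> changes by at most \<open>\<kappa>\<close> per level, so the
    crossing of a height that is \<open>m\<close> away lies at least \<open>m / \<kappa>\<close>
    above \<open>s\<close>.\<close>
  have mu: "m / \<kappa> \<le> real_of_int (u1 - s)" "m / \<kappa> \<le> real_of_int (u2 - s)"
    using u1(3) u2(3) k by (simp_all add: divide_le_eq mult.commute)
  have D0': "0 \<le> \<alpha> * quad_bound e M + \<beta>"
  proof -
    have "0 \<le> log 2 (4 * M)" using M by simp
    then show ?thesis using e k lmx_nonneg alpha beta by (simp add: quad_bound_def)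
  qed
  show ?thesis
  proof (cases "w \<le> u1 \<and> w \<le> u2")
    case True
    have "near (quad_bound e M) (\<Phi> (line s t x y1 u1)) (\<Phi> (line s t x y2 u2))"
    proof (rule near_from_corners[OF e M _ u1(4) _ u1(5) u2(5)])
      show "\<bar>F (line s t x y1 u1) - F (line s t x y2 u2)\<bar> \<le> 2 * (e + \<kappa>)" by (rule abs_diff_via[OF u1(4) u2(4) e])
    qed (use e in simp)
    then have "near (\<alpha> * quad_bound e M + \<beta>) (line s t x y1 u1) (line s t x y2 u2)" by (rule lower)
    then have 1: "lmn * real_of_int (u1 - w) - 1 \<le> \<alpha> * quad_bound e M + \<beta>"
      using True u1 u2 by (intro separated[OF i sep]) auto
    have "m / \<kappa> - real_of_int (w - s) \<le> real_of_int (u1 - w)" using mu(1) by simp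
    then have "lmn * (m / \<kappa> - real_of_int (w - s)) \<le> lmn * real_of_int (u1 - w)"
      using lmn_pos by (intro mult_left_mono) auto
    then show ?thesis using 1 by linarith
  next
    case False
    then have "m / \<kappa> - real_of_int (w - s) \<le> 0" using mu by linarith
    then have "lmn * (m / \<kappa> - real_of_int (w - s)) \<le> 0" using lmn_pos by (simp add: mult_le_0_iff)
    then show ?thesis using D0' by linarith
  qed
qed

text \<open>Here the two upper corners are themselves controlled by the two lower corners.\<close>

lemma quad_opp:
  assumes \<sigma>: "\<bar>\<sigma>\<bar> = 1" and e: "0 \<le> e" and M: "1 \<le> M" and w: "s \<le> w" "w \<le> t"
    and ab: "a \<in> extensional P" "b \<in> extensional N"
    and xx: "x \<in> dn P s t a" "x' \<in> dn P s t a" and yy: "y1 \<in> dn N t s b" "y2 \<in> dn N t s b"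
    and i: "i \<in> N" and sep: "2 \<le> \<bar>up N t w y1 i - up N t w y2 i\<bar>"
    and mono: "\<And>y. y \<in> {y1, y2} \<Longrightarrow> mono_path \<sigma> e s t x y" "\<And>y. y \<in> {y1, y2} \<Longrightarrow> mono_path (- \<sigma>) e s t x' y"
    and dr: "\<And>y. y \<in> {y1, y2} \<Longrightarrow> drifts M s t x y" "\<And>y. y \<in> {y1, y2} \<Longrightarrow> drifts M s t x' y"
    and tops: "\<bar>F (mk t a y1) - F (mk t a y2)\<bar> \<le> e"
  shows "lmn * real_of_int (t - w) - 1 \<le> \<alpha> * quad_bound (2 * e) M + \<beta>"
proof -
  have st: "s \<le> t" using w by simp
  define r where "r i = pos (\<Phi> (if 0 < \<sigma> * lam i then mk s x b else mk s x' b)) i" for i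
  define H where "H = F (mk t a y1)"
  have ends: "line s t x y s = mk s x b" "line s t x y t = mk t a y"
    "line s t x' y s = mk s x' b" "line s t x' y t = mk t a y" if "y \<in> {y1, y2}" for y
    using line_ends[OF st ab xx(1), of y] line_ends[OF st ab xx(2), of y] that yy by auto
  have top: "\<bar>F (mk t a y) - H\<bar> \<le> e" if "y \<in> {y1, y2}" for y
    using that tops e by (auto simp: H_def abs_minus_commute)
  have c: "\<bar>pos (\<Phi> (mk t a y)) j - r j\<bar> \<le> 2 * M * 2 powr (lam j * H + lmx * (2 * e + \<kappa>))" if y: "y \<in> {y1, y2}" for y j
  proof -
    have k0: "0 \<le> \<kappa>" using kappa_ge_1 by simp
    have X: "M * 2 powr (lam j * F (mk t a y) + lmx * e) \<le> 2 * M * 2 powr (lam j * H + lmx * (2 * e + \<kappa>))"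
    proof -
      have "lam j * F (mk t a y) \<le> lam j * H + lmx * e" using top[OF y] by (rule lam_shift)
      then have "lam j * F (mk t a y) + lmx * e \<le> lam j * H + lmx * (2 * e + \<kappa>)"
        using mult_nonneg_nonneg[OF lmx_nonneg k0] by (simp add: algebra_simps)
      then have "M * 2 powr (lam j * F (mk t a y) + lmx * e) \<le> M * 2 powr (lam j * H + lmx * (2 * e + \<kappa>))"
        using M by (intro mult_left_mono powr_mono) auto
      moreover have "0 \<le> M * 2 powr (lam j * H + lmx * (2 * e + \<kappa>))" using M by simp
      ultimately show ?thesis by linarith
    qed
    have "\<sigma> * lam j \<noteq> 0" using \<sigma> nz[of j] by auto
    then consider "0 < \<sigma> * lam j" | "\<sigma> * lam j < 0" by linarith
    then show ?thesis
    proof cases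
      case 1
      have "lam j * F (line s t x y v) \<le> lam j * F (mk t a y) + lmx * e" if "s \<le> v" "v \<le> t" for v
        using mono_pathD[OF mono(1)[OF y] that order.refl] 1 ends(2)[OF y] by (intro lam_bound[OF \<sigma> e]) auto
      then have "\<bar>pos (\<Phi> (line s t x y t)) j - pos (\<Phi> (line s t x y s)) j\<bar> \<le> M * 2 powr (lam j * F (mk t a y) + lmx * e)"
        using dr(1)[OF y] st unfolding drifts_def by blast
      then show ?thesis using X 1 by (simp add: r_def ends[OF y])
    next
      case 2
      have "lam j * F (line s t x' y v) \<le> lam j * F (mk t a y) + lmx * e" if "s \<le> v" "v \<le> t" for v
        using mono_pathD[OF mono(2)[OF y] that order.refl] 2 ends(4)[OF y] by (intro lam_bound[OF \<sigma> e]) auto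
      then have "\<bar>pos (\<Phi> (line s t x' y t)) j - pos (\<Phi> (line s t x' y s)) j\<bar> \<le> M * 2 powr (lam j * F (mk t a y) + lmx * e)"
        using dr(2)[OF y] st unfolding drifts_def by blast
      then show ?thesis using X 2 by (simp add: r_def ends[OF y])
    qed
  qed
  have "near (quad_bound (2 * e) M) (\<Phi> (mk t a y1)) (\<Phi> (mk t a y2))"
    using e M kappa_ge_1 tops c[of y1] c[of y2]
    by (intro near_from_corners[where H = H and d = 0 and r = r]) (auto simp: H_def)
  then have "near (\<alpha> * quad_bound (2 * e) M + \<beta>) (line s t x y1 t) (line s t x y2 t)"
    unfolding ends(2)[of y1, simplified] ends(2)[of y2, simplified] by (rule lower)
  then show ?thesis using w by (intro separated[OF i sep]) auto
qed

end

lemma log_small: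
  fixes c d :: real
  assumes "0 < d" shows "\<exists>L0. \<forall>L\<ge>L0. c + log 2 L < d * L"
proof -
  have "((\<lambda>L::real. (ln L / L) / ln 2) \<longlongrightarrow> 0 / ln 2) at_top"
    by (intro tendsto_divide ln_x_over_x_tendsto_0 tendsto_const) auto
  then have "\<forall>\<^sub>F L in at_top. (ln L / L) / ln 2 < d / 2"
    using assms by (intro order_tendstoD) auto
  then have "\<forall>\<^sub>F L::real in at_top. c + log 2 L < d * L"
    using eventually_gt_at_top[of "max 1 (2 * c / d)"]
  proof eventually_elim
    fix L :: real assume L: "ln L / L / ln 2 < d / 2" "max 1 (2 * c / d) < L"
    then have L0: "0 < L" "2 * c < d * L" using assms by (simp_all add: divide_less_eq mult.commute)
    have "log 2 L = (ln L / L / ln 2) * L" using L0 by (simp add: log_def)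
    also have "\<dots> < (d / 2) * L" using L(1) L0 by (intro mult_strict_right_mono) auto
    finally show "c + log 2 L < d * L" using L0 by simp
  qed
  then obtain L0 where "\<And>L. L \<ge> L0 \<Longrightarrow> c + log 2 L < d * L"
    unfolding eventually_at_top_linorder by blast
  then show ?thesis by blast
qed

context weights begin

text \<open>In each coordinate at most three labels are within 1 of the given one, out of about
  \<open>2 powr (Lam * (w - s))\<close> cells in all.\<close>

lemma freq_unseparated:
  assumes b: "b \<in> extensional N" and w: "s \<le> w" "w \<le> t"
  shows "freq (dn N t s b) (\<lambda>y. \<forall>i\<in>N. \<bar>up N t w y0 i - up N t w y i\<bar> < 2)
    \<le> 3 ^ CARD('n) * 2 ^ CARD('n) * 2 powr (- Lam * real_of_int (w - s))"
proof -
  define c where "c = up N t w y0"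
  have "freq (dn N t s b) (\<lambda>y. \<forall>i\<in>N. \<bar>up N t w y0 i - up N t w y i\<bar> < 2)
      = freq (dn N w s b) (\<lambda>z. \<forall>i\<in>N. \<bar>c i - z i\<bar> < 2)"
    using avg_dn_up[OF coarser_N[OF w(2)] coarser_N[OF w(1)] b, of "\<lambda>z. of_bool (\<forall>i\<in>N. \<bar>c i - z i\<bar> < 2)"]
    by (simp add: c_def)
  also have "\<dots> = real (card {z \<in> dn N w s b. \<forall>i\<in>N. \<bar>c i - z i\<bar> < 2}) / real (card (dn N w s b))"
    by (simp add: freq_card)
  also have "\<dots> \<le> 3 ^ CARD('n) / 2 powr (Lam * real_of_int (w - s) - CARD('n))"
  proof (intro frac_le)
    have sub: "{z \<in> dn N w s b. \<forall>i\<in>N. \<bar>c i - z i\<bar> < 2} \<subseteq> PiE N (\<lambda>i. {c i - 1..c i + 1})"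
    proof
      fix z assume z: "z \<in> {z \<in> dn N w s b. \<forall>i\<in>N. \<bar>c i - z i\<bar> < 2}"
      show "z \<in> PiE N (\<lambda>i. {c i - 1..c i + 1})"
      proof (rule PiE_I)
        fix i assume "i \<in> N"
        then have "\<bar>c i - z i\<bar> < 2" using z by blast
        then show "z i \<in> {c i - 1..c i + 1}" by (simp add: abs_less_iff)
      next
        fix i assume "i \<notin> N"
        then show "z i = undefined" using z dn_ext[of z N w s b] by (auto simp: extensional_def)
      qed
    qed
    have "card {z \<in> dn N w s b. \<forall>i\<in>N. \<bar>c i - z i\<bar> < 2} \<le> card (PiE N (\<lambda>i. {c i - 1..c i + 1}))"
      by (intro card_mono sub finite_PiE) auto
    also have "\<dots> = 3 ^ card N" by (simp add: card_PiE)
    also have "\<dots> \<le> 3 ^ CARD('n)" by (intro power_increasing card_mono) auto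
    finally have "real (card {z \<in> dn N w s b. \<forall>i\<in>N. \<bar>c i - z i\<bar> < 2}) \<le> real (3 ^ CARD('n))"
      by (simp only: of_nat_le_iff)
    then show "real (card {z \<in> dn N w s b. \<forall>i\<in>N. \<bar>c i - z i\<bar> < 2}) \<le> 3 ^ CARD('n)" by simp
    show "2 powr (Lam * real_of_int (w - s) - CARD('n)) \<le> real (card (dn N w s b))"
      using card_dn_N(2)[OF w(1)] by simp
  qed auto
  also have "\<dots> = 3 ^ CARD('n) * 2 ^ CARD('n) * 2 powr (- Lam * real_of_int (w - s))"
  proof -
    have "3 ^ CARD('n) / 2 powr (A - CARD('n)) = 3 ^ CARD('n) * 2 ^ CARD('n) * 2 powr (- A)" for A :: real
      by (simp add: powr_diff powr_realpow powr_minus divide_inverse)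
    then show ?thesis by simp
  qed
  finally show ?thesis .
qed

end

section \<open>Lines from a fixed lower end\<close>

context embedding begin

text \<open>In contrast to \<open>energy_le\<close>, the lower end is fixed and only the
  continuation \<open>y\<close> is averaged, so a bound holds at every point and not merely at most
  points.\<close>

definition up_energy_le :: "int \<Rightarrow> real \<Rightarrow> bool" where
  "up_energy_le r c \<longleftrightarrow> (\<forall>s. \<forall>x\<in>extensional P. \<forall>b\<in>extensional N.
     avg (dn N (s + r) s b) (\<lambda>y. (F (mk (s + r) (up P s (s + r) x) y) - F (mk s x b))\<^sup>2) \<le> c * (real_of_int r)\<^sup>2)"

lemma up_energy_window:
  assumes e: "up_energy_le r c" and r: "0 \<le> r" "s \<le> u" "u + r \<le> t" and xb: "x \<in> extensional P" "b \<in> extensional N"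
  shows "avg (dn N t s b) (\<lambda>y. (F (line s t x y (u + r)) - F (line s t x y u))\<^sup>2) \<le> c * (real_of_int r)\<^sup>2"
proof -
  let ?v = "u + r"
  let ?x = "up P s u x"
  let ?G = "\<lambda>y. (F (mk ?v (up P u ?v ?x) y) - F (mk u ?x (up N ?v u y)))\<^sup>2"
  have "avg (dn N t s b) (\<lambda>y. (F (line s t x y ?v) - F (line s t x y u))\<^sup>2)
     = avg (dn N t s b) (\<lambda>y. ?G (up N t ?v y))"
    using r by (intro avg_cong) (auto simp: line_def up_up coarser_P coarser_N)
  also have "\<dots> = avg (dn N ?v s b) ?G"
    using r xb by (intro avg_dn_up coarser_N) auto
  also have "\<dots> = avg (dn N u s b) (\<lambda>b'. avg (dn N ?v u b') ?G)"
    using r xb by (intro avg_dn_tower coarser_N) auto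
  also have "\<dots> \<le> c * (real_of_int r)\<^sup>2"
  proof (rule avg_le[OF finite_dn dn_ne])
    fix b' assume b': "b' \<in> dn N u s b"
    then have ex: "b' \<in> extensional N" by (rule dn_ext)
    have "avg (dn N ?v u b') ?G = avg (dn N ?v u b') (\<lambda>y. (F (mk ?v (up P u ?v ?x) y) - F (mk u ?x b'))\<^sup>2)"
      using up_dn[OF ex] by (intro avg_cong) auto
    also have "\<dots> \<le> c * (real_of_int r)\<^sup>2" using e ex by (simp add: up_energy_le_def)
    finally show "avg (dn N ?v u b') ?G \<le> c * (real_of_int r)\<^sup>2" .
  qed
  finally show ?thesis .
qed

lemma up_line_ends:
  assumes "s \<le> t" "x \<in> extensional P" "b \<in> extensional N" "y \<in> dn N t s b"
  shows "line s t x y s = mk s x b" "line s t x y t = mk t (up P s t x) y"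
  using assms by (simp_all add: line_def up_self dn_ext up_dn)

lemma up_energy_le_kappa: "up_energy_le 1 (\<kappa>\<^sup>2)"
  unfolding up_energy_le_def
proof (intro allI ballI avg_le)
  fix s :: int and x b :: "'n \<Rightarrow> int" and y assume xb: "x \<in> extensional P" "b \<in> extensional N" and y: "y \<in> dn N (s + 1) s b"
  have "\<bar>F (line s (s + 1) x y (s + 1)) - F (line s (s + 1) x y s)\<bar> \<le> \<kappa> * \<bar>real_of_int (s + 1) - real_of_int s\<bar>"
    using F_line[of s "s + 1" "s + 1" s x y] by simp
  then have "\<bar>F (mk (s + 1) (up P s (s + 1) x) y) - F (mk s x b)\<bar> \<le> \<kappa>"
    using up_line_ends[OF _ xb y] by simp
  then show "(F (mk (s + 1) (up P s (s + 1) x) y) - F (mk s x b))\<^sup>2 \<le> \<kappa>\<^sup>2 * (real_of_int 1)\<^sup>2"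
    using power_mono[of "\<bar>F (mk (s + 1) (up P s (s + 1) x) y) - F (mk s x b)\<bar>" \<kappa> 2] by simp
qed auto

lemma mono_path_weaken: "mono_path \<sigma> e s t x y \<Longrightarrow> e \<le> e' \<Longrightarrow> mono_path \<sigma> e' s t x y"
  unfolding mono_path_def by (meson neg_le_iff_le order.trans)

text \<open>With monotonicity error \<open>2 * (\<zeta> * L)\<close> and drift factor
  \<open>L * 2 powr \<kappa>\<close>, \<open>quad_bound\<close> is
  \<open>\<zeta> * (4 + 4 * lmx) * L\<close> plus a logarithm and a constant. For small
  \<open>\<zeta>\<close> the separation wins, as it is linear in \<open>L\<close> with a slope that
  depends on \<open>\<epsilon>1\<close> but not on \<open>\<zeta>\<close>.\<close>

lemma quad_contradiction:
  fixes \<epsilon>1 :: real and q :: int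
  assumes e1: "0 < \<epsilon>1" "\<epsilon>1 \<le> 1"
  shows "\<exists>\<zeta>>0. \<zeta> \<le> \<epsilon>1 / 2 \<and> (\<exists>L0. \<forall>L\<ge>L0. \<alpha> * quad_bound (2 * (\<zeta> * real_of_int L)) (real_of_int L * 2 powr \<kappa>) + \<beta>
     < lmn * (\<epsilon>1 * real_of_int L / 2 / \<kappa> - real_of_int q) - 1)"
proof -
  have k: "0 < \<kappa>" "1 \<le> \<kappa>" using kappa_ge_1 by auto
  \<comment> \<open>This makes \<open>\<alpha> * (2 * (d * L))\<close> half of the main term
    \<open>lmn * \<epsilon>1 * L / (2 * \<kappa>)\<close> on the right.\<close>
  define d where "d = lmn * \<epsilon>1 / (8 * \<kappa> * \<alpha>)"
  have d: "0 < d" using lmn_pos e1 k alpha by (simp add: d_def)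
  define \<zeta> where "\<zeta> = min (\<epsilon>1 / 2) (d / (4 + 4 * lmx))"
  have l4: "0 < 4 + 4 * lmx" using lmx_nonneg by simp
  have \<zeta>: "0 < \<zeta>" "\<zeta> \<le> \<epsilon>1 / 2" "\<zeta> * (4 + 4 * lmx) \<le> d"
  proof -
    show "0 < \<zeta>" using e1 d l4 by (auto simp: \<zeta>_def)
    show "\<zeta> \<le> \<epsilon>1 / 2" unfolding \<zeta>_def by (rule min.cobounded1)
    have "\<zeta> \<le> d / (4 + 4 * lmx)" by (simp add: \<zeta>_def)
    then show "\<zeta> * (4 + 4 * lmx) \<le> d" using l4 by (simp add: pos_le_divide_eq)
  qed
  define c where "c = 2 * \<kappa> + 2 * lmx * \<kappa> + 2 + \<kappa> + (\<beta> + lmn * q + 1) / \<alpha>"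
  obtain L0 where L0: "\<And>L. L \<ge> L0 \<Longrightarrow> c + log 2 L < d * L" using log_small[OF d, of c] by blast
  have "\<alpha> * quad_bound (2 * (\<zeta> * real_of_int L)) (real_of_int L * 2 powr \<kappa>) + \<beta>
     < lmn * (\<epsilon>1 * real_of_int L / 2 / \<kappa> - real_of_int q) - 1" if L: "L \<ge> max 1 \<lceil>L0\<rceil>" for L :: int
  proof -
    define l where "l = real_of_int L"
    have l: "1 \<le> l" "L0 \<le> l" using L unfolding l_def by linarith+
    have lg: "log 2 (4 * (l * 2 powr \<kappa>)) = 2 + log 2 l + \<kappa>"
    proof -
      have "log 2 (4::real) = 2" using log_pow_cancel[of "2::real" 2] by simp
      then show ?thesis using l by (simp add: log_mult)
    qed
    have "quad_bound (2 * (\<zeta> * l)) (l * 2 powr \<kappa>) = \<zeta> * (4 + 4 * lmx) * l + (2 * \<kappa> + 2 * lmx * \<kappa> + 2 + \<kappa>) + log 2 l"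
      unfolding quad_bound_def lg by (simp add: algebra_simps)
    moreover have "\<zeta> * (4 + 4 * lmx) * l \<le> d * l" using \<zeta>(3) l by (intro mult_right_mono) auto
    ultimately have "quad_bound (2 * (\<zeta> * l)) (l * 2 powr \<kappa>) + (\<beta> + lmn * q + 1) / \<alpha> < 2 * (d * l)"
      using L0[OF l(2)] by (simp add: c_def)
    moreover have dd: "\<alpha> * (B + X / \<alpha>) = \<alpha> * B + X" for B X using alpha by (simp add: distrib_left)
    ultimately have "\<alpha> * (quad_bound (2 * (\<zeta> * l)) (l * 2 powr \<kappa>) + (\<beta> + lmn * q + 1) / \<alpha>) < \<alpha> * (2 * (d * l))"
      using alpha by (intro mult_strict_left_mono) auto
    then have "\<alpha> * quad_bound (2 * (\<zeta> * l)) (l * 2 powr \<kappa>) + \<beta> + lmn * q + 1 < \<alpha> * (2 * (d * l))"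
      unfolding dd by simp
    also have "\<dots> = lmn * \<epsilon>1 * l / (4 * \<kappa>)" using alpha k by (simp add: d_def field_simps)
    also have "\<dots> \<le> lmn * (\<epsilon>1 * l / 2 / \<kappa>)"
      using lmn_pos e1 k l by (simp add: field_simps)
    finally show ?thesis by (simp add: l_def right_diff_distrib)
  qed
  then show ?thesis using \<zeta>(1,2) by blast
qed

end

lemma freq_less_ex:
  assumes "freq A R < freq A Q" shows "\<exists>a\<in>A. Q a \<and> \<not> R a"
proof (rule ccontr)
  assume "\<not> ?thesis"
  then have "freq A Q \<le> freq A R" by (intro freq_mono) auto
  then show False using assms by simp
qed

context quasi begin

text \<open>At a nearly extremal point \<open>F\<close> is almost affine on most lines going up. If its slope exceeded 1, comparison
  with a typical line \<open>x'\<close> of the slab, which has slope 1, would produce a forbidden quadrilateral.\<close>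

lemma up_energy_le_1:
  assumes "0 < \<epsilon>" shows "\<exists>r\<ge>1. up_energy_le r (1 + \<epsilon>)"
proof -
  define n where "n = CARD('n)"
  define S where "S = {c. \<exists>r\<ge>1. up_energy_le r c}"
  define e where "e = Inf S"
  have S0: "0 \<le> c" if cS: "c \<in> S" for c
  proof -
    obtain r where r: "1 \<le> r" "up_energy_le r c" using cS by (auto simp: S_def)
    have "0 \<le> avg (dn N (0 + r) 0 (restrict (\<lambda>_. 0) N))
       (\<lambda>y. (F (mk (0 + r) (up P 0 (0 + r) (restrict (\<lambda>_. 0) P)) y) - F (mk 0 (restrict (\<lambda>_. 0) P) (restrict (\<lambda>_. 0) N)))\<^sup>2)"
      by (intro avg_nonneg) auto
    also have "\<dots> \<le> c * (real_of_int r)\<^sup>2" using r(2) unfolding up_energy_le_def by blast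
    finally show ?thesis using r(1) by (simp add: zero_le_mult_iff)
  qed
  have Sne: "S \<noteq> {}" using up_energy_le_kappa by (auto simp: S_def)
  have bdd: "bdd_below S" using S0 by (rule bdd_belowI)
  have mono: "up_energy_le r d" if "up_energy_le r c" "c \<le> d" for r c d
    using that unfolding up_energy_le_def
    by (meson mult_right_mono order.trans zero_le_power2)
  have "e \<le> 1"
  proof (rule ccontr)
    assume "\<not> e \<le> 1"
    define g where "g = e - 1"
    have g: "0 < g" using \<open>\<not> e \<le> 1\<close> by (simp add: g_def)
    define \<epsilon>1 where "\<epsilon>1 = min 1 (g / 10)"
    have e1: "0 < \<epsilon>1" "\<epsilon>1 \<le> 1" "\<epsilon>1 \<le> g / 10" using g by (auto simp: \<epsilon>1_def)
    have k0: "0 < \<kappa>" "0 < \<kappa>\<^sup>2" "1 \<le> \<kappa>" using kappa_ge_1 by auto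
    define \<theta> where "\<theta> = min 1 (g / (8 * \<kappa>\<^sup>2))"
    have \<theta>: "0 < \<theta>" "\<theta> \<le> 1" "2 * (\<kappa>\<^sup>2 * \<theta>) \<le> g / 4"
    proof -
      show "0 < \<theta>" "\<theta> \<le> 1" using g k0 by (auto simp: \<theta>_def)
      have "\<kappa>\<^sup>2 * \<theta> \<le> \<kappa>\<^sup>2 * (g / (8 * \<kappa>\<^sup>2))" using k0 by (intro mult_left_mono) (auto simp: \<theta>_def)
      then show "2 * (\<kappa>\<^sup>2 * \<theta>) \<le> g / 4" using k0 by simp
    qed
    obtain Q0 where Q0: "\<And>L. L \<ge> Q0 \<Longrightarrow> 3 ^ n * 2 ^ n * L ^ 0 * 2 powr (- Lam * L) \<le> \<theta> / 16"
      using poly_exp_small[OF Lam_pos, of "\<theta> / 16" "3 ^ n * 2 ^ n" 0] \<theta> by auto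
    \<comment> \<open>At height \<open>s + q\<close> all but a fraction \<open>\<theta> / 16\<close>
      of the lines are separated from any given one.\<close>
    define q where "q = max 0 \<lceil>Q0\<rceil>"
    have q: "0 \<le> q" "Q0 \<le> real_of_int q" unfolding q_def by linarith+
    obtain \<zeta> L1 where \<zeta>: "0 < \<zeta>" "\<zeta> \<le> \<epsilon>1 / 2" and
      qc: "\<And>L. L \<ge> L1 \<Longrightarrow> \<alpha> * quad_bound (2 * (\<zeta> * real_of_int L)) (real_of_int L * 2 powr \<kappa>) + \<beta>
        < lmn * (\<epsilon>1 * real_of_int L / 2 / \<kappa> - real_of_int q) - 1"
      using quad_contradiction[OF e1(1,2), of q] by blast
    define \<epsilon>4 where "\<epsilon>4 = min (\<zeta> / 2) (\<theta> / 2)"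
    have e4: "0 < \<epsilon>4" "\<epsilon>4 \<le> 1" "\<epsilon>4 \<le> \<theta> / 2" "2 * \<epsilon>4 \<le> \<zeta>"
    proof -
      have 1: "\<epsilon>4 \<le> \<zeta> / 2" "\<epsilon>4 \<le> \<theta> / 2" unfolding \<epsilon>4_def by simp_all
      then show "\<epsilon>4 \<le> 1" "\<epsilon>4 \<le> \<theta> / 2" "2 * \<epsilon>4 \<le> \<zeta>" using \<zeta> e1 by linarith+
      show "0 < \<epsilon>4" using \<zeta> \<theta> by (simp add: \<epsilon>4_def)
    qed
    obtain L2 where L2: "\<And>L s a b. L \<ge> L2 \<Longrightarrow> a \<in> extensional P \<Longrightarrow> b \<in> extensional N \<Longrightarrow>
      freq (dn P s (s + L) a \<times> dn N (s + L) s b) (\<lambda>(x, y). \<not> (\<exists>\<sigma>. steep \<epsilon>4 s (s + L) x y \<sigma>)) \<le> \<epsilon>4"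
      using box_steep[OF e4(1,2)] by blast
    define \<eta>' where "\<eta>' = \<zeta> / 4"
    have \<eta>': "0 < \<eta>'" using \<zeta> by (simp add: \<eta>'_def)
    define \<epsilon>' where "\<epsilon>' = min (g / 10) (\<theta> * \<eta>'\<^sup>2 / 2)"
    have \<epsilon>': "0 < \<epsilon>'" "\<epsilon>' \<le> g / 10" "2 * \<epsilon>' / \<eta>'\<^sup>2 \<le> \<theta>"
    proof -
      show "0 < \<epsilon>'" "\<epsilon>' \<le> g / 10" using g \<theta> \<eta>' by (auto simp: \<epsilon>'_def)
      have "\<epsilon>' \<le> \<theta> * \<eta>'\<^sup>2 / 2" by (simp add: \<epsilon>'_def)
      then show "2 * \<epsilon>' / \<eta>'\<^sup>2 \<le> \<theta>" using \<eta>' by (simp add: divide_le_eq)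
    qed
    obtain c0 where c0: "c0 \<in> S" "c0 < e + \<epsilon>'"
      using cInf_lessD[OF Sne, of "e + \<epsilon>'"] \<epsilon>' by (auto simp: e_def)
    then obtain r where r: "1 \<le> r" "up_energy_le r c0" by (auto simp: S_def)
    have er: "up_energy_le r (e + \<epsilon>')" using mono[OF r(2)] c0(2) by simp
    define m where "m = 1 + nat L1 + nat L2 + nat q + nat \<lceil>4 * \<kappa> / \<zeta>\<rceil>"
    have m: "1 \<le> m" "L1 \<le> int m" "L2 \<le> int m" "q \<le> int m" "4 * \<kappa> / \<zeta> \<le> m" unfolding m_def by linarith+
    define L where "L = int m * r"
    have mL: "int m \<le> L" using r(1) by (simp add: L_def mult_le_cancel_left1)
    then have L: "1 \<le> L" "L1 \<le> L" "L2 \<le> L" "q \<le> L" using m by linarith+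
    define l where "l = real_of_int L"
    have l: "1 \<le> l" using L(1) by (simp add: l_def)
    have l2: "l = real m * real_of_int r" by (simp add: l_def L_def)
    have \<kappa>r: "4 * (\<kappa> * r) \<le> \<zeta> * l"
    proof -
      have "4 * \<kappa> \<le> \<zeta> * m" using m(5) \<zeta> by (simp add: divide_le_eq mult.commute)
      then have "4 * \<kappa> * r \<le> \<zeta> * m * r" using r(1) by (intro mult_right_mono) auto
      then show ?thesis by (simp add: l2 mult.assoc)
    qed
    have "e - \<epsilon>' \<notin> S" using cInf_lower[OF _ bdd, of "e - \<epsilon>'"] \<epsilon>' by (auto simp: e_def)
    then have "\<not> up_energy_le L (e - \<epsilon>')" using L(1) by (auto simp: S_def)
    then obtain s x b where xb: "x \<in> extensional P" "b \<in> extensional N" and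
      big: "(e - \<epsilon>') * (real_of_int L)\<^sup>2
        < avg (dn N (s + L) s b) (\<lambda>y. (F (mk (s + L) (up P s (s + L) x) y) - F (mk s x b))\<^sup>2)"
      unfolding up_energy_le_def by (auto simp: not_le)
    define t where "t = s + L"
    define a where "a = up P s t x"
    have a: "a \<in> extensional P" by (simp add: a_def)
    have xa: "x \<in> dn P s t a" using xb by (simp add: mem_dn_up a_def)
    have st: "s \<le> t" using L(1) by (simp add: t_def)
    let ?Y = "dn N t s b"
    define h where "h j y = F (line s t x y (s + int j * r))" for j y
    have jr: "int j * r \<le> L" "0 \<le> int j * r" if "j \<le> m" for j
      using that r(1) unfolding L_def by (auto intro: mult_right_mono)
    have ends: "h 0 y = F (mk s x b)" "h m y = F (mk t a y)" if "y \<in> ?Y" for y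
      using up_line_ends[OF st xb that] by (simp_all add: h_def t_def L_def a_def)
    define Bad where "Bad y \<longleftrightarrow> (\<exists>j\<le>m. \<bar>h j y - h 0 y - real j / real m * (h m y - h 0 y)\<bar>
        \<ge> \<eta>' * (real m * real_of_int r))" for y
    define D where "D y = (h m y - h 0 y) / l" for y
    have hD: "h m y - h 0 y = D y * l" for y using l by (simp add: D_def)
    have avg_h: "avg ?Y (\<lambda>y. (h m y - h 0 y)\<^sup>2)
          = avg ?Y (\<lambda>y. (F (mk (s + L) (up P s (s + L) x) y) - F (mk s x b))\<^sup>2)"
      using ends by (intro avg_cong) (auto simp: t_def a_def)
    have fB: "freq ?Y Bad \<le> \<theta>"
    proof -
      have "freq ?Y Bad \<le> 2 * \<epsilon>' / \<eta>'\<^sup>2"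
        unfolding Bad_def
      proof (rule near_affine[where e = e])
        show "(e - \<epsilon>') * (real m * real_of_int r)\<^sup>2 \<le> avg ?Y (\<lambda>y. (h m y - h 0 y)\<^sup>2)"
          unfolding avg_h using big l2 by (simp add: t_def l_def)
        fix j assume j: "j < m"
        have "avg ?Y (\<lambda>y. (F (line s t x y (s + int j * r + r)) - F (line s t x y (s + int j * r)))\<^sup>2)
            \<le> (e + \<epsilon>') * (real_of_int r)\<^sup>2"
          using jr[of j] jr[of "Suc j"] j r(1) xb
          by (intro up_energy_window[OF er]) (auto simp: t_def algebra_simps)
        then show "avg ?Y (\<lambda>y. (h (Suc j) y - h j y)\<^sup>2) \<le> (e + \<epsilon>') * (real_of_int r)\<^sup>2"
          by (simp add: h_def algebra_simps)
      qed (use r(1) \<eta>' m(1) in auto)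
      then show ?thesis using \<epsilon>' by linarith
    qed
    have eD: "e - \<epsilon>' \<le> avg ?Y (\<lambda>y. (D y)\<^sup>2)"
    proof -
      have "(e - \<epsilon>') * l\<^sup>2 \<le> avg ?Y (\<lambda>y. (h m y - h 0 y)\<^sup>2)" unfolding avg_h using big by (simp add: t_def l_def)
      also have "\<dots> = l\<^sup>2 * avg ?Y (\<lambda>y. (D y)\<^sup>2)"
        unfolding avg_cmult[symmetric] hD by (simp add: power_mult_distrib mult.commute)
      finally have "(e - \<epsilon>') * l\<^sup>2 \<le> avg ?Y (\<lambda>y. (D y)\<^sup>2) * l\<^sup>2" by (simp only: mult.commute)
      moreover have "0 < l\<^sup>2" using l by simp
      ultimately show ?thesis by (simp only: mult_le_cancel_right_pos)
    qed
    define Y1 where "Y1 y \<longleftrightarrow> \<not> Bad y \<and> 1 + \<epsilon>1 < \<bar>D y\<bar>" for y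
    have fY1: "freq ?Y Y1 \<le> \<theta>"
    proof (rule ccontr)
      assume nY1: "\<not> freq ?Y Y1 \<le> \<theta>"
      \<comment> \<open>Averaging \<open>box_steep\<close> over the lower end gives one lower end
        from which most lines are steep.\<close>
      obtain x' where x': "x' \<in> dn P s t a" "freq ?Y (\<lambda>y. \<not> (\<exists>\<sigma>. steep \<epsilon>4 s t x' y \<sigma>)) \<le> \<epsilon>4"
      proof -
        have "avg (dn P s t a) (\<lambda>x. freq ?Y (\<lambda>y. \<not> (\<exists>\<sigma>. steep \<epsilon>4 s t x y \<sigma>))) \<le> \<epsilon>4"
          using L2[OF L(3) a xb(2), of s] unfolding t_def[symmetric] by (simp add: avg_Times)
        then show ?thesis
          using ex_le_avg[OF finite_dn dn_ne, of P s t a "\<lambda>x. freq ?Y (\<lambda>y. \<not> (\<exists>\<sigma>. steep \<epsilon>4 s t x y \<sigma>))"] that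
          by force
      qed
      define Z where "Z \<sigma> \<sigma>' y \<longleftrightarrow> \<not> Bad y \<and> 1 + \<epsilon>1 < \<sigma> * D y \<and> steep \<epsilon>4 s t x' y \<sigma>'" for \<sigma> \<sigma>' y
      define J where "J = ({1, -1} \<times> {1, -1} :: (real \<times> real) set)"
      \<comment> \<open>Pigeonhole over the directions of the lines from \<open>x\<close> and from
        \<open>x'\<close>. Four classes of frequency at most \<open>\<theta> / 8\<close> would make
        up at most \<open>\<theta> / 2\<close>, and the lines from \<open>x'\<close> that are not
        steep at most another \<open>\<theta> / 2\<close>.\<close>
      have "\<exists>j\<in>J. \<theta> / 8 < freq ?Y (Z (fst j) (snd j))"
      proof (rule ccontr)
        assume "\<not> ?thesis"
        then have le: "freq ?Y (Z (fst j) (snd j)) \<le> \<theta> / 8" if "j \<in> J" for j using that by (auto simp: not_less)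
        have "freq ?Y Y1 \<le> freq ?Y (\<lambda>y. (\<exists>j\<in>J. Z (fst j) (snd j) y) \<or> \<not> (\<exists>\<sigma>. steep \<epsilon>4 s t x' y \<sigma>))"
        proof (rule freq_mono)
          fix y assume y: "Y1 y"
          show "(\<exists>j\<in>J. Z (fst j) (snd j) y) \<or> \<not> (\<exists>\<sigma>. steep \<epsilon>4 s t x' y \<sigma>)"
          proof (cases "\<exists>\<sigma>. steep \<epsilon>4 s t x' y \<sigma>")
            case True
            then obtain \<sigma>' where \<sigma>': "steep \<epsilon>4 s t x' y \<sigma>'" by blast
            then have s': "\<sigma>' \<in> {1, -1}" by (auto simp: steep_def mono_path_def)
            define \<sigma> :: real where "\<sigma> = (if 0 < D y then 1 else -1)"
            have "Z \<sigma> \<sigma>' y" using y \<sigma>' by (auto simp: Z_def Y1_def \<sigma>_def split: if_splits)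
            moreover have "(\<sigma>, \<sigma>') \<in> J" using s' by (auto simp: J_def \<sigma>_def)
            ultimately show ?thesis by force
          qed simp
        qed
        also have "\<dots> \<le> \<theta>"
        proof (rule freq_disj_le[OF _ x'(2)])
          have "freq ?Y (\<lambda>y. \<exists>j\<in>J. Z (fst j) (snd j) y) \<le> (\<Sum>j\<in>J. freq ?Y (Z (fst j) (snd j)))"
            by (rule freq_Ex) (simp add: J_def)
          also have "\<dots> \<le> real (card J) * (\<theta> / 8)" using le by (rule sum_bounded_above)
          also have "card J = 4" by (simp add: J_def card_cartesian_product)
          finally show "freq ?Y (\<lambda>y. \<exists>j\<in>J. Z (fst j) (snd j) y) \<le> \<theta> / 2" by simp
        qed (use e4 in linarith)
        finally show False using nY1 by simp
      qed
      then obtain j where j: "j \<in> J" "\<theta> / 8 < freq ?Y (Z (fst j) (snd j))" by blast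
      define \<sigma> \<sigma>' where "\<sigma> = fst j" and "\<sigma>' = snd j"
      have \<sigma>: "\<bar>\<sigma>\<bar> = 1" "\<sigma>' = \<sigma> \<or> \<sigma>' = - \<sigma>" using j(1) by (auto simp: J_def \<sigma>_def \<sigma>'_def)
      have fZ: "\<theta> / 8 < freq ?Y (Z \<sigma> \<sigma>')" using j(2) by (simp add: \<sigma>_def \<sigma>'_def)
      have "freq ?Y (\<lambda>_. False) < freq ?Y (Z \<sigma> \<sigma>')" using fZ \<theta>(1) by (simp add: avg_const)
      from freq_less_ex[OF this] obtain y1 where y1: "y1 \<in> ?Y" "Z \<sigma> \<sigma>' y1" by blast
      define w where "w = s + q"
      have w: "s \<le> w" "w \<le> t" using q L by (auto simp: w_def t_def)
      have "freq ?Y (\<lambda>y. \<forall>i\<in>N. \<bar>up N t w y1 i - up N t w y i\<bar> < 2) \<le> \<theta> / 16"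
        using freq_unseparated[OF xb(2) w, of y1] Q0[OF q(2)] by (simp add: w_def n_def)
      then have "freq ?Y (\<lambda>y. \<forall>i\<in>N. \<bar>up N t w y1 i - up N t w y i\<bar> < 2) < freq ?Y (Z \<sigma> \<sigma>')"
        using fZ \<theta>(1) by linarith
      from freq_less_ex[OF this] obtain y2 i where y2: "y2 \<in> ?Y" "Z \<sigma> \<sigma>' y2" and
        i: "i \<in> N" "2 \<le> \<bar>up N t w y1 i - up N t w y2 i\<bar>" by (auto simp: not_less)
      have Zy: "y \<in> ?Y" "\<not> Bad y" "1 + \<epsilon>1 < \<sigma> * D y" "steep \<epsilon>4 s t x' y \<sigma>'" if "y \<in> {y1, y2}" for y
        using that y1 y2 by (auto simp: Z_def)
      have tsl: "real_of_int (t - s) = l" by (simp add: t_def l_def)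
      have mono_x: "mono_path \<sigma> (\<zeta> * l) s t x y" if y: "y \<in> {y1, y2}" for y
        unfolding mono_path_def
      proof (intro conjI allI impI \<sigma>(1))
        fix u v assume uv: "s \<le> u" "u \<le> v" "v \<le> t"
        let ?i = "nat ((u - s) div r)" and ?j = "nat ((v - s) div r)"
        have mm: "m = nat (L div r)" using r(1) by (simp add: L_def)
        have ij: "?i \<le> ?j" using uv r by (intro nat_mono zdiv_mono1) auto
        have v': "s \<le> v" "v \<le> s + L" and u': "u \<le> s + L" using uv by (auto simp: t_def)
        have jm: "?j \<le> m" by (rule grid(1)[OF r(1) v' mm])
        have aff: "\<bar>h j y - h 0 y - real j / real m * (h m y - h 0 y)\<bar> < \<eta>' * l" if "j \<le> m" for j
          using Zy(2)[OF y] that unfolding Bad_def l2 by (meson not_le)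
        have lin: "\<sigma> * (hj - hi) \<ge> - (2 * E)" if "\<bar>hj - h0 - aj * d\<bar> < E" "\<bar>hi - h0 - ai * d\<bar> < E" "ai \<le> aj" "0 < \<sigma> * d"
          for hj hi h0 aj ai d E :: real
        proof -
          have "\<sigma> * (hj - hi) = \<sigma> * (hj - h0 - aj * d) - \<sigma> * (hi - h0 - ai * d) + (aj - ai) * (\<sigma> * d)"
            by (simp add: algebra_simps)
          moreover have "0 \<le> (aj - ai) * (\<sigma> * d)" using that by simp
          moreover have "\<bar>\<sigma> * (hj - h0 - aj * d)\<bar> < E" "\<bar>\<sigma> * (hi - h0 - ai * d)\<bar> < E"
            using that \<sigma>(1) by (simp_all add: abs_mult)
          ultimately show ?thesis by linarith
        qed
        have "0 < \<sigma> * (h m y - h 0 y)"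
        proof -
          have "0 < \<sigma> * D y * l" using Zy(3)[OF y] e1 l by simp
          then show ?thesis by (simp add: hD mult.assoc)
        qed
        then have 1: "- (2 * (\<eta>' * l)) \<le> \<sigma> * (h ?j y - h ?i y)"
          using aff[of ?i] aff[of ?j] ij jm m(1)
          by (intro lin[of _ "h 0 y" "real ?j / real m" "h m y - h 0 y" _ _ "real ?i / real m"]) (auto intro!: divide_right_mono)
        have 2: "\<bar>F (line s t x y u) - h ?i y\<bar> \<le> \<kappa> * r" "\<bar>F (line s t x y v) - h ?j y\<bar> \<le> \<kappa> * r"
          unfolding h_def t_def by (rule grid(5)[OF r(1) uv(1) u' mm], rule grid(5)[OF r(1) v' mm])
        have fin: "- E \<le> \<sigma> * (fv - fu)" if "- (2 * d) \<le> \<sigma> * (hj - hi)" "\<bar>fu - hi\<bar> \<le> k" "\<bar>fv - hj\<bar> \<le> k" "2 * d + 2 * k \<le> E"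
          for d hj hi fu fv k E :: real
        proof -
          have "\<sigma> * (fv - fu) = \<sigma> * (hj - hi) + \<sigma> * (fv - hj) - \<sigma> * (fu - hi)" by (simp add: algebra_simps)
          moreover have "\<bar>\<sigma> * (fv - hj)\<bar> \<le> k" "\<bar>\<sigma> * (fu - hi)\<bar> \<le> k" using that \<sigma>(1) by (simp_all add: abs_mult)
          ultimately show ?thesis using that by linarith
        qed
        have "2 * (\<eta>' * l) + 2 * (\<kappa> * r) \<le> \<zeta> * l" using \<kappa>r by (simp add: \<eta>'_def)
        then show "- (\<zeta> * l) \<le> \<sigma> * (F (line s t x y v) - F (line s t x y u))" by (rule fin[OF 1 2])
      qed
      have e4l: "\<epsilon>4 * l \<le> \<zeta> * l" "2 * (\<epsilon>4 * l) \<le> \<zeta> * l"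
        using mult_right_mono[OF e4(4), of l] l e4(1) by auto
      have mono_x': "mono_path \<sigma>' (\<zeta> * l) s t x' y" if "y \<in> {y1, y2}" for y
        using Zy(4)[OF that] e4l unfolding steep_def tsl by (blast intro: mono_path_weaken)
      have tops: "F (mk t a y) - F (mk s x b) = D y * l" "\<bar>\<sigma>' * (F (mk t a y) - F (mk s x' b)) - l\<bar> \<le> \<epsilon>4 * l"
        if y: "y \<in> {y1, y2}" for y
      proof -
        show "F (mk t a y) - F (mk s x b) = D y * l" using ends[OF Zy(1)[OF y]] hD[of y] by simp
        show "\<bar>\<sigma>' * (F (mk t a y) - F (mk s x' b)) - l\<bar> \<le> \<epsilon>4 * l"
          using Zy(4)[OF y] line_ends[OF st a xb(2) x'(1) Zy(1)[OF y]] unfolding steep_def tsl by simp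
      qed
      have M: "1 \<le> real_of_int (t - s) * 2 powr \<kappa>"
        unfolding tsl using mult_mono[of 1 l 1 "2 powr \<kappa>"] l k0 by (simp add: ge_one_powr_ge_zero)
      have \<zeta>l: "0 \<le> \<zeta> * l" "0 \<le> 2 * (\<zeta> * l)" using \<zeta> l by auto
      have qc': "\<alpha> * quad_bound (2 * (\<zeta> * l)) (real_of_int (t - s) * 2 powr \<kappa>) + \<beta> < lmn * (\<epsilon>1 * l / 2 / \<kappa> - real_of_int q) - 1"
        using qc[OF L(2)] unfolding tsl unfolding l_def .
      show False
      proof (cases "\<sigma>' = \<sigma>")
        case True
        \<comment> \<open>Both fans move in direction \<open>\<sigma>\<close> and share their upper
          ends. So the excess slope from \<open>x\<close> must be made up below: its image starts at
          least \<open>\<epsilon>1 * l / 2\<close> behind that of \<open>x'\<close>.\<close>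
        have "lmn * (\<epsilon>1 * l / 2 / \<kappa> - real_of_int (w - s)) - 1 \<le> \<alpha> * quad_bound (2 * (\<zeta> * l)) (real_of_int (t - s) * 2 powr \<kappa>) + \<beta>"
        proof (rule quad_same[OF \<sigma>(1) \<zeta>l(2) M w a xb(2) xa x'(1) y1(1) y2(1) i])
          show "mono_path \<sigma> (2 * (\<zeta> * l)) s t x y" "mono_path \<sigma> (2 * (\<zeta> * l)) s t x' y" if "y \<in> {y1, y2}" for y
            using mono_x[OF that] mono_x'[OF that] \<zeta>l True by (auto intro: mono_path_weaken)
          have A: "(1 + \<epsilon>1) * l \<le> \<sigma> * (F (mk t a y1) - F (mk s x b))"
          proof -
            have "(1 + \<epsilon>1) * l \<le> \<sigma> * D y1 * l" using Zy(3)[of y1] l by (intro mult_right_mono) auto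
            then show ?thesis using tops(1)[of y1] by (simp add: mult.assoc)
          qed
          have "\<epsilon>1 * l / 2 \<ge> \<epsilon>4 * l"
          proof -
            have "\<zeta> * l \<le> \<epsilon>1 / 2 * l" using \<zeta> l by (intro mult_right_mono) auto
            then show ?thesis using e4l(1) by simp
          qed
          then show "\<epsilon>1 * l / 2 \<le> \<sigma> * (F (mk s x' b) - F (mk s x b))"
            using A tops(2)[of y1] True by (simp add: algebra_simps abs_le_iff)
          show "0 < \<epsilon>1 * l / 2" using e1 l by simp
          show "0 \<le> \<sigma> * (F (mk t a y) - F (mk s x' b))" if "y \<in> {y1, y2}" for y
          proof -
            have "\<epsilon>4 * l \<le> 1 * l" using e4(2) l by (intro mult_right_mono) auto
            then show ?thesis using tops(2)[OF that] True by (simp add: abs_le_iff)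
          qed
        qed (rule drifts_line)+
        then show False using qc' by (simp add: w_def)
      next
        case False
        then have s': "\<sigma>' = - \<sigma>" using \<sigma> by simp
        \<comment> \<open>The directions are opposite. Both tops lie about \<open>l\<close> from the
          image of \<open>x'\<close>, on the same side, hence are nearly level. The bound now
          involves \<open>l - q\<close>, which is larger than the quantity already found to be too
          large.\<close>
        have "lmn * real_of_int (t - w) - 1 \<le> \<alpha> * quad_bound (2 * (\<zeta> * l)) (real_of_int (t - s) * 2 powr \<kappa>) + \<beta>"
        proof (rule quad_opp[OF \<sigma>(1) \<zeta>l(1) M w a xb(2) xa x'(1) y1(1) y2(1) i])
          show "mono_path \<sigma> (\<zeta> * l) s t x y" "mono_path (- \<sigma>) (\<zeta> * l) s t x' y" if "y \<in> {y1, y2}" for y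
            using mono_x[OF that] mono_x'[OF that] s' by auto
          have gen: "\<bar>T1 - T2\<bar> \<le> E" if "\<bar>\<sigma>' * (T1 - B) - l\<bar> \<le> d" "\<bar>\<sigma>' * (T2 - B) - l\<bar> \<le> d" "2 * d \<le> E" for T1 T2 B d E :: real
          proof -
            have "\<bar>\<sigma>'\<bar> = 1" using s' \<sigma> by simp
            then have "\<bar>T1 - T2\<bar> = \<bar>\<sigma>' * (T1 - T2)\<bar>" by (simp add: abs_mult)
            also have "\<sigma>' * (T1 - T2) = (\<sigma>' * (T1 - B) - l) - (\<sigma>' * (T2 - B) - l)" by (simp add: algebra_simps)
            finally show ?thesis using that by linarith
          qed
          show "\<bar>F (mk t a y1) - F (mk t a y2)\<bar> \<le> \<zeta> * l"
            by (rule gen[OF tops(2) tops(2) e4l(2)]) auto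
        qed (rule drifts_line)+
        then have "lmn * (l - q) < lmn * (\<epsilon>1 * l / 2 / \<kappa> - real_of_int q)"
          using qc' by (simp add: w_def t_def l_def)
        then have "l < \<epsilon>1 * l / 2 / \<kappa>" using lmn_pos by simp
        also have "\<dots> \<le> 1 * l / 2 / 1" using e1 l k0 by (intro frac_le mult_right_mono) auto
        finally show False using l by simp
      qed
    qed
    have D\<kappa>: "(D y)\<^sup>2 \<le> \<kappa>\<^sup>2" if "y \<in> ?Y" for y
    proof -
      have "\<bar>h m y - h 0 y\<bar> \<le> \<kappa> * l"
        using F_line[of s "s + int m * r" t "s + int 0 * r" x y] L(1) jr[of m]
        by (simp add: h_def t_def l2 L_def)
      then have "\<bar>D y\<bar> \<le> \<kappa>" using l by (simp add: D_def divide_le_eq)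
      then show ?thesis using power_mono[of "\<bar>D y\<bar>" \<kappa> 2] by simp
    qed
    have "avg ?Y (\<lambda>y. (D y)\<^sup>2) \<le> avg ?Y (\<lambda>y. (1 + \<epsilon>1)\<^sup>2 + \<kappa>\<^sup>2 * of_bool (Bad y \<or> Y1 y))"
    proof (rule avg_mono)
      fix y assume y: "y \<in> ?Y"
      show "(D y)\<^sup>2 \<le> (1 + \<epsilon>1)\<^sup>2 + \<kappa>\<^sup>2 * of_bool (Bad y \<or> Y1 y)"
      proof (cases "Bad y \<or> Y1 y")
        case True
        then show ?thesis using D\<kappa>[OF y] by (simp add: add_increasing)
      next
        case False
        then have "\<bar>D y\<bar> \<le> 1 + \<epsilon>1" by (auto simp: Y1_def not_less)
        then show ?thesis using power_mono[of "\<bar>D y\<bar>" "1 + \<epsilon>1" 2] False by simp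
      qed
    qed
    also have "\<dots> = (1 + \<epsilon>1)\<^sup>2 + \<kappa>\<^sup>2 * freq ?Y (\<lambda>y. Bad y \<or> Y1 y)"
      by (simp add: avg_add avg_cmult avg_const)
    also have "\<dots> \<le> (1 + 3 * \<epsilon>1) + \<kappa>\<^sup>2 * (2 * \<theta>)"
    proof (intro add_mono mult_left_mono)
      have "\<epsilon>1\<^sup>2 \<le> \<epsilon>1" using e1 by (simp add: power2_eq_square mult_left_le_one_le)
      then show "(1 + \<epsilon>1)\<^sup>2 \<le> 1 + 3 * \<epsilon>1" by (simp add: power2_eq_square algebra_simps)
      show "freq ?Y (\<lambda>y. Bad y \<or> Y1 y) \<le> 2 * \<theta>" by (rule freq_disj_le[OF fB fY1]) simp
    qed simp
    finally have "e - \<epsilon>' \<le> 1 + 3 * \<epsilon>1 + 2 * (\<kappa>\<^sup>2 * \<theta>)" using eD by (simp add: mult_ac)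
    then show False using \<theta>(3) e1(3) \<epsilon>'(2) g g_def by linarith
  qed
  then have "Inf S < 1 + \<epsilon>" using assms by (simp add: e_def)
  from cInf_lessD[OF Sne this] obtain c where c: "c \<in> S" "c < 1 + \<epsilon>" by blast
  then obtain r where r: "1 \<le> r" "up_energy_le r c" by (auto simp: S_def)
  then show ?thesis using mono[OF r(2), of "1 + \<epsilon>"] c(2) by auto
qed

lemma up_steep:
  fixes \<epsilon> :: real
  assumes \<epsilon>: "0 < \<epsilon>" "\<epsilon> \<le> 1"
  shows "\<exists>L0. \<forall>L\<ge>L0. \<forall>s. \<forall>x\<in>extensional P. \<forall>b\<in>extensional N.
    freq (dn N (s + L) s b) (\<lambda>y. \<not> (\<exists>\<sigma>. steep \<epsilon> s (s + L) x y \<sigma>)) \<le> \<epsilon>"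
proof -
  obtain \<delta> where \<delta>: "0 < \<delta>" "\<delta> < 1" and st: "\<And>r. r \<ge> 1 \<Longrightarrow> \<exists>L0. \<forall>L\<ge>L0. \<forall>s \<Omega>. finite \<Omega> \<longrightarrow> \<Omega> \<noteq> {} \<longrightarrow>
    (\<forall>u. s \<le> u \<longrightarrow> u + r \<le> s + L \<longrightarrow>
      avg \<Omega> (\<lambda>(x, y). (F (line s (s + L) x y (u + r)) - F (line s (s + L) x y u))\<^sup>2) \<le> (1 + \<delta>) * (real_of_int r)\<^sup>2) \<longrightarrow>
    freq \<Omega> (\<lambda>(x, y). \<forall>u\<in>{s..s+L}. \<forall>v\<in>{s..s+L}.
      F (line s (s + L) x y u) - F (line s (s + L) x y v) < (1 - \<delta>) * real_of_int L) \<le> \<delta> \<longrightarrow>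
    freq \<Omega> (\<lambda>(x, y). \<not> (\<exists>\<sigma>. steep \<epsilon> s (s + L) x y \<sigma>)) \<le> \<epsilon>"
    using mostly_steep[OF \<epsilon>] by blast
  obtain r where r: "1 \<le> r" "up_energy_le r (1 + \<delta>)" using up_energy_le_1[OF \<delta>(1)] by blast
  from st[OF r(1)] obtain L1 where L1: "\<forall>L\<ge>L1. \<forall>s \<Omega>. finite \<Omega> \<longrightarrow> \<Omega> \<noteq> {} \<longrightarrow>
    (\<forall>u. s \<le> u \<longrightarrow> u + r \<le> s + L \<longrightarrow>
      avg \<Omega> (\<lambda>(x, y). (F (line s (s + L) x y (u + r)) - F (line s (s + L) x y u))\<^sup>2) \<le> (1 + \<delta>) * (real_of_int r)\<^sup>2) \<longrightarrow>
    freq \<Omega> (\<lambda>(x, y). \<forall>u\<in>{s..s+L}. \<forall>v\<in>{s..s+L}.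
      F (line s (s + L) x y u) - F (line s (s + L) x y v) < (1 - \<delta>) * real_of_int L) \<le> \<delta> \<longrightarrow>
    freq \<Omega> (\<lambda>(x, y). \<not> (\<exists>\<sigma>. steep \<epsilon> s (s + L) x y \<sigma>)) \<le> \<epsilon>" ..
  obtain L2 where L2: "\<And>L z x b. L \<ge> L2 \<Longrightarrow> x \<in> extensional P \<Longrightarrow> b \<in> extensional N \<Longrightarrow>
    freq (dn N (z + L) z b) (\<lambda>y. \<forall>u\<in>{z..z+L}. \<forall>v\<in>{z..z+L}.
       F (line z (z + L) x y u) - F (line z (z + L) x y v) < (1 - \<delta>) * L) \<le> \<delta>"
    using range_large[OF \<delta>] by blast
  show ?thesis
  proof (intro exI[of _ "max L1 L2"] allI impI ballI)
    fix L s :: int and x b :: "'n \<Rightarrow> int"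
    assume L: "max L1 L2 \<le> L" and xb: "x \<in> extensional P" "b \<in> extensional N"
    have single: "avg ({x} \<times> dn N (s + L) s b) f = avg (dn N (s + L) s b) (\<lambda>y. f (x, y))" for f
      by (simp add: avg_Times avg_def[of "{x}"])
    have "freq ({x} \<times> dn N (s + L) s b) (\<lambda>(x, y). \<not> (\<exists>\<sigma>. steep \<epsilon> s (s + L) x y \<sigma>)) \<le> \<epsilon>"
    proof (rule L1[rule_format])
      show "avg ({x} \<times> dn N (s + L) s b)
        (\<lambda>(x, y). (F (line s (s + L) x y (u + r)) - F (line s (s + L) x y u))\<^sup>2) \<le> (1 + \<delta>) * (real_of_int r)\<^sup>2"
        if "s \<le> u" "u + r \<le> s + L" for u
        unfolding single using that r xb by (simp add: up_energy_window)
      show "freq ({x} \<times> dn N (s + L) s b) (\<lambda>(x, y). \<forall>u\<in>{s..s+L}. \<forall>v\<in>{s..s+L}.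
        F (line s (s + L) x y u) - F (line s (s + L) x y v) < (1 - \<delta>) * real_of_int L) \<le> \<delta>"
        unfolding single using L2[of L x b s] L xb by simp
    qed (use L in auto)
    then show "freq (dn N (s + L) s b) (\<lambda>y. \<not> (\<exists>\<sigma>. steep \<epsilon> s (s + L) x y \<sigma>)) \<le> \<epsilon>"
      unfolding single by simp
  qed
qed

end

section \<open>Level sets\<close>

text \<open>Reversing the height exchanges \<open>P\<close> and \<open>N\<close>.\<close>

definition flip :: "int \<times> 'a \<Rightarrow> int \<times> 'a" where "flip p = (- fst p, snd p)"

lemma flip_simps [simp]: "fst (flip p) = - fst p" "snd (flip p) = snd p" "flip (flip p) = p"
  by (simp_all add: flip_def)

context weights begin

lemma neg: "weights (\<lambda>i. - lam i)"
  using weights_neg weights_axioms by blast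

lemma neg_E: "weights.E (\<lambda>i. - lam i) i z = E i (- z)"
  by (simp add: weights.E_def[OF neg] E_def)

lemma neg_PN: "weights.P (\<lambda>i. - lam i) = N" "weights.N (\<lambda>i. - lam i) = P"
  by (simp_all add: weights.P_def[OF neg] weights.N_def[OF neg] P_def N_def)

lemma neg_depth: "weights.depth (\<lambda>i. - lam i) u v = depth (- u) (- v)"
  by (simp add: weights.depth_def[OF neg] depth_def neg_E fun_eq_iff)

lemma neg_up: "weights.up (\<lambda>i. - lam i) A u v = up A (- u) (- v)"
  by (simp add: weights.up_def[OF neg] up_def neg_depth fun_eq_iff)

lemma neg_dn: "weights.dn (\<lambda>i. - lam i) A u v = dn A (- u) (- v)"
  by (simp add: weights.dn_def[OF neg] dn_def neg_depth fun_eq_iff)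

lemma neg_mk: "weights.mk (\<lambda>i. - lam i) z x y = flip (mk (- z) y x)"
  by (auto simp: weights.mk_def[OF neg] mk_def neg_PN flip_def P_N fun_eq_iff)

lemma neg_line: "weights.line (\<lambda>i. - lam i) s t x y u = flip (line (- t) (- s) y x (- u))"
  by (simp add: weights.line_def[OF neg] line_def neg_mk neg_up neg_PN)

lemma neg_near: "weights.near (\<lambda>i. - lam i) D p q = near D (flip p) (flip q)"
proof -
  have "weights.pos (\<lambda>i. - lam i) p = pos (flip p)" for p
    by (simp add: weights.pos_def[OF neg] pos_def neg_E fun_eq_iff)
  then show ?thesis by (simp add: weights.near_def[OF neg] near_def abs_minus_commute)
qed

end

context embedding begin

lemma neg_embedding: "embedding (\<lambda>i. - lam i) (\<lambda>p. flip (\<Phi> (flip p))) \<alpha> \<beta>"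
proof -
  interpret n: weights "\<lambda>i. - lam i" by (rule neg)
  show ?thesis
    by unfold_locales (use alpha beta upper lower in \<open>auto simp: neg_near\<close>)
qed

lemma neg_F: "embedding.F (\<lambda>p. flip (\<Phi> (flip p))) p = - F (flip p)"
  using embedding.F_def[OF neg_embedding] by (simp add: F_def)

text \<open>The direction \<open>\<sigma>\<close> is unchanged, since reversing the source and
  reversing the image each flip it once.\<close>

lemma neg_steep:
  "embedding.steep (\<lambda>i. - lam i) (\<lambda>p. flip (\<Phi> (flip p))) e s t x y \<sigma> \<longleftrightarrow> steep e (- t) (- s) y x \<sigma>"
proof -
  interpret n: embedding "\<lambda>i. - lam i" "\<lambda>p. flip (\<Phi> (flip p))" \<alpha> \<beta> by (rule neg_embedding)
  have "n.mono_path \<sigma> e s t x y \<longleftrightarrow> mono_path \<sigma> e (- t) (- s) y x" for e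
  proof -
    have "(\<forall>u v. s \<le> u \<longrightarrow> u \<le> v \<longrightarrow> v \<le> t \<longrightarrow> Q (- v) (- u)) \<longleftrightarrow> (\<forall>u v. - t \<le> u \<longrightarrow> u \<le> v \<longrightarrow> v \<le> - s \<longrightarrow> Q u v)" for Q :: "int \<Rightarrow> int \<Rightarrow> bool"
    proof (intro iffI allI impI)
      fix u v assume a: "\<forall>u v. s \<le> u \<longrightarrow> u \<le> v \<longrightarrow> v \<le> t \<longrightarrow> Q (- v) (- u)" "- t \<le> u" "u \<le> v" "v \<le> - s"
      then show "Q u v" using a(1)[rule_format, of "- v" "- u"] by simp
    next
      fix u v assume a: "\<forall>u v. - t \<le> u \<longrightarrow> u \<le> v \<longrightarrow> v \<le> - s \<longrightarrow> Q u v" "s \<le> u" "u \<le> v" "v \<le> t"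
      then show "Q (- v) (- u)" using a(1)[rule_format, of "- v" "- u"] by simp
    qed
    from this[of "\<lambda>u v. - e \<le> \<sigma> * (F (line (- t) (- s) y x v) - F (line (- t) (- s) y x u))"]
    show ?thesis by (simp add: n.mono_path_def mono_path_def neg_line neg_F)
  qed
  then show ?thesis by (simp add: n.steep_def steep_def neg_line neg_F algebra_simps)
qed

end

context quasi begin

lemma neg_quasi: "quasi (\<lambda>i. - lam i) (\<lambda>p. flip (\<Phi> (flip p))) \<alpha> \<beta>"
proof -
  interpret n: embedding "\<lambda>i. - lam i" "\<lambda>p. flip (\<Phi> (flip p))" \<alpha> \<beta> by (rule neg_embedding)
  show ?thesis
  proof
    fix w
    obtain p where "near \<beta> (\<Phi> p) (flip w)" using onto by blast
    then have "n.near \<beta> (flip (\<Phi> (flip (flip p)))) w" by (simp add: neg_near)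
    then show "\<exists>p. n.near \<beta> (flip (\<Phi> (flip p))) w" by blast
  qed
qed

text \<open>Reversal turns the fan of lines below a fixed upper end into the fan above a fixed lower
  end.\<close>

lemma down_steep:
  fixes \<epsilon> :: real
  assumes \<epsilon>: "0 < \<epsilon>" "\<epsilon> \<le> 1"
  shows "\<exists>L0. \<forall>L\<ge>L0. \<forall>s. \<forall>y\<in>extensional N. \<forall>a\<in>extensional P.
    freq (dn P s (s + L) a) (\<lambda>x. \<not> (\<exists>\<sigma>. steep \<epsilon> s (s + L) x y \<sigma>)) \<le> \<epsilon>"
proof -
  obtain L0 where L0: "\<forall>L\<ge>L0. \<forall>s. \<forall>x\<in>extensional N. \<forall>b\<in>extensional P.
    freq (dn P (- (s + L)) (- s) b) (\<lambda>y. \<not> (\<exists>\<sigma>. steep \<epsilon> (- (s + L)) (- s) y x \<sigma>)) \<le> \<epsilon>"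
    using quasi.up_steep[OF neg_quasi \<epsilon>] unfolding neg_PN neg_dn neg_steep by blast
  show ?thesis
  proof (intro exI[of _ L0] allI impI ballI)
    fix L s :: int and y a :: "'n \<Rightarrow> int" assume "L0 \<le> L" "y \<in> extensional N" "a \<in> extensional P"
    then show "freq (dn P s (s + L) a) (\<lambda>x. \<not> (\<exists>\<sigma>. steep \<epsilon> s (s + L) x y \<sigma>)) \<le> \<epsilon>"
      using L0[rule_format, of L y a "- (s + L)"] by (simp add: add.commute[of s L])
  qed
qed

text \<open>The two ends are joined through a point \<open>y'\<close> above and a point \<open>x'\<close> below by three steep lines; the sum of
  three increments of size about \<open>L\<close> cannot be small.\<close>

lemma vertical_expands:
  "\<exists>S\<ge>1. \<forall>L\<ge>S. \<forall>s. \<forall>x\<in>extensional P. \<forall>y\<in>extensional N.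
     real_of_int L / 2 \<le> \<bar>F (line s (s + L) x y (s + L)) - F (line s (s + L) x y s)\<bar>"
proof -
  have e: "(0::real) < 1 / 16" "(1 / 16 :: real) \<le> 1" by auto
  obtain L1 where L1: "\<And>L s x b. L \<ge> L1 \<Longrightarrow> x \<in> extensional P \<Longrightarrow> b \<in> extensional N \<Longrightarrow>
    freq (dn N (s + L) s b) (\<lambda>y. \<not> (\<exists>\<sigma>. steep (1 / 16) s (s + L) x y \<sigma>)) \<le> 1 / 16"
    using up_steep[OF e] by blast
  obtain L2 where L2: "\<And>L s y a. L \<ge> L2 \<Longrightarrow> y \<in> extensional N \<Longrightarrow> a \<in> extensional P \<Longrightarrow>
    freq (dn P s (s + L) a) (\<lambda>x. \<not> (\<exists>\<sigma>. steep (1 / 16) s (s + L) x y \<sigma>)) \<le> 1 / 16"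
    using down_steep[OF e] by blast
  obtain L3 where L3: "\<And>L s a b. L \<ge> L3 \<Longrightarrow> a \<in> extensional P \<Longrightarrow> b \<in> extensional N \<Longrightarrow>
      freq (dn P s (s + L) a \<times> dn N (s + L) s b) (\<lambda>(x, y). \<not> (\<exists>\<sigma>. steep (1 / 16) s (s + L) x y \<sigma>)) \<le> 1 / 16"
    using box_steep[OF e] by blast
  show ?thesis
  proof (intro exI[of _ "max 1 (max L1 (max L2 L3))"] conjI allI impI ballI)
    fix L s :: int and x y :: "'n \<Rightarrow> int" assume L: "max 1 (max L1 (max L2 L3)) \<le> L" and xy: "x \<in> extensional P" "y \<in> extensional N"
    define t where "t = s + L"
    have st: "s \<le> t" using L by (simp add: t_def)
    define a b where "a = up P s t x" and "b = up N t s y"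
    have ab: "a \<in> extensional P" "b \<in> extensional N" by (simp_all add: a_def b_def)
    have xa: "x \<in> dn P s t a" and yb: "y \<in> dn N t s b" using xy by (simp_all add: mem_dn_up a_def b_def)
    let ?X = "dn P s t a" and ?Y = "dn N t s b"
    let ?bad = "\<lambda>x y. \<not> (\<exists>\<sigma>. steep (1 / 16) s t x y \<sigma>)"
    have f1: "freq (?X \<times> ?Y) (\<lambda>p. ?bad x (snd p)) \<le> 1 / 16"
      using L1[of L x b s] L xy ab by (simp add: avg_Times avg_const t_def)
    have f2: "freq (?X \<times> ?Y) (\<lambda>p. ?bad (fst p) y) \<le> 1 / 16"
      using L2[of L y a s] L xy ab by (simp add: avg_Times avg_const t_def)
    have f3: "freq (?X \<times> ?Y) (\<lambda>p. ?bad (fst p) (snd p)) \<le> 1 / 16"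
      using L3[of L a b s] L ab by (simp add: t_def case_prod_unfold)
    have f12: "freq (?X \<times> ?Y) (\<lambda>p. ?bad x (snd p) \<or> ?bad (fst p) y) \<le> 1 / 8"
      by (rule freq_disj_le[OF f1 f2]) simp
    have "freq (?X \<times> ?Y) (\<lambda>p. (?bad x (snd p) \<or> ?bad (fst p) y) \<or> ?bad (fst p) (snd p)) \<le> 3 / 16"
      by (rule freq_disj_le[OF f12 f3]) simp
    then have "freq (?X \<times> ?Y) (\<lambda>p. (?bad x (snd p) \<or> ?bad (fst p) y) \<or> ?bad (fst p) (snd p)) < 1"
      by linarith
    from freq_less_1_ex[OF finite_cartesian_product[OF finite_dn finite_dn] _ this] obtain p where p: "p \<in> ?X \<times> ?Y"
      "\<not> ((?bad x (snd p) \<or> ?bad (fst p) y) \<or> ?bad (fst p) (snd p))"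
      using dn_ne by (auto simp only: times_eq_iff Times_empty)
    define x' y' where "x' = fst p" and "y' = snd p"
    have x': "x' \<in> ?X" and y': "y' \<in> ?Y"
      using p(1) unfolding x'_def y'_def by (simp_all only: mem_Times_iff)
    obtain \<sigma>1 \<sigma>2 \<sigma>3 where st3: "steep (1 / 16) s t x y' \<sigma>1" "steep (1 / 16) s t x' y \<sigma>2" "steep (1 / 16) s t x' y' \<sigma>3"
      using p(2) unfolding x'_def[symmetric] y'_def[symmetric] de_Morgan_disj not_not by (elim conjE exE)
    define l where "l = real_of_int L"
    have l: "1 \<le> l" using L by (simp add: l_def)
    have val: "F (mk t a v) - F (mk s u b) \<in> {- (17 / 16 * l)..- (15 / 16 * l)} \<union> {15 / 16 * l..17 / 16 * l}"
      if "steep (1 / 16) s t u v \<sigma>" "u \<in> ?X" "v \<in> ?Y" for u v \<sigma>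
    proof -
      have \<sigma>: "\<sigma> = 1 \<or> \<sigma> = -1" using that(1) by (auto simp: steep_def mono_path_def)
      have "\<bar>\<sigma> * (F (mk t a v) - F (mk s u b)) - l\<bar> \<le> 1 / 16 * l"
        using that(1) line_ends[OF st ab that(2,3)] by (simp add: steep_def t_def l_def)
      then have "15 / 16 * l \<le> \<sigma> * (F (mk t a v) - F (mk s u b))" "\<sigma> * (F (mk t a v) - F (mk s u b)) \<le> 17 / 16 * l"
        unfolding abs_le_iff by linarith+
      then show ?thesis using \<sigma> by auto
    qed
    have tri: "l / 2 \<le> \<bar>q - p\<bar>" if "T - p \<in> {- (17 / 16 * l)..- (15 / 16 * l)} \<union> {15 / 16 * l..17 / 16 * l}"
      "q - r \<in> {- (17 / 16 * l)..- (15 / 16 * l)} \<union> {15 / 16 * l..17 / 16 * l}"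
      "T - r \<in> {- (17 / 16 * l)..- (15 / 16 * l)} \<union> {15 / 16 * l..17 / 16 * l}" for T p q r :: real
    proof -
      have "q - p = (q - r) - (T - r) + (T - p)" by simp
      moreover have "q - p \<le> \<bar>q - p\<bar>" "- (q - p) \<le> \<bar>q - p\<bar>" by (rule abs_ge_self, rule abs_ge_minus_self)
      ultimately show ?thesis using that l unfolding Un_iff atLeastAtMost_iff
        by (elim disjE conjE) linarith+
    qed
    have "l / 2 \<le> \<bar>F (mk t a y) - F (mk s x b)\<bar>"
      by (rule tri[OF val[OF st3(1) xa y'] val[OF st3(2) x' yb] val[OF st3(3) x' y']])
    then show "real_of_int L / 2 \<le> \<bar>F (line s (s + L) x y (s + L)) - F (line s (s + L) x y s)\<bar>"
      using line_ends[OF st ab xa yb] by (simp add: l_def t_def)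
  qed auto
qed

end

section \<open>Definite rate of climb\<close>

context weights begin

lemma line_sub:
  assumes "s \<le> s'" "s' \<le> u" "u \<le> t'" "t' \<le> t"
  shows "line s' t' (up P s s' x) (up N t t' y) u = line s t x y u"
  using assms by (simp add: line_def up_up coarser_P coarser_N)

end

text \<open>Moving one end of a window by one level changes its increment by at most
  \<open>k\<close>, whereas increments over windows of length at least \<open>S\<close> exceed
  \<open>k\<close> in absolute value. So the sign cannot change along such moves, and every long
  window is reached from the full one, moving the lower end and then the upper end.\<close>

lemma sign_coherent:
  fixes h :: "int \<Rightarrow> real"
  assumes step: "\<And>u. s \<le> u \<Longrightarrow> u < t \<Longrightarrow> \<bar>h (u + 1) - h u\<bar> \<le> k"
    and S: "1 \<le> S" "2 * k < S" "s + S \<le> t"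
    and ex: "\<And>u v. s \<le> u \<Longrightarrow> u + S \<le> v \<Longrightarrow> v \<le> t \<Longrightarrow> real_of_int (v - u) / 2 \<le> \<bar>h v - h u\<bar>"
  shows "\<exists>\<sigma>. \<bar>\<sigma>\<bar> = 1 \<and> (\<forall>u v. s \<le> u \<longrightarrow> u + S \<le> v \<longrightarrow> v \<le> t \<longrightarrow> real_of_int (v - u) / 2 \<le> \<sigma> * (h v - h u))"
proof -
  define \<sigma> :: real where "\<sigma> = (if 0 < h t - h s then 1 else -1)"
  have pos: "0 < \<bar>h v - h u\<bar> \<and> k < \<bar>h v - h u\<bar>" if "s \<le> u" "u + S \<le> v" "v \<le> t" for u v
  proof -
    have "real_of_int S / 2 \<le> real_of_int (v - u) / 2" using that(2) by simp
    then show ?thesis using ex[OF that] S by linarith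
  qed
  have cont: "0 < \<sigma> * d'" if "0 < \<sigma> * d" "\<bar>d' - d\<bar> \<le> k" "k < \<bar>d'\<bar>" for d d' :: real
  proof -
    have "\<sigma> = 1 \<or> \<sigma> = -1" by (simp add: \<sigma>_def)
    then show ?thesis
    proof
      assume "\<sigma> = 1"
      then have "0 < d" using that(1) by simp
      then have "0 < d'" using that(2,3) by linarith
      then show ?thesis using \<open>\<sigma> = 1\<close> by simp
    next
      assume "\<sigma> = -1"
      then have "d < 0" using that(1) by simp
      then have "d' < 0" using that(2,3) by linarith
      then show ?thesis using \<open>\<sigma> = -1\<close> by simp
    qed
  qed
  have "h t - h s \<noteq> 0" using pos[of s t] S(3) by auto
  then have base: "0 < \<sigma> * (h t - h s)" by (simp add: \<sigma>_def)
  have 1: "0 < \<sigma> * (h t - h u)" if "s \<le> u" "u + S \<le> t" for u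
    using that
  proof (induction u rule: int_ge_induct)
    case (step u)
    then have "0 < \<sigma> * (h t - h u)" by simp
    moreover have "\<bar>(h t - h (u + 1)) - (h t - h u)\<bar> \<le> k"
      using assms(1)[of u] step.prems step.hyps S(1) by linarith
    moreover have "k < \<bar>h t - h (u + 1)\<bar>" using pos[of "u + 1" t] step by linarith
    ultimately show ?case by (rule cont)
  qed (use base in simp)
  have 2: "0 < \<sigma> * (h v - h u)" if "s \<le> u" "u + S \<le> v" "v \<le> t" for u v
    using that(3,2)
  proof (induction v rule: int_le_induct)
    case base
    then show ?case using 1 that by simp
  next
    case (step v)
    then have "0 < \<sigma> * (h v - h u)" by simp
    moreover have "\<bar>(h (v - 1) - h u) - (h v - h u)\<bar> \<le> k"
      using assms(1)[of "v - 1", unfolded diff_add_cancel] step.prems step.hyps S(1) that(1) by linarith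
    moreover have "k < \<bar>h (v - 1) - h u\<bar>" using pos[of u "v - 1"] step that by linarith
    ultimately show ?case by (rule cont)
  qed
  show ?thesis
  proof (intro exI[of _ \<sigma>] conjI allI impI)
    show "\<bar>\<sigma>\<bar> = 1" by (simp add: \<sigma>_def)
    fix u v assume uv: "s \<le> u" "u + S \<le> v" "v \<le> t"
    have "\<bar>\<sigma>\<bar> = 1" by (simp add: \<sigma>_def)
    then have "\<bar>h v - h u\<bar> = \<bar>\<sigma> * (h v - h u)\<bar>" by (simp add: abs_mult)
    also have "\<dots> = \<sigma> * (h v - h u)" using 2[OF uv] by (rule abs_of_pos)
    finally show "real_of_int (v - u) / 2 \<le> \<sigma> * (h v - h u)" using ex[OF uv] by simp
  qed
qed

context quasi begin

text \<open>With a definite rate of climb the drift bounds become geometric series, so vertical lines map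
  to vertical lines up to a constant.\<close>

lemma climbing:
  "\<exists>S\<ge>1. \<exists>C>0. \<exists>M\<ge>1. \<forall>s t. \<forall>x\<in>extensional P. \<forall>y\<in>extensional N. s + S \<le> t \<longrightarrow>
     drifts M s t x y \<and> (\<exists>\<sigma>. \<bar>\<sigma>\<bar> = 1 \<and> (\<forall>u v. s \<le> u \<longrightarrow> u \<le> v \<longrightarrow> v \<le> t \<longrightarrow>
       real_of_int (v - u) / 2 - C \<le> \<sigma> * (F (line s t x y v) - F (line s t x y u))))"
proof -
  obtain S0 where S0: "1 \<le> S0" and ex: "\<And>L s x y. L \<ge> S0 \<Longrightarrow> x \<in> extensional P \<Longrightarrow> y \<in> extensional N \<Longrightarrow>
     real_of_int L / 2 \<le> \<bar>F (line s (s + L) x y (s + L)) - F (line s (s + L) x y s)\<bar>"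
    using vertical_expands by blast
  define S where "S = S0 + \<lceil>2 * \<kappa>\<rceil> + 1"
  have k1: "1 \<le> \<kappa>" by (rule kappa_ge_1)
  have S: "1 \<le> S" "S0 \<le> S" "2 * \<kappa> < S" using S0 k1 unfolding S_def by linarith+
  define C where "C = (\<kappa> + 1) * S"
  have C: "0 < C" using k1 S by (simp add: C_def)
  \<comment> \<open>Per source level the image height changes by at least 1/2 on average, so the
    scale in every coordinate changes by at least \<open>lmn / 2\<close> in the exponent.\<close>
  define \<rho> where "\<rho> = 2 powr (- lmn / 2)"
  have \<rho>: "0 < \<rho>" "\<rho> < 1" using lmn_pos powr_less_mono[of "- lmn / 2" 0 2] by (simp_all add: \<rho>_def)
  define M where "M = max 1 (2 powr (lmx * C + \<kappa>) / (1 - \<rho>))"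
  have climb: "\<exists>\<sigma>. \<bar>\<sigma>\<bar> = 1 \<and> (\<forall>u v. s \<le> u \<longrightarrow> u \<le> v \<longrightarrow> v \<le> t \<longrightarrow>
       real_of_int (v - u) / 2 - C \<le> \<sigma> * (F (line s t x y v) - F (line s t x y u)))"
    if xy: "x \<in> extensional P" "y \<in> extensional N" and st: "s + S \<le> t" for s t x y
  proof -
    let ?h = "\<lambda>u. F (line s t x y u)"
    have "\<exists>\<sigma>. \<bar>\<sigma>\<bar> = 1 \<and> (\<forall>u v. s \<le> u \<longrightarrow> u + S \<le> v \<longrightarrow> v \<le> t \<longrightarrow> real_of_int (v - u) / 2 \<le> \<sigma> * (?h v - ?h u))"
    proof (rule sign_coherent[OF _ S(1,3) st])
      show "\<bar>?h (u + 1) - ?h u\<bar> \<le> \<kappa>" if "s \<le> u" "u < t" for u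
        using F_line[of s "u + 1" t u x y] that by simp
      show "real_of_int (v - u) / 2 \<le> \<bar>?h v - ?h u\<bar>" if "s \<le> u" "u + S \<le> v" "v \<le> t" for u v
      proof -
        have "u + (v - u) = v" by simp
        then have "real_of_int (v - u) / 2 \<le> \<bar>F (line u v (up P s u x) (up N t v y) v) - F (line u v (up P s u x) (up N t v y) u)\<bar>"
          using ex[of "v - u" "up P s u x" "up N t v y" u] that S(2) by simp
        then show ?thesis using that S(1) by (simp add: line_sub)
      qed
    qed
    then obtain \<sigma> where \<sigma>: "\<bar>\<sigma>\<bar> = 1" and
      far: "\<And>u v. s \<le> u \<Longrightarrow> u + S \<le> v \<Longrightarrow> v \<le> t \<Longrightarrow> real_of_int (v - u) / 2 \<le> \<sigma> * (?h v - ?h u)" by blast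
    have "real_of_int (v - u) / 2 - C \<le> \<sigma> * (?h v - ?h u)" if uv: "s \<le> u" "u \<le> v" "v \<le> t" for u v
    proof (cases "u + S \<le> v")
      case True
      then show ?thesis using far[of u v] uv C by linarith
    next
      case False
      have "\<bar>?h v - ?h u\<bar> \<le> \<kappa> * real_of_int \<bar>v - u\<bar>" using F_line[of s v t u x y] uv by simp
      also have "\<dots> \<le> \<kappa> * S" using False uv k1 by (intro mult_left_mono) auto
      finally have 1: "\<bar>\<sigma> * (?h v - ?h u)\<bar> \<le> \<kappa> * S" using \<sigma> by (simp add: abs_mult)
      have "real_of_int (v - u) \<le> S" "0 \<le> real_of_int (v - u)" using False uv by linarith+
      moreover have "C = \<kappa> * S + S" by (simp add: C_def algebra_simps)
      moreover have "n / 2 - c \<le> X" if "n \<le> r" "0 \<le> n" "c = m + r" "\<bar>X\<bar> \<le> m" for n r c m X :: real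
        using that by (simp add: abs_le_iff)
      ultimately show ?thesis using 1 by blast
    qed
    then show ?thesis using \<sigma> by blast
  qed
  have "drifts M s t x y" if xy: "x \<in> extensional P" "y \<in> extensional N" and st: "s + S \<le> t" for s t x y
    unfolding drifts_def
  proof (intro allI impI)
    fix u v c i assume uv: "s \<le> u" "u \<le> v" "v \<le> t"
      and c: "\<forall>w. u \<le> w \<longrightarrow> w \<le> v \<longrightarrow> lam i * F (line s t x y w) \<le> c"
    let ?h = "\<lambda>u. F (line s t x y u)"
    obtain \<sigma> where \<sigma>: "\<bar>\<sigma>\<bar> = 1" and
      cl: "\<And>u v. s \<le> u \<Longrightarrow> u \<le> v \<Longrightarrow> v \<le> t \<Longrightarrow> real_of_int (v - u) / 2 - C \<le> \<sigma> * (?h v - ?h u)"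
      using climb[OF xy st] by blast
    have s2: "\<sigma> * \<sigma> = 1" using \<sigma> by (auto simp: abs_if split: if_splits)
    have li: "0 \<le> \<bar>lam i\<bar>" "lmn \<le> \<bar>lam i\<bar>" "\<bar>lam i\<bar> \<le> lmx" by (simp, rule lmn_le, rule abs_lam_le)
    have key: "lam i * ?h w \<le> c + lmx * C - lmn * (real_of_int d / 2)"
      if w: "u \<le> w" "w \<le> v" and d: "0 \<le> d" "0 < \<sigma> * lam i \<Longrightarrow> d = v - w" "\<sigma> * lam i < 0 \<Longrightarrow> d = w - u" for w d
    proof -
      have e: "lam i * z = (\<sigma> * lam i) * (\<sigma> * z)" for z
        using s2 by (metis (no_types, opaque_lifting) mult.assoc mult.commute mult_1)
      have gen: "\<bar>lam i\<bar> * (C - real_of_int d / 2) \<le> lmx * C - lmn * (real_of_int d / 2)"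
      proof -
        have "\<bar>lam i\<bar> * C \<le> lmx * C" using li C by (intro mult_right_mono) auto
        moreover have "lmn * (real_of_int d / 2) \<le> \<bar>lam i\<bar> * (real_of_int d / 2)"
          using li d(1) by (intro mult_right_mono) auto
        ultimately show ?thesis by (simp add: right_diff_distrib)
      qed
      have "\<sigma> * lam i \<noteq> 0" using \<sigma> nz[of i] by auto
      then consider "0 < \<sigma> * lam i" | "\<sigma> * lam i < 0" by linarith
      then show ?thesis
      proof cases
        case 1
        then have ab: "\<sigma> * lam i = \<bar>lam i\<bar>" using \<sigma> by (metis abs_mult abs_of_pos mult_1)
        have "\<sigma> * ?h w \<le> \<sigma> * ?h v + (C - real_of_int d / 2)"
          using cl[of w v] w uv d(2)[OF 1] by (simp add: right_diff_distrib)
        then have "(\<sigma> * lam i) * (\<sigma> * ?h w) \<le> (\<sigma> * lam i) * (\<sigma> * ?h v + (C - real_of_int d / 2))"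
          using 1 by (intro mult_left_mono) auto
        then have "lam i * ?h w \<le> lam i * ?h v + \<bar>lam i\<bar> * (C - real_of_int d / 2)"
          by (simp only: e[of "?h w"] e[of "?h v"] distrib_left ab)
        moreover have "lam i * ?h v \<le> c" using c uv by blast
        ultimately show ?thesis using gen by linarith
      next
        case 2
        then have ab: "\<sigma> * lam i = - \<bar>lam i\<bar>" using \<sigma> by (metis abs_mult abs_of_neg minus_minus mult_1)
        have "\<sigma> * ?h u - (C - real_of_int d / 2) \<le> \<sigma> * ?h w"
          using cl[of u w] w uv d(3)[OF 2] by (simp add: right_diff_distrib)
        then have "(\<sigma> * lam i) * (\<sigma> * ?h w) \<le> (\<sigma> * lam i) * (\<sigma> * ?h u - (C - real_of_int d / 2))"
          using 2 by (intro mult_left_mono_neg) auto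
        then have "lam i * ?h w \<le> lam i * ?h u + \<bar>lam i\<bar> * (C - real_of_int d / 2)"
          by (simp only: e[of "?h w"] e[of "?h u"] right_diff_distrib[of "\<bar>lam i\<bar>" "\<sigma> * F (line s t x y u)"] ab mult_minus_left minus_diff_eq uminus_add_conv_diff)
        moreover have "lam i * ?h u \<le> c" using c uv by blast
        ultimately show ?thesis using gen by linarith
      qed
    qed
    \<comment> \<open>The distance from the end at which \<open>lam i * F\<close> is largest up to a
      constant: the upper end if \<open>\<sigma> * lam i\<close> is positive, the lower end
      otherwise. The displacements decay geometrically with it.\<close>
    define D where "D w = nat (if 0 < \<sigma> * lam i then v - w else w - u)" for w
    have "\<bar>pos (\<Phi> (line s t x y v)) i - pos (\<Phi> (line s t x y u)) i\<bar> \<le> (\<Sum>w\<in>{u..<v}. 2 powr (lam i * ?h w + \<kappa>))"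
      by (rule drift_sum[OF uv])
    also have "\<dots> \<le> (\<Sum>w\<in>{u..<v}. 2 powr (c + lmx * C + \<kappa>) * \<rho> ^ D w)"
    proof (intro sum_mono)
      fix w assume w: "w \<in> {u..<v}"
      have "lam i * ?h w \<le> c + lmx * C - lmn * (real_of_int (int (D w)) / 2)"
        using w by (intro key) (auto simp: D_def)
      then have "2 powr (lam i * ?h w + \<kappa>) \<le> 2 powr (c + lmx * C + \<kappa> + (- lmn / 2) * real (D w))"
        by (intro powr_mono) (auto simp: algebra_simps)
      also have "\<dots> = 2 powr (c + lmx * C + \<kappa>) * \<rho> ^ D w"
      proof -
        have "\<rho> ^ D w = 2 powr ((- lmn / 2) * real (D w))"
          by (subst powr_realpow[OF \<rho>(1), symmetric]) (simp only: \<rho>_def powr_powr)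
        then show ?thesis by (simp only: powr_add)
      qed
      finally show "2 powr (lam i * ?h w + \<kappa>) \<le> 2 powr (c + lmx * C + \<kappa>) * \<rho> ^ D w" .
    qed
    also have "\<dots> = 2 powr (c + lmx * C + \<kappa>) * (\<Sum>w\<in>{u..<v}. \<rho> ^ D w)" by (simp add: sum_distrib_left)
    also have "\<dots> \<le> 2 powr (c + lmx * C + \<kappa>) * (1 / (1 - \<rho>))"
    proof (intro mult_left_mono)
      have inj: "inj_on D {u..<v}" by (rule inj_onI) (auto simp: D_def split: if_splits)
      have "(\<Sum>w\<in>{u..<v}. \<rho> ^ D w) = (\<Sum>k\<in>D ` {u..<v}. \<rho> ^ k)" by (simp add: sum.reindex[OF inj])
      also have "\<dots> \<le> (\<Sum>k. \<rho> ^ k)" using \<rho> by (intro sum_le_suminf summable_geometric) auto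
      also have "\<dots> = 1 / (1 - \<rho>)" using \<rho> by (simp add: suminf_geometric)
      finally show "(\<Sum>w\<in>{u..<v}. \<rho> ^ D w) \<le> 1 / (1 - \<rho>)" .
    qed simp
    also have "\<dots> = (2 powr (lmx * C + \<kappa>) / (1 - \<rho>)) * 2 powr c" by (simp add: powr_add)
    also have "\<dots> \<le> M * 2 powr c" by (intro mult_right_mono) (auto simp: M_def)
    finally show "\<bar>pos (\<Phi> (line s t x y v)) i - pos (\<Phi> (line s t x y u)) i\<bar> \<le> M * 2 powr c" .
  qed
  note drift = this
  have M: "1 \<le> M" by (simp add: M_def)
  show ?thesis
    by (rule exI[of _ S], rule conjI[OF S(1)], rule exI[of _ C], rule conjI[OF C], rule exI[of _ M],
        rule conjI[OF M], intro allI ballI impI conjI, erule (2) drift, erule (2) climb)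
qed

end

lemma sign_unique:
  fixes \<sigma> \<tau> d :: real
  assumes "\<bar>\<sigma>\<bar> = 1" "\<bar>\<tau>\<bar> = 1" "0 < \<sigma> * d" "0 < \<tau> * d" shows "\<sigma> = \<tau>"
  using assms by (auto simp: abs_if zero_less_mult_iff split: if_splits)

lemma half_gap: "a / 2 - C \<le> X \<Longrightarrow> b \<le> a \<Longrightarrow> b / 2 - C \<le> X" for a b C X :: real
  by linarith

section \<open>Variation of the image height over a level set\<close>

context quasi begin

text \<open>Two labels that merge above and two continuations of \<open>y\<close> that separate soon
  give four lines. Lines with the same lower end share their first \<open>S1\<close> levels, lines
  with the same upper end share all levels from \<open>t0\<close> on, so all four climb in the same
  direction. \<open>quad_same\<close> with the bounded errors of \<open>climbing\<close> then limits
  the height difference, no matter how late the labels merge.\<close>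

lemma level_merging:
  "\<exists>B. \<forall>z t0. \<forall>x\<in>extensional P. \<forall>x'\<in>extensional P. \<forall>y\<in>extensional N. z \<le> t0 \<longrightarrow>
     up P z t0 x = up P z t0 x' \<longrightarrow> \<bar>F (mk z x y) - F (mk z x' y)\<bar> \<le> B"
proof -
  obtain S C M where S: "1 \<le> S" and C: "0 < C" and M: "1 \<le> M" and
    cl: "\<And>s t x y. x \<in> extensional P \<Longrightarrow> y \<in> extensional N \<Longrightarrow> s + S \<le> t \<Longrightarrow>
     drifts M s t x y \<and> (\<exists>\<sigma>. \<bar>\<sigma>\<bar> = 1 \<and> (\<forall>u v. s \<le> u \<longrightarrow> u \<le> v \<longrightarrow> v \<le> t \<longrightarrow>
       real_of_int (v - u) / 2 - C \<le> \<sigma> * (F (line s t x y v) - F (line s t x y u))))"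
    using climbing by (elim exE conjE) blast
  define S1 where "S1 = max S (\<lceil>2 * C\<rceil> + 1)"
  have S1: "S \<le> S1" "1 \<le> S1" "0 < real_of_int S1 / 2 - C"
  proof -
    show "S \<le> S1" "1 \<le> S1" using S by (auto simp: S1_def)
    have "2 * C < real_of_int (\<lceil>2 * C\<rceil> + 1)" by linarith
    also have "\<dots> \<le> real_of_int S1" by (simp only: of_int_le_iff S1_def max.cobounded2)
    finally show "0 < real_of_int S1 / 2 - C" by simp
  qed
  obtain q :: int where q: "0 \<le> q" "3 ^ CARD('n) * 2 ^ CARD('n) * 2 powr (- Lam * real_of_int q) < 1"
  proof -
    define c where "c = log 2 (3 ^ CARD('n) * 2 ^ CARD('n))"
    define q where "q = max 0 (\<lceil>c / Lam\<rceil> + 1)"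
    have "c / Lam < real_of_int q" unfolding q_def by linarith
    then have "c < Lam * real_of_int q" using Lam_pos by (simp add: divide_less_eq mult.commute)
    then have "2 powr c * 2 powr (- Lam * real_of_int q) < 1"
      using powr_less_mono[of "c - Lam * real_of_int q" 0 2] by (simp add: powr_add[symmetric])
    moreover have "2 powr c = 3 ^ CARD('n) * 2 ^ CARD('n)" by (simp add: c_def)
    moreover have "0 \<le> q" by (simp add: q_def)
    ultimately show ?thesis by (intro that) auto
  qed
  define B where "B = max 0 (\<kappa> * ((\<alpha> * quad_bound C M + \<beta> + 1) / lmn + real_of_int (S1 + q)))"
  show ?thesis
  proof (intro exI[of _ B] allI ballI impI)
    fix z t0 :: int and x x' y :: "'n \<Rightarrow> int" assume x: "x \<in> extensional P" "x' \<in> extensional P" and y: "y \<in> extensional N"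
      and zt: "z \<le> t0" and mg: "up P z t0 x = up P z t0 x'"
    define t where "t = max (z + S1 + q) (t0 + S1)"
    have t: "z + S1 + q \<le> t" "t0 + S1 \<le> t" "z + S1 \<le> t" "z \<le> t" using q S1 zt by (auto simp: t_def)
    define a where "a = up P z t x"
    have a': "a = up P z t x'" using mg up_up[OF coarser_P coarser_P, of z t0 t x] up_up[OF coarser_P coarser_P, of z t0 t x'] zt t S1 unfolding a_def by simp
    have xa: "x \<in> dn P z t a" "x' \<in> dn P z t a" and aP: "a \<in> extensional P"
      using x a' by (simp_all add: mem_dn_up a_def)
    \<comment> \<open>\<open>b'\<close> fixes the continuation of \<open>y\<close> over
      \<open>S1\<close> levels, which is long enough to determine the direction of climb. The two
      continuations \<open>y1\<close> and \<open>y2\<close> branch off only after that and are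
      separated \<open>q\<close> levels later.\<close>
    obtain b' where b': "b' \<in> dn N (z + S1) z y" using dn_ne by blast
    have b'N: "b' \<in> extensional N" and b'y: "up N (z + S1) z b' = y" using b' y by (auto simp: mem_dn_up)
    obtain y1 where y1: "y1 \<in> dn N t (z + S1) b'" using dn_ne by blast
    have "freq (dn N t (z + S1) b') (\<lambda>y. \<forall>i\<in>N. \<bar>up N t (z + S1 + q) y1 i - up N t (z + S1 + q) y i\<bar> < 2) < 1"
      using freq_unseparated[OF b'N, of "z + S1" "z + S1 + q" t y1] q t by simp
    from freq_less_1_ex[OF finite_dn dn_ne this] obtain y2 where y2: "y2 \<in> dn N t (z + S1) b'"
      and "\<not> (\<forall>i\<in>N. \<bar>up N t (z + S1 + q) y1 i - up N t (z + S1 + q) y2 i\<bar> < 2)" by blast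
    then obtain i where i: "i \<in> N" "2 \<le> \<bar>up N t (z + S1 + q) y1 i - up N t (z + S1 + q) y2 i\<bar>"
      unfolding not_less[symmetric] by blast
    have ups: "up N t (z + S1) v = b'" and vN: "v \<in> extensional N" if "v \<in> {y1, y2}" for v
      using that y1 y2 b'N by (auto simp: mem_dn_up)
    have upz: "up N t z v = y" if v: "v \<in> {y1, y2}" for v
      using up_up[OF coarser_N coarser_N, of "z + S1" t z v] S1 t ups[OF v] b'y by simp
    have yv: "v \<in> dn N t z y" if "v \<in> {y1, y2}" for v
      using upz[OF that] vN[OF that] y by (simp add: mem_dn_up)
    have xv: "v \<in> extensional P" "v \<in> dn P z t a" "up P z t0 v = up P z t0 x" if "v \<in> {x, x'}" for v
      using that x xa mg by auto
    define cc where "cc \<sigma> v w \<longleftrightarrow> \<bar>\<sigma>\<bar> = 1 \<and> (\<forall>i j. z \<le> i \<longrightarrow> i \<le> j \<longrightarrow> j \<le> t \<longrightarrow>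
       real_of_int (j - i) / 2 - C \<le> \<sigma> * (F (line z t v w j) - F (line z t v w i)))" for \<sigma> :: real and v w :: "'n \<Rightarrow> int"
    have ccD: "0 < \<sigma> * (F (line z t v w j) - F (line z t v w i))"
      if "cc \<sigma> v w" "z \<le> i" "i + S1 \<le> j" "j \<le> t" for \<sigma> v w i j
    proof -
      have "real_of_int (j - i) / 2 - C \<le> \<sigma> * (F (line z t v w j) - F (line z t v w i))"
        using that S1(2) unfolding cc_def by auto
      moreover have "real_of_int S1 \<le> real_of_int (j - i)" using that by linarith
      ultimately have "real_of_int S1 / 2 - C \<le> \<sigma> * (F (line z t v w j) - F (line z t v w i))" by (rule half_gap)
      then show ?thesis by (rule less_le_trans[OF S1(3)])
    qed
    have ex: "drifts M z t v w \<and> (\<exists>\<sigma>. cc \<sigma> v w)" if "v \<in> {x, x'}" "w \<in> {y1, y2}" for v w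
      using cl[OF xv(1)[OF that(1)] vN[OF that(2)], of z t] t S1 unfolding cc_def by simp
    have same_x: "\<sigma> = \<tau>" if c: "cc \<sigma> v w" "cc \<tau> v w'" and w: "w \<in> {y1, y2}" "w' \<in> {y1, y2}" for \<sigma> \<tau> :: real and v w w' :: "'n \<Rightarrow> int"
    proof -
      have "up N t u w = up N t u w'" if "u \<le> z + S1" for u
        using up_up[OF coarser_N coarser_N, of "z + S1" t u] that t ups[OF w(1)] ups[OF w(2)] by metis
      then have l: "line z t v w u = line z t v w' u" if "u \<le> z + S1" for u using that by (simp add: line_def)
      show ?thesis
        using ccD[OF c(1), of z "z + S1"] ccD[OF c(2), of z "z + S1"] l[of z] l[of "z + S1"] c t S1(2)
        by (intro sign_unique[of \<sigma> \<tau> "F (line z t v w (z + S1)) - F (line z t v w z)"]) (auto simp: cc_def)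
    qed
    have same_y: "\<sigma> = \<tau>" if c: "cc \<sigma> v w" "cc \<tau> v' w" and v: "v \<in> {x, x'}" "v' \<in> {x, x'}" for \<sigma> \<tau> :: real and v v' w :: "'n \<Rightarrow> int"
    proof -
      have "up P z u v = up P z u v'" if "t0 \<le> u" for u
        using up_up[OF coarser_P coarser_P, of z t0 u] that zt xv(3)[OF v(1)] xv(3)[OF v(2)] by metis
      then have l: "line z t v w u = line z t v' w u" if "t0 \<le> u" for u using that by (simp add: line_def)
      show ?thesis
        using ccD[OF c(1), of t0 t] ccD[OF c(2), of t0 t] l[of t0] l[of t] c t zt S1(2)
        by (intro sign_unique[of \<sigma> \<tau> "F (line z t v w t) - F (line z t v w t0)"]) (auto simp: cc_def)
    qed
    obtain \<sigma> where \<sigma>: "cc \<sigma> x y1" using ex[of x y1] by auto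
    have all: "cc \<sigma> v w" if v: "v \<in> {x, x'}" and w: "w \<in> {y1, y2}" for v w
    proof -
      obtain \<tau> \<tau>' where "cc \<tau> v w" "cc \<tau>' v y1" using ex[OF v w] ex[OF v, of y1] by auto
      then show ?thesis using same_x[of \<tau> v w \<tau>' y1] same_y[OF \<sigma>, of \<tau>' v] v w \<sigma> by simp
    qed
    have s1: "\<bar>\<sigma>\<bar> = 1" using \<sigma> by (simp add: cc_def)
    have mono: "mono_path \<sigma> C z t v w" if "v \<in> {x, x'}" "w \<in> {y1, y2}" for v w
      unfolding mono_path_def
    proof (intro allI impI conjI)
      fix i j assume ij: "z \<le> i" "i \<le> j" "j \<le> t"
      then have "real_of_int (j - i) / 2 - C \<le> \<sigma> * (F (line z t v w j) - F (line z t v w i))"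
        using all[OF that] unfolding cc_def by blast
      moreover have "0 \<le> real_of_int (j - i)" using ij by simp
      ultimately have "0 / 2 - C \<le> \<sigma> * (F (line z t v w j) - F (line z t v w i))" by (rule half_gap)
      then show "- C \<le> \<sigma> * (F (line z t v w j) - F (line z t v w i))" by simp
    qed (use s1 in \<open>auto simp: abs_if split: if_splits\<close>)
    have half: "\<sigma> * (F (mk z v' y) - F (mk z v y)) \<le> B" if v: "v \<in> {x, x'}" "v' \<in> {x, x'}" for v v'
    proof (rule ccontr)
      let ?m = "\<sigma> * (F (mk z v' y) - F (mk z v y))"
      assume "\<not> ?m \<le> B"
      then have m: "B < ?m" "0 < ?m" by (auto simp: B_def)
      have high: "0 \<le> \<sigma> * (F (mk t a w) - F (mk z v' y))" if w: "w \<in> {y1, y2}" for w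
        using ccD[OF all[OF v(2) w], of z t] line_ends[OF t(4) aP y xv(2)[OF v(2)] yv[OF w]] t by simp
      have "lmn * (?m / \<kappa> - real_of_int (z + S1 + q - z)) - 1 \<le> \<alpha> * quad_bound C M + \<beta>"
        by (rule quad_same[OF s1 _ M _ _ aP y xv(2)[OF v(1)] xv(2)[OF v(2)] yv yv i mono mono _ _ order.refl m(2) high])
          (use C q S1 t ex v in auto)
      then have "lmn * (?m / \<kappa> - real_of_int (S1 + q)) \<le> \<alpha> * quad_bound C M + \<beta> + 1" by simp
      then have "?m / \<kappa> - real_of_int (S1 + q) \<le> (\<alpha> * quad_bound C M + \<beta> + 1) / lmn"
        using lmn_pos by (simp add: le_divide_eq mult.commute)
      then have "?m / \<kappa> \<le> (\<alpha> * quad_bound C M + \<beta> + 1) / lmn + real_of_int (S1 + q)" by linarith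
      then have "?m \<le> \<kappa> * ((\<alpha> * quad_bound C M + \<beta> + 1) / lmn + real_of_int (S1 + q))"
        using kappa_ge_1 by (simp add: divide_le_eq mult.commute)
      then show False using m by (simp add: B_def)
    qed
    have "\<bar>F (mk z x y) - F (mk z x' y)\<bar> = \<bar>\<sigma> * (F (mk z x y) - F (mk z x' y))\<bar>" using s1 by (simp add: abs_mult)
    also have "\<dots> \<le> B" using half[of x x'] half[of x' x] unfolding right_diff_distrib by (auto simp: abs_le_iff)
    finally show "\<bar>F (mk z x y) - F (mk z x' y)\<bar> \<le> B" .
  qed
qed

text \<open>Repeated halving with rounding down sends every nonnegative integer to 0 and every
  negative one to -1. Since \<open>K < 2 ^ K\<close>, depth \<open>K\<close> is enough for labels
  bounded by \<open>K\<close>.\<close>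

lemma merges_with_signs:
  fixes x :: "'n \<Rightarrow> int"
  shows "\<exists>t0\<ge>z. up P z t0 x = up P z t0 (\<lambda>i\<in>P. if 0 \<le> x i then 0 else - 1)"
proof -
  define K where "K = (\<Sum>i\<in>UNIV. nat \<bar>x i\<bar>)"
  define t0 where "t0 = z + \<lceil>(real K + 2) / lmn\<rceil>"
  have K: "\<bar>x i\<bar> \<le> int K" for i
  proof -
    have "nat \<bar>x i\<bar> \<le> K" unfolding K_def by (rule member_le_sum) auto
    then show ?thesis by simp
  qed
  have "0 \<le> (real K + 2) / lmn" using lmn_pos by simp
  then have zt: "z \<le> t0" unfolding t0_def by linarith
  have depth: "K \<le> depth z t0 i" if "i \<in> P" for i
  proof -
    have d: "(real K + 2) / lmn \<le> real_of_int (t0 - z)" unfolding t0_def by simp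
    have "real K + 2 \<le> lmn * real_of_int (t0 - z)" using d lmn_pos by (simp add: divide_le_eq mult.commute)
    also have "\<dots> \<le> lam i * real_of_int (t0 - z)"
      using lmn_le[of i] that zt by (intro mult_right_mono) (auto simp: P_def)
    also have "\<dots> = lam i * t0 - lam i * z" by (simp add: right_diff_distrib)
    finally have "real K \<le> real_of_int (E i t0 - E i z)" using E_ge[of i t0] E_le[of i z] by simp
    then show ?thesis unfolding depth_def by linarith
  qed
  have "x i div 2 ^ depth z t0 i = (if 0 \<le> x i then 0 else - 1) div 2 ^ depth z t0 i" if "i \<in> P" for i
  proof -
    have "int K < 2 ^ K" by (metis of_nat_less_iff of_nat_less_two_power of_nat_numeral of_nat_power)
    also have "(2::int) ^ K \<le> 2 ^ depth z t0 i" using depth[OF that] by (intro power_increasing) auto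
    finally have "\<bar>x i\<bar> < 2 ^ depth z t0 i" using K[of i] by linarith
    moreover have "(- 1 :: int) div q = - 1" "0 div q = 0" if "0 < q" for q using that by (simp_all add: int_div_eq_iff)
    moreover have "x i div 2 ^ depth z t0 i = (if 0 \<le> x i then 0 else - 1)"
      using calculation(1) by (subst int_div_eq_iff) auto
    ultimately show ?thesis by simp
  qed
  then have "up P z t0 x = up P z t0 (\<lambda>i\<in>P. if 0 \<le> x i then 0 else - 1)" by (auto simp: up_def)
  then show ?thesis using zt by blast
qed

text \<open>Cells of the \<open>P\<close>-tree merge going up unless they lie in different orthants, and the cells
  touching the origin are neighbours.\<close>

lemma level_P:
  "\<exists>B. \<forall>z. \<forall>x\<in>extensional P. \<forall>x'\<in>extensional P. \<forall>y\<in>extensional N.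
     \<bar>F (mk z x y) - F (mk z x' y)\<bar> \<le> B"
proof -
  obtain B where B: "\<And>z t0 x x' y. x \<in> extensional P \<Longrightarrow> x' \<in> extensional P \<Longrightarrow> y \<in> extensional N \<Longrightarrow> z \<le> t0 \<Longrightarrow>
     up P z t0 x = up P z t0 x' \<Longrightarrow> \<bar>F (mk z x y) - F (mk z x' y)\<bar> \<le> B"
    using level_merging by (elim exE) blast
  define s where "s x = (\<lambda>i\<in>P. if 0 \<le> x i then 0 else - 1 :: int)" for x :: "'n \<Rightarrow> int"
  have s: "s x \<in> extensional P" for x by (simp add: s_def)
  have 1: "\<bar>F (mk z x y) - F (mk z (s x) y)\<bar> \<le> B"
    if "x \<in> extensional P" "y \<in> extensional N" for z x y
    using merges_with_signs[of z x] B[OF that(1) s that(2)] unfolding s_def[symmetric] by (elim exE conjE)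
  have 2: "\<bar>F (mk z (s x) y) - F (mk z (s x') y)\<bar> \<le> \<beta>" for z x x' y
  proof -
    have "\<bar>pos (mk z (s x) y) i - pos (mk z (s x') y) i\<bar> \<le> 2 powr (lam i * real_of_int z)" for i
    proof -
      have "\<bar>pos (mk z (s x) y) i - pos (mk z (s x') y) i\<bar> \<le> 2 powr E i z"
        by (simp add: pos_def mk_def s_def)
      also have "\<dots> \<le> 2 powr (lam i * real_of_int z)" using E_le by (intro powr_mono) auto
      finally show ?thesis .
    qed
    then have "near 0 (mk z (s x) y) (mk z (s x') y)" by (simp add: near_def)
    from F_near[OF this] show ?thesis by simp
  qed
  show ?thesis
  proof (intro exI[of _ "2 * B + \<beta>"] allI ballI)
    fix z :: int and x x' y :: "'n \<Rightarrow> int" assume e: "x \<in> extensional P" "x' \<in> extensional P" "y \<in> extensional N"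
    show "\<bar>F (mk z x y) - F (mk z x' y)\<bar> \<le> 2 * B + \<beta>"
      using 1[OF e(1,3), of z] 1[OF e(2,3), of z] 2[of z x y x'] unfolding mult_2 by linarith
  qed
qed

text \<open>The \<open>P\<close>-part is changed with the \<open>N\<close>-part kept fixed; the
  \<open>N\<close>-part is then changed by the same result for the reversed space.\<close>

theorem levels_preserved: "\<exists>B. \<forall>p q. fst p = fst q \<longrightarrow> \<bar>F p - F q\<bar> \<le> B"
proof -
  interpret n: quasi "\<lambda>i. - lam i" "\<lambda>p. flip (\<Phi> (flip p))" \<alpha> \<beta> by (rule neg_quasi)
  obtain B1 where B1: "\<And>z x x' y. x \<in> extensional P \<Longrightarrow> x' \<in> extensional P \<Longrightarrow> y \<in> extensional N \<Longrightarrow>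
     \<bar>F (mk z x y) - F (mk z x' y)\<bar> \<le> B1"
    using level_P by (elim exE) blast
  obtain B2 where B2: "\<And>z y y' x. y \<in> extensional N \<Longrightarrow> y' \<in> extensional N \<Longrightarrow> x \<in> extensional P \<Longrightarrow>
     \<bar>- F (mk (- z) x y) - - F (mk (- z) x y')\<bar> \<le> B2"
    using n.level_P unfolding neg_PN neg_mk neg_F flip_simps by (elim exE) blast
  show ?thesis
  proof (intro exI[of _ "B1 + B2"] allI impI)
    fix p q :: "int \<times> ('n \<Rightarrow> int)" assume eq: "fst p = fst q"
    let ?x = "\<lambda>p. restrict (snd p) P" and ?y = "\<lambda>p. restrict (snd p) N"
    have "\<bar>F (mk (fst q) (?x p) (?y p)) - F (mk (fst q) (?x q) (?y p))\<bar> \<le> B1" by (rule B1) auto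
    moreover have "\<bar>- F (mk (- (- fst q)) (?x q) (?y p)) - - F (mk (- (- fst q)) (?x q) (?y q))\<bar> \<le> B2" by (rule B2) auto
    ultimately show "\<bar>F p - F q\<bar> \<le> B1 + B2"
      using mk_surj[of p] mk_surj[of q] eq by (simp only: minus_minus)
  qed
qed

end

section \<open>Diagonalisation of symmetric matrices\<close>

text \<open>The first-order condition at the minimum \<open>t = 0\<close>, obtained by inserting
  \<open>t = - c / k\<close> with \<open>k\<close> larger than \<open>q\<close>.\<close>

lemma linear_coeff_zero:
  fixes c q :: real
  assumes "\<And>t. 0 \<le> 2 * t * c + t\<^sup>2 * q" shows "c = 0"
proof (rule ccontr)
  assume c: "c \<noteq> 0"
  define k where "k = \<bar>q\<bar> + 1"
  have k: "0 < k" "q < k" by (simp_all add: k_def)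
  have "0 \<le> (2 * (- c / k) * c + (- c / k)\<^sup>2 * q) * k\<^sup>2" using assms[of "- c / k"] by simp
  also have "\<dots> = - c\<^sup>2 * (2 * k - q)" using k by (simp add: field_simps power2_eq_square)
  also have "\<dots> < 0" using c k by (simp add: mult_neg_pos)
  finally show False by simp
qed

text \<open>The quadratic form of \<open>M\<close> attains its maximum \<open>m\<close> on the unit
  sphere of \<open>S\<close> at some \<open>u\<close>. Then
  \<open>m * (x \<bullet> x) - x \<bullet> (M *v x)\<close> is nonnegative on \<open>S\<close> and
  vanishes at \<open>u\<close>, so its derivative at \<open>u\<close> vanishes in all directions of
  \<open>S\<close>.\<close>

lemma sym_eigenvector_in:
  fixes M :: "real^'n^'n"
  assumes sym: "transpose M = M" and S: "subspace S" "\<And>x. x \<in> S \<Longrightarrow> M *v x \<in> S" and ne: "S \<noteq> {0}"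
  shows "\<exists>u\<in>S. norm u = 1 \<and> (\<exists>c. M *v u = c *\<^sub>R u)"
proof -
  have sw: "x \<bullet> (M *v y) = y \<bullet> (M *v x)" for x y
    using dot_lmul_matrix[of x M y] sym by (simp add: inner_commute transpose_matrix_vector[symmetric])
  obtain w where w: "w \<in> S" "w \<noteq> 0" using ne subspace_0[OF S(1)] by auto
  let ?K = "S \<inter> sphere 0 1"
  have "compact ?K" using closed_subspace[OF S(1)] by (simp add: closed_Int_compact)
  moreover have "(1 / norm w) *\<^sub>R w \<in> ?K" using w subspace_mul[OF S(1)] by simp
  moreover have "continuous_on ?K (\<lambda>x. x \<bullet> (M *v x))" by (intro continuous_intros)
  ultimately obtain u where u: "u \<in> ?K" and mx: "\<And>x. x \<in> ?K \<Longrightarrow> x \<bullet> (M *v x) \<le> u \<bullet> (M *v u)"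
    using continuous_attains_sup[of ?K "\<lambda>x. x \<bullet> (M *v x)"] by blast
  define m where "m = u \<bullet> (M *v u)"
  have uu: "u \<bullet> u = 1" using u by (simp add: dot_square_norm)
  have Q: "0 \<le> m * (x \<bullet> x) - x \<bullet> (M *v x)" if x: "x \<in> S" for x
  proof (cases "x = 0")
    case False
    have "(1 / norm x) *\<^sub>R x \<in> ?K" using False x subspace_mul[OF S(1)] by simp
    from mx[OF this] have "x \<bullet> (M *v x) / (norm x)\<^sup>2 \<le> m"
      by (simp add: m_def matrix_vector_mult_scaleR power2_eq_square)
    then show ?thesis using False by (simp add: divide_le_eq dot_square_norm)
  qed simp
  have "v \<bullet> (m *\<^sub>R u - M *v u) = 0" if v: "v \<in> S" for v
  proof (rule linear_coeff_zero)
    fix t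
    have "u + t *\<^sub>R v \<in> S" using u v S(1) by (simp add: subspace_add subspace_mul)
    from Q[OF this] show "0 \<le> 2 * t * (v \<bullet> (m *\<^sub>R u - M *v u)) + t\<^sup>2 * (m * (v \<bullet> v) - v \<bullet> (M *v v))"
      using uu sw[of u v]
      by (simp add: m_def[symmetric] matrix_vector_right_distrib matrix_vector_mult_scaleR inner_add inner_diff inner_commute[of u v] algebra_simps power2_eq_square)
  qed
  moreover have "m *\<^sub>R u - M *v u \<in> S" using u S by (simp add: subspace_diff subspace_mul)
  ultimately have "m *\<^sub>R u - M *v u = 0" using inner_eq_zero_iff by blast
  then show ?thesis using u by (intro bexI[of _ u] conjI exI[of _ m]) auto
qed

text \<open>Induction on the dimension: by symmetry, the orthogonal complement in \<open>S\<close>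
  of an eigenvector is again invariant.\<close>

lemma sym_eigenbasis_in:
  fixes M :: "real^'n^'n"
  assumes sym: "transpose M = M" and "subspace S" "\<And>x. x \<in> S \<Longrightarrow> M *v x \<in> S"
  shows "\<exists>B\<subseteq>S. span B = S \<and> pairwise orthogonal B \<and> (\<forall>b\<in>B. norm b = 1 \<and> (\<exists>c. M *v b = c *\<^sub>R b))"
  using assms(2,3)
proof (induction "dim S" arbitrary: S rule: less_induct)
  case less
  show ?case
  proof (cases "S = {0}")
    case True
    then show ?thesis by (intro exI[of _ "{}"]) (auto simp: pairwise_def)
  next
    case False
    obtain u c where u: "u \<in> S" "norm u = 1" "M *v u = c *\<^sub>R u" using sym_eigenvector_in[OF sym less.prems False] by blast
    have uu: "u \<bullet> u = 1" using u by (simp add: dot_square_norm)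
    define T where "T = {x \<in> S. x \<bullet> u = 0}"
    have T: "subspace T" unfolding T_def using less.prems(1)
      by (simp add: subspace_def inner_add_left)
    have "u \<notin> T" using uu by (simp add: T_def)
    moreover have "T \<subseteq> S" unfolding T_def by (rule Collect_restrict)
    ultimately have "T \<subset> S" using u(1) by blast
    then have "span T \<subset> span S" using T less.prems(1) by (simp add: span_eq_iff[THEN iffD2])
    then have "dim T < dim S" by (rule dim_psubset)
    moreover have "M *v x \<in> T" if "x \<in> T" for x
    proof -
      have "(M *v x) \<bullet> u = x \<bullet> (M *v u)" using dot_lmul_matrix[of x M u] sym by (simp add: transpose_matrix_vector[symmetric])
      then show ?thesis using that less.prems(2) u by (simp add: T_def)
    qed
    ultimately obtain B where B: "B \<subseteq> T" "span B = T" "pairwise orthogonal B"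
      "\<forall>b\<in>B. norm b = 1 \<and> (\<exists>c. M *v b = c *\<^sub>R b)" using less.hyps[OF _ T] by blast
    have "x \<in> span (insert u B)" if "x \<in> S" for x
    proof -
      have "x - (x \<bullet> u) *\<^sub>R u \<in> T" using that u uu less.prems(1)
        by (simp add: T_def subspace_diff subspace_mul inner_diff_left)
      then show ?thesis unfolding span_insert B(2) by blast
    qed
    moreover have "span (insert u B) \<subseteq> S"
      by (rule span_minimal) (use B(1) u less.prems(1) in \<open>auto simp: T_def\<close>)
    moreover have "pairwise orthogonal (insert u B)"
      using B(1,3) by (auto simp: pairwise_insert T_def orthogonal_def inner_commute)
    ultimately show ?thesis using B u by (intro exI[of _ "insert u B"]) (auto simp: T_def)
  qed
qed

lemma sym_diagonalisation:
  fixes M :: "real^'n^'n"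
  assumes sym: "transpose M = M"
  shows "\<exists>U d. orthogonal_matrix U \<and> M = U ** diag_mat d ** transpose U"
proof -
  obtain B where B: "span B = UNIV" "pairwise orthogonal B" "\<And>b. b \<in> B \<Longrightarrow> norm b = 1"
    "\<forall>b\<in>B. \<exists>c. M *v b = c *\<^sub>R b" using sym_eigenbasis_in[OF sym subspace_UNIV] by auto
  have "0 \<notin> B" using B(3)[of 0] by auto
  then have ind: "independent B" using B(2) by (rule pairwise_orthogonal_independent[rotated])
  have "card B = dim (span B)" using ind by (simp add: dim_eq_card_independent)
  then have "card B = CARD('n)" using B(1) by simp
  then obtain f where f: "bij_betw f (UNIV :: 'n set) B"
    using finite_same_card_bij[of "UNIV :: 'n set" B] independent_imp_finite[OF ind] by auto
  obtain c where c: "\<And>b. b \<in> B \<Longrightarrow> M *v b = c b *\<^sub>R b" using B(4) by metis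
  have fB: "f j \<in> B" for j using f by (auto simp: bij_betw_def)
  have ff: "f i \<bullet> f j = (if i = j then 1 else 0)" for i j
  proof (cases "i = j")
    case True
    then show ?thesis using B(3)[OF fB[of j]] by (simp add: dot_square_norm)
  next
    case False
    then have "f i \<noteq> f j" using f by (auto simp: bij_betw_def inj_on_def)
    then show ?thesis using B(2) fB False by (auto simp: pairwise_def orthogonal_def)
  qed
  define U :: "real^'n^'n" where "U = (\<chi> i j. f j $ i)"
  define d :: "real^'n" where "d = (\<chi> j. c (f j))"
  have "(\<Sum>k\<in>UNIV. f i $ k * f j $ k) = (if i = j then 1 else 0)" for i j
    using ff[of i j] by (simp add: inner_vec_def)
  then have "transpose U ** U = mat 1"
    by (simp add: vec_eq_iff transpose_def matrix_matrix_mult_def U_def mat_def)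
  then have orth: "orthogonal_matrix U" "U ** transpose U = mat 1"
    using matrix_left_right_inverse by (auto simp: orthogonal_matrix)
  have "M ** U = U ** diag_mat d"
  proof -
    have "(M ** U) $ i $ j = (U ** diag_mat d) $ i $ j" for i j
    proof -
      have "(M ** U) $ i $ j = (M *v f j) $ i"
        by (simp add: matrix_matrix_mult_def matrix_vector_mult_def U_def)
      also have "\<dots> = (U ** diag_mat d) $ i $ j" by (simp add: c[OF fB] mat_mult_diag_mat U_def d_def)
      finally show ?thesis .
    qed
    then show ?thesis by (simp add: vec_eq_iff)
  qed
  then have "M = U ** diag_mat d ** transpose U"
    using orth(2) by (metis matrix_mul_assoc matrix_mul_rid)
  then show ?thesis using orth by blast
qed

lemma diagonalised_eigenvector:
  assumes "orthogonal_matrix U" "M = U ** diag_mat d ** transpose U"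
  shows "M *v column i U = (d $ i) *\<^sub>R column i U"
proof -
  have "M ** U = U ** diag_mat d ** (transpose U ** U)" by (simp add: assms(2) matrix_mul_assoc)
  then have "M ** U = U ** diag_mat d" using assms(1) by (simp add: orthogonal_matrix_def)
  then have "(M ** U) $ k $ i = U $ k $ i * d $ i" for k by (simp add: mat_mult_diag_mat)
  then show ?thesis
    by (simp add: vec_eq_iff column_def matrix_matrix_mult_def matrix_vector_mult_def mult.commute)
qed

text \<open>Each assumption on \<open>M\<close> becomes one property of the logarithms: positivity
  makes them meaningful, the absence of the eigenvalue 1 makes them nonzero, and determinant 1 makes
  their sum vanish.\<close>

lemma weights_of_diagonalisation:
  fixes M :: "real^'n^'n"
  assumes pd: "pos_def M" and det: "det M = 1" and ev: "\<not> eigenvalue M 1"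
    and U: "orthogonal_matrix U" "M = U ** diag_mat d ** transpose U"
  shows "\<And>i. 0 < d $ i" and "weights (\<lambda>i. log 2 (d $ i))"
proof -
  have c: "column i U \<bullet> column i U = 1" for i
    using U(1) by (simp add: orthogonal_matrix_orthonormal_columns dot_square_norm)
  have c0: "column i U \<noteq> 0" for i using c[of i] by auto
  show pos: "0 < d $ i" for i
    using pd[unfolded pos_def_def, rule_format, OF c0[of i]] c[of i]
    by (simp add: diagonalised_eigenvector[OF U])
  have ne: "d $ i \<noteq> 1" for i
    using ev diagonalised_eigenvector[OF U, of i] c0[of i] unfolding eigenvalue_def by metis
  have "det (transpose U ** U) = 1" using U(1) by (simp add: orthogonal_matrix_def)
  then have dU: "det U * det U = 1" by (simp add: det_mul)
  have "det M = (det U * det U) * det (diag_mat d)" by (simp add: U(2) det_mul)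
  also have "det (diag_mat d) = (\<Prod>i\<in>UNIV. d $ i)" by (subst det_diagonal) (auto simp: diag_mat_def)
  finally have pr: "(\<Prod>i\<in>UNIV. d $ i) = 1" using det dU by simp
  have "(\<Sum>i\<in>UNIV. log 2 (d $ i)) = ln (\<Prod>i\<in>UNIV. d $ i) / ln 2"
    by (subst ln_prod) (use pos in \<open>simp_all add: log_def sum_divide_distrib less_imp_neq[symmetric]\<close>)
  moreover have "log 2 (d $ i) \<noteq> 0" for i using pos[of i] ne[of i] by (simp add: log_def)
  ultimately show "weights (\<lambda>i. log 2 (d $ i))" using pr by (simp add: weights_def)
qed

section \<open>Riemannian distance in eigencoordinates\<close>

text \<open>For velocities that may be unbounded, the fundamental theorem yields a gauge integral
  only. It is a Lebesgue integral as soon as the right-hand side is finite, and for an infinite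
  right-hand side nothing is to be shown.\<close>

lemma has_integral_nn_bound:
  fixes f :: "real \<Rightarrow> real"
  assumes f: "(f has_integral I) {a..b}"
  shows "ennreal \<bar>I\<bar> \<le> (\<integral>\<^sup>+ t\<in>{a..b}. ennreal \<bar>f t\<bar> \<partial>lborel)"
proof (cases "(\<integral>\<^sup>+ t\<in>{a..b}. ennreal \<bar>f t\<bar> \<partial>lborel) = \<infinity>")
  case False
  have nn: "(\<integral>\<^sup>+ t. ennreal (norm (f t)) \<partial>lebesgue_on {a..b}) = (\<integral>\<^sup>+ t\<in>{a..b}. ennreal \<bar>f t\<bar> \<partial>lborel)"
    by (simp add: nn_integral_restrict_space nn_integral_completion)
  have "f \<in> borel_measurable (lebesgue_on {a..b})"
    using has_integral_implies_lebesgue_measurable_cbox[of f I a b] f by simp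
  then have i: "integrable (lebesgue_on {a..b}) f"
    using False nn by (intro integrableI_bounded) (simp_all add: less_top)
  then have "I = integral\<^sup>L (lebesgue_on {a..b}) f"
    using has_integral_integral_lebesgue_on[OF i] has_integral_unique[OF f] by simp
  then show ?thesis using integral_norm_bound_ennreal[OF i] unfolding nn by simp
qed simp

lemma valid_path_variation:
  fixes \<gamma> :: "real \<Rightarrow> 'a::real_normed_vector" and h :: "'a \<Rightarrow> real"
  assumes \<gamma>: "valid_path \<gamma>" and h: "bounded_linear h" and ab: "0 \<le> a" "a \<le> b" "b \<le> 1"
  shows "ennreal \<bar>h (\<gamma> b) - h (\<gamma> a)\<bar> \<le> (\<integral>\<^sup>+ t\<in>{a..b}. ennreal \<bar>h (vector_derivative \<gamma> (at t))\<bar> \<partial>lborel)"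
proof (rule has_integral_nn_bound)
  obtain S where S: "finite S" "\<gamma> C1_differentiable_on ({0..1} - S)" and c: "continuous_on {0..1} \<gamma>"
    using \<gamma> by (auto simp: valid_path_def piecewise_C1_differentiable_on_def)
  show "((\<lambda>t. h (vector_derivative \<gamma> (at t))) has_integral h (\<gamma> b) - h (\<gamma> a)) {a..b}"
  proof (rule fundamental_theorem_of_calculus_interior_strong[OF S(1) ab(2)])
    fix x assume "x \<in> {a<..<b} - S"
    then have "x \<in> {0..1} - S" using ab by auto
    then have "\<gamma> differentiable at x" using S(2) by (auto simp: C1_differentiable_on_eq)
    then have "(\<gamma> has_vector_derivative vector_derivative \<gamma> (at x)) (at x)" by (simp add: vector_derivative_works)
    then show "((\<lambda>t. h (\<gamma> t)) has_vector_derivative h (vector_derivative \<gamma> (at x))) (at x)"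
      by (rule bounded_linear.has_vector_derivative[OF h])
  next
    show "continuous_on {a..b} (\<lambda>t. h (\<gamma> t))"
      using bounded_linear.continuous_on[OF h continuous_on_subset[OF c]] ab by simp
  qed
qed

text \<open>A linear functional dominated by the norm of \<open>g\<close> along the path cannot
  change by more than the length. Lower bounds for distances are obtained by choosing such
  functionals.\<close>

lemma length_ge_variation:
  assumes \<gamma>: "valid_path \<gamma>" and h: "bounded_linear h" and ab: "0 \<le> a" "a \<le> b" "b \<le> 1"
    and le: "\<And>t v. 0 \<le> t \<Longrightarrow> t \<le> b \<Longrightarrow> \<bar>h v\<bar> \<le> sqrt (g (\<gamma> t) v v)"
  shows "ennreal \<bar>h (\<gamma> b) - h (\<gamma> a)\<bar> \<le> riemannian_length g \<gamma>"
proof -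
  have "ennreal \<bar>h (\<gamma> b) - h (\<gamma> a)\<bar> \<le> (\<integral>\<^sup>+ t\<in>{a..b}. ennreal \<bar>h (vector_derivative \<gamma> (at t))\<bar> \<partial>lborel)"
    by (rule valid_path_variation[OF \<gamma> h ab])
  also have "\<dots> \<le> riemannian_length g \<gamma>"
    unfolding riemannian_length_def
    by (intro nn_integral_mono) (use le ab in \<open>auto simp: indicator_def intro!: ennreal_leI\<close>)
  finally show ?thesis .
qed

text \<open>Paths of bounded speed can be concatenated without measurability of \<open>g\<close> along the path.\<close>

definition joined :: "('a::euclidean_space \<Rightarrow> 'a \<Rightarrow> 'a \<Rightarrow> real) \<Rightarrow> real \<Rightarrow> 'a \<Rightarrow> 'a \<Rightarrow> bool" where
  "joined g L p q \<longleftrightarrow> (\<exists>\<gamma> S. valid_path \<gamma> \<and> pathstart \<gamma> = p \<and> pathfinish \<gamma> = q \<and> finite S \<and>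
     (\<forall>t\<in>{0..1} - S. \<exists>v. (\<gamma> has_vector_derivative v) (at t) \<and> sqrt (g (\<gamma> t) v v) \<le> L))"

lemma joined_dist:
  assumes j: "joined g L p q" and L: "0 \<le> L"
  shows "(INF \<gamma> \<in> {\<gamma>. valid_path \<gamma> \<and> pathstart \<gamma> = p \<and> pathfinish \<gamma> = q}. riemannian_length g \<gamma>) \<le> ennreal L"
proof -
  obtain \<gamma> S where \<gamma>: "valid_path \<gamma>" "pathstart \<gamma> = p" "pathfinish \<gamma> = q" and S: "finite S" and
    v: "\<And>t. t \<in> {0..1} - S \<Longrightarrow> \<exists>v. (\<gamma> has_vector_derivative v) (at t) \<and> sqrt (g (\<gamma> t) v v) \<le> L"
    using j unfolding joined_def by blast
  have "AE t in lborel. t \<notin> S" using S by (intro AE_not_in) (simp add: finite_imp_null_set_lborel)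
  moreover have "sqrt (g (\<gamma> t) (vector_derivative \<gamma> (at t)) (vector_derivative \<gamma> (at t))) \<le> L"
    if "t \<in> {0..1}" "t \<notin> S" for t
    using v[of t] that vector_derivative_at by auto
  ultimately have "AE t in lborel. ennreal (sqrt (g (\<gamma> t) (vector_derivative \<gamma> (at t)) (vector_derivative \<gamma> (at t)))) * indicator {0..1} t
      \<le> ennreal L * indicator {0..1} t"
    by (elim eventually_mono) (auto simp: indicator_def intro!: ennreal_leI)
  then have "riemannian_length g \<gamma> \<le> (\<integral>\<^sup>+ t. ennreal L * indicator {0..1::real} t \<partial>lborel)"
    unfolding riemannian_length_def by (rule nn_integral_mono_AE)
  also have "\<dots> = ennreal L" by (simp add: nn_integral_cmult)
  finally show ?thesis using \<gamma> by (intro INF_lower2[of \<gamma>]) auto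
qed

lemma joined_mono:
  assumes "joined g L p q" "L \<le> L'" shows "joined g L' p q"
proof -
  obtain \<gamma> S where "valid_path \<gamma>" "pathstart \<gamma> = p" "pathfinish \<gamma> = q" "finite S" and
    v: "\<forall>t\<in>{0..1} - S. \<exists>v. (\<gamma> has_vector_derivative v) (at t) \<and> sqrt (g (\<gamma> t) v v) \<le> L"
    using assms(1) unfolding joined_def by blast
  moreover have "\<forall>t\<in>{0..1} - S. \<exists>v. (\<gamma> has_vector_derivative v) (at t) \<and> sqrt (g (\<gamma> t) v v) \<le> L'"
    using v assms(2) order.trans by blast
  ultimately show ?thesis unfolding joined_def by blast
qed

lemma joined_linepath:
  assumes "\<And>t. 0 \<le> t \<Longrightarrow> t \<le> 1 \<Longrightarrow> sqrt (g (linepath p q t) (q - p) (q - p)) \<le> L"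
  shows "joined g L p q"
  unfolding joined_def
  by (rule exI[of _ "linepath p q"], rule exI[of _ "{}"])
     (use assms in \<open>auto simp: has_vector_derivative_linepath_within intro!: exI[of _ "q - p"]\<close>)

text \<open>Each path is run at double speed on its half of the unit interval, hence
  \<open>2 * L\<close>.\<close>

lemma joined_trans:
  fixes g :: "'a::euclidean_space \<Rightarrow> 'a \<Rightarrow> 'a \<Rightarrow> real"
  assumes sc: "\<And>p c v. g p (c *\<^sub>R v) (c *\<^sub>R v) = c\<^sup>2 * g p v v"
    and "joined g L p q" "joined g L q r"
  shows "joined g (2 * L) p r"
proof -
  obtain \<gamma>1 S1 where \<gamma>1: "valid_path \<gamma>1" "pathstart \<gamma>1 = p" "pathfinish \<gamma>1 = q" "finite S1" and
    v1: "\<And>t. t \<in> {0..1} - S1 \<Longrightarrow> \<exists>v. (\<gamma>1 has_vector_derivative v) (at t) \<and> sqrt (g (\<gamma>1 t) v v) \<le> L"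
    using assms(2) unfolding joined_def by blast
  obtain \<gamma>2 S2 where \<gamma>2: "valid_path \<gamma>2" "pathstart \<gamma>2 = q" "pathfinish \<gamma>2 = r" "finite S2" and
    v2: "\<And>t. t \<in> {0..1} - S2 \<Longrightarrow> \<exists>v. (\<gamma>2 has_vector_derivative v) (at t) \<and> sqrt (g (\<gamma>2 t) v v) \<le> L"
    using assms(3) unfolding joined_def by blast
  let ?\<gamma> = "\<gamma>1 +++ \<gamma>2"
  let ?S = "insert (1/2) ((\<lambda>s. s / 2) ` S1 \<union> (\<lambda>s. (s + 1) / 2) ` S2)"
  have "\<exists>v. (?\<gamma> has_vector_derivative v) (at t) \<and> sqrt (g (?\<gamma> t) v v) \<le> 2 * L" if t: "t \<in> {0..1} - ?S" for t
  proof (cases "t < 1 / 2")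
    case True
    have "2 * t \<notin> S1" using t imageI[of "2 * t" S1 "\<lambda>s. s / 2"] by auto
    then obtain v where v: "(\<gamma>1 has_vector_derivative v) (at (2 * t))" "sqrt (g (\<gamma>1 (2 * t)) v v) \<le> L"
      using v1[of "2 * t"] t True by auto
    have "((\<lambda>t. \<gamma>1 (2 * t)) has_vector_derivative 2 *\<^sub>R v) (at t)"
      using vector_diff_chain_at[of "\<lambda>t. 2 * t" 2 t \<gamma>1 v] v(1)
      by (auto simp: o_def intro!: derivative_eq_intros simp: has_real_derivative_iff_has_vector_derivative[symmetric])
    then have "(?\<gamma> has_vector_derivative 2 *\<^sub>R v) (at t)"
      by (rule has_vector_derivative_transform_within_open[where S = "{..<1/2}"]) (use True in \<open>auto simp: joinpaths_def\<close>)
    then show ?thesis using v(2) True by (intro exI[of _ "2 *\<^sub>R v"]) (simp add: sc real_sqrt_mult joinpaths_def)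
  next
    case False
    then have t2: "1 / 2 < t" using t by auto
    have "2 * t - 1 \<notin> S2" using t imageI[of "2 * t - 1" S2 "\<lambda>s. (s + 1) / 2"] by auto
    then obtain v where v: "(\<gamma>2 has_vector_derivative v) (at (2 * t - 1))" "sqrt (g (\<gamma>2 (2 * t - 1)) v v) \<le> L"
      using v2[of "2 * t - 1"] t t2 by auto
    have "((\<lambda>t. 2 * t - 1) has_real_derivative 2) (at t)" by (auto intro!: derivative_eq_intros)
    then have "((\<lambda>t. \<gamma>2 (2 * t - 1)) has_vector_derivative 2 *\<^sub>R v) (at t)"
      using vector_diff_chain_at[of "\<lambda>t. 2 * t - 1" 2 t \<gamma>2 v] v(1)
      by (auto simp: o_def intro!: derivative_eq_intros simp: has_real_derivative_iff_has_vector_derivative[symmetric])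
    then have "(?\<gamma> has_vector_derivative 2 *\<^sub>R v) (at t)"
      by (rule has_vector_derivative_transform_within_open[where S = "{1/2<..}"]) (use t2 in \<open>auto simp: joinpaths_def\<close>)
    then show ?thesis using v(2) t2 by (intro exI[of _ "2 *\<^sub>R v"]) (simp add: sc real_sqrt_mult joinpaths_def)
  qed
  moreover have "finite ?S" using \<gamma>1 \<gamma>2 by simp
  moreover have "valid_path ?\<gamma>" "pathstart ?\<gamma> = p" "pathfinish ?\<gamma> = r" using \<gamma>1 \<gamma>2 by (auto intro: valid_path_join)
  ultimately show ?thesis unfolding joined_def by blast
qed

section \<open>Distances compared with eigencoordinates\<close>

lemma le_two_powr: "0 \<le> x \<Longrightarrow> x \<le> 2 powr x" for x :: real
proof -
  assume x: "0 \<le> x"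
  define n where "n = nat \<lfloor>x\<rfloor>"
  have n: "real n \<le> x" "x \<le> real n + 1" using x unfolding n_def by linarith+
  have "n < 2 ^ n" by (rule less_exp)
  then have "n + 1 \<le> 2 ^ n" by linarith
  then have "real (n + 1) \<le> real (2 ^ n)" by (rule of_nat_mono)
  then have "real n + 1 \<le> 2 powr real n" by (simp add: powr_realpow)
  also have "\<dots> \<le> 2 powr x" using n by simp
  finally show "x \<le> 2 powr x" using n by simp
qed

text \<open>Coordinates of the horizontal part in the orthonormal basis formed by the columns of
  \<open>U\<close>, which in the application are eigenvectors of \<open>M\<close>.\<close>

definition \<omega> :: "real^'n^'n \<Rightarrow> real \<times> (real^'n) \<Rightarrow> 'n \<Rightarrow> real" where
  "\<omega> U p i = (transpose U *v snd p) $ i"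

lemma \<omega>_simps: "\<omega> U (p + q) i = \<omega> U p i + \<omega> U q i" "\<omega> U (p - q) i = \<omega> U p i - \<omega> U q i"
  "\<omega> U (c *\<^sub>R p) i = c * \<omega> U p i"
  by (simp_all add: \<omega>_def matrix_vector_right_distrib matrix_vector_mult_diff_distrib matrix_vector_mult_scaleR del: transpose_matrix_vector)

lemma bounded_linear_\<omega>: "bounded_linear (\<lambda>p. \<omega> U p i)"
  by (intro linear_conv_bounded_linear[THEN iffD1] linearI) (simp_all add: \<omega>_simps)

text \<open>The metric enters only through its comparison with the sum of the vertical speed and the
  speeds in the eigencoordinates, the latter rescaled by \<open>2 powr (- lam i * z)\<close> at
  height \<open>z\<close>.\<close>

locale sol_metric = weights lam for lam :: "'n::finite \<Rightarrow> real" +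
  fixes U :: "real^'n^'n" and g :: "real \<times> (real^'n) \<Rightarrow> real \<times> (real^'n) \<Rightarrow> real \<times> (real^'n) \<Rightarrow> real"
    and k K :: real
  assumes orth: "orthogonal_matrix U" and k: "0 < k" and K: "0 < K"
    and scale: "\<And>p c v. g p (c *\<^sub>R v) (c *\<^sub>R v) = c\<^sup>2 * g p v v"
    and lower_z: "\<And>p v. k * \<bar>fst v\<bar> \<le> sqrt (g p v v)"
    and lower_w: "\<And>p v i. k * (2 powr (- lam i * fst p) * \<bar>\<omega> U v i\<bar>) \<le> sqrt (g p v v)"
    and upper_g: "\<And>p v. sqrt (g p v v) \<le> K * (\<bar>fst v\<bar> + (\<Sum>i\<in>UNIV. 2 powr (- lam i * fst p) * \<bar>\<omega> U v i\<bar>))"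
begin

abbreviation "d \<equiv> riemannian_dist g"

definition close :: "real \<Rightarrow> real \<times> (real^'n) \<Rightarrow> real \<times> (real^'n) \<Rightarrow> bool" where
  "close D p q \<longleftrightarrow> \<bar>fst p - fst q\<bar> \<le> D \<and> (\<forall>i. \<bar>\<omega> U p i - \<omega> U q i\<bar> \<le> 2 powr (lam i * fst p + D))"

definition of_\<omega> :: "real \<Rightarrow> ('n \<Rightarrow> real) \<Rightarrow> real \<times> (real^'n)" where
  "of_\<omega> z w = (z, U *v (\<chi> i. w i))"

lemma of_\<omega> [simp]: "fst (of_\<omega> z w) = z" "\<omega> U (of_\<omega> z w) = w"
  using orth by (auto simp: of_\<omega>_def \<omega>_def fun_eq_iff matrix_vector_mul_assoc orthogonal_matrix_def)

lemma \<omega>_surj: "of_\<omega> (fst p) (\<omega> U p) = p"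
  using orth by (simp add: of_\<omega>_def \<omega>_def matrix_vector_mul_assoc orthogonal_matrix_def del: transpose_matrix_vector)

lemma joined_segment:
  assumes "\<And>u i. u \<in> {fst p..fst q} \<union> {fst q..fst p} \<Longrightarrow> 2 powr (- lam i * u) * \<bar>\<omega> U q i - \<omega> U p i\<bar> \<le> c"
    and "\<bar>fst q - fst p\<bar> \<le> b"
  shows "joined g (K * (b + real CARD('n) * c)) p q"
proof (rule joined_linepath)
  fix t :: real assume t: "0 \<le> t" "t \<le> 1"
  let ?u = "fst (linepath p q t)"
  have "?u = fst p + t * (fst q - fst p)" by (simp add: linepath_def algebra_simps)
  then have "?u \<in> closed_segment (fst p) (fst q)"
    unfolding closed_segment_def using t by (auto simp: algebra_simps intro!: exI[of _ t])
  then have u: "?u \<in> {fst p..fst q} \<union> {fst q..fst p}" by (auto simp: closed_segment_eq_real_ivl split: if_splits)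
  have "(\<Sum>i\<in>UNIV. 2 powr (- lam i * ?u) * \<bar>\<omega> U (q - p) i\<bar>) \<le> (\<Sum>i\<in>(UNIV :: 'n set). c)"
    by (intro sum_mono) (use assms(1)[OF u] in \<open>simp add: \<omega>_simps\<close>)
  then have "\<bar>fst (q - p)\<bar> + (\<Sum>i\<in>UNIV. 2 powr (- lam i * ?u) * \<bar>\<omega> U (q - p) i\<bar>) \<le> b + real CARD('n) * c"
    using assms(2) by simp
  then show "sqrt (g (linepath p q t) (q - p) (q - p)) \<le> K * (b + real CARD('n) * c)"
    using upper_g[of "linepath p q t" "q - p"] K by (meson mult_left_mono order.trans less_imp_le)
qed

text \<open>Coordinates are moved at a height where their expanding direction has become short.\<close>

lemma close_joined:
  assumes cl: "close D p q"
  shows "joined g (16 * (K * ((4 / lmn + 2) * D + real CARD('n)))) p q"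
proof -
  \<comment> \<open>A change of height by \<open>D / lmn\<close> in the right direction brings a
    displacement of \<open>2 powr (lam i * fst p + D)\<close> below unit size, in every
    coordinate.\<close>
  define h where "h = D / lmn"
  have D: "0 \<le> D" using cl abs_ge_zero order.trans unfolding close_def by blast
  have h: "0 \<le> h" using D lmn_pos by (simp add: h_def)
  define L where "L = K * ((4 / lmn + 2) * D + real CARD('n))"
  have L: "K * (b + real CARD('n) * c) \<le> L" if "b \<le> 4 * h + 2 * D" "c \<le> 1" for b c
  proof -
    have "real CARD('n) * c \<le> real CARD('n) * 1" using that(2) by (intro mult_left_mono) auto
    moreover have "(4 / lmn + 2) * D = 4 * h + 2 * D" by (simp add: h_def algebra_simps)
    ultimately have "b + real CARD('n) * c \<le> (4 / lmn + 2) * D + real CARD('n)" using that(1) by linarith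
    then show ?thesis unfolding L_def using K by (intro mult_left_mono) auto
  qed
  note mono = joined_mono[of g]
  have vert: "joined g L (of_\<omega> u w) (of_\<omega> v w)" if "\<bar>v - u\<bar> \<le> 4 * h + 2 * D" for u v w
    by (rule mono[OF joined_segment[where b = "\<bar>v - u\<bar>" and c = 0] L]) (use that in auto)
  have horiz: "joined g L (of_\<omega> u w) (of_\<omega> u w')"
    if "\<And>i. 2 powr (- lam i * u) * \<bar>w' i - w i\<bar> \<le> 1" for u w w'
    by (rule mono[OF joined_segment[where b = 0 and c = 1] L]) (use that h D in auto)
  let ?z = "fst p" and ?z' = "fst q" and ?w = "\<omega> U p" and ?w' = "\<omega> U q"
  define wm where "wm i = (if i \<in> P then ?w' i else ?w i)" for i
  have small: "2 powr (- lam i * u) * \<bar>?w' i - ?w i\<bar> \<le> 1" if "lam i * ?z + D \<le> lam i * u" for i u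
  proof -
    have "2 powr (- lam i * u) * \<bar>?w' i - ?w i\<bar> \<le> 2 powr (- lam i * u) * 2 powr (lam i * ?z + D)"
      using cl unfolding close_def by (intro mult_left_mono) (simp_all add: abs_minus_commute)
    also have "\<dots> = 2 powr (lam i * ?z + D - lam i * u)" by (simp add: powr_add[symmetric] algebra_simps)
    also have "\<dots> \<le> 2 powr 0" using that by (intro powr_mono) auto
    finally show ?thesis by simp
  qed
  have lmD: "D \<le> \<bar>lam i\<bar> * h" for i
  proof -
    have "lmn * h \<le> \<bar>lam i\<bar> * h" using lmn_le h by (intro mult_right_mono)
    then show ?thesis using lmn_pos by (simp add: h_def)
  qed
  have 1: "joined g L (of_\<omega> ?z ?w) (of_\<omega> (?z + h) ?w)" by (rule vert) (use h D in auto)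
  have 2: "joined g L (of_\<omega> (?z + h) ?w) (of_\<omega> (?z + h) wm)"
  proof (rule horiz)
    fix i show "2 powr (- lam i * (?z + h)) * \<bar>wm i - ?w i\<bar> \<le> 1"
      using small[of i "?z + h"] lmD[of i] by (simp add: wm_def P_def distrib_left)
  qed
  have 3: "joined g L (of_\<omega> (?z + h) wm) (of_\<omega> (?z - h) wm)" by (rule vert) (use h D in auto)
  have 4: "joined g L (of_\<omega> (?z - h) wm) (of_\<omega> (?z - h) ?w')"
  proof (rule horiz)
    fix i show "2 powr (- lam i * (?z - h)) * \<bar>?w' i - wm i\<bar> \<le> 1"
      using small[of i "?z - h"] lmD[of i] nz[of i] by (simp add: wm_def P_def right_diff_distrib)
  qed
  have 5: "joined g L (of_\<omega> (?z - h) ?w') (of_\<omega> ?z' ?w')"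
    by (rule vert) (use h D cl in \<open>auto simp: close_def\<close>)
  have L0: "0 \<le> L" using L[of 0 0] h D by simp
  note tr = joined_trans[of g, OF scale]
  have 12: "joined g (2 * L) (of_\<omega> ?z ?w) (of_\<omega> (?z + h) wm)" by (rule tr[OF 1 2])
  have 34: "joined g (2 * L) (of_\<omega> (?z + h) wm) (of_\<omega> (?z - h) ?w')" by (rule tr[OF 3 4])
  \<comment> \<open>Each concatenation doubles the bound on the speed; bracketing the five segments
    as ((1 2) (3 4)) 5 makes three doublings suffice.\<close>
  have "joined g (2 * (2 * (2 * L))) (of_\<omega> ?z ?w) (of_\<omega> ?z' ?w')"
    by (rule tr[OF tr[OF 12 34] mono[OF 5]]) (use L0 in simp)
  then show ?thesis unfolding \<omega>_surj L_def[symmetric] by (rule mono) (use L0 in simp)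
qed

lemma close_infdist:
  assumes "close D p q"
  shows "(INF \<gamma> \<in> {\<gamma>. valid_path \<gamma> \<and> pathstart \<gamma> = p \<and> pathfinish \<gamma> = q}. riemannian_length g \<gamma>)
    \<le> ennreal (16 * (K * ((4 / lmn + 2) * D + real CARD('n))))"
proof (rule joined_dist[OF close_joined[OF assms]])
  have "0 \<le> D" using assms abs_ge_zero order.trans unfolding close_def by blast
  then show "0 \<le> 16 * (K * ((4 / lmn + 2) * D + real CARD('n)))" using K lmn_pos by simp
qed

lemma close_dist:
  assumes cl: "close D p q"
  shows "d p q \<le> 16 * (K * ((4 / lmn + 2) * D + real CARD('n)))"
proof -
  have "0 \<le> D" using cl abs_ge_zero order.trans unfolding close_def by blast
  then have "0 \<le> 16 * (K * ((4 / lmn + 2) * D + real CARD('n)))" using K lmn_pos by simp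
  then show ?thesis unfolding riemannian_dist_def using enn2real_mono[OF close_infdist[OF cl]] by simp
qed

text \<open>Together with \<open>close_infdist\<close> this makes the infimum of lengths between any
  two points finite, so that \<open>enn2real\<close> returns its true value.\<close>

lemma ex_close: "\<exists>D. close D p q"
proof -
  define D where "D = \<bar>fst p - fst q\<bar> + (\<Sum>i\<in>UNIV. \<bar>\<omega> U p i - \<omega> U q i\<bar> + \<bar>lam i * fst p\<bar>)"
  have nn: "0 \<le> (\<Sum>i\<in>UNIV. \<bar>\<omega> U p i - \<omega> U q i\<bar> + \<bar>lam i * fst p\<bar>)" by (intro sum_nonneg) auto
  have "\<bar>\<omega> U p i - \<omega> U q i\<bar> \<le> 2 powr (lam i * fst p + D)" for i
  proof -
    have "\<bar>\<omega> U p i - \<omega> U q i\<bar> + \<bar>lam i * fst p\<bar> \<le> (\<Sum>i\<in>UNIV. \<bar>\<omega> U p i - \<omega> U q i\<bar> + \<bar>lam i * fst p\<bar>)"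
      by (rule member_le_sum) auto
    then have e: "\<bar>\<omega> U p i - \<omega> U q i\<bar> \<le> lam i * fst p + D" unfolding D_def by linarith
    then have "0 \<le> lam i * fst p + D" by (rule order.trans[OF abs_ge_zero])
    then show ?thesis using e le_two_powr order.trans by blast
  qed
  then show ?thesis unfolding close_def D_def using nn by (intro exI[of _ D]) (simp add: D_def)
qed

text \<open>A path of length below \<open>D + 1\<close> changes height by at most
  \<open>(D + 1) / k\<close>, so along it the rescaling of each coordinate stays comparable with
  that at \<open>p\<close>, and the length bounds the change of the coordinate as well.\<close>

lemma dist_close:
  assumes D: "0 \<le> D" and dD: "d p q \<le> D"
  shows "close ((lmx + 1) * ((D + 1) / k)) p q"
proof -
  let ?I = "INF \<gamma> \<in> {\<gamma>. valid_path \<gamma> \<and> pathstart \<gamma> = p \<and> pathfinish \<gamma> = q}. riemannian_length g \<gamma>"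
  obtain D' where "close D' p q" using ex_close by blast
  from close_infdist[OF this] have fin: "?I < top" by (rule le_less_trans) simp
  then have "?I = ennreal (d p q)" unfolding riemannian_dist_def by (rule ennreal_enn2real[symmetric])
  \<comment> \<open>The added 1 yields an actual path, as the infimum need not be attained.\<close>
  also have "\<dots> < ennreal (D + 1)" using D dD by (intro ennreal_lessI) auto
  finally obtain \<gamma> where \<gamma>: "valid_path \<gamma>" "\<gamma> 0 = p" "\<gamma> 1 = q" and len: "riemannian_length g \<gamma> < ennreal (D + 1)"
    unfolding INF_less_iff by (auto simp: pathstart_def pathfinish_def)
  have var: "\<bar>h (\<gamma> b) - h p\<bar> \<le> D + 1"
    if "bounded_linear h" "0 \<le> b" "b \<le> 1" "\<And>t v. 0 \<le> t \<Longrightarrow> t \<le> b \<Longrightarrow> \<bar>h v\<bar> \<le> sqrt (g (\<gamma> t) v v)" for h b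
  proof -
    have "ennreal \<bar>h (\<gamma> b) - h (\<gamma> 0)\<bar> < ennreal (D + 1)"
      using length_ge_variation[OF \<gamma>(1) that(1) order.refl that(2,3), of g] that(4) len by (auto intro: le_less_trans)
    then show ?thesis using \<gamma>(2) D by (simp add: ennreal_less_iff del: ennreal_plus ennreal_1)
  qed
  define \<rho> where "\<rho> = (D + 1) / k"
  have \<rho>: "0 \<le> \<rho>" using D k by (simp add: \<rho>_def)
  have z: "\<bar>fst (\<gamma> t) - fst p\<bar> \<le> \<rho>" if "0 \<le> t" "t \<le> 1" for t
  proof -
    have "\<bar>k * fst (\<gamma> t) - k * fst p\<bar> \<le> D + 1"
      by (rule var[where h = "\<lambda>v. k * fst v"])
         (use that k lower_z in \<open>auto intro: bounded_linear_const_mult bounded_linear_fst simp: abs_mult\<close>)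
    then have "k * \<bar>fst (\<gamma> t) - fst p\<bar> \<le> D + 1" using k by (simp add: right_diff_distrib[symmetric] abs_mult)
    then show ?thesis using k by (simp add: \<rho>_def le_divide_eq mult.commute)
  qed
  have "\<bar>\<omega> U p i - \<omega> U q i\<bar> \<le> 2 powr (lam i * fst p + (lmx + 1) * \<rho>)" for i
  proof -
    \<comment> \<open>\<open>m\<close> bounds the rescaling factor of coordinate \<open>i\<close>
      from below along the whole path, so one fixed linear functional can be used.\<close>
    define m where "m = 2 powr (- (lam i * fst p + lmx * \<rho>))"
    have m: "0 < m" by (simp add: m_def)
    have "\<bar>k * (m * \<omega> U (\<gamma> 1) i) - k * (m * \<omega> U p i)\<bar> \<le> D + 1"
    proof (rule var[where h = "\<lambda>v. k * (m * \<omega> U v i)"])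
      show "bounded_linear (\<lambda>v. k * (m * \<omega> U v i))" by (intro bounded_linear_const_mult bounded_linear_\<omega>)
      fix t :: real and v assume t: "0 \<le> t" "t \<le> 1"
      have "lam i * fst (\<gamma> t) \<le> lam i * fst p + lmx * \<rho>" by (rule lam_shift[OF z[OF t]])
      then have "m \<le> 2 powr (- lam i * fst (\<gamma> t))" by (simp add: m_def)
      then have "m * \<bar>\<omega> U v i\<bar> \<le> 2 powr (- lam i * fst (\<gamma> t)) * \<bar>\<omega> U v i\<bar>" by (rule mult_right_mono) simp
      then have "k * (m * \<bar>\<omega> U v i\<bar>) \<le> k * (2 powr (- lam i * fst (\<gamma> t)) * \<bar>\<omega> U v i\<bar>)" using k by (intro mult_left_mono) auto
      also have "\<dots> \<le> sqrt (g (\<gamma> t) v v)" by (rule lower_w)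
      finally show "\<bar>k * (m * \<omega> U v i)\<bar> \<le> sqrt (g (\<gamma> t) v v)" using k m by (simp add: abs_mult)
    qed auto
    then have "k * (m * \<bar>\<omega> U q i - \<omega> U p i\<bar>) \<le> D + 1"
      using k m \<gamma>(3) by (simp add: right_diff_distrib[symmetric] abs_mult)
    then have "m * \<bar>\<omega> U q i - \<omega> U p i\<bar> \<le> \<rho>" using k by (simp add: \<rho>_def le_divide_eq mult.commute)
    also have "\<dots> \<le> 2 powr \<rho>" using \<rho> by (rule le_two_powr)
    finally have "2 powr (lam i * fst p + lmx * \<rho>) * (m * \<bar>\<omega> U q i - \<omega> U p i\<bar>) \<le> 2 powr (lam i * fst p + lmx * \<rho>) * 2 powr \<rho>"
      by (rule mult_left_mono) simp
    moreover have "2 powr (lam i * fst p + lmx * \<rho>) * m = 1" unfolding m_def powr_minus by simp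
    ultimately show ?thesis
      by (simp add: mult.assoc[symmetric] powr_add[symmetric] distrib_right add.assoc abs_minus_commute)
  qed
  moreover have "\<bar>fst p - fst q\<bar> \<le> (lmx + 1) * \<rho>"
  proof -
    have "1 * \<rho> \<le> (lmx + 1) * \<rho>" using \<rho> lmx_nonneg by (intro mult_right_mono) auto
    then show ?thesis using z[of 1] \<gamma>(3) by (simp add: abs_minus_commute)
  qed
  ultimately show ?thesis by (simp add: close_def \<rho>_def)
qed

end

lemma inner_product_bounds:
  fixes b :: "'a::euclidean_space \<Rightarrow> 'a \<Rightarrow> real"
  assumes b: "is_inner_product b"
  shows "\<exists>m>0. \<exists>K>0. \<forall>u. m * (norm u)\<^sup>2 \<le> b u u \<and> b u u \<le> K * (norm u)\<^sup>2"
proof -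
  have bil: "bilinear b" and pos: "\<And>u. u \<noteq> 0 \<Longrightarrow> b u u > 0" using b by (auto simp: is_inner_product_def)
  interpret b: bounded_bilinear b using bil by (simp add: bilinear_conv_bounded_bilinear)
  obtain e :: 'a where e: "e \<in> Basis" using nonempty_Basis by blast
  have "continuous_on (sphere 0 1) (\<lambda>u. b u u)" by (intro b.continuous_on continuous_on_id)
  moreover have "sphere (0::'a) 1 \<noteq> {}" using e norm_Basis[OF e] by auto
  ultimately obtain u0 where u0: "u0 \<in> sphere 0 1" "\<And>u. u \<in> sphere 0 1 \<Longrightarrow> b u0 u0 \<le> b u u"
    using continuous_attains_inf[OF compact_sphere, of 0 1 "\<lambda>u. b u u"] by blast
  obtain K where K: "0 < K" "\<And>u v. norm (b u v) \<le> norm u * norm v * K" using b.pos_bounded by blast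
  have "b u0 u0 * (norm u)\<^sup>2 \<le> b u u" for u
  proof (cases "u = 0")
    case False
    have "u = norm u *\<^sub>R ((1 / norm u) *\<^sub>R u)" using False by simp
    then have "b u u = (norm u)\<^sup>2 * b ((1 / norm u) *\<^sub>R u) ((1 / norm u) *\<^sub>R u)"
      by (metis b.scaleR_left b.scaleR_right mult.assoc power2_eq_square real_scaleR_def)
    moreover have "b u0 u0 \<le> b ((1 / norm u) *\<^sub>R u) ((1 / norm u) *\<^sub>R u)" using False by (intro u0(2)) simp
    ultimately show ?thesis by (simp only: mult.commute[of "b u0 u0"] mult_left_mono zero_le_power2)
  qed (simp add: b.zero_left)
  moreover have "0 < b u0 u0" using u0(1) by (intro pos) auto
  moreover have "b u u \<le> K * (norm u)\<^sup>2" for u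
    using K(2)[of u u] by (simp add: power2_eq_square mult_ac)
  ultimately show ?thesis using K(1) by blast
qed

text \<open>\<open>lift p v\<close> is \<open>v\<close> translated back to the identity.\<close>

lemma left_translate:
  fixes M :: "real^'n^'n"
  assumes U: "orthogonal_matrix U" "M = U ** diag_mat e ** transpose U" and e: "\<And>i. 0 < e $ i"
    and g: "left_invariant (sol_mult M) g"
  defines "lift p v \<equiv> (fst v, U *v (\<chi> i. 2 powr (- log 2 (e $ i) * fst p) * \<omega> U v i))"
  shows "g p v v = g 0 (lift p v) (lift p v)"
proof -
  let ?A = "mat_powr M (fst p)"
  have uu: "transpose U ** U = mat 1" "U ** transpose U = mat 1" using U(1) by (auto simp: orthogonal_matrix_def)
  have "(sol_mult M p has_derivative (\<lambda>w. (0 + fst w, 0 + ?A *v snd w))) (at 0)"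
    unfolding sol_mult_def[abs_def]
    by (intro has_derivative_Pair has_derivative_add has_derivative_const bounded_linear_imp_has_derivative
        bounded_linear_fst bounded_linear_compose[OF matrix_vector_mul_bounded_linear bounded_linear_snd])
  then have D: "frechet_derivative (sol_mult M p) (at 0) = (\<lambda>w. (fst w, ?A *v snd w))"
    by (simp add: frechet_derivative_at[symmetric])
  have "diag_mat (\<chi> i. (e $ i) powr fst p) *v (\<chi> i. 2 powr (- log 2 (e $ i) * fst p) * \<omega> U v i) = (\<chi> i. \<omega> U v i)"
  proof -
    have "(e $ i) powr fst p * 2 powr (- log 2 (e $ i) * fst p) = 1" for i
    proof -
      have "(e $ i) powr fst p = (2 powr log 2 (e $ i)) powr fst p" using e by simp
      then show ?thesis by (simp add: powr_powr powr_add[symmetric])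
    qed
    then show ?thesis
      by (simp add: vec_eq_iff matrix_vector_mult_def diag_mat_def if_distrib[of "\<lambda>x. x * _"] mult.assoc[symmetric] cong: if_cong)
  qed
  then have "?A *v (U *v (\<chi> i. 2 powr (- log 2 (e $ i) * fst p) * \<omega> U v i)) = U *v (\<chi> i. \<omega> U v i)"
    unfolding mat_powr_eq[OF U] by (simp add: matrix_vector_mul_assoc[symmetric] del: transpose_matrix_vector)
       (simp add: matrix_vector_mul_assoc uu del: transpose_matrix_vector)
  also have "\<dots> = snd v" by (simp add: \<omega>_def matrix_vector_mul_assoc uu del: transpose_matrix_vector)
  finally have "frechet_derivative (sol_mult M p) (at 0) (lift p v) = v" unfolding D lift_def by simp
  moreover have "sol_mult M p 0 = p" by (simp add: sol_mult_def)
  ultimately show ?thesis using g unfolding left_invariant_def by metis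
qed

lemma mult_le_trans: "c * y \<le> z \<Longrightarrow> x \<le> y \<Longrightarrow> 0 \<le> c \<Longrightarrow> c * x \<le> z" for c :: real
  using mult_left_mono order.trans by blast

text \<open>At the identity any inner product is comparable with the Euclidean one; left translation
  carries the comparison to every point, multiplying eigencoordinates by the powers of the
  eigenvalues.\<close>

lemma sol_metric_exists:
  fixes M :: "real^'n^'n"
  assumes sym: "transpose M = M" and M: "pos_def M" "det M = 1" "\<not> eigenvalue M 1"
    and g: "riemannian_metric g" "left_invariant (sol_mult M) g"
  shows "\<exists>lam U k K. sol_metric lam U g k K"
proof -
  obtain U e where U: "orthogonal_matrix U" "M = U ** diag_mat e ** transpose U" using sym_diagonalisation[OF sym] by blast
  note e = weights_of_diagonalisation[OF M U]
  define lift where "lift p v = (fst v, U *v (\<chi> i. 2 powr (- log 2 (e $ i) * fst p) * \<omega> U v i))"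
    for p v :: "real \<times> (real^'n)"
  have gl: "g p v v = g 0 (lift p v) (lift p v)" for p v
    unfolding lift_def by (rule left_translate[OF U e(1) g(2)])
  have ip: "is_inner_product (g p)" for p using g(1) unfolding riemannian_metric_def by (elim conjE allE)
  from inner_product_bounds[OF this, of 0] obtain m K where m: "0 < m" and K: "0 < K"
    and b: "\<And>u. m * (norm u)\<^sup>2 \<le> g 0 u u" "\<And>u. g 0 u u \<le> K * (norm u)\<^sup>2" by blast
  have lo: "sqrt m * norm (lift p v) \<le> sqrt (g p v v)" for p v
    using real_sqrt_le_mono[OF b(1)[of "lift p v"]] unfolding gl[of p v] by (simp add: real_sqrt_mult)
  have hi: "sqrt (g p v v) \<le> sqrt K * norm (lift p v)" for p v
    using real_sqrt_le_mono[OF b(2)[of "lift p v"]] unfolding gl[of p v] by (simp add: real_sqrt_mult)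
  have nU: "norm (U *v x) = norm x" for x
    using U(1) by (simp add: orthogonal_transformation_norm orthogonal_transformation_matrix)
  have "\<bar>fst v\<bar> \<le> norm (lift p v)" for p v using norm_fst_le[of "fst (lift p v)" "snd (lift p v)"] by (simp add: lift_def)
  then have 1: "sqrt m * \<bar>fst v\<bar> \<le> sqrt (g p v v)" for p v
    using m by (intro mult_le_trans[OF lo]) auto
  have "2 powr (- log 2 (e $ i) * fst p) * \<bar>\<omega> U v i\<bar> \<le> norm (lift p v)" for p v i
  proof -
    let ?x = "\<chi> i. 2 powr (- log 2 (e $ i) * fst p) * \<omega> U v i"
    have "\<bar>?x $ i\<bar> \<le> norm ?x" by (rule component_le_norm_cart)
    also have "\<dots> \<le> norm (lift p v)" using norm_snd_le[of "U *v ?x" "fst v"] by (simp add: nU lift_def)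
    finally show ?thesis by (simp add: abs_mult)
  qed
  then have 2: "sqrt m * (2 powr (- log 2 (e $ i) * fst p) * \<bar>\<omega> U v i\<bar>) \<le> sqrt (g p v v)" for p v i
    using m by (intro mult_le_trans[OF lo]) auto
  have "norm (lift p v) \<le> \<bar>fst v\<bar> + (\<Sum>i\<in>UNIV. 2 powr (- log 2 (e $ i) * fst p) * \<bar>\<omega> U v i\<bar>)" for p v
  proof -
    let ?x = "\<chi> i. 2 powr (- log 2 (e $ i) * fst p) * \<omega> U v i"
    have "norm (lift p v) \<le> norm (fst v) + norm (U *v ?x)" unfolding lift_def by (rule norm_Pair_le)
    moreover have "norm ?x \<le> (\<Sum>i\<in>UNIV. \<bar>?x $ i\<bar>)" by (rule norm_le_l1_cart)
    ultimately show ?thesis by (simp add: nU abs_mult)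
  qed
  then have 3: "sqrt (g p v v) \<le> sqrt K * (\<bar>fst v\<bar> + (\<Sum>i\<in>UNIV. 2 powr (- log 2 (e $ i) * fst p) * \<bar>\<omega> U v i\<bar>))" for p v
    using K by (intro order.trans[OF hi] mult_left_mono) auto
  have 4: "g p (c *\<^sub>R v) (c *\<^sub>R v) = c\<^sup>2 * g p v v" for p c v
  proof -
    have "bilinear (g p)" using ip by (simp add: is_inner_product_def)
    then show ?thesis by (simp add: bilinear_lmul bilinear_rmul power2_eq_square)
  qed
  have "sol_metric (\<lambda>i. log 2 (e $ i)) U g (sqrt m) (sqrt K)"
    by (intro sol_metric.intro sol_metric_axioms.intro e(2) U(1) 4 1 2 3) (use m K in auto)
  then show ?thesis by blast
qed

section \<open>From the group to cells\<close>

text \<open>Implication between two families of relations up to an affine change of the parameter.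
  Chains of comparisons then compose without bookkeeping of constants.\<close>

definition coarse_le :: "(real \<Rightarrow> 'a \<Rightarrow> 'a \<Rightarrow> bool) \<Rightarrow> (real \<Rightarrow> 'a \<Rightarrow> 'a \<Rightarrow> bool) \<Rightarrow> bool" where
  "coarse_le A B \<longleftrightarrow> (\<exists>a\<ge>1. \<exists>b\<ge>0. \<forall>D\<ge>0. \<forall>x y. A D x y \<longrightarrow> B (a * D + b) x y)"

lemma coarse_leI:
  "\<lbrakk>1 \<le> a; 0 \<le> b; \<And>D x y. 0 \<le> D \<Longrightarrow> A D x y \<Longrightarrow> B (a * D + b) x y\<rbrakk> \<Longrightarrow> coarse_le A B"
  unfolding coarse_le_def by blast

lemma coarse_le_trans [trans]:
  assumes "coarse_le A B" "coarse_le B C" shows "coarse_le A C"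
proof -
  obtain a b where ab: "1 \<le> a" "0 \<le> b" "\<forall>D\<ge>0. \<forall>x y. A D x y \<longrightarrow> B (a * D + b) x y"
    using assms(1) unfolding coarse_le_def by blast
  obtain a' b' where ab': "1 \<le> a'" "0 \<le> b'" "\<forall>D\<ge>0. \<forall>x y. B D x y \<longrightarrow> C (a' * D + b') x y"
    using assms(2) unfolding coarse_le_def by blast
  show ?thesis
  proof (rule coarse_leI[of "a' * a" "a' * b + b'"])
    show "1 \<le> a' * a" "0 \<le> a' * b + b'" using ab(1,2) ab'(1,2) mult_mono[of 1 a' 1 a] by auto
    fix D x y assume D: "0 \<le> D" "A D x y"
    then have "C (a' * (a * D + b) + b') x y" using ab ab' by simp
    then show "C (a' * a * D + (a' * b + b')) x y" by (simp add: algebra_simps)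
  qed
qed

lemma coarse_le_image: "coarse_le A B \<Longrightarrow> coarse_le (\<lambda>D x y. A D (h x) (h y)) (\<lambda>D x y. B D (h x) (h y))"
  unfolding coarse_le_def by blast

context sol_metric begin

lemma close_nearby: "close D p q \<longleftrightarrow> nearby D (fst p, \<omega> U p) (fst q, \<omega> U q)"
  by (simp add: close_def nearby_def)

lemma close_sym: "close D p q \<Longrightarrow> close ((1 + lmx) * D) q p" unfolding close_nearby by (rule nearby_sym)
lemma close_trans: "close D p q \<Longrightarrow> close D' q r \<Longrightarrow> close ((1 + lmx) * (D + D') + 1) p r"
  unfolding close_nearby by (rule nearby_trans)

lemma close_mono: "close D p q \<Longrightarrow> D \<le> D' \<Longrightarrow> close D' p q"
  unfolding close_nearby by (rule nearby_mono)

text \<open>Maps that differ by a bounded amount pull back \<open>close\<close> to equivalent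
  relations, by two uses of the triangle inequality.\<close>

lemma perturb:
  assumes c: "0 \<le> c" "\<And>x. close c (f x) (h x)" "\<And>x. close c (h x) (f x)"
  shows "coarse_le (\<lambda>D x y. close D (f x) (f y)) (\<lambda>D x y. close D (h x) (h y))"
proof (rule coarse_leI)
  show "1 \<le> (1 + lmx) * (1 + lmx)" using lmx_nonneg mult_mono[of 1 "1 + lmx" 1 "1 + lmx"] by simp
  show "0 \<le> (1 + lmx) * ((1 + lmx) * c + 1 + c) + 1" using lmx_nonneg c(1) by auto
  fix D x y assume "close D (f x) (f y)"
  from close_trans[OF close_trans[OF c(3) this] c(2)]
  show "close ((1 + lmx) * (1 + lmx) * D + ((1 + lmx) * ((1 + lmx) * c + 1 + c) + 1)) (h x) (h y)"
    by (simp add: algebra_simps)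
qed

lemma close_coarse_dist: "coarse_le close (\<lambda>D p q. d p q \<le> D)"
proof (rule coarse_leI)
  let ?a = "16 * (K * (4 / lmn + 2))" and ?b = "16 * (K * real CARD('n))"
  show "1 \<le> max 1 ?a" "0 \<le> ?b" using K by auto
  fix D p q assume D: "0 \<le> D" and "close D p q"
  then have "d p q \<le> ?a * D + ?b" using close_dist by (simp add: algebra_simps)
  also have "\<dots> \<le> max 1 ?a * D + ?b" using D by (intro add_right_mono mult_right_mono) auto
  finally show "d p q \<le> max 1 ?a * D + ?b" .
qed

lemma dist_coarse_close: "coarse_le (\<lambda>D p q. d p q \<le> D) close"
proof (rule coarse_leI)
  let ?a = "(lmx + 1) / k"
  show "1 \<le> max 1 ?a" "0 \<le> ?a" using k lmx_nonneg by auto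
  fix D p q assume D: "0 \<le> D" and "d p q \<le> D"
  then have "close ((lmx + 1) * ((D + 1) / k)) p q" by (rule dist_close)
  moreover have "(lmx + 1) * ((D + 1) / k) = ?a * D + ?a" using k by (simp add: field_simps)
  moreover have "?a * D \<le> max 1 ?a * D" using D by (intro mult_right_mono) auto
  ultimately show "close (max 1 ?a * D + ?a) p q" by (auto intro: close_mono)
qed

definition coarse_qi :: "(real \<times> (real^'n) \<Rightarrow> real \<times> (real^'n)) \<Rightarrow> bool" where
  "coarse_qi f \<longleftrightarrow> coarse_le close (\<lambda>D p q. close D (f p) (f q)) \<and>
     coarse_le (\<lambda>D p q. close D (f p) (f q)) close \<and> (\<exists>c\<ge>0. \<forall>y. \<exists>x. close c (f x) y)"

lemma quasi_isometry_coarse_qi: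
  assumes q: "quasi_isometry \<kappa> c d d f" shows "coarse_qi f"
proof -
  have qi: "1 \<le> \<kappa>" "0 \<le> c" "\<And>p q. d p q \<le> \<kappa> * (d (f p) (f q) + c)" "\<And>p q. d (f p) (f q) \<le> \<kappa> * d p q + c"
    "\<And>y. \<exists>x. d (f x) y \<le> c"
  proof -
    have q': "1 \<le> \<kappa> \<and> 0 \<le> c \<and> (\<forall>p q. 1 / \<kappa> * d p q - c \<le> d (f p) (f q) \<and> d (f p) (f q) \<le> \<kappa> * d p q + c) \<and>
        (\<forall>y. \<exists>x. d (f x) y \<le> c)"
      using q unfolding quasi_isometry_def .
    show \<kappa>: "1 \<le> \<kappa>" and "0 \<le> c" and "\<And>p q. d (f p) (f q) \<le> \<kappa> * d p q + c" "\<And>y. \<exists>x. d (f x) y \<le> c"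
      using q' by blast+
    fix p q
    have "1 / \<kappa> * d p q - c \<le> d (f p) (f q)" using q' by blast
    then have "1 / \<kappa> * d p q \<le> d (f p) (f q) + c" by simp
    then show "d p q \<le> \<kappa> * (d (f p) (f q) + c)" using \<kappa> by (simp add: divide_le_eq mult.commute)
  qed
  have 1: "coarse_le (\<lambda>D p q. d p q \<le> D) (\<lambda>D p q. d (f p) (f q) \<le> D)"
  proof (rule coarse_leI[OF qi(1,2)])
    fix D p q assume "d p q \<le> D"
    then have "\<kappa> * d p q \<le> \<kappa> * D" using qi(1) by (intro mult_left_mono) auto
    then show "d (f p) (f q) \<le> \<kappa> * D + c" using qi(4)[of p q] by linarith
  qed
  have 2: "coarse_le (\<lambda>D p q. d (f p) (f q) \<le> D) (\<lambda>D p q. d p q \<le> D)"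
  proof (rule coarse_leI[of \<kappa> "\<kappa> * c"])
    fix D p q assume "d (f p) (f q) \<le> D"
    then have "\<kappa> * (d (f p) (f q) + c) \<le> \<kappa> * (D + c)" using qi(1) by (intro mult_left_mono) auto
    then show "d p q \<le> \<kappa> * D + \<kappa> * c" using qi(3)[of p q] unfolding distrib_left by linarith
  qed (use qi in auto)
  have "coarse_le close (\<lambda>D p q. close D (f p) (f q))"
    by (rule coarse_le_trans[OF close_coarse_dist coarse_le_trans[OF 1 coarse_le_image[OF dist_coarse_close]]])
  moreover have "coarse_le (\<lambda>D p q. close D (f p) (f q)) close"
    by (rule coarse_le_trans[OF coarse_le_image[OF close_coarse_dist] coarse_le_trans[OF 2 dist_coarse_close]])
  moreover have "\<exists>c'\<ge>0. \<forall>y. \<exists>x. close c' (f x) y"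
  proof -
    have "close ((lmx + 1) * ((c + 1) / k)) p q" if "d p q \<le> c" for p q using qi(2) that by (rule dist_close)
    moreover have "0 \<le> (lmx + 1) * ((c + 1) / k)" using lmx_nonneg k qi(2) by simp
    ultimately show ?thesis using qi(5) by blast
  qed
  ultimately show ?thesis unfolding coarse_qi_def by blast
qed

section \<open>Discretisation of quasi-isometries\<close>

definition pt :: "int \<times> ('n \<Rightarrow> int) \<Rightarrow> real \<times> (real^'n)" where "pt p = of_\<omega> (real_of_int (fst p)) (pos p)"
definition disc :: "real \<times> (real^'n) \<Rightarrow> int \<times> ('n \<Rightarrow> int)" where
  "disc p = (\<lfloor>fst p\<rfloor>, \<lambda>i. \<lfloor>\<omega> U p i / 2 powr E i \<lfloor>fst p\<rfloor>\<rfloor>)"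

lemma near_pt: "near D p q \<longleftrightarrow> close D (pt p) (pt q)"
  by (simp add: near_def close_def pt_def)

lemma close_disc: "close (1 + lmx) p (pt (disc p))" "close (1 + lmx) (pt (disc p)) p"
proof -
  let ?z = "\<lfloor>fst p\<rfloor>"
  have z: "\<bar>fst p - real_of_int ?z\<bar> \<le> 1" "\<bar>real_of_int ?z - fst p\<bar> \<le> 1" by linarith+
  have w: "\<bar>\<omega> U p i - \<omega> U (pt (disc p)) i\<bar> \<le> 2 powr (lam i * ?z)" for i
  proof -
    let ?q = "2 powr real_of_int (E i ?z)"
    have "\<omega> U p i - \<omega> U (pt (disc p)) i = (\<omega> U p i / ?q - \<lfloor>\<omega> U p i / ?q\<rfloor>) * ?q"
      by (simp add: pt_def pos_def disc_def left_diff_distrib)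
    also have "\<bar>\<dots>\<bar> \<le> 1 * ?q" unfolding abs_mult by (intro mult_mono) (auto simp: abs_le_iff, linarith)
    also have "\<dots> \<le> 2 powr (lam i * ?z)" using E_le[of i ?z] by (simp add: powr_mono)
    finally show ?thesis .
  qed
  have "\<bar>\<omega> U p i - \<omega> U (pt (disc p)) i\<bar> \<le> 2 powr (lam i * fst p + (1 + lmx))" for i
    using lam_shift[OF z(2), of i] by (intro order.trans[OF w] powr_mono) auto
  then show "close (1 + lmx) p (pt (disc p))"
    using z lmx_nonneg by (simp add: close_def pt_def disc_def)
  have "\<bar>\<omega> U (pt (disc p)) i - \<omega> U p i\<bar> \<le> 2 powr (lam i * ?z + (1 + lmx))" for i
    using lmx_nonneg unfolding abs_minus_commute[of _ "\<omega> U p i"] by (intro order.trans[OF w] powr_mono) auto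
  then show "close (1 + lmx) (pt (disc p)) p"
    using z lmx_nonneg by (simp add: close_def pt_def disc_def)
qed

text \<open>\<open>pt\<close> turns \<open>near\<close> into \<open>close\<close>, and rounding by
  \<open>disc\<close> moves every point a bounded amount, so the coarse properties of
  \<open>f\<close> pass to the map between cells.\<close>

lemma discretised:
  assumes f: "coarse_qi f"
  shows "\<exists>\<alpha> \<beta>. quasi lam (\<lambda>p. disc (f (pt p))) \<alpha> \<beta>"
proof -
  let ?\<Phi> = "\<lambda>p. disc (f (pt p))"
  have c0: "0 \<le> 1 + lmx" using lmx_nonneg by simp
  have f1: "coarse_le close (\<lambda>D p q. close D (f p) (f q))" and f2: "coarse_le (\<lambda>D p q. close D (f p) (f q)) close"
    using f by (simp_all add: coarse_qi_def)
  note pb = perturb[OF c0, of "\<lambda>p. f (pt p)" "\<lambda>p. pt (?\<Phi> p)", OF close_disc(1) close_disc(2)]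
    perturb[OF c0, of "\<lambda>p. pt (?\<Phi> p)" "\<lambda>p. f (pt p)", OF close_disc(2) close_disc(1)]
  have "coarse_le near (\<lambda>D p q. near D (?\<Phi> p) (?\<Phi> q))" unfolding near_pt
    by (rule coarse_le_trans[OF coarse_le_image[OF f1, of pt] pb(1)])
  then obtain a b where ab: "1 \<le> a" "0 \<le> b" "\<forall>D\<ge>0. \<forall>p q. near D p q \<longrightarrow> near (a * D + b) (?\<Phi> p) (?\<Phi> q)"
    unfolding coarse_le_def by blast
  have "coarse_le (\<lambda>D p q. near D (?\<Phi> p) (?\<Phi> q)) near" unfolding near_pt
    by (rule coarse_le_trans[OF pb(2) coarse_le_image[OF f2, of pt]])
  then obtain a' b' where ab': "1 \<le> a'" "0 \<le> b'" "\<forall>D\<ge>0. \<forall>p q. near D (?\<Phi> p) (?\<Phi> q) \<longrightarrow> near (a' * D + b') p q"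
    unfolding coarse_le_def by blast
  have "\<exists>c. \<forall>w. \<exists>p. near c (?\<Phi> p) w"
  proof -
    obtain c where c: "\<forall>y. \<exists>x. close c (f x) y" using f unfolding coarse_qi_def by blast
    obtain a b where ab: "\<forall>D\<ge>0. \<forall>p q. close D p q \<longrightarrow> close (a * D + b) (f p) (f q)"
      using f1 unfolding coarse_le_def by blast
    let ?c = "(1 + lmx) * ((1 + lmx) + ((1 + lmx) * ((a * (1 + lmx) + b) + c) + 1)) + 1"
    have "\<exists>p. near ?c (?\<Phi> p) w" for w
    proof -
      obtain x where x: "close c (f x) (pt w)" using c by blast
      have "close (a * (1 + lmx) + b) (f (pt (disc x))) (f x)" using ab c0 close_disc(2) by blast
      from close_trans[OF close_disc(2) close_trans[OF this x]] have "near ?c (?\<Phi> (disc x)) w" unfolding near_pt .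
      then show ?thesis by blast
    qed
    then show ?thesis by blast
  qed
  then obtain c where c: "\<And>w. \<exists>p. near c (?\<Phi> p) w" by blast
  define \<alpha> \<beta> where "\<alpha> = max a a'" and "\<beta> = max c (max b b')"
  have le: "a * D + b \<le> \<alpha> * D + \<beta>" "a' * D + b' \<le> \<alpha> * D + \<beta>" if "0 \<le> D" for D
    using that by (auto simp: \<alpha>_def \<beta>_def intro!: add_mono mult_right_mono)
  have "quasi lam ?\<Phi> \<alpha> \<beta>"
  proof
    show "1 \<le> \<alpha>" "0 \<le> \<beta>" using ab(1,2) by (auto simp: \<alpha>_def \<beta>_def)
    show "near (\<alpha> * D + \<beta>) (?\<Phi> p) (?\<Phi> q)" if "near D p q" for D p q
      using ab(3) that near_nonneg[OF that] le(1) near_mono by blast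
    show "near (\<alpha> * D + \<beta>) p q" if "near D (?\<Phi> p) (?\<Phi> q)" for D p q
      using ab'(3) that near_nonneg[OF that] le(2) near_mono by blast
    show "\<exists>p. near \<beta> (?\<Phi> p) w" for w
    proof -
      obtain p where "near c (?\<Phi> p) w" using c by blast
      then have "near \<beta> (?\<Phi> p) w" by (rule near_mono) (simp add: \<beta>_def)
      then show ?thesis by blast
    qed
  qed
  then show ?thesis by blast
qed

text \<open>Points of equal height are rounded to cells of equal height, where
  \<open>levels_preserved\<close> applies. A difference of height up to \<open>r\<close> is first
  removed by a vertical move, whose image is bounded.\<close>

lemma coarse_qi_heights:
  assumes f: "coarse_qi f" and r: "0 \<le> r"
  shows "\<exists>B\<ge>0. \<forall>p q. \<bar>fst p - fst q\<bar> \<le> r \<longrightarrow> \<bar>fst (f p) - fst (f q)\<bar> \<le> B"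
proof -
  obtain \<alpha> \<beta> where q: "quasi lam (\<lambda>p. disc (f (pt p))) \<alpha> \<beta>" using discretised[OF f] by blast
  have em: "embedding lam (\<lambda>p. disc (f (pt p))) \<alpha> \<beta>" using q by (simp add: quasi_def)
  have F: "embedding.F (\<lambda>p. disc (f (pt p))) p = real_of_int \<lfloor>fst (f (pt p))\<rfloor>" for p
    unfolding embedding.F_def[OF em] by (simp add: disc_def)
  obtain B where B: "\<And>p q. fst p = fst q \<Longrightarrow> \<bar>real_of_int \<lfloor>fst (f (pt p))\<rfloor> - real_of_int \<lfloor>fst (f (pt q))\<rfloor>\<bar> \<le> B"
    using quasi.levels_preserved[OF q] unfolding F by blast
  obtain a b where ab: "1 \<le> a" "0 \<le> b" "\<forall>D\<ge>0. \<forall>p q. close D p q \<longrightarrow> close (a * D + b) (f p) (f q)"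
    using f unfolding coarse_qi_def coarse_le_def by blast
  have mv: "\<bar>fst (f p) - fst (f q)\<bar> \<le> a * D + b" if "0 \<le> D" "close D p q" for D p q
    using ab(3) that unfolding close_def by blast
  define c where "c = a * (1 + lmx) + b"
  have c: "\<bar>fst (f p) - fst (f (pt (disc p)))\<bar> \<le> c" for p
    using mv[OF _ close_disc(1)] lmx_nonneg unfolding c_def by simp
  have lev: "\<bar>fst (f p) - fst (f q)\<bar> \<le> B + 2 * c + 2" if "fst p = fst q" for p q
  proof -
    have "fst (disc p) = fst (disc q)" using that by (simp add: disc_def)
    from B[OF this] show ?thesis using c[of p] c[of q] by linarith
  qed
  show ?thesis
  proof (intro exI[of _ "\<bar>B + 2 * c + 2\<bar> + (a * r + b)"] conjI allI impI)
    show "0 \<le> \<bar>B + 2 * c + 2\<bar> + (a * r + b)" using r ab by simp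
    fix p q :: "real \<times> (real^'n)" assume pq: "\<bar>fst p - fst q\<bar> \<le> r"
    have "close r p (fst q, snd p)" using pq by (simp add: close_def \<omega>_def)
    from mv[OF r this] lev[of "(fst q, snd p)" q]
    show "\<bar>fst (f p) - fst (f q)\<bar> \<le> \<bar>B + 2 * c + 2\<bar> + (a * r + b)" by simp
  qed
qed

lemma coarse_qi_inverse:
  assumes f: "coarse_qi f" and c: "0 \<le> c" "\<And>y. close c (f (h y)) y"
  shows "coarse_qi h"
proof -
  have c': "0 \<le> (1 + lmx) * c" "c \<le> (1 + lmx) * c" using c lmx_nonneg mult_right_mono[of 1 "1 + lmx" c] by auto
  have f1: "coarse_le close (\<lambda>D p q. close D (f p) (f q))" and f2: "coarse_le (\<lambda>D p q. close D (f p) (f q)) close"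
    using f by (simp_all add: coarse_qi_def)
  have cl: "close ((1 + lmx) * c) (f (h y)) y" "close ((1 + lmx) * c) y (f (h y))" for y
    using close_mono[OF c(2) c'(2)] close_sym[OF c(2)] by auto
  note pb = perturb[OF c'(1), of "\<lambda>y. f (h y)" "\<lambda>y. y", OF cl] perturb[OF c'(1), of "\<lambda>y. y" "\<lambda>y. f (h y)", OF cl(2,1)]
  obtain a b where ab: "1 \<le> a" "0 \<le> b" "\<forall>D\<ge>0. \<forall>p q. close D (f p) (f q) \<longrightarrow> close (a * D + b) p q"
    using f2 unfolding coarse_le_def by blast
  have "\<exists>x. close (a * c + b) (h x) y" for y
    using ab(3) c(1) c(2)[of "f y"] by blast
  moreover have "0 \<le> a * c + b" using ab c by simp
  ultimately show ?thesis
    unfolding coarse_qi_def using coarse_le_trans[OF pb(2) coarse_le_image[OF f2, of h]]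
      coarse_le_trans[OF coarse_le_image[OF f1, of h] pb(1)] by blast
qed

text \<open>That the image of a level set stays near one level is the height bound for
  \<open>f\<close>. That it fills this level coarsely follows from the height bound for a coarse
  inverse \<open>h\<close>: a point \<open>v\<close> of the level has \<open>h v\<close> at nearly
  the original height, and moving \<open>h v\<close> vertically into the original level set changes
  its image by a bounded amount.\<close>

lemma coarse_qi_height_respecting:
  assumes f: "coarse_qi f" shows "height_respecting d f"
proof -
  obtain c where c: "0 \<le> c" "\<forall>y. \<exists>x. close c (f x) y" using f unfolding coarse_qi_def by blast
  then obtain h where h: "\<And>y. close c (f (h y)) y" by metis
  have hq: "coarse_qi h" by (rule coarse_qi_inverse[OF f c(1) h])
  obtain B1 where B1: "0 \<le> B1" "\<forall>p q. \<bar>fst p - fst q\<bar> \<le> 0 \<longrightarrow> \<bar>fst (f p) - fst (f q)\<bar> \<le> B1"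
    using coarse_qi_heights[OF f order.refl] by blast
  obtain B2 where B2: "0 \<le> B2" "\<forall>p q. \<bar>fst p - fst q\<bar> \<le> 0 \<longrightarrow> \<bar>fst (h p) - fst (h q)\<bar> \<le> B2"
    using coarse_qi_heights[OF hq order.refl] by blast
  obtain a b where ab: "1 \<le> a" "0 \<le> b" "\<forall>D\<ge>0. \<forall>p q. close D p q \<longrightarrow> close (a * D + b) (f p) (f q)"
    using f unfolding coarse_qi_def coarse_le_def by blast
  obtain a' b' where ab': "1 \<le> a'" "0 \<le> b'" "\<forall>D\<ge>0. \<forall>p q. close D (f p) (f q) \<longrightarrow> close (a' * D + b') p q"
    using f unfolding coarse_qi_def coarse_le_def by blast
  obtain e e' where ee: "1 \<le> e" "0 \<le> e'" "\<forall>D\<ge>0. \<forall>p q. close D p q \<longrightarrow> d p q \<le> e * D + e'"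
    using close_coarse_dist unfolding coarse_le_def by blast
  define B3 where "B3 = B2 + (a' * c + b')"
  define B4 where "B4 = (1 + lmx) * ((a * B3 + b) + c) + 1"
  define B where "B = max (e * B1 + e') (e * B4 + e')"
  have B3: "0 \<le> B3" using B2 ab' c(1) by (simp add: B3_def)
  have B4: "0 \<le> B4" using B3 ab c(1) lmx_nonneg by (simp add: B4_def)
  \<comment> \<open>The level assigned to height \<open>t\<close> is that of the image of the base
    point \<open>(t, 0)\<close>.\<close>
  have "hausdorff_dist d (f ` level_set t) (level_set (fst (f (t, 0)))) \<le> ennreal B" for t
    unfolding hausdorff_dist_def
  proof (intro max.boundedI SUP_least)
    let ?s = "fst (f (t, 0))"
    fix u assume "u \<in> f ` level_set t"
    then obtain p where p: "u = f p" "fst p = t" by (auto simp: level_set_def height_def)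
    have "close B1 u (?s, snd u)" using B1(2)[rule_format, of p "(t, 0)"] B1(1) p by (simp add: close_def \<omega>_def)
    then have "d u (?s, snd u) \<le> e * B1 + e'" using ee(3) B1(1) by blast
    also have "\<dots> \<le> B" by (simp add: B_def)
    finally show "(INF v\<in>level_set ?s. ennreal (d u v)) \<le> ennreal B"
      by (intro INF_lower2[of "(?s, snd u)"] ennreal_leI) (simp_all add: level_set_def height_def)
  next
    let ?s = "fst (f (t, 0))"
    fix v :: "real \<times> (real^'n)" assume "v \<in> level_set ?s"
    then have v: "fst v = ?s" by (simp add: level_set_def height_def)
    have 1: "\<bar>fst (h v) - fst (h (f (t, 0)))\<bar> \<le> B2" using B2(2)[rule_format, of v "f (t, 0)"] v by simp
    have "close (a' * c + b') (h (f (t, 0))) (t, 0)" using ab'(3) c(1) h[of "f (t, 0)"] by blast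
    then have "\<bar>fst (h (f (t, 0))) - t\<bar> \<le> a' * c + b'" by (simp add: close_def)
    then have "\<bar>t - fst (h v)\<bar> \<le> B3" using 1 unfolding B3_def by linarith
    then have "close B3 (t, snd (h v)) (h v)" using B3 by (simp add: close_def \<omega>_def)
    then have "close (a * B3 + b) (f (t, snd (h v))) (f (h v))" using ab(3) B3 by blast
    from close_trans[OF this h] have "close B4 (f (t, snd (h v))) v" unfolding B4_def .
    then have "d (f (t, snd (h v))) v \<le> e * B4 + e'" using ee(3) B4 by blast
    also have "\<dots> \<le> B" by (simp add: B_def)
    finally show "(INF u\<in>f ` level_set t. ennreal (d u v)) \<le> ennreal B"
      by (intro INF_lower2[of "f (t, snd (h v))"] ennreal_leI) (simp_all add: level_set_def height_def)
  qed
  then show ?thesis unfolding height_respecting_def by blast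
qed

end

theorem theorem2p2:
  fixes M :: "real^'n^'n"
    and g :: "real \<times> (real^'n) \<Rightarrow> real \<times> (real^'n) \<Rightarrow> real \<times> (real^'n) \<Rightarrow> real"
  assumes "transpose M = M" and "pos_def M" and "det M = 1" and "\<not> eigenvalue M 1"
    and "riemannian_metric g" and "left_invariant (sol_mult M) g"
  shows "\<forall>K C. \<exists>R::real. \<forall>\<phi>.
    quasi_isometry K C (riemannian_dist g) (riemannian_dist g) \<phi> \<longrightarrow>
    (\<exists>\<phi>'. (\<exists>K' C'. quasi_isometry K' C' (riemannian_dist g) (riemannian_dist g) \<phi>') \<and>
          height_respecting (riemannian_dist g) \<phi>' \<and>
          (\<forall>p. riemannian_dist g (\<phi> p) (\<phi>' p) \<le> R))"
proof -
  obtain lam U k0 K0 where "sol_metric lam U g k0 K0" using sol_metric_exists[OF assms] by blast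
  then interpret sol_metric lam U g k0 K0 .
  \<comment> \<open>As \<open>\<phi>'\<close> is \<open>\<phi>\<close> itself, a bound for
    \<open>d p p\<close> is all that is required, and \<open>close_dist\<close> with parameter 0
    gives one that depends on the space alone.\<close>
  have refl: "d p p \<le> 16 * (K0 * ((4 / lmn + 2) * 0 + real CARD('n)))" for p
    by (rule close_dist) (simp add: close_def)
  show ?thesis
  proof (intro allI exI impI conjI)
    fix K C \<phi> p assume \<phi>: "quasi_isometry K C d d \<phi>"
    then show "quasi_isometry K C d d \<phi>" .
    show "height_respecting d \<phi>" by (rule coarse_qi_height_respecting[OF quasi_isometry_coarse_qi[OF \<phi>]])
    show "d (\<phi> p) (\<phi> p) \<le> 16 * (K0 * ((4 / lmn + 2) * 0 + real CARD('n)))" by (rule refl)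
  qed
qed

end
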